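(* Let $q$ be not a root of unity, let $n\ge 3$, let $k=\lfloor n/2\rfloor$, and let $\mathbf m=(m_{1n},\dots,m_{kn})$ be a highest weight: all $m_{in}$ are integers or all are half-integers (elements of $\frac12+\mathbb Z$), with $m_{1n}\ge\dots\ge m_{kn}\ge 0$ if $n=2k+1$ and $m_{1n}\ge\dots\ge m_{k-1,n}\ge|m_{kn}|$ if $n=2k$. Let $V_{\mathbf m}$ be the complex Hilbert space with orthonormal basis the Gel'fand--Tsetlin patterns $\alpha$ with top row $\mathbf m$, and let $T_{\mathbf m}(I_{i,i-1})$, $i=2,\dots,n$, be the operators on $V_{\mathbf m}$ given by $$T_{\mathbf m}(I_{2p+1,2p})\alpha=\sum_{j=1}^pA^j_{2p}(\alpha)\alpha^{2p}_j-\sum_{j=1}^pA^j_{2p}(\bar\alpha^{2p}_j)\bar\alpha^{2p}_j ,$$ $$T_{\mathbf m}(I_{2p+2,2p+1})\alpha=\sum_{j=1}^pB^j_{2p}(\alpha)\alpha^{2p+1}_j-\sum_{j=1}^pB^j_{2p}(\bar\alpha^{2p+1}_j)\bar\alpha^{2p+1}_j+\mathrm i\,\frac{\prod_{r=1}^{p+1}[l_{r,2p+2}]\prod_{r=1}^p[l_{r,2p}]}{\prod_{r=1}^p[l_{r,2p+1}][l_{r,2p+1}-1]}\,\alpha .$$ Then the operators $T_{\mathbf m}(I_{i,i-1})$ satisfy the defining relations of $U_q(\mathrm{so}(n,\mathbb C))$ and the conditions $T_{\mathbf m}(I_{i,i-1})^*=-T_{\mathbf m}(I_{i,i-1})$ for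 $i=2,\dots,n$, so that $T_{\mathbf m}$ is a finite-dimensional representation of the compact $q$-deformed algebra $U_q(\mathrm{so}_n)$.
   Context: Let $q=e^{\tau}$, $\tau\in\mathbb C$, with $q$ not a root of unity (in particular $q\ne1$); put $q^{b}=e^{\tau b}$ and $[b]=\dfrac{q^{b/2}-q^{-b/2}}{q^{1/2}-q^{-1/2}}$ for $b\in\mathbb C$. $U_q(\mathrm{so}(n,\mathbb C))$, $n\ge3$, is the complex associative algebra generated by $I_{i,i-1}$, $i=2,\dots,n$, with defining relations $[I_{i,i-1},I_{j,j-1}]=0$ (commutator) if $|i-j|>1$, and, for $2\le i\le n-1$, $$I_{i+1,i}^2I_{i,i-1}-(q^{1/2}+q^{-1/2})I_{i+1,i}I_{i,i-1}I_{i+1,i}+I_{i,i-1}I_{i+1,i}^2=-I_{i,i-1},$$ $$I_{i+1,i}I_{i,i-1}^2-(q^{1/2}+q^{-1/2})I_{i,i-1}I_{i+1,i}I_{i,i-1}+I_{i,i-1}^2I_{i+1,i}=-I_{i+1,i}.$$ $U_q(\mathrm{so}_n)$ is this algebra with the $*$-structure (antilinear antiautomorphism) $I_{i,i-1}^*=-I_{i,i-1}$, $i=2,\dots,n$; a finite-dimensional representation of it is a homomorphism $T$ into the linear operators on a finite-dimensional Hilbert space with $T(a^* )=T(a)^*$. Gel'fand--Tsetlin patterns. A pattern $\alpha$ consists of rows $(m_{1k},\dots,m_{\lfloor k/2\rfloor,k})$, $k=n,n-1,\dots,2$, all entries being integers or all half-integers, satisfying the betweenness conditions $$m_{1,2p+1}\ge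 m_{1,2p}\ge m_{2,2p+1}\ge\dots\ge m_{p,2p+1}\ge m_{p,2p}\ge-m_{p,2p+1},$$ $$m_{1,2p}\ge m_{1,2p-1}\ge m_{2,2p}\ge\dots\ge m_{p-1,2p-1}\ge|m_{p,2p}| .$$ $\alpha^k_j$ (resp. $\bar\alpha^k_j$) is obtained from $\alpha$ by replacing $m_{jk}$ by $m_{jk}+1$ (resp. $m_{jk}-1$); terms for which the result is not a pattern are omitted. Put $l_{j,2p}=m_{j,2p}+p-j$, $l_{j,2p+1}=m_{j,2p+1}+p-j+1$. Coefficients. With $l_r=l_{r,2p+1}$, $l'_r=l_{r,2p}$, $l''_r=l_{r,2p-1}$, $$A^j_{2p}(\alpha)=\left(\frac{[l'_j][l'_j+1]}{[2l'_j][2l'_j+2]}\,\frac{\prod_{r=1}^p[l_r+l'_j][|l_r-l'_j-1|]\prod_{r=1}^{p-1}[l''_r+l'_j][|l''_r-l'_j-1|]}{\prod_{r\ne j}[l'_r+l'_j][|l'_r-l'_j|][l'_r+l'_j+1][|l'_r-l'_j-1|]}\right)^{1/2},$$ and with $l_r=l_{r,2p+2}$, $l'_r=l_{r,2p+1}$, $l''_r=l_{r,2p}$, $$B^j_{2p}(\alpha)=\left(\frac{\prod_{r=1}^{p+1}[l_r+l'_j][|l_r-l'_j|]\prod_{r=1}^{p}[l''_r+l'_j][|l''_r-l'_j|]}{\prod_{r\ne j}[l'_r+l'_j][|l'_r-l'_j|][l'_r+l'_j-1][|l'_r-l'_j-1|]}\cdot\frac1{[l'_j]^2[2l'_j+1][2l'_j-1]}\right)^{1/2}.$$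 Here $r,j\in\{1,\dots,p\}$ in the products over $r\neq j$. The formula for $I_{2p+1,2p}$ is used for $p\ge1$, that for $I_{2p+2,2p+1}$ for $p\ge0$ (for $p=0$ it reads $T(I_{21})\alpha=\mathrm i[m_{12}]\alpha$). Conventions. $[x]/[2x]$ is read as $1/(q^{x/2}+q^{-x/2})$ (also at $x=0$). The diagonal coefficient is $0$ if some $l_{r,2p+1}=1$ (its numerator then vanishes). Square roots are positive when $q>0$; for general $q$ the square root of the displayed product is the product of square roots of its factors, a square root of $[k]$ for each positive integer $k$, and of $q^{x/2}+q^{-x/2}$ for each $x\ge0$ in $\frac12\mathbb Z$ (the expression is even in $x$), being fixed once for all, and $([l'_j]^2)^{1/2}=[l'_j]$.
   Formalization: The conditions T(I)^* = -T(I) and the *-representation claim are stated only for q > 0 (real τ), since they fail for general q (n=3, m=(1/2): T(I_21) has eigenvalues ±i/(q^{1/4}+q^{-1/4})); the defining relations are stated for all q not a root of unity. *)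

theory Defs
  imports Complex_Main "HOL-Library.FuncSet" "HOL-Algebra.Module" "HOL-Algebra.QuotRing"
begin

section \<open>\<open>q\<close>-numbers\<close>

definition qpow :: "complex \<Rightarrow> complex \<Rightarrow> complex" where
  "qpow \<tau> b = exp (\<tau> * b)"

definition qnum :: "complex \<Rightarrow> complex \<Rightarrow> complex" where
  "qnum \<tau> b = (qpow \<tau> (b / 2) - qpow \<tau> (- b / 2)) / (qpow \<tau> (1 / 2) - qpow \<tau> (- 1 / 2))"

definition root_of_unity :: "complex \<Rightarrow> bool" where
  "root_of_unity q \<longleftrightarrow> (\<exists>k::nat. k > 0 \<and> q ^ k = 1)"

definition half_integers :: "real set" where
  "half_integers = {x. x - 1 / 2 \<in> \<int>}"

text \<open>\<open>s k\<close> is the chosen square root of \<open>[k]\<close> for a positive integer \<open>k\<close>, and \<open>u x\<close> that of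
  \<open>q\<^sup>x\<^sup>/\<^sup>2 + q\<^sup>-\<^sup>x\<^sup>/\<^sup>2\<close> for a nonnegative integer or half-integer \<open>x\<close>; the values at other
  arguments are never used. The powers of \<open>q\<close> depend on \<open>\<tau>\<close>, so \<open>q > 0\<close> means that \<open>\<tau>\<close> is real.\<close>

definition root_choice :: "complex \<Rightarrow> (real \<Rightarrow> complex) \<Rightarrow> (real \<Rightarrow> complex) \<Rightarrow> bool" where
  "root_choice \<tau> s u \<longleftrightarrow>
     (\<forall>k::nat. k > 0 \<longrightarrow> (s (real k))\<^sup>2 = qnum \<tau> (of_nat k) \<and>
        (\<tau> \<in> \<real> \<longrightarrow> s (real k) \<in> \<real> \<and> Re (s (real k)) > 0)) \<and>
     (\<forall>x. x \<ge> 0 \<and> (x \<in> \<int> \<or> x \<in> half_integers) \<longrightarrow>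
        (u x)\<^sup>2 = qpow \<tau> (of_real x / 2) + qpow \<tau> (- of_real x / 2) \<and>
        (\<tau> \<in> \<real> \<longrightarrow> u x \<in> \<real> \<and> Re (u x) > 0))"


section \<open>The algebra \<open>U\<^sub>q(so(n,\<complex>))\<close> and its \<open>*\<close>-structure\<close>

text \<open>Complex algebras are records of type \<^typ>\<open>(complex, 'a) module\<close>, used only as ring plus
  scalar multiplication. The free algebra consists of the finitely supported functions on words in
  the letters \<open>2, \<dots>, n\<close>; the letter \<open>i\<close> stands for \<open>I\<^bsub>i,i-1\<^esub>\<close>.\<close>

definition free_algebra :: "nat \<Rightarrow> (complex, nat list \<Rightarrow> complex) module" where
  "free_algebra n =
     \<lparr>carrier = {f. finite {w. f w \<noteq> 0} \<and> (\<forall>w. f w \<noteq> 0 \<longrightarrow> set w \<subseteq> {2..n})},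
      mult = (\<lambda>f g w. \<Sum>i\<le>length w. f (take i w) * g (drop i w)),
      one = (\<lambda>w. if w = [] then 1 else 0),
      zero = (\<lambda>w. 0),
      add = (\<lambda>f g w. f w + g w),
      smult = (\<lambda>c f w. c * f w)\<rparr>"

definition free_gen :: "nat \<Rightarrow> nat list \<Rightarrow> complex" where
  "free_gen i = (\<lambda>w. if w = [i] then 1 else 0)"

text \<open>The antilinear antiautomorphism sending each generator to its negative.\<close>

definition free_star :: "(nat list \<Rightarrow> complex) \<Rightarrow> nat list \<Rightarrow> complex" where
  "free_star f = (\<lambda>w. (- 1) ^ length w * cnj (f (rev w)))"

text \<open>The defining relations, as pairs (left-hand side, right-hand side), for elements \<open>x i\<close>
  (in place of \<open>I\<^bsub>i,i-1\<^esub>\<close>) of an algebra \<open>A\<close>.\<close>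

definition defining_relations ::
    "complex \<Rightarrow> nat \<Rightarrow> (complex, 'a) module \<Rightarrow> (nat \<Rightarrow> 'a) \<Rightarrow> ('a \<times> 'a) set" where
  "defining_relations \<tau> n A x =
     (let c = qpow \<tau> (1 / 2) + qpow \<tau> (- 1 / 2) in
      {(x i \<otimes>\<^bsub>A\<^esub> x j \<ominus>\<^bsub>A\<^esub> x j \<otimes>\<^bsub>A\<^esub> x i, \<zero>\<^bsub>A\<^esub>) | i j.
         i \<in> {2..n} \<and> j \<in> {2..n} \<and> \<bar>int i - int j\<bar> > 1} \<union>
      {((x (i + 1) \<otimes>\<^bsub>A\<^esub> x (i + 1) \<otimes>\<^bsub>A\<^esub> x i
           \<ominus>\<^bsub>A\<^esub> c \<odot>\<^bsub>A\<^esub> (x (i + 1) \<otimes>\<^bsub>A\<^esub> x i \<otimes>\<^bsub>A\<^esub> x (i + 1)))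
           \<oplus>\<^bsub>A\<^esub> x i \<otimes>\<^bsub>A\<^esub> x (i + 1) \<otimes>\<^bsub>A\<^esub> x (i + 1),
        \<ominus>\<^bsub>A\<^esub> x i) | i. 2 \<le> i \<and> i \<le> n - 1} \<union>
      {((x (i + 1) \<otimes>\<^bsub>A\<^esub> x i \<otimes>\<^bsub>A\<^esub> x i
           \<ominus>\<^bsub>A\<^esub> c \<odot>\<^bsub>A\<^esub> (x i \<otimes>\<^bsub>A\<^esub> x (i + 1) \<otimes>\<^bsub>A\<^esub> x i))
           \<oplus>\<^bsub>A\<^esub> x i \<otimes>\<^bsub>A\<^esub> x i \<otimes>\<^bsub>A\<^esub> x (i + 1),
        \<ominus>\<^bsub>A\<^esub> x (i + 1)) | i. 2 \<le> i \<and> i \<le> n - 1})"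

definition Uq_ideal :: "complex \<Rightarrow> nat \<Rightarrow> (nat list \<Rightarrow> complex) set" where
  "Uq_ideal \<tau> n = Idl\<^bsub>free_algebra n\<^esub>
     {l \<ominus>\<^bsub>free_algebra n\<^esub> r | l r. (l, r) \<in> defining_relations \<tau> n (free_algebra n) free_gen}"

definition Uq :: "complex \<Rightarrow> nat \<Rightarrow> (complex, (nat list \<Rightarrow> complex) set) module" where
  "Uq \<tau> n = ring.extend (free_algebra n Quot Uq_ideal \<tau> n)
     (module.fields
       (\<lambda>c X. \<Union>a\<in>X. Uq_ideal \<tau> n +>\<^bsub>free_algebra n\<^esub> (c \<odot>\<^bsub>free_algebra n\<^esub> a)))"

definition Uq_gen :: "complex \<Rightarrow> nat \<Rightarrow> nat \<Rightarrow> (nat list \<Rightarrow> complex) set" where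
  "Uq_gen \<tau> n i = Uq_ideal \<tau> n +>\<^bsub>free_algebra n\<^esub> free_gen i"

text \<open>Well defined on classes only if \<open>q\<^sup>1\<^sup>/\<^sup>2 + q\<^sup>-\<^sup>1\<^sup>/\<^sup>2\<close> is real, in particular if \<open>\<tau>\<close> is real:
  only then is the ideal of relations stable under \<^const>\<open>free_star\<close>.\<close>

definition Uq_star :: "(nat list \<Rightarrow> complex) set \<Rightarrow> (nat list \<Rightarrow> complex) set" where
  "Uq_star X = free_star ` X"

definition algebra_hom ::
    "(complex, 'a) module \<Rightarrow> (complex, 'b) module \<Rightarrow> ('a \<Rightarrow> 'b) set" where
  "algebra_hom A B =
     {h \<in> ring_hom A B. \<forall>c. \<forall>a\<in>carrier A. h (c \<odot>\<^bsub>A\<^esub> a) = c \<odot>\<^bsub>B\<^esub> h a}"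


section \<open>The Hilbert space with a given finite orthonormal basis\<close>

definition hilb :: "'b set \<Rightarrow> ('b \<Rightarrow> complex) set" where
  "hilb B = {v. \<forall>\<beta>. \<beta> \<notin> B \<longrightarrow> v \<beta> = 0}"

definition hinner :: "'b set \<Rightarrow> ('b \<Rightarrow> complex) \<Rightarrow> ('b \<Rightarrow> complex) \<Rightarrow> complex" where
  "hinner B v w = (\<Sum>\<beta>\<in>B. cnj (v \<beta>) * w \<beta>)"

definition ket :: "'b \<Rightarrow> 'b \<Rightarrow> complex" where
  "ket \<alpha> = (\<lambda>\<beta>. if \<beta> = \<alpha> then 1 else 0)"

definition operators ::
    "'b set \<Rightarrow> (complex, ('b \<Rightarrow> complex) \<Rightarrow> 'b \<Rightarrow> complex) module" where
  "operators B =
     \<lparr>carrier = {f \<in> hilb B \<rightarrow>\<^sub>E hilb B. \<forall>v\<in>hilb B. \<forall>w\<in>hilb B. \<forall>a b.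
        f (\<lambda>\<beta>. a * v \<beta> + b * w \<beta>) = (\<lambda>\<beta>. a * f v \<beta> + b * f w \<beta>)},
      mult = compose (hilb B),
      one = (\<lambda>v\<in>hilb B. v),
      zero = (\<lambda>v\<in>hilb B. \<lambda>\<beta>. 0),
      add = (\<lambda>f g. \<lambda>v\<in>hilb B. \<lambda>\<beta>. f v \<beta> + g v \<beta>),
      smult = (\<lambda>c f. \<lambda>v\<in>hilb B. \<lambda>\<beta>. c * f v \<beta>)\<rparr>"

definition hadjoint ::
    "'b set \<Rightarrow> (('b \<Rightarrow> complex) \<Rightarrow> 'b \<Rightarrow> complex) \<Rightarrow> ('b \<Rightarrow> complex) \<Rightarrow> 'b \<Rightarrow> complex" where
  "hadjoint B f = (THE g. g \<in> carrier (operators B) \<and>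
     (\<forall>v\<in>hilb B. \<forall>w\<in>hilb B. hinner B (f v) w = hinner B v (g w)))"

text \<open>Representations of \<open>U\<^sub>q(so(n,\<complex>))\<close>, and of \<open>U\<^sub>q(so\<^sub>n)\<close>, on the Hilbert space with the finite
  orthonormal basis \<open>B\<close>.\<close>

definition Uq_representation where
  "Uq_representation \<tau> n B T \<longleftrightarrow> finite B \<and> T \<in> algebra_hom (Uq \<tau> n) (operators B)"

definition Uq_star_representation where
  "Uq_star_representation \<tau> n B T \<longleftrightarrow> Uq_representation \<tau> n B T \<and>
     (\<forall>a\<in>carrier (Uq \<tau> n). T (Uq_star a) = hadjoint B (T a))"


section \<open>Gel'fand--Tsetlin patterns\<close>

definition highest_weight :: "nat \<Rightarrow> (nat \<Rightarrow> real) \<Rightarrow> bool" where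
  "highest_weight n m \<longleftrightarrow>
     (let k = n div 2 in
      ((\<forall>j\<in>{1..k}. m j \<in> \<int>) \<or> (\<forall>j\<in>{1..k}. m j \<in> half_integers)) \<and>
      (if odd n then (\<forall>j\<in>{1..<k}. m j \<ge> m (j + 1)) \<and> m k \<ge> 0
       else (\<forall>j\<in>{1..<k - 1}. m j \<ge> m (j + 1)) \<and> m (k - 1) \<ge> \<bar>m k\<bar>))"

text \<open>\<open>\<alpha> j k\<close> is the entry \<open>m\<^bsub>jk\<^esub>\<close>. Positions outside the pattern hold \<open>0\<close>, so that a pattern is
  determined by its entries. The row of index \<open>1\<close> is empty, whence \<open>p \<ge> 2\<close> in the second
  betweenness condition.\<close>

type_synonym pattern = "nat \<Rightarrow> nat \<Rightarrow> real"

definition GT_patterns :: "nat \<Rightarrow> (nat \<Rightarrow> real) \<Rightarrow> pattern set" where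
  "GT_patterns n m = {\<alpha>.
     (\<forall>j\<in>{1..n div 2}. \<alpha> j n = m j) \<and>
     ((\<forall>k\<in>{2..n}. \<forall>j\<in>{1..k div 2}. \<alpha> j k \<in> \<int>) \<or>
      (\<forall>k\<in>{2..n}. \<forall>j\<in>{1..k div 2}. \<alpha> j k \<in> half_integers)) \<and>
     (\<forall>p. 1 \<le> p \<and> 2 * p + 1 \<le> n \<longrightarrow>
        (\<forall>j\<in>{1..p}. \<alpha> j (2 * p + 1) \<ge> \<alpha> j (2 * p)) \<and>
        (\<forall>j\<in>{1..<p}. \<alpha> j (2 * p) \<ge> \<alpha> (j + 1) (2 * p + 1)) \<and>
        \<alpha> p (2 * p) \<ge> - \<alpha> p (2 * p + 1)) \<and>
     (\<forall>p. 2 \<le> p \<and> 2 * p \<le> n \<longrightarrow>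
        (\<forall>j\<in>{1..p - 1}. \<alpha> j (2 * p) \<ge> \<alpha> j (2 * p - 1)) \<and>
        (\<forall>j\<in>{1..<p - 1}. \<alpha> j (2 * p - 1) \<ge> \<alpha> (j + 1) (2 * p)) \<and>
        \<alpha> (p - 1) (2 * p - 1) \<ge> \<bar>\<alpha> p (2 * p)\<bar>) \<and>
     (\<forall>j k. \<not> (k \<in> {2..n} \<and> j \<in> {1..k div 2}) \<longrightarrow> \<alpha> j k = 0)}"

definition raise :: "nat \<Rightarrow> nat \<Rightarrow> pattern \<Rightarrow> pattern" where
  "raise j k \<alpha> = \<alpha>(j := (\<alpha> j)(k := \<alpha> j k + 1))"

definition lower :: "nat \<Rightarrow> nat \<Rightarrow> pattern \<Rightarrow> pattern" where
  "lower j k \<alpha> = \<alpha>(j := (\<alpha> j)(k := \<alpha> j k - 1))"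

definition lab :: "pattern \<Rightarrow> nat \<Rightarrow> nat \<Rightarrow> real" where
  "lab \<alpha> j k = (if even k then \<alpha> j k + real (k div 2) - real j
                 else \<alpha> j k + real (k div 2) - real j + 1)"


section \<open>The operators \<open>T\<^sub>m(I\<^bsub>i,i-1\<^esub>)\<close>\<close>

text \<open>The square root is taken factor by factor; \<open>[x]/[2x] = 1/(q\<^sup>x\<^sup>/\<^sup>2 + q\<^sup>-\<^sup>x\<^sup>/\<^sup>2)\<close> contributes
  \<open>1/u \<bar>x\<bar>\<close>. Whenever \<open>\<alpha>\<close> and \<open>raise j (2 * p) \<alpha>\<close> are both patterns, all arguments
  of \<open>s\<close> are positive integers; likewise for \<open>B_coeff\<close>.\<close>

definition A_coeff ::
    "(real \<Rightarrow> complex) \<Rightarrow> (real \<Rightarrow> complex) \<Rightarrow> nat \<Rightarrow> nat \<Rightarrow> pattern \<Rightarrow> complex" where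
  "A_coeff s u p j \<alpha> =
     (let l = (\<lambda>r. lab \<alpha> r (2 * p + 1));
          l' = (\<lambda>r. lab \<alpha> r (2 * p));
          l'' = (\<lambda>r. lab \<alpha> r (2 * p - 1))
      in 1 / (u \<bar>l' j\<bar> * u \<bar>l' j + 1\<bar>) *
         ((\<Prod>r\<in>{1..p}. s (l r + l' j) * s \<bar>l r - l' j - 1\<bar>) *
          (\<Prod>r\<in>{1..p - 1}. s (l'' r + l' j) * s \<bar>l'' r - l' j - 1\<bar>)) /
         (\<Prod>r\<in>{1..p} - {j}. s (l' r + l' j) * s \<bar>l' r - l' j\<bar> *
             s (l' r + l' j + 1) * s \<bar>l' r - l' j - 1\<bar>))"

definition B_coeff ::
    "complex \<Rightarrow> (real \<Rightarrow> complex) \<Rightarrow> nat \<Rightarrow> nat \<Rightarrow> pattern \<Rightarrow> complex" where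
  "B_coeff \<tau> s p j \<alpha> =
     (let l = (\<lambda>r. lab \<alpha> r (2 * p + 2));
          l' = (\<lambda>r. lab \<alpha> r (2 * p + 1));
          l'' = (\<lambda>r. lab \<alpha> r (2 * p))
      in ((\<Prod>r\<in>{1..p + 1}. s (l r + l' j) * s \<bar>l r - l' j\<bar>) *
          (\<Prod>r\<in>{1..p}. s (l'' r + l' j) * s \<bar>l'' r - l' j\<bar>)) /
         (\<Prod>r\<in>{1..p} - {j}. s (l' r + l' j) * s \<bar>l' r - l' j\<bar> *
             s (l' r + l' j - 1) * s \<bar>l' r - l' j - 1\<bar>) *
         (1 / (qnum \<tau> (of_real (l' j)) * s (2 * l' j + 1) * s (2 * l' j - 1))))"

definition diag_coeff :: "complex \<Rightarrow> nat \<Rightarrow> pattern \<Rightarrow> complex" where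
  "diag_coeff \<tau> p \<alpha> =
     (if \<exists>r\<in>{1..p}. lab \<alpha> r (2 * p + 1) = 1 then 0
      else ((\<Prod>r\<in>{1..p + 1}. qnum \<tau> (of_real (lab \<alpha> r (2 * p + 2)))) *
            (\<Prod>r\<in>{1..p}. qnum \<tau> (of_real (lab \<alpha> r (2 * p))))) /
           (\<Prod>r\<in>{1..p}. qnum \<tau> (of_real (lab \<alpha> r (2 * p + 1))) *
              qnum \<tau> (of_real (lab \<alpha> r (2 * p + 1)) - 1)))"

text \<open>The images of a basis vector \<open>\<alpha>\<close> under \<open>T\<^sub>m(I\<^bsub>2p+1,2p\<^esub>)\<close> and \<open>T\<^sub>m(I\<^bsub>2p+2,2p+1\<^esub>)\<close>; \<open>P\<close> is the
  set of patterns with top row \<open>m\<close>, and terms outside \<open>P\<close> are omitted.\<close>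

definition image_odd ::
    "(real \<Rightarrow> complex) \<Rightarrow> (real \<Rightarrow> complex) \<Rightarrow> pattern set \<Rightarrow> nat \<Rightarrow> pattern \<Rightarrow>
      pattern \<Rightarrow> complex" where
  "image_odd s u P p \<alpha> = (\<lambda>\<beta>.
     (\<Sum>j\<in>{j\<in>{1..p}. raise j (2 * p) \<alpha> \<in> P}.
        A_coeff s u p j \<alpha> * ket (raise j (2 * p) \<alpha>) \<beta>)
   - (\<Sum>j\<in>{j\<in>{1..p}. lower j (2 * p) \<alpha> \<in> P}.
        A_coeff s u p j (lower j (2 * p) \<alpha>) * ket (lower j (2 * p) \<alpha>) \<beta>))"

definition image_even ::
    "complex \<Rightarrow> (real \<Rightarrow> complex) \<Rightarrow> pattern set \<Rightarrow> nat \<Rightarrow> pattern \<Rightarrow>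
      pattern \<Rightarrow> complex" where
  "image_even \<tau> s P p \<alpha> = (\<lambda>\<beta>.
     (\<Sum>j\<in>{j\<in>{1..p}. raise j (2 * p + 1) \<alpha> \<in> P}.
        B_coeff \<tau> s p j \<alpha> * ket (raise j (2 * p + 1) \<alpha>) \<beta>)
   - (\<Sum>j\<in>{j\<in>{1..p}. lower j (2 * p + 1) \<alpha> \<in> P}.
        B_coeff \<tau> s p j (lower j (2 * p + 1) \<alpha>) * ket (lower j (2 * p + 1) \<alpha>) \<beta>)
   + \<i> * diag_coeff \<tau> p \<alpha> * ket \<alpha> \<beta>)"

text \<open>\<open>T\<^sub>m(I\<^bsub>i,i-1\<^esub>)\<close>, extended linearly from the basis: \<open>i = 2p + 1\<close> or \<open>i = 2p + 2\<close>.\<close>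

definition GT_operator ::
    "complex \<Rightarrow> (real \<Rightarrow> complex) \<Rightarrow> (real \<Rightarrow> complex) \<Rightarrow> nat \<Rightarrow> (nat \<Rightarrow> real) \<Rightarrow> nat \<Rightarrow>
      (pattern \<Rightarrow> complex) \<Rightarrow> pattern \<Rightarrow> complex" where
  "GT_operator \<tau> s u n m i = (\<lambda>v\<in>hilb (GT_patterns n m). \<lambda>\<beta>.
     \<Sum>\<alpha>\<in>GT_patterns n m. v \<alpha> *
       (if odd i then image_odd s u (GT_patterns n m) ((i - 1) div 2) \<alpha> \<beta>
        else image_even \<tau> s (GT_patterns n m) ((i - 2) div 2) \<alpha> \<beta>))"

end

theory Submission
  imports Defs
begin

text \<open>Put \<open>t\<^sub>j\<^sub>k = m\<^sub>j\<^sub>k + k/2 - j\<close>, which is \<open>l\<^sub>j\<^sub>k\<close> for even \<open>k\<close> and \<open>l\<^sub>j\<^sub>k - 1/2\<close> for odd \<open>k\<close>. In these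
  coordinates even and odd rows are treated alike: the coefficient of a step in row \<open>a\<close> depends on the
  entries of both neighbouring rows in the same symmetric way, and only through \<open>q\<^sup>w + q\<^sup>-\<^sup>w\<close>.
  Give a step that changes \<open>t\<close> to \<open>t \<plusminus> 1\<close> the signed position \<open>\<theta> = \<plusminus>t\<close>, and the diagonal term
  \<open>\<theta> = -1/2\<close>. If \<open>\<omega>\<close> belongs to a step of an adjacent row, exchanging the two steps multiplies
  the product of their coefficients by \<open>[\<omega> - \<theta> - 1/2] / [\<omega> - \<theta> + 1/2]\<close>. Hence the contribution of
  steps \<open>\<theta>, \<theta>'\<close> in row \<open>a\<close> and one step \<open>\<omega>\<close> in row \<open>b\<close> to a Serre relation is a multiple of
  \<open>[\<theta> - \<theta>' + 1]\<close>, independently of \<open>\<omega>\<close>. For steps that are not opposite this cancels against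
  the contribution of \<open>\<theta>', \<theta>\<close>; for opposite steps the sum over \<open>\<theta>\<close> is a divided difference of a polynomial at the
  nodes \<open>q\<^sup>\<theta>\<^sup>+\<^sup>1\<^sup>/\<^sup>2 + q\<^sup>-\<^sup>\<theta>\<^sup>-\<^sup>1\<^sup>/\<^sup>2\<close> whose degree is one less than the number of nodes, so that only
  the leading coefficient survives. Steps that leave the set of patterns carry a vanishing
  numerator; nodes that coincide are double zeros of the polynomial and drop out.\<close>

section \<open>\<open>q\<close>-numbers and divided differences\<close>

text \<open>The right-hand side of a Serre relation demands an exact count of nodes against zeros. A
  row \<open>a\<close> has \<open>a\<close> steps, the diagonal one included, and \<open>a\<close>
  or \<open>a - 1\<close> neighbouring entries according as \<open>a\<close> is odd or even. A
  moving neighbour drops out of the numerator: its influence is used up in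
  \<open>serre_kernel\<close>, which leaves [2\<theta> + 2]. For odd \<open>a\<close> the count is
  then right. For even \<open>a\<close> one zero is missing; it comes from the factor that the moved
  entry itself contributes, since [\<theta>][\<theta> + 1] is, up to a constant, the difference of
  the node and \<open>ch (1/2)\<close>. An entry at position 0 of an even row makes its raising and
  lowering share that very node and is handled apart. The other obstacle is the chosen square roots.
  A step followed by its reverse squares every root, but only up to sign, as the roots belong to
  [|k|]; the signs come from the neighbours dominated by the moved entry, and their number is even.
  Elsewhere two orders of the same steps are compared, and all roots that are not squared are common
  to both sides.\<close>

locale qnumbers =
  fixes \<tau> :: complex
  assumes not_root: "\<not> root_of_unity (exp \<tau>)"
begin

definition ex :: "real \<Rightarrow> complex" where "ex x = exp (\<tau> * of_real x / 2)"

definition br :: "real \<Rightarrow> complex" where "br x = qnum \<tau> (of_real x)"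

definition ch :: "real \<Rightarrow> complex" where "ch x = qpow \<tau> (of_real x) + qpow \<tau> (- of_real x)"

text \<open>The square of the denominator of [b]. With it a product of two brackets becomes a
  difference of values of \<open>ch\<close>, which is how brackets turn into linear factors at the
  nodes.\<close>

definition dl :: complex where "dl = (ex 1 - ex (- 1))\<^sup>2"

lemma ex_add: "ex (x + y) = ex x * ex y"
  by (simp add: ex_def exp_add[symmetric] field_simps)

lemma ex_minus: "ex (- x) = inverse (ex x)"
  by (simp add: ex_def exp_minus)

lemma ex_nz [simp]: "ex x \<noteq> 0"
  by (simp add: ex_def)

lemma ex_0 [simp]: "ex 0 = 1"
  by (simp add: ex_def)

lemma br_ex: "br x = (ex x - ex (- x)) / (ex 1 - ex (- 1))"
  by (simp add: br_def qnum_def qpow_def ex_def)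

lemma ch_ex: "ch x = ex (2 * x) + ex (- (2 * x))"
  by (simp add: ch_def qpow_def ex_def)

text \<open>Labels may be half-integral. Squaring q^x gives the integral power q^(2x), to which the
  hypothesis on roots of unity applies.\<close>

lemma ex_eq_1: assumes "2 * x \<in> \<int>" "ex (2 * x) = 1" shows "x = 0"
proof (rule ccontr)
  assume "x \<noteq> 0"
  from assms obtain k :: int where k: "2 * x = of_int k" by (auto elim: Ints_cases)
  then have "k \<noteq> 0" using \<open>x \<noteq> 0\<close> by auto
  have e: "exp (\<tau> * of_int k) = 1"
  proof -
    have "(ex (2 * x))\<^sup>2 = exp (\<tau> * of_int k)"
      using k by (simp add: ex_def power2_eq_square exp_add[symmetric])
    then show ?thesis using assms by simp
  qed
  have "exp \<tau> ^ nat \<bar>k\<bar> = 1"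
  proof (cases "k \<ge> 0")
    case True
    then have "exp \<tau> ^ nat \<bar>k\<bar> = exp (of_nat (nat k) * \<tau>)" by (simp only: exp_of_nat_mult abs_of_nonneg)
    also have "of_nat (nat k) * \<tau> = \<tau> * of_int k" using True by (simp add: of_nat_nat)
    finally show ?thesis using e by simp
  next
    case False
    then have "exp \<tau> ^ nat \<bar>k\<bar> = exp (of_nat (nat (- k)) * \<tau>)"
      by (simp only: exp_of_nat_mult abs_of_neg not_le)
    also have "of_nat (nat (- k)) * \<tau> = - (\<tau> * of_int k)" using False by (simp add: of_nat_nat)
    finally show ?thesis using e by (simp add: exp_minus)
  qed
  then show False using not_root \<open>k \<noteq> 0\<close> unfolding root_of_unity_def
    by (metis zero_less_abs_iff zero_less_nat_eq)
qed

lemma ex_sub_eq_0: "ex x - ex (- x) = 0 \<longleftrightarrow> ex (2 * x) = 1"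
proof -
  have "ex (2 * x) = ex x * ex x" using ex_add[of x x] by simp
  then show ?thesis by (simp add: ex_minus field_simps)
qed

lemma den_nz: "ex 1 - ex (- 1) \<noteq> 0"
proof
  assume "ex 1 - ex (- 1) = 0"
  then have "ex (2 * 1) = 1" using ex_sub_eq_0 by blast
  then show False using ex_eq_1[of 1] by auto
qed

lemma dl_nz [simp]: "dl \<noteq> 0"
  using den_nz by (simp add: dl_def)

lemma br_0 [simp]: "br 0 = 0" by (simp add: br_ex)

lemma br_1 [simp]: "br 1 = 1" using den_nz by (simp add: br_ex)

lemma br_minus: "br (- x) = - br x"
  by (simp add: br_ex minus_divide_left)

lemma br_eq_0: "2 * x \<in> \<int> \<Longrightarrow> br x = 0 \<longleftrightarrow> x = 0"
  using ex_eq_1[of x] ex_sub_eq_0[of x] den_nz by (auto simp: br_ex)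

lemma ch_minus [simp]: "ch (- x) = ch x" by (simp add: ch_ex)

lemma ch_abs [simp]: "ch \<bar>x\<bar> = ch x" by (simp add: abs_if)

text \<open>The product-to-sum formula for hyperbolic sines, in the normalisation of
  \<open>br\<close> and \<open>ch\<close>.\<close>

lemma br_mult: "dl * (br a * br b) = ch ((a + b) / 2) - ch ((a - b) / 2)"
proof -
  have h: "2 * (x / 2) = x" for x :: real by simp
  have "dl * (br a * br b) = (ex a - ex (- a)) * (ex b - ex (- b))"
    using den_nz by (simp add: dl_def br_ex power2_eq_square)
  also have "\<dots> = ex (a + b) + ex (- (a + b)) - (ex (a - b) + ex (- (a - b)))"
    by (simp add: algebra_simps flip: ex_add)
  also have "\<dots> = ch ((a + b) / 2) - ch ((a - b) / 2)"
    by (simp only: ch_ex h)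
  finally show ?thesis .
qed

lemma br_mult': "a + b = 2 * x \<Longrightarrow> \<bar>a - b\<bar> = 2 * \<bar>y\<bar> \<Longrightarrow> dl * (br a * br b) = ch x - ch y"
  using br_mult[of a b] ch_abs[of "(a - b) / 2"] ch_abs[of y] by simp

lemma ch_diff: "ch a - ch b = dl * (br (a + b) * br (a - b))"
  using br_mult[of "a + b" "a - b"] by simp

text \<open>Decides when two nodes coincide: by \<open>ch_diff\<close> their difference is a product
  of two brackets, and a bracket vanishes only at 0.\<close>

lemma ch_eq_iff: assumes "2 * a \<in> \<int>" "2 * b \<in> \<int>"
  shows "ch a = ch b \<longleftrightarrow> \<bar>a\<bar> = \<bar>b\<bar>"
proof
  assume "ch a = ch b"
  then have "br (a + b) * br (a - b) = 0" using ch_diff[of a b] by simp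
  moreover have "2 * (a + b) \<in> \<int>" "2 * (a - b) \<in> \<int>"
    using assms by (simp_all add: distrib_left right_diff_distrib)
  ultimately show "\<bar>a\<bar> = \<bar>b\<bar>" by (auto simp: br_eq_0)
next
  assume "\<bar>a\<bar> = \<bar>b\<bar>"
  then show "ch a = ch b" by (metis ch_abs)
qed

lemma br_double: "br (2 * x) = br x * ch (x / 2)"
proof -
  have "ex (2 * x) - ex (- (2 * x)) = (ex x - ex (- x)) * (ex x + ex (- x))"
    using ex_add[of x x] ex_add[of "- x" "- x"] by (simp add: algebra_simps flip: ex_add)
  then show ?thesis by (simp add: br_ex ch_ex)
qed

text \<open>Since [2x] = [x] \<open>ch (x / 2)\<close>, a zero of \<open>ch (x / 2)\<close> would be
  a zero of [2x]; at x = 0 the value is 2.\<close>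

lemma ch_half_nz: assumes "2 * x \<in> \<int>" shows "ch (x / 2) \<noteq> 0"
proof (cases "x = 0")
  case True
  then show ?thesis by (simp add: ch_ex)
next
  case False
  have "2 * (2 * x) \<in> \<int>" using assms by (metis Ints_mult Ints_numeral)
  then have "br (2 * x) \<noteq> 0" using False br_eq_0 by simp
  then show ?thesis using br_double by auto
qed

text \<open>The three-term recurrence of the brackets; \<open>ch (1 / 2)\<close> = [2] is the
  constant of the Serre relations.\<close>

lemma br_step: "ch (1 / 2) * br a = br (a + 1) + br (a - 1)"
proof -
  have "ch (1 / 2) * (ex a - ex (- a))
      = (ex (a + 1) - ex (- (a + 1))) + (ex (a - 1) - ex (- (a - 1)))"
    by (simp add: ch_ex algebra_simps flip: ex_add)
  then show ?thesis by (simp add: br_ex add_divide_distrib[symmetric])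
qed

lemma br_diff: "br (a + 1) - br (a - 1) = ch (a / 2)"
proof -
  have "br (a + 1) - br (a - 1) = ((ex a + ex (- a)) * (ex 1 - ex (- 1))) / (ex 1 - ex (- 1))"
    unfolding br_ex diff_divide_distrib[symmetric]
    by (rule arg_cong[where f = "\<lambda>x. x / _"]) (simp add: algebra_simps flip: ex_add)
  then show ?thesis using den_nz by (simp add: ch_ex)
qed

text \<open>Here u and v stand for the differences \<omega> - \<theta> and \<omega> - \<theta>', and
  the three products are the relative weights of the three orders of interleaving. A change of
  \<omega> shifts u and v alike, so it drops out of v - u.\<close>

lemma serre_kernel:
  "br (u + 1/2) * br (v + 1/2) - ch (1/2) * (br (u - 1/2) * br (v + 1/2))
     + br (u - 1/2) * br (v - 1/2) = br (v - u + 1)"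
proof -
  have "ch (1/2) * br (u - 1/2) = br (u + 1/2) + br (u - 3/2)"
    using br_step[of "u - 1/2"] by (simp add: add.commute)
  then have "br (u + 1/2) * br (v + 1/2) - ch (1/2) * (br (u - 1/2) * br (v + 1/2))
     + br (u - 1/2) * br (v - 1/2) = br (u - 1/2) * br (v - 1/2) - br (u - 3/2) * br (v + 1/2)"
    by (simp add: distrib_right flip: mult.assoc)
  \<comment> \<open>By the product-to-sum formula the terms in u + v cancel, and what remains is the
    expansion of [v - u + 1][1].\<close>
  also have "dl * \<dots> = dl * br (v - u + 1)"
  proof -
    have "dl * (br (v - u + 1) * br 1) = ch ((v - u) / 2 + 1) - ch ((v - u) / 2)"
      by (rule br_mult') auto
    moreover have "dl * (br (u - 1/2) * br (v - 1/2)) = ch ((u + v - 1) / 2) - ch ((v - u) / 2)"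
      by (rule br_mult') (auto simp: abs_if field_simps)
    moreover have "dl * (br (u - 3/2) * br (v + 1/2)) = ch ((u + v - 1) / 2) - ch ((v - u) / 2 + 1)"
      by (rule br_mult') (auto simp: abs_if field_simps)
    ultimately show ?thesis by (simp add: right_diff_distrib)
  qed
  then show ?thesis using calculation dl_nz mult_left_cancel by metis
qed

text \<open>\<open>T1\<close>, \<open>T2\<close>, \<open>T3\<close> will be the products of coefficients along the three orders in which a step of
  row \<open>b\<close> is interleaved with two steps of row \<open>a\<close>, and \<open>T1'\<close>, \<open>T2'\<close>, \<open>T3'\<close> the same with the latter two
  exchanged. The equations are cross-multiplied since any of these products may vanish.\<close>

lemma serre_pair:
  fixes T1 T2 T3 T1' T2' T3' :: complex
  assumes half: "2 * u \<in> \<int>" "2 * v \<in> \<int>"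
    and gap: "v - u \<noteq> 1" "u - v \<noteq> 1"
    and e1: "T1 * br (u - 1/2) = T2 * br (u + 1/2)"
    and e2: "T2 * br (v - 1/2) = T3 * br (v + 1/2)"
    and e1': "T1' * br (v - 1/2) = T2' * br (v + 1/2)"
    and e2': "T2' * br (u - 1/2) = T3' * br (u + 1/2)"
    and f1: "T1 * br (v - u + 1) = T1' * br (v - u - 1)"
    and f3: "T3 * br (v - u + 1) = T3' * br (v - u - 1)"
  shows "(T1 - ch (1/2) * T2 + T3) + (T1' - ch (1/2) * T2' + T3') = 0"
proof -
  have nz: "2 * x \<in> \<int> \<Longrightarrow> x \<noteq> 0 \<Longrightarrow> br x \<noteq> 0" for x using br_eq_0 by blast
  have h: "2 * (u - 1/2) \<in> \<int>" "2 * (u + 1/2) \<in> \<int>" "2 * (v - 1/2) \<in> \<int>" "2 * (v + 1/2) \<in> \<int>"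
    using half by (simp_all add: distrib_left right_diff_distrib)
  \<comment> \<open>Two cross-multiplied equations have a common factor \<open>r\<close> unless x =
    1/2 and y = - 1/2, when the middle product is 0 and the outer two are unrelated. The gap
    hypothesis excludes just this.\<close>
  have chain: "\<exists>r. S1 = r * br (x + 1/2) * br (y + 1/2) \<and> S2 = r * br (x - 1/2) * br (y + 1/2)
      \<and> S3 = r * br (x - 1/2) * br (y - 1/2)"
    if "S1 * br (x - 1/2) = S2 * br (x + 1/2)" "S2 * br (y - 1/2) = S3 * br (y + 1/2)"
      "2 * (x - 1/2) \<in> \<int>" "2 * (x + 1/2) \<in> \<int>" "2 * (y - 1/2) \<in> \<int>" "2 * (y + 1/2) \<in> \<int>" 
      "x - y \<noteq> 1" for S1 S2 S3 :: complex and x y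
  proof (cases "br (x - 1/2) = 0")
    case True
    then have x: "x = 1/2" using that br_eq_0 by force
    then have "br (y + 1/2) \<noteq> 0" using that nz by (smt (verit) field_sum_of_halves)
    moreover have "S2 = 0" using that(1) x by simp
    ultimately have "S3 = 0" using that(2) by simp
    then show ?thesis using \<open>S2 = 0\<close> \<open>br (y + 1/2) \<noteq> 0\<close>
      unfolding x by (intro exI[of _ "S1 / br (y + 1/2)"]) simp
  next
    case False
    show ?thesis
    proof (cases "br (y + 1/2) = 0")
      case True
      then have y: "y = - 1/2" using that br_eq_0 by force
      have "br (y - 1/2) \<noteq> 0" using nz[of "y - 1/2"] that y by simp
      then have "S2 = 0" using that(2) True by simp
      then have "S1 = 0" using that(1) False by simp
      then show ?thesis using \<open>S2 = 0\<close> True False \<open>br (y - 1/2) \<noteq> 0\<close>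
        by (intro exI[of _ "S3 / (br (x - 1/2) * br (y - 1/2))"]) simp
    next
      case nz: False
      show ?thesis using False nz that(1,2)
        by (intro exI[of _ "S2 / (br (x - 1/2) * br (y + 1/2))"]) (simp add: field_simps)
    qed
  qed
  obtain r where r: "T1 = r * br (u + 1/2) * br (v + 1/2)" "T2 = r * br (u - 1/2) * br (v + 1/2)"
      "T3 = r * br (u - 1/2) * br (v - 1/2)"
    using chain[OF e1 e2 h gap(2)] by blast
  obtain r' where r': "T1' = r' * br (v + 1/2) * br (u + 1/2)" "T2' = r' * br (v - 1/2) * br (u + 1/2)"
      "T3' = r' * br (v - 1/2) * br (u - 1/2)"
    using chain[OF e1' e2' h(3,4) h(1,2) gap(1)] by blast
  \<comment> \<open>The two factors are compared through the first products, or through the third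
    ones when a bracket of the first vanishes; the gap keeps both from vanishing together.\<close>
  have rr: "r * br (v - u + 1) = r' * br (v - u - 1)"
  proof (cases "br (u + 1/2) * br (v + 1/2) = 0")
    case False
    then show ?thesis using f1 r r' by (simp add: field_simps)
  next
    case True
    then have "u = - 1/2 \<or> v = - 1/2" using h br_eq_0 by force
    then have "br (u - 1/2) * br (v - 1/2) \<noteq> 0" using nz h gap by auto
    then show ?thesis using f3 r r' by (simp add: field_simps)
  qed
  have "T1 - ch (1/2) * T2 + T3 = r * br (v - u + 1)"
    unfolding r serre_kernel[symmetric] by (simp add: algebra_simps)
  moreover have "T1' - ch (1/2) * T2' + T3' = r' * br (u - v + 1)"
    unfolding r' serre_kernel[symmetric] by (simp add: algebra_simps)
  moreover have "br (u - v + 1) = - br (v - u - 1)"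
    using br_minus[of "v - u - 1"] by (simp add: algebra_simps)
  ultimately show ?thesis using rr by simp
qed

end

section \<open>Divided differences of products of linear factors\<close>

lemma prod_remove2:
  "finite A \<Longrightarrow> a \<in> A \<Longrightarrow> b \<in> A \<Longrightarrow> a \<noteq> b \<Longrightarrow> prod f A = f a * (f b * prod f (A - {a, b}))"
  for f :: "'a \<Rightarrow> 'b::comm_monoid_mult"
  by (simp add: prod.remove[of A a] prod.remove[of "A - {a}" b] Diff_insert2[symmetric]
      insert_commute)

text \<open>The divided difference of the constant 1. Multiplying by z b - z a = (z \<sigma> - z a)
  - (z \<sigma> - z b) splits it into two sums of the same kind, one without the node a and one
  without b, which are equal by induction.\<close>

lemma divided_difference_one:
  fixes z :: "'j \<Rightarrow> 'a::field"
  assumes "finite J" "inj_on z J" "J \<noteq> {}"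
  shows "(\<Sum>\<sigma>\<in>J. 1 / (\<Prod>\<mu>\<in>J - {\<sigma>}. z \<sigma> - z \<mu>)) = (if card J = 1 then 1 else 0)"
  using assms
proof (induction "card J" arbitrary: J rule: less_induct)
  case less
  show ?case
  proof (cases "card J = 1")
    case True
    then obtain a where "J = {a}" using card_1_singletonE by blast
    then show ?thesis by simp
  next
    case False
    obtain a where a: "a \<in> J" using less.prems(3) by blast
    have "J \<noteq> {a}" using False by auto
    then obtain b where ab: "a \<in> J" "b \<in> J" "a \<noteq> b" using a by blast
    have rem: "(\<Sum>\<sigma>\<in>J. (z \<sigma> - z c) / (\<Prod>\<mu>\<in>J - {\<sigma>}. z \<sigma> - z \<mu>))
        = (\<Sum>\<sigma>\<in>J - {c}. 1 / (\<Prod>\<mu>\<in>(J - {c}) - {\<sigma>}. z \<sigma> - z \<mu>))" if "c \<in> J" for c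
    proof -
      have "(\<Sum>\<sigma>\<in>J. (z \<sigma> - z c) / (\<Prod>\<mu>\<in>J - {\<sigma>}. z \<sigma> - z \<mu>))
          = (\<Sum>\<sigma>\<in>J - {c}. (z \<sigma> - z c) / (\<Prod>\<mu>\<in>J - {\<sigma>}. z \<sigma> - z \<mu>))"
        using less.prems that by (subst sum.remove[of _ c]) auto
      also have "\<dots> = (\<Sum>\<sigma>\<in>J - {c}. 1 / (\<Prod>\<mu>\<in>(J - {c}) - {\<sigma>}. z \<sigma> - z \<mu>))"
      proof (rule sum.cong[OF refl])
        fix \<sigma> assume s: "\<sigma> \<in> J - {c}"
        have "z \<sigma> \<noteq> z c" using s that less.prems by (auto dest: inj_onD)
        moreover have "(\<Prod>\<mu>\<in>J - {\<sigma>}. z \<sigma> - z \<mu>)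
            = (z \<sigma> - z c) * (\<Prod>\<mu>\<in>J - {\<sigma>} - {c}. z \<sigma> - z \<mu>)"
          using s that less.prems by (subst prod.remove[of _ c]) auto
        moreover have "J - {\<sigma>} - {c} = (J - {c}) - {\<sigma>}" by auto
        ultimately show "(z \<sigma> - z c) / (\<Prod>\<mu>\<in>J - {\<sigma>}. z \<sigma> - z \<mu>)
            = 1 / (\<Prod>\<mu>\<in>(J - {c}) - {\<sigma>}. z \<sigma> - z \<mu>)" by simp
      qed
      finally show ?thesis .
    qed
    have ih: "(\<Sum>\<sigma>\<in>J - {c}. 1 / (\<Prod>\<mu>\<in>(J - {c}) - {\<sigma>}. z \<sigma> - z \<mu>))
        = (if card J = 2 then 1 else 0)" if "c \<in> J" for c
    proof -
      have "card (J - {c}) < card J" using that less.prems by (meson card_Diff1_less)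
      moreover have "J - {c} \<noteq> {}" using that ab by blast
      moreover have "card (J - {c}) = 1 \<longleftrightarrow> card J = 2" using that less.prems by auto
      ultimately show ?thesis using less.hyps[of "J - {c}"] less.prems
        by (simp add: inj_on_diff)
    qed
    have "(z b - z a) * (\<Sum>\<sigma>\<in>J. 1 / (\<Prod>\<mu>\<in>J - {\<sigma>}. z \<sigma> - z \<mu>))
        = (\<Sum>\<sigma>\<in>J. (z \<sigma> - z a) / (\<Prod>\<mu>\<in>J - {\<sigma>}. z \<sigma> - z \<mu>))
          - (\<Sum>\<sigma>\<in>J. (z \<sigma> - z b) / (\<Prod>\<mu>\<in>J - {\<sigma>}. z \<sigma> - z \<mu>))"
      unfolding sum_distrib_left sum_subtractf[symmetric] diff_divide_distrib[symmetric]
      by (rule sum.cong) auto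
    also have "\<dots> = 0" using rem ih ab by simp
    finally have "(\<Sum>\<sigma>\<in>J. 1 / (\<Prod>\<mu>\<in>J - {\<sigma>}. z \<sigma> - z \<mu>)) = 0"
      using ab less.prems by (auto dest: inj_onD)
    then show ?thesis using False by simp
  qed
qed

text \<open>In z \<sigma> the numerator is a polynomial of degree \<open>card W\<close> with leading
  coefficient (-1)^\<open>card W\<close>; its divided difference is this coefficient when there is
  one node more than the degree, and 0 when there are still more nodes.\<close>

lemma divided_difference_prod:
  fixes z :: "'j \<Rightarrow> 'a::field"
  assumes "finite W" "finite J" "inj_on z J" "card J \<ge> card W + 1"
  shows "(\<Sum>\<sigma>\<in>J. (\<Prod>w\<in>W. f w - z \<sigma>) / (\<Prod>\<mu>\<in>J - {\<sigma>}. z \<sigma> - z \<mu>))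
      = (if card J = card W + 1 then (- 1) ^ card W else 0)"
  using assms
proof (induction W arbitrary: J rule: finite_induct)
  case empty
  then have "J \<noteq> {}" by auto
  from divided_difference_one[OF empty(1,2) this] show ?case by simp
next
  case (insert w W)
  then obtain a where a: "a \<in> J" by (metis Suc_eq_plus1 card.empty ex_in_conv not_less_eq_eq zero_le)
  have cJ: "card J = Suc (card (J - {a}))" using a insert.prems by (metis card.remove)
  \<comment> \<open>The factor f w - z \<sigma> is written as (f w - z a) - (z \<sigma> - z a): the
    first part lowers the degree, the second cancels the node a as well.\<close>
  have "(\<Sum>\<sigma>\<in>J. (\<Prod>w\<in>insert w W. f w - z \<sigma>) / (\<Prod>\<mu>\<in>J - {\<sigma>}. z \<sigma> - z \<mu>))
     = (f w - z a) * (\<Sum>\<sigma>\<in>J. (\<Prod>w\<in>W. f w - z \<sigma>) / (\<Prod>\<mu>\<in>J - {\<sigma>}. z \<sigma> - z \<mu>))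
      - (\<Sum>\<sigma>\<in>J. (z \<sigma> - z a) * (\<Prod>w\<in>W. f w - z \<sigma>) / (\<Prod>\<mu>\<in>J - {\<sigma>}. z \<sigma> - z \<mu>))"
    unfolding sum_distrib_left sum_subtractf[symmetric]
    using insert.hyps by (intro sum.cong refl) (simp add: algebra_simps diff_divide_distrib[symmetric])
  also have "(\<Sum>\<sigma>\<in>J. (z \<sigma> - z a) * (\<Prod>w\<in>W. f w - z \<sigma>) / (\<Prod>\<mu>\<in>J - {\<sigma>}. z \<sigma> - z \<mu>))
      = (\<Sum>\<sigma>\<in>J - {a}. (z \<sigma> - z a) * (\<Prod>w\<in>W. f w - z \<sigma>) / (\<Prod>\<mu>\<in>J - {\<sigma>}. z \<sigma> - z \<mu>))"
    using a insert.prems by (subst sum.remove[of _ a]) auto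
  also have "\<dots> = (\<Sum>\<sigma>\<in>J - {a}. (\<Prod>w\<in>W. f w - z \<sigma>) / (\<Prod>\<mu>\<in>(J - {a}) - {\<sigma>}. z \<sigma> - z \<mu>))"
  proof (rule sum.cong[OF refl])
    fix \<sigma> assume s: "\<sigma> \<in> J - {a}"
    have "z \<sigma> \<noteq> z a" using s a insert.prems by (auto dest: inj_onD)
    moreover have "(\<Prod>\<mu>\<in>J - {\<sigma>}. z \<sigma> - z \<mu>)
        = (z \<sigma> - z a) * (\<Prod>\<mu>\<in>J - {\<sigma>} - {a}. z \<sigma> - z \<mu>)"
      using s a insert.prems by (subst prod.remove[of _ a]) auto
    moreover have "J - {\<sigma>} - {a} = (J - {a}) - {\<sigma>}" by auto
    ultimately show "(z \<sigma> - z a) * (\<Prod>w\<in>W. f w - z \<sigma>) / (\<Prod>\<mu>\<in>J - {\<sigma>}. z \<sigma> - z \<mu>)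
        = (\<Prod>w\<in>W. f w - z \<sigma>) / (\<Prod>\<mu>\<in>(J - {a}) - {\<sigma>}. z \<sigma> - z \<mu>)" by simp
  qed
  also have "(\<Sum>\<sigma>\<in>J. (\<Prod>w\<in>W. f w - z \<sigma>) / (\<Prod>\<mu>\<in>J - {\<sigma>}. z \<sigma> - z \<mu>)) = 0"
    using insert.IH[of J] insert.prems insert.hyps by simp
  also have "(\<Sum>\<sigma>\<in>J - {a}. (\<Prod>w\<in>W. f w - z \<sigma>) / (\<Prod>\<mu>\<in>(J - {a}) - {\<sigma>}. z \<sigma> - z \<mu>))
      = (if card (J - {a}) = card W + 1 then (- 1) ^ card W else 0)"
    using insert.IH[of "J - {a}"] insert.prems insert.hyps cJ by (simp add: inj_on_diff)
  finally show ?case using insert.hyps cJ by simp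
qed

text \<open>Coinciding nodes contribute \<open>0\<close> on the left, as \<open>x / 0 = 0\<close>; the double zero of the
  numerator makes this the right value.\<close>

lemma divided_difference_degenerate:
  fixes z :: "'j \<Rightarrow> 'a::field"
  assumes "finite W" "finite J" "card J = card W + 1"
    and "\<And>a b c. \<lbrakk>a \<in> J; b \<in> J; c \<in> J; z a = z b; z b = z c; a \<noteq> b; b \<noteq> c\<rbrakk> \<Longrightarrow> a = c"
    and "\<And>a b. \<lbrakk>a \<in> J; b \<in> J; z a = z b; a \<noteq> b\<rbrakk>
      \<Longrightarrow> \<exists>v\<in>W. \<exists>w\<in>W. v \<noteq> w \<and> f v = z a \<and> f w = z a"
  shows "(\<Sum>\<sigma>\<in>J. (\<Prod>w\<in>W. f w - z \<sigma>) / (\<Prod>\<mu>\<in>J - {\<sigma>}. z \<sigma> - z \<mu>)) = (- 1) ^ card W"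
  using assms
proof (induction "card J" arbitrary: J W rule: less_induct)
  case less
  show ?case
  proof (cases "inj_on z J")
    case True
    then show ?thesis using divided_difference_prod[of W J z f] less.prems by simp
  next
    case False
    then obtain a b where ab: "a \<in> J" "b \<in> J" "z a = z b" "a \<noteq> b" by (auto simp: inj_on_def)
    then obtain v w where vw: "v \<in> W" "w \<in> W" "v \<noteq> w" "f v = z a" "f w = z a"
      using less.prems(5) by blast
    let ?J = "J - {a, b}" and ?W = "W - {v, w}"
    have cJ: "card J = card ?J + 2" using card_Diff_subset[of "{a, b}" J] card_mono[of J "{a, b}"] ab less.prems(2) by simp
    have cW: "card W = card ?W + 2" using card_Diff_subset[of "{v, w}" W] card_mono[of W "{v, w}"] vw less.prems(1) by simp
    \<comment> \<open>No three nodes coincide, so the remaining ones avoid the common value. There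
      the double zero of the numerator cancels against the two removed nodes, and induction applies
      to the smaller sets.\<close>
    have other: "z c \<noteq> z a" if "c \<in> ?J" for c
      using less.prems(4)[of a b c] that ab by auto
    have "(\<Sum>\<sigma>\<in>?J. (\<Prod>w\<in>?W. f w - z \<sigma>) / (\<Prod>\<mu>\<in>?J - {\<sigma>}. z \<sigma> - z \<mu>)) = (- 1) ^ card ?W"
    proof (rule less.hyps)
      show "card ?J < card J" using cJ by simp
      show "card ?J = card ?W + 1" using cJ cW less.prems(3) by simp
      show "\<exists>v\<in>?W. \<exists>w\<in>?W. v \<noteq> w \<and> f v = z c \<and> f w = z c"
        if "c \<in> ?J" "d \<in> ?J" "z c = z d" "c \<noteq> d" for c d
      proof -
        obtain v' w' where "v' \<in> W" "w' \<in> W" "v' \<noteq> w'" "f v' = z c" "f w' = z c"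
          using less.prems(5)[of c d] \<open>c \<in> ?J\<close> \<open>d \<in> ?J\<close> \<open>z c = z d\<close> \<open>c \<noteq> d\<close> by auto
        then show ?thesis using other[OF \<open>c \<in> ?J\<close>] vw by (intro bexI[of _ v'] bexI[of _ w']) auto
      qed
          show "a' = c'" if "a' \<in> ?J" "b' \<in> ?J" "c' \<in> ?J" "z a' = z b'" "z b' = z c'" "a' \<noteq> b'" "b' \<noteq> c'"
        for a' b' c'
        using less.prems(4)[of a' b' c'] that by blast
    qed (use less.prems(1,2) in auto)
    also have "(- 1) ^ card ?W = ((- 1) ^ card W :: 'a)" using cW by simp
    also have "(\<Sum>\<sigma>\<in>?J. (\<Prod>w\<in>?W. f w - z \<sigma>) / (\<Prod>\<mu>\<in>?J - {\<sigma>}. z \<sigma> - z \<mu>))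
        = (\<Sum>\<sigma>\<in>?J. (\<Prod>w\<in>W. f w - z \<sigma>) / (\<Prod>\<mu>\<in>J - {\<sigma>}. z \<sigma> - z \<mu>))"
    proof (rule sum.cong[OF refl])
      fix c assume c: "c \<in> ?J"
      have "(\<Prod>w\<in>W. f w - z c) = (f v - z c) * ((f w - z c) * (\<Prod>w\<in>?W. f w - z c))"
        using vw less.prems(1) by (intro prod_remove2)
      moreover have "(\<Prod>\<mu>\<in>J - {c}. z c - z \<mu>)
          = (z c - z a) * ((z c - z b) * (\<Prod>\<mu>\<in>(J - {c}) - {a, b}. z c - z \<mu>))"
        using c ab less.prems(2) by (intro prod_remove2) auto
      moreover have "(J - {c}) - {a, b} = ?J - {c}" by auto
      ultimately show "(\<Prod>w\<in>?W. f w - z c) / (\<Prod>\<mu>\<in>?J - {c}. z c - z \<mu>)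
        = (\<Prod>w\<in>W. f w - z c) / (\<Prod>\<mu>\<in>J - {c}. z c - z \<mu>)"
        using other[OF c] vw ab by (simp add: divide_simps) (simp add: algebra_simps)
    qed
    also have "\<dots> = (\<Sum>\<sigma>\<in>J. (\<Prod>w\<in>W. f w - z \<sigma>) / (\<Prod>\<mu>\<in>J - {\<sigma>}. z \<sigma> - z \<mu>))"
    proof (rule sum.mono_neutral_left)
      show "\<forall>i\<in>J - ?J. (\<Prod>w\<in>W. f w - z i) / (\<Prod>\<mu>\<in>J - {i}. z i - z \<mu>) = 0"
      proof
        fix i assume "i \<in> J - ?J"
        then have "f v - z i = 0" using ab vw by auto
        then have "(\<Prod>w\<in>W. f w - z i) = 0" using vw(1) less.prems(1) by (meson prod_zero)
        then show "(\<Prod>w\<in>W. f w - z i) / (\<Prod>\<mu>\<in>J - {i}. z i - z \<mu>) = 0" by simp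
      qed
    qed (use less.prems(2) in auto)
    finally show ?thesis by simp
  qed
qed

section \<open>Patterns in symmetric coordinates\<close>

definition pos :: "pattern \<Rightarrow> nat \<Rightarrow> nat \<Rightarrow> real" where
  "pos \<alpha> j k = \<alpha> j k + real k / 2 - real j"

definition idx :: "nat \<Rightarrow> nat set" where "idx k = {1..k div 2}"

definition adj :: "nat \<Rightarrow> nat \<Rightarrow> bool" where "adj a b \<longleftrightarrow> a = Suc b \<or> b = Suc a"

definition nb :: "nat \<Rightarrow> (nat \<times> nat) set" where "nb a = {(i, b). adj a b \<and> i \<in> idx b}"

text \<open>\<open>above j a i b\<close>: in every pattern the entry \<open>(j, a)\<close> dominates the entry \<open>(i, b)\<close>
  of an adjacent row.\<close>

definition above :: "nat \<Rightarrow> nat \<Rightarrow> nat \<Rightarrow> nat \<Rightarrow> bool" where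
  "above j a i b \<longleftrightarrow> (if b < a then j \<le> i else j < i)"

text \<open>The single form that the betweenness conditions take for both parities of the row. The
  absolute value covers the lower ends of the chains; the 1/2 is the offset between the positions in
  adjacent rows.\<close>

definition sep :: "pattern \<Rightarrow> nat \<Rightarrow> nat \<Rightarrow> nat \<Rightarrow> nat \<Rightarrow> bool" where
  "sep \<alpha> j a i b \<longleftrightarrow> (if above j a i b then pos \<alpha> j a \<ge> \<bar>pos \<alpha> i b\<bar> + 1/2
     else pos \<alpha> i b \<ge> \<bar>pos \<alpha> j a\<bar> + 1/2)"

text \<open>What is left of the notion of pattern when betweenness is taken out: the part that
  survives any step below the top row.\<close>

definition frame :: "nat \<Rightarrow> (nat \<Rightarrow> real) \<Rightarrow> pattern \<Rightarrow> bool" where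
  "frame n m \<alpha> \<longleftrightarrow> (\<forall>j\<in>idx n. \<alpha> j n = m j) \<and>
     ((\<forall>k\<in>{2..n}. \<forall>j\<in>idx k. \<alpha> j k \<in> \<int>) \<or> (\<forall>k\<in>{2..n}. \<forall>j\<in>idx k. \<alpha> j k \<in> half_integers)) \<and>
     (\<forall>j k. \<not> (k \<in> {2..n} \<and> j \<in> idx k) \<longrightarrow> \<alpha> j k = 0)"

definition shift :: "nat \<Rightarrow> nat \<times> real \<Rightarrow> pattern \<Rightarrow> pattern" where
  "shift k \<sigma> \<alpha> = \<alpha>(fst \<sigma> := (\<alpha> (fst \<sigma>))(k := \<alpha> (fst \<sigma>) k + snd \<sigma>))"

text \<open>The step \<open>(0, 0)\<close> stands for the diagonal term.\<close>

definition moves :: "nat \<Rightarrow> (nat \<times> real) set" where "moves k = idx k \<times> {1, - 1}"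

definition steps :: "nat \<Rightarrow> (nat \<times> real) set" where
  "steps k = moves k \<union> (if odd k then {(0, 0)} else {})"

definition neg :: "nat \<times> real \<Rightarrow> nat \<times> real" where "neg \<sigma> = (fst \<sigma>, - snd \<sigma>)"

definition th :: "nat \<Rightarrow> nat \<times> real \<Rightarrow> pattern \<Rightarrow> real" where
  "th k \<sigma> \<alpha> = (if fst \<sigma> = 0 then - 1/2 else snd \<sigma> * pos \<alpha> (fst \<sigma>) k)"

lemma finite_idx [simp]: "finite (idx k)" by (simp add: idx_def)

lemma zero_idx [simp]: "0 \<notin> idx k" by (simp add: idx_def)

lemma idx_pos: "j \<in> idx k \<Longrightarrow> j \<noteq> 0" by (auto simp: idx_def)

lemma adj_sym: "adj a b \<longleftrightarrow> adj b a" by (auto simp: adj_def)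

lemma adj_neq: "adj a b \<Longrightarrow> a \<noteq> b" by (auto simp: adj_def)

lemma above_swap: "adj a b \<Longrightarrow> above i b j a \<longleftrightarrow> \<not> above j a i b"
  by (auto simp: adj_def above_def)

lemma sep_swap: "adj a b \<Longrightarrow> sep \<alpha> i b j a \<longleftrightarrow> sep \<alpha> j a i b"
  by (simp add: sep_def above_swap)

lemma pos_shift: "pos (shift k \<sigma> \<alpha>) j l = pos \<alpha> j l + (if j = fst \<sigma> \<and> l = k then snd \<sigma> else 0)"
  by (simp add: pos_def shift_def)

lemma pos_shift_row [simp]: "l \<noteq> k \<Longrightarrow> pos (shift k \<sigma> \<alpha>) j l = pos \<alpha> j l"
  by (simp add: pos_shift)

lemma shift_commute: "shift a \<sigma> (shift b \<kappa> \<alpha>) = shift b \<kappa> (shift a \<sigma> \<alpha>)"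
  by (auto simp: shift_def fun_eq_iff)

lemma shift_neg [simp]: "shift a (neg \<sigma>) (shift a \<sigma> \<alpha>) = \<alpha>"
  by (auto simp: shift_def neg_def fun_eq_iff)

lemma shift_diag [simp]: "shift a (0, 0) \<alpha> = \<alpha>"
  by (auto simp: shift_def fun_eq_iff)

lemma neg_neg [simp]: "neg (neg \<sigma>) = \<sigma>" by (simp add: neg_def)

lemma fst_neg [simp]: "fst (neg \<sigma>) = fst \<sigma>" by (simp add: neg_def)

lemma snd_neg [simp]: "snd (neg \<sigma>) = - snd \<sigma>" by (simp add: neg_def)

lemma neg_steps [simp]: "neg \<sigma> \<in> steps a \<longleftrightarrow> \<sigma> \<in> steps a"
  by (cases \<sigma>) (auto simp: steps_def moves_def neg_def)

lemma neg_moves: "\<sigma> \<in> moves a \<Longrightarrow> neg \<sigma> \<in> moves a"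
  by (cases \<sigma>) (auto simp: moves_def neg_def)

lemma finite_steps [simp]: "finite (steps a)" "finite (moves a)"
  by (simp_all add: steps_def moves_def)

lemma movesD: assumes "\<sigma> \<in> moves a"
  shows "fst \<sigma> \<in> idx a" "fst \<sigma> \<noteq> 0" "snd \<sigma> = 1 \<or> snd \<sigma> = - 1" "th a \<sigma> \<alpha> = snd \<sigma> * pos \<alpha> (fst \<sigma>) a"
    "snd \<sigma> * snd \<sigma> = 1" "\<bar>th a \<sigma> \<alpha>\<bar> = \<bar>pos \<alpha> (fst \<sigma>) a\<bar>"
  using assms idx_pos by (auto simp: moves_def th_def abs_mult)

lemma steps_cases: assumes "\<sigma> \<in> steps a"
  obtains "\<sigma> \<in> moves a" | "odd a" "\<sigma> = (0, 0)"
  using assms by (auto simp: steps_def split: if_splits)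

lemma diag_not_move [simp]: "(0, x) \<notin> moves a" by (auto simp: moves_def idx_def)

lemma th_diag [simp]: "th a (0, x) \<alpha> = - 1/2" by (simp add: th_def)

text \<open>Undoing a step at \<theta> is a step at - \<theta> - 1. The position - 1/2 given to the
  diagonal step is the fixed point of this reflection.\<close>

lemma th_neg_shift: "\<sigma> \<in> steps a \<Longrightarrow> th a (neg \<sigma>) (shift a \<sigma> \<alpha>) = - th a \<sigma> \<alpha> - 1"
  by (erule steps_cases) (auto simp: movesD th_def pos_shift moves_def idx_pos)

lemma th_shift_other: "a \<noteq> b \<Longrightarrow> th a \<sigma> (shift b \<kappa> \<alpha>) = th a \<sigma> \<alpha>"
  by (simp add: th_def)

lemma th_shift_same: "\<sigma> \<in> moves a \<Longrightarrow> th a \<sigma> (shift a \<sigma> \<alpha>) = th a \<sigma> \<alpha> + 1"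
  by (auto simp: th_def pos_shift movesD moves_def idx_pos)

lemma th_shift_index: "fst \<tau> \<noteq> fst \<sigma> \<Longrightarrow> th a \<tau> (shift a \<sigma> \<alpha>) = th a \<tau> \<alpha>"
  by (simp add: th_def pos_shift)

lemma half_integers_add_int: "x \<in> half_integers \<Longrightarrow> y \<in> \<int> \<Longrightarrow> x + y \<in> half_integers"
  using Ints_add[of "x - 1/2" y] by (simp add: half_integers_def diff_add_eq)

lemma frame_shift:
  assumes "frame n m \<alpha>" "a < n" "\<sigma> \<in> steps a"
  shows "frame n m (shift a \<sigma> \<alpha>)"
  using assms(3)
proof (cases rule: steps_cases)
  case 1
  then have j: "fst \<sigma> \<in> idx a" and e: "snd \<sigma> \<in> \<int>" using movesD[OF 1] by (auto)
  then have a2: "2 \<le> a" by (auto simp: idx_def)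
  show ?thesis unfolding frame_def
  proof (intro conjI)
    show "\<forall>j\<in>idx n. shift a \<sigma> \<alpha> j n = m j" using assms by (simp add: frame_def shift_def)
    show "\<forall>j k. \<not> (k \<in> {2..n} \<and> j \<in> idx k) \<longrightarrow> shift a \<sigma> \<alpha> j k = 0"
      using assms a2 j by (auto simp: frame_def shift_def)
    show "(\<forall>k\<in>{2..n}. \<forall>j\<in>idx k. shift a \<sigma> \<alpha> j k \<in> \<int>) \<or>
      (\<forall>k\<in>{2..n}. \<forall>j\<in>idx k. shift a \<sigma> \<alpha> j k \<in> half_integers)"
      using assms e half_integers_add_int by (auto simp: frame_def shift_def)
  qed
qed (use assms in simp)

text \<open>The two rows form one chain x 1, y 1, x 2, y 2, ... in which each term exceeds the
  modulus of the next by 1/2. Hence comparing consecutive terms is enough to compare any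
  two.\<close>

lemma chain_sep:
  assumes c1: "\<And>j. 1 \<le> j \<Longrightarrow> j \<le> q \<Longrightarrow> x j \<ge> \<bar>y j\<bar> + (1/2::real)"
    and c2: "\<And>j. 1 \<le> j \<Longrightarrow> Suc j \<le> p \<Longrightarrow> y j \<ge> \<bar>x (Suc j)\<bar> + 1/2"
    and qp: "q \<le> p" "p \<le> Suc q"
    and j: "1 \<le> j" "j \<le> p" and i: "1 \<le> i" "i \<le> q"
  shows "if j \<le> i then x j \<ge> \<bar>y i\<bar> + 1/2 else y i \<ge> \<bar>x j\<bar> + 1/2"
proof -
  have dec: "x j \<ge> \<bar>x k\<bar> + 1" if "1 \<le> j" "j < k" "k \<le> p" for j k
    using that(2,3)
  proof (induction k)
    case (Suc k)
    have s: "x k \<ge> \<bar>x (Suc k)\<bar> + 1" if "1 \<le> k"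
      using c1[of k] c2[of k] Suc.prems qp that by linarith
    show ?case
    proof (cases "j = k")
      case True
      then show ?thesis using s \<open>1 \<le> j\<close> by simp
    next
      case False
      then have "x j \<ge> \<bar>x k\<bar> + 1" using Suc by simp
      then show ?thesis using s Suc.prems \<open>1 \<le> j\<close> by fastforce
    qed
  qed simp
  show ?thesis
  proof (cases "j \<le> i")
    case True
    have "x i \<ge> \<bar>y i\<bar> + 1/2" using c1 i by simp
    moreover have "x j \<ge> x i" using dec[of j i] j i qp True by (cases "j = i") auto
    ultimately show ?thesis using True by simp
  next
    case False
    then have "y i \<ge> \<bar>x (Suc i)\<bar> + 1/2" using c2 i j by simp
    moreover have "\<bar>x (Suc i)\<bar> \<ge> \<bar>x j\<bar>" using dec[of "Suc i" j] False j by (cases "j = Suc i") auto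
    ultimately show ?thesis using False by simp
  qed
qed

text \<open>Only the last inequality restricts signs. Added to its predecessor it makes the last
  entry of the odd row at least 1/2; going back along the chain, all entries of that row are, so
  moduli may be inserted everywhere.\<close>

lemma row_chain_odd:
  fixes \<alpha> :: pattern
  assumes "1 \<le> p"
  shows "((\<forall>j\<in>{1..p}. \<alpha> j (2 * p + 1) \<ge> \<alpha> j (2 * p)) \<and>
        (\<forall>j\<in>{1..<p}. \<alpha> j (2 * p) \<ge> \<alpha> (j + 1) (2 * p + 1)) \<and>
        \<alpha> p (2 * p) \<ge> - \<alpha> p (2 * p + 1))
     \<longleftrightarrow> (\<forall>j\<in>idx (2*p+1). \<forall>i\<in>idx (2*p). sep \<alpha> j (2*p+1) i (2*p))" (is "?L = ?R")
proof
  assume L: ?L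
  let ?x = "\<lambda>j. pos \<alpha> j (2*p+1)" and ?y = "\<lambda>j. pos \<alpha> j (2*p)"
  have a: "?x j \<ge> ?y j + 1/2" if "1 \<le> j" "j \<le> p" for j
    using L that by (auto simp: pos_def add_divide_distrib)
  have b: "?y j \<ge> ?x (Suc j) + 1/2" if "1 \<le> j" "j < p" for j
    using L that by (auto simp: pos_def add_divide_distrib)
  have c: "?x p \<ge> - ?y p + 1/2" using L by (auto simp: pos_def add_divide_distrib)
  have xp: "?x p \<ge> 1/2" using a[of p] c assms by linarith
  have xj: "?x j \<ge> 1/2" if "1 \<le> j" "j \<le> p" for j
    using that(2,1)
  proof (induction j rule: inc_induct)
    case (step k) then show ?case using a[of k] b[of k] by fastforce
  qed (use xp in simp)
  have c1: "?x j \<ge> \<bar>?y j\<bar> + 1/2" if "1 \<le> j" "j \<le> p" for j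
  proof (cases "j = p")
    case True then show ?thesis using a[of p] c assms by auto
  next
    case False then show ?thesis using a[of j] b[of j] xj[of "Suc j"] that by auto
  qed
  have c2: "?y j \<ge> \<bar>?x (Suc j)\<bar> + 1/2" if "1 \<le> j" "Suc j \<le> p" for j
    using b[of j] xj[of "Suc j"] that by auto
  show ?R
  proof (intro ballI)
    fix j i assume "j \<in> idx (2 * p + 1)" "i \<in> idx (2 * p)"
    then have "if j \<le> i then ?x j \<ge> \<bar>?y i\<bar> + 1/2 else ?y i \<ge> \<bar>?x j\<bar> + 1/2"
      using chain_sep[where q = p and x = ?x and y = ?y and p = p, OF c1 c2, of j i]
      by (auto simp: idx_def)
    then show "sep \<alpha> j (2*p+1) i (2*p)" by (auto simp: sep_def above_def split: if_splits)
  qed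
next
  assume R: ?R
  have 1: "pos \<alpha> j (2*p+1) \<ge> \<bar>pos \<alpha> j (2*p)\<bar> + 1/2" if "1 \<le> j" "j \<le> p" for j
    using R[rule_format, of j j] that by (simp add: idx_def sep_def above_def)
  have 2: "pos \<alpha> j (2*p) \<ge> \<bar>pos \<alpha> (Suc j) (2*p+1)\<bar> + 1/2" if "1 \<le> j" "j < p" for j
    using R[rule_format, of "Suc j" j] that by (simp add: idx_def sep_def above_def)
  show ?L
  proof (intro conjI ballI)
    fix j assume "j \<in> {1..p}"
    then show "\<alpha> j (2 * p) \<le> \<alpha> j (2 * p + 1)" using 1[of j] by (auto simp: pos_def add_divide_distrib)
  next
    fix j assume "j \<in> {1..<p}"
    then show "\<alpha> (j + 1) (2 * p + 1) \<le> \<alpha> j (2 * p)" using 2[of j]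
      by (auto simp: pos_def add_divide_distrib)
  next
    show "- \<alpha> p (2 * p + 1) \<le> \<alpha> p (2 * p)" using 1[of p] assms
      by (auto simp: pos_def add_divide_distrib)
  qed
qed

text \<open>Row 2p has one entry more than row 2p - 1, and this last entry alone may be negative.
  The condition on it makes the last entry of row 2p - 1 at least 1/2, and positivity spreads back
  along the chain.\<close>

lemma row_chain_even:
  fixes \<alpha> :: pattern
  assumes "2 \<le> p"
  shows "((\<forall>j\<in>{1..p - 1}. \<alpha> j (2 * p) \<ge> \<alpha> j (2 * p - 1)) \<and>
        (\<forall>j\<in>{1..<p - 1}. \<alpha> j (2 * p - 1) \<ge> \<alpha> (j + 1) (2 * p)) \<and>
        \<alpha> (p - 1) (2 * p - 1) \<ge> \<bar>\<alpha> p (2 * p)\<bar>)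
     \<longleftrightarrow> (\<forall>j\<in>idx (2*p). \<forall>i\<in>idx (2*p-1). sep \<alpha> j (2*p) i (2*p-1))" (is "?L = ?R")
proof -
  obtain q where p: "p = Suc q" and q: "1 \<le> q" using assms by (cases p) auto
  let ?x = "\<lambda>j. pos \<alpha> j (2*p)" and ?y = "\<lambda>j. pos \<alpha> j (2*p-1)"
  have r: "pos \<alpha> j (Suc (2 * q)) = \<alpha> j (Suc (2 * q)) + real q + 1/2 - real j"
    "pos \<alpha> j (Suc (Suc (2 * q))) = \<alpha> j (Suc (Suc (2 * q))) + real q + 1 - real j" for j
    by (auto simp: pos_def add_divide_distrib)
  have ix: "idx (2*p) = {1..p}" "idx (2*p-1) = {1..q}" using p by (auto simp: idx_def)
  show ?thesis
  proof
    assume L: ?L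
    have a: "?x j \<ge> ?y j + 1/2" if "1 \<le> j" "j \<le> q" for j
      using L that p by (auto simp: r)
    have b: "?y j \<ge> ?x (Suc j) + 1/2" if "1 \<le> j" "j < q" for j
      using L that p by (auto simp: r)
    have c: "?y q \<ge> \<bar>?x p\<bar> + 1/2" using L p by (auto simp: r)
    have yj: "?y j \<ge> 1/2" if "1 \<le> j" "j \<le> q" for j
      using that(2,1)
    proof (induction j rule: inc_induct)
      case (step k) then show ?case using a[of "Suc k"] b[of k] by fastforce
    qed (use c in simp)
    have c1: "?x j \<ge> \<bar>?y j\<bar> + 1/2" if "1 \<le> j" "j \<le> q" for j
      using a[of j] yj[of j] that by auto
    have c2: "?y j \<ge> \<bar>?x (Suc j)\<bar> + 1/2" if "1 \<le> j" "Suc j \<le> p" for j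
    proof (cases "j = q")
      case True then show ?thesis using c p by simp
    next
      case False then show ?thesis using b[of j] a[of "Suc j"] yj[of "Suc j"] that p by auto
    qed
    show ?R
    proof (intro ballI)
      fix j i assume "j \<in> idx (2 * p)" "i \<in> idx (2 * p - 1)"
      then have "if j \<le> i then ?x j \<ge> \<bar>?y i\<bar> + 1/2 else ?y i \<ge> \<bar>?x j\<bar> + 1/2"
        using chain_sep[where q = q and x = ?x and y = ?y and p = p, OF c1 c2, of j i] p
        unfolding ix by auto
      then show "sep \<alpha> j (2*p) i (2*p-1)" using assms by (auto simp: sep_def above_def split: if_splits)
    qed
  next
    assume R: ?R
    have 1: "?x j \<ge> \<bar>?y j\<bar> + 1/2" if "1 \<le> j" "j \<le> q" for j
      using R[unfolded ix, rule_format, of j j] that assms p by (simp add: sep_def above_def)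
    have 2: "?y j \<ge> \<bar>?x (Suc j)\<bar> + 1/2" if "1 \<le> j" "j \<le> q" for j
      using R[unfolded ix, rule_format, of "Suc j" j] that assms p by (simp add: sep_def above_def)
    show ?L
    proof (intro conjI ballI)
      fix j assume "j \<in> {1..p - 1}"
      then show "\<alpha> j (2 * p - 1) \<le> \<alpha> j (2 * p)" using 1[of j] p by (auto simp: r)
    next
      fix j assume "j \<in> {1..<p - 1}"
      then show "\<alpha> (j + 1) (2 * p) \<le> \<alpha> j (2 * p - 1)" using 2[of j] p by (auto simp: r)
    next
      show "\<bar>\<alpha> p (2 * p)\<bar> \<le> \<alpha> (p - 1) (2 * p - 1)" using 2[of q] q p by (auto simp: r)
    qed
  qed
qed

text \<open>Pairs of consecutive rows are sorted by the parity of the lower one. Rows 0 and 1 are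
  empty, so the pairs that the original conditions leave out impose nothing.\<close>

lemma GT_patterns_iff:
  "\<alpha> \<in> GT_patterns n m \<longleftrightarrow> frame n m \<alpha> \<and>
     (\<forall>a b. adj a b \<and> a \<le> n \<and> b \<le> n \<longrightarrow> (\<forall>j\<in>idx a. \<forall>i\<in>idx b. sep \<alpha> j a i b))"
proof -
  let ?rows = "\<forall>k<n. \<forall>j\<in>idx (Suc k). \<forall>i\<in>idx k. sep \<alpha> j (Suc k) i k"
  have rows: "?rows \<longleftrightarrow> (\<forall>a b. adj a b \<and> a \<le> n \<and> b \<le> n \<longrightarrow> (\<forall>j\<in>idx a. \<forall>i\<in>idx b. sep \<alpha> j a i b))"
  proof
    assume ?rows
    then show "\<forall>a b. adj a b \<and> a \<le> n \<and> b \<le> n \<longrightarrow> (\<forall>j\<in>idx a. \<forall>i\<in>idx b. sep \<alpha> j a i b)"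
      by (auto simp: adj_def sep_swap[of _ "Suc _"] Suc_le_eq)
  qed (auto simp: adj_def)
  let ?odd = "\<lambda>p. (\<forall>j\<in>{1..p}. \<alpha> j (2 * p + 1) \<ge> \<alpha> j (2 * p)) \<and>
        (\<forall>j\<in>{1..<p}. \<alpha> j (2 * p) \<ge> \<alpha> (j + 1) (2 * p + 1)) \<and>
        \<alpha> p (2 * p) \<ge> - \<alpha> p (2 * p + 1)"
  let ?even = "\<lambda>p. (\<forall>j\<in>{1..p - 1}. \<alpha> j (2 * p) \<ge> \<alpha> j (2 * p - 1)) \<and>
        (\<forall>j\<in>{1..<p - 1}. \<alpha> j (2 * p - 1) \<ge> \<alpha> (j + 1) (2 * p)) \<and>
        \<alpha> (p - 1) (2 * p - 1) \<ge> \<bar>\<alpha> p (2 * p)\<bar>"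
  have "(\<forall>p. 1 \<le> p \<and> 2 * p + 1 \<le> n \<longrightarrow> ?odd p) \<and> (\<forall>p. 2 \<le> p \<and> 2 * p \<le> n \<longrightarrow> ?even p) \<longleftrightarrow> ?rows"
  proof
    assume L: "(\<forall>p. 1 \<le> p \<and> 2 * p + 1 \<le> n \<longrightarrow> ?odd p) \<and> (\<forall>p. 2 \<le> p \<and> 2 * p \<le> n \<longrightarrow> ?even p)"
    show ?rows
    proof (intro allI impI)
      fix k assume k: "k < n"
      consider "k < 2" | p where "k = 2 * p" "1 \<le> p" | p where "k = 2 * p - 1" "2 \<le> p"
      proof (cases "even k")
        case True
        then obtain p where "k = 2 * p" by (elim evenE)
        then show ?thesis using that(1,2) by (cases "p = 0") auto
      next
        case False
        then obtain p where "k = 2 * p + 1" by (elim oddE)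
        then show ?thesis using that(1) that(3)[of "Suc p"] by (cases "p = 0") auto
      qed
      then show "\<forall>j\<in>idx (Suc k). \<forall>i\<in>idx k. sep \<alpha> j (Suc k) i k"
      proof cases
        case 1 then show ?thesis by (auto simp: idx_def)
      next
        case 2 then show ?thesis using L row_chain_odd[of p \<alpha>] k by simp
      next
        case 3 then show ?thesis using L row_chain_even[of p \<alpha>] k by simp
      qed
    qed
  next
    assume R: ?rows
    show "(\<forall>p. 1 \<le> p \<and> 2 * p + 1 \<le> n \<longrightarrow> ?odd p) \<and> (\<forall>p. 2 \<le> p \<and> 2 * p \<le> n \<longrightarrow> ?even p)"
    proof (rule conjI; intro allI impI)
      fix p assume p: "1 \<le> p \<and> 2 * p + 1 \<le> n"
      then show "?odd p" using R[rule_format, of "2 * p"] row_chain_odd[of p \<alpha>] by simp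
    next
      fix p assume p: "2 \<le> p \<and> 2 * p \<le> n"
      then have "2 * p - 1 < n" "Suc (2 * p - 1) = 2 * p" by auto
      then have "\<forall>j\<in>idx (2 * p). \<forall>i\<in>idx (2 * p - 1). sep \<alpha> j (2 * p) i (2 * p - 1)"
        using R by metis
      then show "?even p" using row_chain_even[of p \<alpha>] p by simp
    qed
  qed
  then show ?thesis unfolding rows[symmetric] unfolding GT_patterns_def frame_def mem_Collect_eq idx_def
    by argo
qed

text \<open>The first entry of row k + 1 dominates every entry of row k, so a bound on the positions
  in the top row passes down to all rows; below a bound there are only finitely many multiples of
  1/2.\<close>

lemma finite_GT_patterns: "finite (GT_patterns n m)"
proof -
  \<comment> \<open>The multiples of \<open>n\<close> absorb the offsets k/2 - j, once on the way
    from entries to positions and once on the way back.\<close>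
  define M where "M = (\<Sum>j\<in>idx n. \<bar>m j\<bar>) + 3 * real n"
  define V where "V = {x::real. 2 * x \<in> \<int> \<and> \<bar>x\<bar> \<le> M + 3 * n}"
  have finV: "finite V"
  proof -
    have "V \<subseteq> (\<lambda>k::int. of_int k / 2) ` {- \<lceil>2 * (M + 3 * n)\<rceil>..\<lceil>2 * (M + 3 * n)\<rceil>}"
    proof
      fix x assume "x \<in> V"
      then obtain k :: int where k: "2 * x = of_int k" and b: "\<bar>x\<bar> \<le> M + 3 * n"
        by (auto simp: V_def elim: Ints_cases)
      then have "of_int \<bar>k\<bar> \<le> 2 * (M + 3 * n)" by auto
      then have "\<bar>k\<bar> \<le> \<lceil>2 * (M + 3 * n)\<rceil>" by linarith
      then show "x \<in> (\<lambda>k::int. of_int k / 2) ` {- \<lceil>2 * (M + 3 * n)\<rceil>..\<lceil>2 * (M + 3 * n)\<rceil>}"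
        using k by (intro image_eqI[of _ _ k]) auto
    qed
    then show ?thesis by (rule finite_subset) simp
  qed
  have M0: "M \<ge> 0" by (simp add: M_def sum_nonneg)
  let ?A = "{1..n} \<times> {2..n}"
  have "(\<lambda>\<alpha>. case_prod \<alpha>) ` GT_patterns n m
      \<subseteq> {f. \<forall>x. (x \<in> ?A \<longrightarrow> f x \<in> V) \<and> (x \<notin> ?A \<longrightarrow> f x = 0)}"
  proof (rule image_subsetI)
    fix \<alpha> :: pattern
    assume P: "\<alpha> \<in> GT_patterns n m"
    then have fr: "frame n m \<alpha>"
      and sp: "\<And>a b j i. \<lbrakk>adj a b; a \<le> n; b \<le> n; j \<in> idx a; i \<in> idx b\<rbrakk> \<Longrightarrow> sep \<alpha> j a i b"
      unfolding GT_patterns_iff by blast+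
    have top: "\<bar>pos \<alpha> j n\<bar> \<le> M" if "j \<in> idx n" for j
    proof -
      have "\<bar>m j\<bar> \<le> (\<Sum>j\<in>idx n. \<bar>m j\<bar>)" using that by (intro member_le_sum) auto
      moreover have "\<alpha> j n = m j" using fr that by (simp add: frame_def)
      moreover have "real j \<le> real n" using that by (auto simp: idx_def)
      ultimately show ?thesis by (simp add: M_def pos_def)
    qed
    have all: "\<forall>j\<in>idx k. \<bar>pos \<alpha> j k\<bar> \<le> M" if "k \<le> n" for k
      using that
    proof (induction k rule: inc_induct)
      case base then show ?case using top by blast
    next
      case (step k)
      show ?case
      proof
        fix j assume j: "j \<in> idx k"
        then have 1: "1 \<in> idx (Suc k)" by (auto simp: idx_def)
        then have "sep \<alpha> 1 (Suc k) j k" using sp[of "Suc k" k 1 j] j step by (simp add: adj_def)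
        then have "pos \<alpha> 1 (Suc k) \<ge> \<bar>pos \<alpha> j k\<bar> + 1/2" using j by (simp add: sep_def above_def idx_def)
        then show "\<bar>pos \<alpha> j k\<bar> \<le> M" using step.IH 1 by fastforce
      qed
    qed
    have 1: "\<alpha> j k \<in> V" if "1 \<le> j \<and> j \<le> n \<and> 2 \<le> k \<and> k \<le> n" for j k
    proof (cases "j \<in> idx k")
      case True
      have "\<bar>pos \<alpha> j k\<bar> \<le> M" using all that True by blast
      then have "\<bar>\<alpha> j k\<bar> \<le> M + 3 * n" using that by (auto simp: pos_def)
      moreover have "\<alpha> j k \<in> \<int> \<or> \<alpha> j k \<in> half_integers" using fr that True by (auto simp: frame_def)
      then have "2 * \<alpha> j k \<in> \<int>"
      proof
        assume "\<alpha> j k \<in> half_integers"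
        then have "2 * (\<alpha> j k - 1/2) + 1 \<in> \<int>" unfolding half_integers_def
          by (intro Ints_add Ints_mult) auto
        then show ?thesis by (simp add: right_diff_distrib)
      qed simp
      ultimately show ?thesis by (simp add: V_def)
    next
      case False
      then have "\<alpha> j k = 0" using fr by (simp add: frame_def)
      then show ?thesis using M0 by (simp add: V_def)
    qed
    have 2: "\<alpha> j k = 0" if "\<not> (1 \<le> j \<and> j \<le> n \<and> 2 \<le> k \<and> k \<le> n)" for j k
    proof -
      have "k div 2 \<le> n" if "k \<le> n" using that by linarith
      then have "\<not> (k \<in> {2..n} \<and> j \<in> idx k)" using that by (auto simp: idx_def)
      then show ?thesis using fr unfolding frame_def by blast
    qed
    show "case_prod \<alpha> \<in> {f. \<forall>x. (x \<in> ?A \<longrightarrow> f x \<in> V) \<and> (x \<notin> ?A \<longrightarrow> f x = 0)}"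
      using 1 2 by auto
  qed
  moreover have "finite {f. \<forall>x. (x \<in> ?A \<longrightarrow> f x \<in> V) \<and> (x \<notin> ?A \<longrightarrow> f x = (0::real))}"
    by (intro finite_set_of_finite_funs finV) auto
  ultimately have "finite ((\<lambda>\<alpha>. case_prod \<alpha>) ` GT_patterns n m)" by (rule finite_subset)
  moreover have "inj (\<lambda>\<alpha>::pattern. case_prod \<alpha>)"
    by (rule injI) (metis curry_case_prod)
  ultimately show ?thesis by (meson finite_imageD inj_on_subset subset_UNIV)
qed

lemma sep_cong:
  "pos \<alpha> j a = pos \<beta> j a \<Longrightarrow> pos \<alpha> i b = pos \<beta> i b \<Longrightarrow> sep \<alpha> j a i b = sep \<beta> j a i b"
  by (simp add: sep_def)

lemma finite_nb [simp]: "finite (nb a)"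
proof (rule finite_subset)
  show "nb a \<subseteq> idx (Suc a) \<times> {Suc a} \<union> idx (a - 1) \<times> {a - 1}"
    by (auto simp: nb_def adj_def)
qed simp

lemma nb_adj: "(i, b) \<in> nb a \<longleftrightarrow> adj a b \<and> i \<in> idx b" by (simp add: nb_def)

context
  fixes n :: nat and m :: "nat \<Rightarrow> real" and \<alpha> :: pattern
  assumes P: "\<alpha> \<in> GT_patterns n m"
begin

lemma GT_sep: "\<lbrakk>adj a b; a \<le> n; b \<le> n; j \<in> idx a; i \<in> idx b\<rbrakk> \<Longrightarrow> sep \<alpha> j a i b"
  using P unfolding GT_patterns_iff by blast

lemma GT_frame: "frame n m \<alpha>"
  using P unfolding GT_patterns_iff by blast

lemma GT_diff:
  assumes "k \<le> n" "l \<le> n" "j \<in> idx k" "i \<in> idx l"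
  shows "\<alpha> j k - \<alpha> i l \<in> \<int>"
proof -
  have "k \<in> {2..n}" "l \<in> {2..n}" using assms by (auto simp: idx_def)
  then consider "\<alpha> j k \<in> \<int>" "\<alpha> i l \<in> \<int>" | "\<alpha> j k - 1/2 \<in> \<int>" "\<alpha> i l - 1/2 \<in> \<int>"
    using GT_frame assms unfolding frame_def half_integers_def by blast
  then show ?thesis
  proof cases
    case 2
    then have "(\<alpha> j k - 1/2) - (\<alpha> i l - 1/2) \<in> \<int>" by (rule Ints_diff)
    then show ?thesis by simp
  qed simp
qed

lemma GT_pos_same:
  assumes "k \<le> n" "j \<in> idx k" "i \<in> idx k"
  shows "pos \<alpha> j k - pos \<alpha> i k \<in> \<int>"
proof -
  have "pos \<alpha> j k - pos \<alpha> i k = (\<alpha> j k - \<alpha> i k) + of_int (int i - int j)" by (simp add: pos_def)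
  then show ?thesis using GT_diff[of k k j i] assms by (metis Ints_add Ints_of_int)
qed

lemma GT_pos_adj:
  assumes "adj k l" "k \<le> n" "l \<le> n" "j \<in> idx k" "i \<in> idx l"
  shows "pos \<alpha> j k - pos \<alpha> i l - 1/2 \<in> \<int>"
proof -
  have "pos \<alpha> j k - pos \<alpha> i l - 1/2
      = (\<alpha> j k - \<alpha> i l) + of_int (int i - int j + (if k = Suc l then 0 else - 1))"
    using assms(1) by (auto simp: pos_def adj_def field_simps)
  then show ?thesis using GT_diff[of k l j i] assms by (metis Ints_add Ints_of_int)
qed

lemma GT_pos_half:
  assumes "k \<le> n" "j \<in> idx k"
  shows "2 * pos \<alpha> j k \<in> \<int>"
proof -
  have k: "k \<in> {2..n}" using assms by (auto simp: idx_def)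
  have "2 * \<alpha> j k \<in> \<int>"
  proof (cases "\<alpha> j k \<in> \<int>")
    case False
    then have "\<alpha> j k - 1/2 \<in> \<int>" using GT_frame k assms unfolding frame_def half_integers_def by blast
    then have "2 * (\<alpha> j k - 1/2) + 1 \<in> \<int>" by (intro Ints_add Ints_mult) auto
    then show ?thesis by (simp add: right_diff_distrib)
  qed simp
  moreover have "2 * pos \<alpha> j k = 2 * \<alpha> j k + of_int (int k - 2 * int j)"
    by (simp add: pos_def field_simps)
  ultimately show ?thesis by (metis Ints_add Ints_of_int)
qed

text \<open>A step disturbs only those inequalities in which the moved entry takes part.\<close>

lemma GT_shift_iff:
  assumes "a < n" "\<sigma> \<in> moves a"
  shows "shift a \<sigma> \<alpha> \<in> GT_patterns n m
    \<longleftrightarrow> (\<forall>b i. (i, b) \<in> nb a \<longrightarrow> sep (shift a \<sigma> \<alpha>) (fst \<sigma>) a i b)" (is "_ \<longleftrightarrow> ?R")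
proof
  assume "shift a \<sigma> \<alpha> \<in> GT_patterns n m"
  moreover have "b \<le> n" if "adj a b" for b using that assms(1) by (auto simp: adj_def)
  ultimately show ?R using assms movesD(1)[OF assms(2)] unfolding GT_patterns_iff nb_adj by auto
next
  assume R: ?R
  show "shift a \<sigma> \<alpha> \<in> GT_patterns n m" unfolding GT_patterns_iff
  proof (intro conjI allI impI ballI)
    show "frame n m (shift a \<sigma> \<alpha>)" using frame_shift[OF GT_frame] assms by (simp add: steps_def)
    fix a' b' j i
    assume h: "adj a' b' \<and> a' \<le> n \<and> b' \<le> n" "j \<in> idx a'" "i \<in> idx b'"
    then have s: "sep \<alpha> j a' i b'" using GT_sep by blast
    consider "a' = a" "j = fst \<sigma>" | "b' = a" "i = fst \<sigma>"
      | "\<not> (a' = a \<and> j = fst \<sigma>)" "\<not> (b' = a \<and> i = fst \<sigma>)" by blast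
    then show "sep (shift a \<sigma> \<alpha>) j a' i b'"
    proof cases
      case 1 then show ?thesis using R h by (simp add: nb_adj)
    next
      case 2
      then have "sep (shift a \<sigma> \<alpha>) i b' j a'" using R h adj_sym by (simp add: nb_adj)
      then show ?thesis using sep_swap h by blast
    next
      case 3
      then have "pos (shift a \<sigma> \<alpha>) j a' = pos \<alpha> j a'" "pos (shift a \<sigma> \<alpha>) i b' = pos \<alpha> i b'"
        by (auto simp: pos_shift)
      then show ?thesis using s sep_cong by blast
    qed
  qed
qed

end

section \<open>Arithmetic of a step beside a neighbouring entry\<close>

definition sp :: "bool \<Rightarrow> real \<Rightarrow> real \<Rightarrow> bool" where
  "sp A x y \<longleftrightarrow> (if A then x \<ge> \<bar>y\<bar> + 1/2 else y \<ge> \<bar>x\<bar> + 1/2)"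

lemma sep_sp: "sep \<alpha> j a i b = sp (above j a i b) (pos \<alpha> j a) (pos \<alpha> i b)"
  by (simp add: sep_def sp_def)

lemma sp_swap: "sp (\<not> A) y x = sp A x y" by (simp add: sp_def)

lemma Ints_less_1: "x \<in> \<int> \<Longrightarrow> x < 1 \<Longrightarrow> x \<le> 0" for x :: real
  by (auto elim!: Ints_cases)

lemma Ints_gap: "x \<in> \<int> \<Longrightarrow> x < 1 \<Longrightarrow> x \<le> 0" "x \<in> \<int> \<Longrightarrow> - x < 1 \<Longrightarrow> - x \<le> 0" for x :: real
  using Ints_less_1[of x] Ints_less_1[of "- x"] by simp_all

text \<open>Replacing a half-integer y by - y changes a difference by the integer 2y.\<close>

lemma Ints_abs_adj: "x - y - 1/2 \<in> \<int> \<Longrightarrow> x - \<bar>y\<bar> - 1/2 \<in> \<int>" "x - y - 1/2 \<in> \<int> \<Longrightarrow> y - \<bar>x\<bar> - 1/2 \<in> \<int>"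
  if "2 * x \<in> \<int>" "2 * y \<in> \<int>" for x y :: real
proof -
  assume h: "x - y - 1/2 \<in> \<int>"
  have "x - y - 1/2 + 2 * y \<in> \<int>" "2 * y - 2 * x + (x - y - 1/2) \<in> \<int>" "- (x - y - 1/2) - 1 \<in> \<int>"
    "- (x - y - 1/2) - 1 + 2 * x \<in> \<int>" using h that by (meson Ints_add Ints_diff Ints_minus Ints_1)+
  then show "x - \<bar>y\<bar> - 1/2 \<in> \<int>" "y - \<bar>x\<bar> - 1/2 \<in> \<int>"
    using h by (auto simp: abs_if algebra_simps)
qed

text \<open>If both steps together are possible but one of them cannot come first, the two entries
  are as close as betweenness permits. The conclusion is that the bracket
  [\<omega> - \<theta> - 1/2] of the exchange rule vanishes.\<close>

lemma sp_blocked: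
  assumes "e = 1 \<or> e = - 1" "h = 1 \<or> h = - 1" "2 * x \<in> \<int>" "2 * y \<in> \<int>" "x - y - 1/2 \<in> \<int>"
    and "sp A x y" "sp A (x + e) (y + h)" "\<not> sp A (x + e) y"
  shows "h * y - e * x - 1/2 = 0"
proof (cases A)
  note half = Ints_gap[OF assms(3)] Ints_gap[OF assms(4)]
  case True
  have "x - \<bar>y\<bar> - 1/2 \<in> \<int>" using Ints_abs_adj assms by blast
  then have "x - \<bar>y\<bar> - 1/2 < 1 \<Longrightarrow> x - \<bar>y\<bar> - 1/2 \<le> 0" by (rule Ints_less_1)
  then show ?thesis using assms(1,2,6-) True half unfolding sp_def by (auto simp: abs_if split: if_splits)
next
  note half = Ints_gap[OF assms(3)] Ints_gap[OF assms(4)]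
  case False
  have "y - \<bar>x\<bar> - 1/2 \<in> \<int>" using Ints_abs_adj assms by blast
  then have "y - \<bar>x\<bar> - 1/2 < 1 \<Longrightarrow> y - \<bar>x\<bar> - 1/2 \<le> 0" by (rule Ints_less_1)
  then show ?thesis using assms(1,2,6-) False half unfolding sp_def by (auto simp: abs_if split: if_splits)
qed

text \<open>If both orders are possible, [\<omega> - \<theta> - 1/2] and [\<omega> - \<theta> + 1/2]
  have arguments of the same sign, as \<open>phi_exchange\<close> requires.\<close>

lemma sp_free:
  assumes "e = 1 \<or> e = - 1" "h = 1 \<or> h = - 1"
    and "sp A x y" "sp A (x + e) (y + h)" "sp A (x + e) y" "sp A x (y + h)"
  shows "\<bar>h * y - e * x\<bar> > 1/2"
  using assms unfolding sp_def by (auto simp: abs_if split: if_splits)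

text \<open>For a possible step the roots in \<open>phi\<close> are taken at nonzero arguments,
  where the choice of roots says something.\<close>

lemma sp_sum:
  assumes "e = 1 \<or> e = - 1"
    and "sp A x y" "sp A (x + e) y" 
  shows "y + e * x + 1/2 \<noteq> 0" "y - e * x - 1/2 \<noteq> 0"
  using assms unfolding sp_def by (auto simp: abs_if split: if_splits)

section \<open>Coefficients of steps and their exchange rules\<close>

locale gt = qnumbers \<tau> for \<tau> +
  fixes s u :: "real \<Rightarrow> complex" and n :: nat and m :: "nat \<Rightarrow> real"
  assumes roots: "root_choice \<tau> s u"
begin

abbreviation P where "P \<equiv> GT_patterns n m"

text \<open>At the signed position \<open>t = \<theta>\<close> of a step, a neighbouring entry \<open>w\<close> contributes \<open>phi t w\<close>, another
  entry \<open>w\<close> of the same row \<open>1 / psi t w\<close>, and the moved entry itself \<open>ecf a t\<close>. For a raising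
  step, \<open>mv\<close> is \<open>A\<^sup>j\<^sub>2\<^sub>p(\<alpha>)\<close> or \<open>B\<^sup>j\<^sub>2\<^sub>p(\<alpha>)\<close>; for a lowering step, the same formula is minus the
  coefficient at the lowered pattern, because all three factors are invariant under \<open>t \<mapsto> - t - 1\<close>.\<close>

definition phi :: "real \<Rightarrow> real \<Rightarrow> complex" where
  "phi t w = s \<bar>w + t + 1/2\<bar> * s \<bar>w - t - 1/2\<bar>"

definition psi :: "real \<Rightarrow> real \<Rightarrow> complex" where
  "psi t w = s \<bar>w + t\<bar> * s \<bar>w - t\<bar> * (s \<bar>w + t + 1\<bar> * s \<bar>w - t - 1\<bar>)"

definition ecf :: "nat \<Rightarrow> real \<Rightarrow> complex" where
  "ecf a t = (if even a then 1 / (u \<bar>t\<bar> * u \<bar>t + 1\<bar>)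
     else 1 / (br \<bar>t + 1/2\<bar> * s \<bar>2 * t + 2\<bar> * s \<bar>2 * t\<bar>))"

abbreviation posp :: "pattern \<Rightarrow> nat \<times> nat \<Rightarrow> real" where
  "posp \<alpha> w \<equiv> pos \<alpha> (fst w) (snd w)"

definition mv :: "nat \<Rightarrow> nat \<times> real \<Rightarrow> pattern \<Rightarrow> complex" where
  "mv a \<sigma> \<alpha> = of_real (snd \<sigma>) * ecf a (th a \<sigma> \<alpha>) * (\<Prod>w\<in>nb a. phi (th a \<sigma> \<alpha>) (posp \<alpha> w))
     / (\<Prod>r\<in>idx a - {fst \<sigma>}. psi (th a \<sigma> \<alpha>) (pos \<alpha> r a))"

definition dg :: "nat \<Rightarrow> pattern \<Rightarrow> complex" where
  "dg a \<alpha> = (if \<exists>r\<in>idx a. pos \<alpha> r a = 1/2 then 0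
     else (\<Prod>w\<in>nb a. br (posp \<alpha> w))
       / (\<Prod>r\<in>idx a. br (pos \<alpha> r a + 1/2) * br (pos \<alpha> r a - 1/2)))"

text \<open>Extending by 0 allows sums over all steps; sequences of steps that leave the set of
  patterns drop out by themselves.\<close>

definition cf :: "nat \<Rightarrow> nat \<times> real \<Rightarrow> pattern \<Rightarrow> complex" where
  "cf a \<sigma> \<alpha> = (if \<alpha> \<in> P \<and> shift a \<sigma> \<alpha> \<in> P
     then if fst \<sigma> = 0 then \<i> * dg a \<alpha> else mv a \<sigma> \<alpha> else 0)"

lemma s_sq: assumes "k \<in> \<int>" "k \<noteq> 0"
  shows "s \<bar>k\<bar> * s \<bar>k\<bar> = (if k > 0 then br k else - br k)"
proof -
  obtain i :: int where i: "k = of_int i" using assms by (auto elim: Ints_cases)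
  define j where "j = nat \<bar>i\<bar>"
  have j: "j > 0" "\<bar>k\<bar> = real j" using i assms by (auto simp: j_def)
  then have "(s \<bar>k\<bar>)\<^sup>2 = br \<bar>k\<bar>" using roots unfolding root_choice_def br_def by simp
  then show ?thesis using assms br_minus[of k] by (auto simp: power2_eq_square abs_if)
qed

lemma half_cases: assumes "2 * x \<in> \<int>" shows "\<bar>x\<bar> \<in> \<int> \<or> \<bar>x\<bar> \<in> half_integers"
proof -
  from assms have "2 * \<bar>x\<bar> \<in> \<int>" by (auto simp: abs_if)
  then obtain k :: int where k: "2 * \<bar>x\<bar> = of_int k" by (auto elim: Ints_cases)
  show ?thesis
  proof (cases "even k")
    case True
    then obtain l where "k = 2 * l" by (elim evenE)
    then have "\<bar>x\<bar> = of_int l" using k by simp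
    then show ?thesis by (metis Ints_of_int)
  next
    case False
    then obtain l where "k = 2 * l + 1" by (elim oddE)
    then have "\<bar>x\<bar> - 1/2 = of_int l" using k by simp
    then show ?thesis unfolding half_integers_def by (metis Ints_of_int mem_Collect_eq)
  qed
qed

lemma u_sq: assumes "2 * x \<in> \<int>" shows "u \<bar>x\<bar> * u \<bar>x\<bar> = ch (x / 2)"
proof -
  have "\<bar>x\<bar> \<in> \<int> \<or> \<bar>x\<bar> \<in> half_integers" using half_cases[OF assms] .
  then have "(u \<bar>x\<bar>)\<^sup>2 = ch (\<bar>x\<bar> / 2)" using roots unfolding root_choice_def ch_def by simp
  then show ?thesis by (metis abs_divide abs_numeral ch_abs power2_eq_square)
qed

lemma phi_minus: "phi t (- w) = phi t w"
  unfolding phi_def by (subst abs_minus_cancel[symmetric], subst (2) abs_minus_cancel[symmetric])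
    (simp add: algebra_simps)

lemma phi_reflect: "phi (- t - 1) w = phi t w"
  by (simp add: phi_def algebra_simps)

lemma psi_minus: "psi t (- w) = psi t w"
proof -
  have "\<bar>- w + t\<bar> = \<bar>w - t\<bar>" "\<bar>- w - t\<bar> = \<bar>w + t\<bar>" "\<bar>- w + t + 1\<bar> = \<bar>w - t - 1\<bar>"
    "\<bar>- w - t - 1\<bar> = \<bar>w + t + 1\<bar>" by auto
  then show ?thesis by (simp add: psi_def mult_ac)
qed

lemma psi_reflect: "psi (- t - 1) w = psi t w"
proof -
  have "\<bar>w + (- t - 1)\<bar> = \<bar>w - t - 1\<bar>" "\<bar>w - (- t - 1)\<bar> = \<bar>w + t + 1\<bar>"
    "\<bar>w + (- t - 1) + 1\<bar> = \<bar>w - t\<bar>" "\<bar>w - (- t - 1) - 1\<bar> = \<bar>w + t\<bar>" by auto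
  then show ?thesis unfolding psi_def by (simp add: mult_ac)
qed

lemma ecf_reflect: "ecf a (- t - 1) = ecf a t"
proof -
  have "\<bar>- t - 1\<bar> = \<bar>t + 1\<bar>" "\<bar>- t - 1 + 1\<bar> = \<bar>t\<bar>" "\<bar>- t - 1 + 1/2\<bar> = \<bar>t + 1/2\<bar>"
    "\<bar>2 * (- t - 1) + 2\<bar> = \<bar>2 * t\<bar>" "\<bar>2 * (- t - 1)\<bar> = \<bar>2 * t + 2\<bar>" by auto
  then show ?thesis unfolding ecf_def by (simp only: mult_ac)
qed

text \<open>This is the minus sign in front of the lowering terms and, for real \<tau>, the
  skew-adjointness of the off-diagonal part.\<close>

lemma mv_neg_shift: assumes "\<sigma> \<in> moves a"
  shows "mv a (neg \<sigma>) (shift a \<sigma> \<alpha>) = - mv a \<sigma> \<alpha>"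
proof -
  have t: "th a (neg \<sigma>) (shift a \<sigma> \<alpha>) = - th a \<sigma> \<alpha> - 1"
    using assms th_neg_shift by (simp add: steps_def)
  have "(\<Prod>w\<in>nb a. phi (th a \<sigma> \<alpha>) (posp (shift a \<sigma> \<alpha>) w)) = (\<Prod>w\<in>nb a. phi (th a \<sigma> \<alpha>) (posp \<alpha> w))"
    by (rule prod.cong) (auto simp: nb_def adj_def)
  moreover have "(\<Prod>r\<in>idx a - {fst \<sigma>}. psi (th a \<sigma> \<alpha>) (pos (shift a \<sigma> \<alpha>) r a))
      = (\<Prod>r\<in>idx a - {fst \<sigma>}. psi (th a \<sigma> \<alpha>) (pos \<alpha> r a))"
    by (rule prod.cong) (auto simp: pos_shift)
  ultimately show ?thesis unfolding mv_def t phi_reflect psi_reflect ecf_reflect by simp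
qed

text \<open>\<open>R\<close> collects the factors that do not involve the entry moved by
  \<open>\<kappa>\<close>; only the \<open>phi\<close> factor of that entry changes.\<close>

lemma mv_shift_adj: assumes "\<sigma> \<in> moves a" "\<kappa> \<in> moves b" "adj a b"
  obtains R where "mv a \<sigma> \<alpha> = R * phi (th a \<sigma> \<alpha>) (th b \<kappa> \<alpha>)"
    "mv a \<sigma> (shift b \<kappa> \<alpha>) = R * phi (th a \<sigma> \<alpha>) (th b \<kappa> \<alpha> + 1)"
proof -
  let ?w = "(fst \<kappa>, b)" and ?t = "th a \<sigma> \<alpha>"
  have w: "?w \<in> nb a" using assms movesD(1)[OF assms(2)] by (simp add: nb_def)
  have ab: "a \<noteq> b" using assms adj_neq by blast
  define R where "R = of_real (snd \<sigma>) * ecf a ?t * (\<Prod>w\<in>nb a - {?w}. phi ?t (posp \<alpha> w))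
     / (\<Prod>r\<in>idx a - {fst \<sigma>}. psi ?t (pos \<alpha> r a))"
  have sgn: "phi t (snd \<kappa> * y) = phi t y" for t y using movesD(3)[OF assms(2)] phi_minus by auto
  have 1: "phi ?t (th b \<kappa> \<alpha>) = phi ?t (posp \<alpha> ?w)" using movesD(4)[OF assms(2)] sgn by simp
  have "th b \<kappa> \<alpha> + 1 = snd \<kappa> * (pos \<alpha> (fst \<kappa>) b + snd \<kappa>)"
    using movesD(4)[OF assms(2)] movesD(5)[OF assms(2)] by (simp add: distrib_left)
  then have 2: "phi ?t (th b \<kappa> \<alpha> + 1) = phi ?t (posp (shift b \<kappa> \<alpha>) ?w)"
    using sgn by (simp add: pos_shift)
  have "(\<Prod>w\<in>nb a. phi ?t (posp \<alpha> w)) = phi ?t (posp \<alpha> ?w) * (\<Prod>w\<in>nb a - {?w}. phi ?t (posp \<alpha> w))"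
    using w by (subst prod.remove) auto
  then have 3: "mv a \<sigma> \<alpha> = R * phi ?t (th b \<kappa> \<alpha>)" unfolding 1 mv_def R_def by simp
  have "(\<Prod>w\<in>nb a - {?w}. phi ?t (posp (shift b \<kappa> \<alpha>) w)) = (\<Prod>w\<in>nb a - {?w}. phi ?t (posp \<alpha> w))"
    by (rule prod.cong) (auto simp: pos_shift)
  then have "(\<Prod>w\<in>nb a. phi ?t (posp (shift b \<kappa> \<alpha>) w))
      = phi ?t (posp (shift b \<kappa> \<alpha>) ?w) * (\<Prod>w\<in>nb a - {?w}. phi ?t (posp \<alpha> w))"
    using w by (subst prod.remove) auto
  then have "mv a \<sigma> (shift b \<kappa> \<alpha>) = R * phi ?t (th b \<kappa> \<alpha> + 1)"
    unfolding 2 mv_def R_def th_shift_other[OF ab] using ab by simp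
  with 3 show ?thesis by (rule that)
qed

lemma mv_shift_row: assumes "\<sigma> \<in> moves a" "\<kappa> \<in> moves a" "fst \<sigma> \<noteq> fst \<kappa>"
  obtains R where "mv a \<sigma> \<alpha> = R / psi (th a \<sigma> \<alpha>) (th a \<kappa> \<alpha>)"
    "mv a \<sigma> (shift a \<kappa> \<alpha>) = R / psi (th a \<sigma> \<alpha>) (th a \<kappa> \<alpha> + 1)"
proof -
  let ?k = "fst \<kappa>" and ?t = "th a \<sigma> \<alpha>"
  have w: "?k \<in> idx a - {fst \<sigma>}" using assms movesD(1)[OF assms(2)] by simp
  define R where "R = of_real (snd \<sigma>) * ecf a ?t * (\<Prod>w\<in>nb a. phi ?t (posp \<alpha> w))
     / (\<Prod>r\<in>idx a - {fst \<sigma>} - {?k}. psi ?t (pos \<alpha> r a))"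
  have sgn: "psi t (snd \<kappa> * y) = psi t y" for t y using movesD(3)[OF assms(2)] psi_minus by auto
  have 1: "psi ?t (th a \<kappa> \<alpha>) = psi ?t (pos \<alpha> ?k a)" using movesD(4)[OF assms(2)] sgn by simp
  have "th a \<kappa> \<alpha> + 1 = snd \<kappa> * (pos \<alpha> (fst \<kappa>) a + snd \<kappa>)"
    using movesD(4)[OF assms(2)] movesD(5)[OF assms(2)] by (simp add: distrib_left)
  then have 2: "psi ?t (th a \<kappa> \<alpha> + 1) = psi ?t (pos (shift a \<kappa> \<alpha>) ?k a)"
    using sgn by (simp add: pos_shift)
  have "(\<Prod>r\<in>idx a - {fst \<sigma>}. psi ?t (pos \<alpha> r a))
      = psi ?t (pos \<alpha> ?k a) * (\<Prod>r\<in>idx a - {fst \<sigma>} - {?k}. psi ?t (pos \<alpha> r a))"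
    using w by (subst prod.remove) auto
  then have 3: "mv a \<sigma> \<alpha> = R / psi ?t (th a \<kappa> \<alpha>)" unfolding 1 mv_def R_def by simp
  have "(\<Prod>r\<in>idx a - {fst \<sigma>} - {?k}. psi ?t (pos (shift a \<kappa> \<alpha>) r a))
      = (\<Prod>r\<in>idx a - {fst \<sigma>} - {?k}. psi ?t (pos \<alpha> r a))"
    by (rule prod.cong) (auto simp: pos_shift)
  then have "(\<Prod>r\<in>idx a - {fst \<sigma>}. psi ?t (pos (shift a \<kappa> \<alpha>) r a))
      = psi ?t (pos (shift a \<kappa> \<alpha>) ?k a) * (\<Prod>r\<in>idx a - {fst \<sigma>} - {?k}. psi ?t (pos \<alpha> r a))"
    using w by (subst prod.remove) auto
  moreover have "(\<Prod>w\<in>nb a. phi ?t (posp (shift a \<kappa> \<alpha>) w)) = (\<Prod>w\<in>nb a. phi ?t (posp \<alpha> w))"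
    by (rule prod.cong) (auto simp: nb_def adj_def)
  ultimately have "mv a \<sigma> (shift a \<kappa> \<alpha>) = R / psi ?t (th a \<kappa> \<alpha> + 1)"
    unfolding 2 mv_def R_def th_shift_index[OF assms(3)] by simp
  with 3 show ?thesis by (rule that)
qed

text \<open>The two products share the roots at sums of positions. The roots at differences occur
  squared, as [w - t + 1/2] on one side and [w - t - 1/2] on the other, and with a common sign
  because |w - t| > 1/2.\<close>

lemma phi_exchange:
  assumes "w - t - 1/2 \<in> \<int>" "\<bar>w - t\<bar> > 1/2"
  shows "phi w t * phi t (w + 1) * br (w - t - 1/2) = phi t w * phi w (t + 1) * br (w - t + 1/2)"
proof -
  let ?X = "s \<bar>w + t + 1/2\<bar> * s \<bar>w + t + 3/2\<bar>"
  have i: "w - t + 1/2 \<in> \<int>" using Ints_add[OF assms(1) Ints_1] by (simp add: algebra_simps)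
  have a: "\<bar>t - w - 1/2\<bar> = \<bar>w - t + 1/2\<bar>" "\<bar>w + 1 - t - 1/2\<bar> = \<bar>w - t + 1/2\<bar>"
    "\<bar>t + 1 - w - 1/2\<bar> = \<bar>w - t - 1/2\<bar>" "\<bar>w + 1 + t + 1/2\<bar> = \<bar>w + t + 3/2\<bar>"
    "\<bar>t + 1 + w + 1/2\<bar> = \<bar>w + t + 3/2\<bar>" "\<bar>t + w + 1/2\<bar> = \<bar>w + t + 1/2\<bar>" by auto
  have "phi w t * phi t (w + 1) = ?X * (s \<bar>w - t + 1/2\<bar> * s \<bar>w - t + 1/2\<bar>)"
    unfolding phi_def a by (simp only: mult_ac)
  moreover have "phi t w * phi w (t + 1) = ?X * (s \<bar>w - t - 1/2\<bar> * s \<bar>w - t - 1/2\<bar>)"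
    unfolding phi_def a by (simp only: mult_ac)
  moreover have "s \<bar>w - t + 1/2\<bar> * s \<bar>w - t + 1/2\<bar> = (if w > t then 1 else - 1) * br (w - t + 1/2)"
    using s_sq[OF i] assms(2) by (auto simp: abs_if split: if_splits)
  moreover have "s \<bar>w - t - 1/2\<bar> * s \<bar>w - t - 1/2\<bar> = (if w > t then 1 else - 1) * br (w - t - 1/2)"
    using s_sq[OF assms(1)] assms(2) by (auto simp: abs_if split: if_splits)
  ultimately show ?thesis by (simp add: mult_ac)
qed

text \<open>As in \<open>phi_exchange\<close>, the roots that do not cancel occur squared. Positions
  in one row differ by integers, whence [t - w + 1] and [t - w - 1] in place of the half-integral
  shifts.\<close>

lemma psi_exchange:
  assumes "w - t \<in> \<int>" "\<bar>w - t\<bar> > 1"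
  shows "br (t - w + 1) / (psi t w * psi w (t + 1)) = br (t - w - 1) / (psi w t * psi t (w + 1))"
proof -
  let ?X = "s \<bar>w + t\<bar> * s \<bar>w - t\<bar> * s \<bar>w - t\<bar> * s \<bar>w + t + 1\<bar> * s \<bar>w + t + 1\<bar> * s \<bar>w + t + 2\<bar>"
  have j: "t - w \<in> \<int>" using Ints_minus[OF assms(1)] by simp
  have i: "t - w + 1 \<in> \<int>" "t - w - 1 \<in> \<int>" using j by auto
  have a: "\<bar>w - t - 1\<bar> = \<bar>t - w + 1\<bar>" "\<bar>t + 1 + w\<bar> = \<bar>w + t + 1\<bar>" "\<bar>t + 1 - w\<bar> = \<bar>t - w + 1\<bar>"
    "\<bar>t + 1 + w + 1\<bar> = \<bar>w + t + 2\<bar>" "\<bar>t + 1 - w - 1\<bar> = \<bar>w - t\<bar>" "\<bar>t + w\<bar> = \<bar>w + t\<bar>"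
    "\<bar>t - w\<bar> = \<bar>w - t\<bar>" "\<bar>t + w + 1\<bar> = \<bar>w + t + 1\<bar>" "\<bar>w + 1 + t\<bar> = \<bar>w + t + 1\<bar>"
    "\<bar>w + 1 - t\<bar> = \<bar>t - w - 1\<bar>" "\<bar>w + 1 + t + 1\<bar> = \<bar>w + t + 2\<bar>" "\<bar>w + 1 - t - 1\<bar> = \<bar>w - t\<bar>" by auto
  have 1: "psi t w * psi w (t + 1) = ?X * (s \<bar>t - w + 1\<bar> * s \<bar>t - w + 1\<bar>)"
    unfolding psi_def a by (simp only: mult_ac)
  have 2: "psi w t * psi t (w + 1) = ?X * (s \<bar>t - w - 1\<bar> * s \<bar>t - w - 1\<bar>)"
    unfolding psi_def a by (simp only: mult_ac)
  have 3: "s \<bar>t - w + 1\<bar> * s \<bar>t - w + 1\<bar> = (if w > t then - 1 else 1) * br (t - w + 1)"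
    using s_sq[OF i(1)] assms(2) by (auto simp: abs_if split: if_splits)
  have 4: "s \<bar>t - w - 1\<bar> * s \<bar>t - w - 1\<bar> = (if w > t then - 1 else 1) * br (t - w - 1)"
    using s_sq[OF i(2)] assms(2) by (auto simp: abs_if split: if_splits)
  have h: "2 * (t - w + 1) \<in> \<int>" "2 * (t - w - 1) \<in> \<int>"
    using Ints_mult[OF Ints_numeral i(1)] Ints_mult[OF Ints_numeral i(2)] by blast+
  have "br (t - w + 1) \<noteq> 0" "br (t - w - 1) \<noteq> 0"
    unfolding br_eq_0[OF h(1)] br_eq_0[OF h(2)] using assms(2) by auto
  then show ?thesis unfolding 1 2 3 4 by simp
qed

lemma cf_outside: "\<alpha> \<notin> P \<Longrightarrow> cf a \<sigma> \<alpha> = 0" "shift a \<sigma> \<alpha> \<notin> P \<Longrightarrow> cf a \<sigma> \<alpha> = 0"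
  by (auto simp: cf_def)

lemma cf_path_outside:
  "\<not> (\<alpha> \<in> P \<and> shift a \<sigma> (shift b \<kappa> \<alpha>) \<in> P) \<Longrightarrow> cf b \<kappa> \<alpha> * cf a \<sigma> (shift b \<kappa> \<alpha>) = 0"
  by (auto simp: cf_def)

lemma cf_move: "\<sigma> \<in> moves a \<Longrightarrow> \<alpha> \<in> P \<Longrightarrow> shift a \<sigma> \<alpha> \<in> P \<Longrightarrow> cf a \<sigma> \<alpha> = mv a \<sigma> \<alpha>"
  by (auto simp: cf_def movesD)

lemma cf_diag: "\<alpha> \<in> P \<Longrightarrow> cf a (0, 0) \<alpha> = \<i> * dg a \<alpha>"
  by (simp add: cf_def)

text \<open>The pattern after both steps already certifies every inequality of the entry moved by
  \<open>\<sigma>\<close>, except the one with the entry moved by \<open>\<kappa>\<close>.\<close>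

lemma move_in_P_iff:
  assumes "\<alpha> \<in> P" "shift a \<sigma> (shift b \<kappa> \<alpha>) \<in> P" "adj a b" "a < n" "b < n" "\<sigma> \<in> moves a" "\<kappa> \<in> moves b"
  shows "shift a \<sigma> \<alpha> \<in> P \<longleftrightarrow> sep (shift a \<sigma> \<alpha>) (fst \<sigma>) a (fst \<kappa>) b"
proof -
  have ab: "a \<noteq> b" using assms adj_neq by blast
  have "sep (shift a \<sigma> \<alpha>) (fst \<sigma>) a i b'" if "(i, b') \<in> nb a" "(i, b') \<noteq> (fst \<kappa>, b)" for i b'
  proof -
    have "sep (shift a \<sigma> (shift b \<kappa> \<alpha>)) (fst \<sigma>) a i b'"
      using GT_sep[OF assms(2), of a b' "fst \<sigma>" i] assms that movesD(1)[OF assms(6)]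
      by (auto simp: nb_adj adj_def)
    then show ?thesis using that ab by (subst (asm) sep_cong[of _ _ _ "shift a \<sigma> \<alpha>"]) (auto simp: pos_shift)
  qed
  moreover have "(fst \<kappa>, b) \<in> nb a" using assms movesD(1) by (simp add: nb_adj)
  ultimately show ?thesis unfolding GT_shift_iff[OF assms(1,4,6)] by auto
qed

text \<open>If both intermediate patterns exist, this is \<open>phi_exchange\<close>. If just one
  exists, the path through the other has coefficient 0, and \<open>sp_blocked\<close> makes the
  bracket on the opposite side vanish.\<close>

lemma cf_exchange_moves:
  assumes ab: "adj a b" "a < n" "b < n" "\<sigma> \<in> moves a" "\<kappa> \<in> moves b"
  shows "cf b \<kappa> \<alpha> * cf a \<sigma> (shift b \<kappa> \<alpha>) * br (th b \<kappa> \<alpha> - th a \<sigma> \<alpha> - 1/2)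
    = cf a \<sigma> \<alpha> * cf b \<kappa> (shift a \<sigma> \<alpha>) * br (th b \<kappa> \<alpha> - th a \<sigma> \<alpha> + 1/2)"
proof (cases "\<alpha> \<in> P \<and> shift a \<sigma> (shift b \<kappa> \<alpha>) \<in> P")
  case False
  then show ?thesis using cf_path_outside shift_commute[of a \<sigma> b \<kappa> \<alpha>] by (metis mult_zero_left)
next
  case True
  then have in1: "\<alpha> \<in> P" and in2: "shift a \<sigma> (shift b \<kappa> \<alpha>) \<in> P" by auto
  have in2': "shift b \<kappa> (shift a \<sigma> \<alpha>) \<in> P" using in2 shift_commute by metis
  define j i where "j = fst \<sigma>" and "i = fst \<kappa>"
  define x y e h where "x = pos \<alpha> j a" and "y = pos \<alpha> i b" and "e = snd \<sigma>" and "h = snd \<kappa>"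
  define A where "A = above j a i b"
  note S = movesD[OF ab(4)] and K = movesD[OF ab(5)]
  have ne: "a \<noteq> b" using ab adj_neq by blast
  have eh: "e = 1 \<or> e = - 1" "h = 1 \<or> h = - 1" using S K by (auto simp: e_def h_def)
  have t: "th a \<sigma> \<alpha> = e * x" "th b \<kappa> \<alpha> = h * y"
    using S(4) K(4) by (auto simp: e_def h_def x_def y_def i_def j_def)
  have half: "2 * x \<in> \<int>" "2 * y \<in> \<int>"
    using GT_pos_half[OF in1] S(1) K(1) ab by (auto simp: x_def y_def j_def i_def)
  have xy: "x - y - 1/2 \<in> \<int>"
    using GT_pos_adj[OF in1 ab(1)] S(1) K(1) ab by (auto simp: x_def y_def j_def i_def)
  have yx: "y - x - 1/2 \<in> \<int>" using Ints_diff[OF Ints_minus[OF xy] Ints_1] by simp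
  have v0: "sp A x y" using GT_sep[OF in1 ab(1)] S(1) K(1) ab
    by (auto simp: sep_sp A_def x_def y_def j_def i_def)
  have v3: "sp A (x + e) (y + h)" using GT_sep[OF in2 ab(1), of j i] S(1) K(1) ab ne
    by (auto simp: sep_sp A_def x_def y_def e_def h_def pos_shift j_def i_def)
  have v1: "shift a \<sigma> \<alpha> \<in> P \<longleftrightarrow> sp A (x + e) y"
    using move_in_P_iff[OF in1 in2 ab] ne
    by (simp add: sep_sp A_def x_def y_def e_def pos_shift j_def i_def)
  have v2: "shift b \<kappa> \<alpha> \<in> P \<longleftrightarrow> sp A x (y + h)"
  proof -
    have "sp (above i b j a) (y + h) x = sp A x (y + h)"
      unfolding A_def above_swap[OF ab(1)] sp_swap ..
    then show ?thesis using move_in_P_iff[OF in1 in2' _ ab(3,2,5,4)] ab(1) ne adj_sym[of a b]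
      by (simp add: sep_sp x_def y_def h_def pos_shift j_def i_def)
  qed
  show ?thesis
  proof (cases "sp A (x + e) y \<and> sp A x (y + h)")
    case True
    then have i1: "shift a \<sigma> \<alpha> \<in> P" and i2: "shift b \<kappa> \<alpha> \<in> P" using v1 v2 by auto
    obtain R where R: "mv a \<sigma> \<alpha> = R * phi (th a \<sigma> \<alpha>) (th b \<kappa> \<alpha>)"
      "mv a \<sigma> (shift b \<kappa> \<alpha>) = R * phi (th a \<sigma> \<alpha>) (th b \<kappa> \<alpha> + 1)"
      using mv_shift_adj[OF ab(4,5,1)] .
    obtain R' where R': "mv b \<kappa> \<alpha> = R' * phi (th b \<kappa> \<alpha>) (th a \<sigma> \<alpha>)"
      "mv b \<kappa> (shift a \<sigma> \<alpha>) = R' * phi (th b \<kappa> \<alpha>) (th a \<sigma> \<alpha> + 1)"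
      using mv_shift_adj[OF ab(5,4)] ab(1) adj_sym by metis
    have "\<bar>th b \<kappa> \<alpha> - th a \<sigma> \<alpha>\<bar> > 1/2" unfolding t using sp_free[OF eh v0 v3] True by simp
    moreover have "th b \<kappa> \<alpha> - th a \<sigma> \<alpha> - 1/2 \<in> \<int>"
    proof -
      have "x - y - 1/2 + 2 * y \<in> \<int>" "y - x - 1/2 - 2 * y \<in> \<int>"
        using xy yx half by (meson Ints_add Ints_diff)+
      moreover have "x - y - 1/2 + 2 * y = 1 * y - (- 1) * x - 1/2"
        "y - x - 1/2 - 2 * y = (- 1) * y - 1 * x - 1/2" "y - x - 1/2 = 1 * y - 1 * x - 1/2"
        "x - y - 1/2 = (- 1) * y - (- 1) * x - 1/2" by simp_all
      ultimately show ?thesis unfolding t using eh xy yx by metis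
    qed
    ultimately have "phi (th b \<kappa> \<alpha>) (th a \<sigma> \<alpha>) * phi (th a \<sigma> \<alpha>) (th b \<kappa> \<alpha> + 1)
          * br (th b \<kappa> \<alpha> - th a \<sigma> \<alpha> - 1/2)
        = phi (th a \<sigma> \<alpha>) (th b \<kappa> \<alpha>) * phi (th b \<kappa> \<alpha>) (th a \<sigma> \<alpha> + 1)
          * br (th b \<kappa> \<alpha> - th a \<sigma> \<alpha> + 1/2)" by (intro phi_exchange)
    then show ?thesis using in1 in2 in2' i1 i2 ab R R' by (simp add: cf_move mult.assoc)
  next
    case False
    consider "sp A (x + e) y" "\<not> sp A x (y + h)" | "\<not> sp A (x + e) y" "sp A x (y + h)"
      | "\<not> sp A (x + e) y" "\<not> sp A x (y + h)" using False by blast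
    then show ?thesis
    proof cases
      case 1
      have "e * x - h * y - 1/2 = 0"
        using sp_blocked[OF eh(2,1) half(2,1) yx, of "\<not> A"] v0 v3 1 by (simp add: sp_swap)
      then have z: "th b \<kappa> \<alpha> - th a \<sigma> \<alpha> + 1/2 = 0" by (simp add: t)
      show ?thesis unfolding z using 1 v2 cf_outside by simp
    next
      case 2
      have "h * y - e * x - 1/2 = 0" using sp_blocked[OF eh half xy v0 v3] 2 by simp
      then have z: "th b \<kappa> \<alpha> - th a \<sigma> \<alpha> - 1/2 = 0" by (simp add: t)
      show ?thesis unfolding z using 2 v1 cf_outside by simp
    next
      case 3
      then show ?thesis using v1 v2 cf_outside by simp
    qed
  qed
qed

lemma dg_ratio:
  assumes "w \<in> nb a" "\<And>v. v \<in> nb a - {w} \<Longrightarrow> posp \<beta> v = posp \<alpha> v" "\<And>r. pos \<beta> r a = pos \<alpha> r a"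
  shows "dg a \<beta> * br (posp \<alpha> w) = dg a \<alpha> * br (posp \<beta> w)"
proof -
  have 1: "(\<Prod>v\<in>nb a. br (posp \<alpha> v)) = br (posp \<alpha> w) * (\<Prod>v\<in>nb a - {w}. br (posp \<alpha> v))"
    using assms(1) by (subst prod.remove) auto
  have "(\<Prod>v\<in>nb a - {w}. br (posp \<beta> v)) = (\<Prod>v\<in>nb a - {w}. br (posp \<alpha> v))"
    using assms(2) by (intro prod.cong) auto
  then have 2: "(\<Prod>v\<in>nb a. br (posp \<beta> v)) = br (posp \<beta> w) * (\<Prod>v\<in>nb a - {w}. br (posp \<alpha> v))"
    using assms(1) by (subst prod.remove) auto
  show ?thesis unfolding dg_def 1 2 assms(3) by simp
qed

lemma br_sign: "h = 1 \<or> h = - 1 \<Longrightarrow> br (h * x) = of_real h * br x"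
  using br_minus by auto

lemma dg_shift_adj:
  assumes "\<kappa> \<in> moves b" "adj a b"
  shows "dg a (shift b \<kappa> \<alpha>) * br (th b \<kappa> \<alpha>) = dg a \<alpha> * br (th b \<kappa> \<alpha> + 1)"
proof -
  note K = movesD[OF assms(1)]
  have "dg a (shift b \<kappa> \<alpha>) * br (posp \<alpha> (fst \<kappa>, b)) = dg a \<alpha> * br (posp (shift b \<kappa> \<alpha>) (fst \<kappa>, b))"
    using assms K adj_neq[OF assms(2)] by (intro dg_ratio) (auto simp: nb_def pos_shift)
  moreover have "th b \<kappa> \<alpha> = snd \<kappa> * posp \<alpha> (fst \<kappa>, b)"
    "th b \<kappa> \<alpha> + 1 = snd \<kappa> * posp (shift b \<kappa> \<alpha>) (fst \<kappa>, b)"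
    using K(4,5) by (auto simp: pos_shift distrib_left)
  ultimately show ?thesis by (simp add: br_sign[OF K(3)])
qed

text \<open>At \<theta> = - 1/2 the brackets of the exchange rule become [\<omega>] and
  [\<omega> + 1], the factor of the diagonal coefficient that belongs to the moving entry, before
  and after its step. This dictates the position of the diagonal step.\<close>

lemma cf_exchange_diag:
  assumes ab: "adj a b" "a < n" "b < n" "\<kappa> \<in> moves b"
  shows "cf b \<kappa> \<alpha> * cf a (0, 0) (shift b \<kappa> \<alpha>) * br (th b \<kappa> \<alpha>)
    = cf a (0, 0) \<alpha> * cf b \<kappa> \<alpha> * br (th b \<kappa> \<alpha> + 1)"
proof (cases "\<alpha> \<in> P \<and> shift b \<kappa> \<alpha> \<in> P")
  case False
  then have "cf b \<kappa> \<alpha> = 0" by (auto simp: cf_def)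
  then show ?thesis by simp
next
  case True
  then show ?thesis using dg_shift_adj[OF ab(4,1), of \<alpha>] by (simp add: cf_diag mult_ac)
qed

text \<open>Two diagonal steps never meet here: only odd rows have one, and adjacent rows differ in
  parity.\<close>

lemma cf_exchange:
  assumes ab: "adj a b" "a < n" "b < n" "\<sigma> \<in> steps a" "\<kappa> \<in> steps b"
  shows "cf b \<kappa> \<alpha> * cf a \<sigma> (shift b \<kappa> \<alpha>) * br (th b \<kappa> \<alpha> - th a \<sigma> \<alpha> - 1/2)
    = cf a \<sigma> \<alpha> * cf b \<kappa> (shift a \<sigma> \<alpha>) * br (th b \<kappa> \<alpha> - th a \<sigma> \<alpha> + 1/2)"
  using ab(4)
proof (cases rule: steps_cases)
  case 1
  from ab(5) show ?thesis
  proof (cases rule: steps_cases)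
    case k: 1
    then show ?thesis using cf_exchange_moves[OF ab(1-3) 1 k] by blast
  next
    case k: 2
    have "br (- th a \<sigma> \<alpha>) = - br (th a \<sigma> \<alpha>)" "br (- 1 - th a \<sigma> \<alpha>) = - br (th a \<sigma> \<alpha> + 1)"
      using br_minus[of "th a \<sigma> \<alpha>"] br_minus[of "th a \<sigma> \<alpha> + 1"] by (simp_all add: minus_diff_commute)
    then show ?thesis using cf_exchange_diag[of b a \<sigma> \<alpha>] ab(1-3) 1 k adj_sym
      by (auto simp: mult_ac)
  qed
next
  case 2
  from ab(5) show ?thesis
  proof (cases rule: steps_cases)
    case k: 1
    then show ?thesis using cf_exchange_diag[OF ab(1-3) k, of \<alpha>] 2 by (simp add: add.commute)
  next
    case k: 2
    then show ?thesis using 2 ab(1) by (auto simp: adj_def)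
  qed
qed

end

section \<open>Cancellation in the Serre relations\<close>

lemma separator:
  assumes "adj a b" "j \<in> idx a" "k \<in> idx a" "j < k"
  obtains i where "i \<in> idx b" "above j a i b" "\<not> above k a i b"
proof (cases "b = Suc a")
  case True
  then show ?thesis using assms by (intro that[of k]) (auto simp: above_def idx_def)
next
  case False
  then have "a = Suc b" using assms(1) by (simp add: adj_def)
  then show ?thesis using assms by (intro that[of j]) (auto simp: above_def idx_def)
qed

text \<open>In an odd row even the last entry dominates some entry of each adjacent row; this is why
  positions in odd rows are at least 1/2.\<close>

lemma dominated:
  assumes "adj a b" "j \<in> idx a" "odd a"
  obtains i where "i \<in> idx b" "above j a i b"
proof (cases "b = Suc a")
  case True
  then show ?thesis using assms by (intro that[of "Suc j"]) (auto simp: above_def idx_def elim!: oddE)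
next
  case False
  then have "a = Suc b" using assms(1) by (simp add: adj_def)
  then show ?thesis using assms by (intro that[of j]) (auto simp: above_def idx_def elim!: evenE)
qed

text \<open>Of the two rows adjacent to \<open>a\<close>, one contains the step
  \<open>\<kappa>\<close>; the other stays fixed and supplies inequalities that hold before and
  after all the steps.\<close>

lemma other_neighbour:
  assumes "a \<ge> 1" "adj a b"
  obtains b' where "adj a b'" "b' \<noteq> b"
proof (cases "b = Suc a")
  case True
  then show ?thesis using assms by (intro that[of "a - 1"]) (auto simp: adj_def)
next
  case False
  then show ?thesis by (intro that[of "Suc a"]) (auto simp: adj_def)
qed

lemma row_gap:
  fixes e h x y w :: real
  assumes "e = 1 \<or> e = - 1" "h = 1 \<or> h = - 1"
    "x \<ge> \<bar>w\<bar> + 1/2" "x + e \<ge> \<bar>w\<bar> + 1/2" "w \<ge> \<bar>y\<bar> + 1/2" "w \<ge> \<bar>y + h\<bar> + 1/2"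
  shows "\<bar>e * x - h * y\<bar> > 1"
  using assms by auto

text \<open>Serves the case of one step made twice, where \<omega> - \<theta> = 1/2 would annihilate
  the bracket common to both exchange equations.\<close>

lemma sp_no_double:
  assumes "e = 1 \<or> e = - 1" "h = 1 \<or> h = - 1" "2 * x \<in> \<int>" "2 * y \<in> \<int>"
    "sp A x y" "sp A (x + 2 * e) (y + h)" 
  shows "h * y - e * x \<noteq> 1/2"
proof -
  note half = Ints_gap[OF assms(3)] Ints_gap[OF assms(4)]
  show ?thesis using half assms(1,2,5,6) unfolding sp_def by (auto simp: abs_if split: if_splits)
qed

context gt
begin

lemma th_half: "\<alpha> \<in> P \<Longrightarrow> a \<le> n \<Longrightarrow> \<sigma> \<in> steps a \<Longrightarrow> 2 * th a \<sigma> \<alpha> \<in> \<int>"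
proof (erule steps_cases)
  assume "\<alpha> \<in> P" "a \<le> n" "\<sigma> \<in> moves a"
  then have "2 * pos \<alpha> (fst \<sigma>) a \<in> \<int>" "th a \<sigma> \<alpha> = snd \<sigma> * pos \<alpha> (fst \<sigma>) a"
    "snd \<sigma> = 1 \<or> snd \<sigma> = - 1"
    using GT_pos_half movesD by blast+
  then show ?thesis by auto
qed simp

lemma row_separated:
  assumes "\<alpha> \<in> P" "\<beta> \<in> P" "adj a b" "a < n" "j \<in> idx a" "k \<in> idx a" "j < k"
    and "\<And>i. pos \<beta> i b = pos \<alpha> i b"
  obtains w where "pos \<alpha> j a \<ge> \<bar>w\<bar> + 1/2" "pos \<beta> j a \<ge> \<bar>w\<bar> + 1/2"
    "w \<ge> \<bar>pos \<alpha> k a\<bar> + 1/2" "w \<ge> \<bar>pos \<beta> k a\<bar> + 1/2"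
proof -
  obtain i where i: "i \<in> idx b" "above j a i b" "\<not> above k a i b"
    using separator[OF assms(3,5-7)] .
  have "a \<le> n" "b \<le> n" using assms(3,4) by (auto simp: adj_def)
  then have "sep \<alpha> j a i b" "sep \<alpha> k a i b" "sep \<beta> j a i b" "sep \<beta> k a i b"
    using GT_sep[OF assms(1,3)] GT_sep[OF assms(2,3)] i assms(5,6) by blast+
  then show ?thesis using i assms(8) by (intro that[of "pos \<alpha> i b"]) (auto simp: sep_def)
qed

text \<open>The pattern \<open>\<beta>\<close> has both steps of row \<open>a\<close> carried out
  and may also differ from \<open>\<alpha>\<close> outside that row; row \<open>b\<close> is one
  that has not changed and separates the two entries in both patterns.\<close>

lemma moves_gap:
  assumes "\<alpha> \<in> P" "\<beta> \<in> P" "adj a b" "a < n" "\<sigma> \<in> moves a" "\<rho> \<in> moves a" "fst \<sigma> \<noteq> fst \<rho>"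
    and "\<And>i. pos \<beta> i b = pos \<alpha> i b"
    and "pos \<beta> (fst \<sigma>) a = pos \<alpha> (fst \<sigma>) a + snd \<sigma>" "pos \<beta> (fst \<rho>) a = pos \<alpha> (fst \<rho>) a + snd \<rho>"
  shows "\<bar>th a \<sigma> \<alpha> - th a \<rho> \<alpha>\<bar> > 1"
proof -
  have *: "\<bar>th a \<sigma> \<alpha> - th a \<rho> \<alpha>\<bar> > 1"
    if "fst \<sigma> < fst \<rho>" "\<sigma> \<in> moves a" "\<rho> \<in> moves a"
      "pos \<beta> (fst \<sigma>) a = pos \<alpha> (fst \<sigma>) a + snd \<sigma>" "pos \<beta> (fst \<rho>) a = pos \<alpha> (fst \<rho>) a + snd \<rho>"
    for \<sigma> \<rho>
  proof -
    note S = movesD[OF that(2)] and T = movesD[OF that(3)]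
    note lt = that(1)
    obtain w where "pos \<alpha> (fst \<sigma>) a \<ge> \<bar>w\<bar> + 1/2" "pos \<beta> (fst \<sigma>) a \<ge> \<bar>w\<bar> + 1/2"
      "w \<ge> \<bar>pos \<alpha> (fst \<rho>) a\<bar> + 1/2" "w \<ge> \<bar>pos \<beta> (fst \<rho>) a\<bar> + 1/2"
      using row_separated[OF assms(1-4) S(1) T(1) lt assms(8)] .
    then show ?thesis unfolding S(4) T(4) that(4,5) by (intro row_gap[OF S(3) T(3)])
  qed
  show ?thesis
  proof (cases "fst \<sigma> < fst \<rho>")
    case True then show ?thesis using *[of \<sigma> \<rho>] assms by blast
  next
    case False
    then have "\<bar>th a \<rho> \<alpha> - th a \<sigma> \<alpha>\<bar> > 1" using *[of \<rho> \<sigma>] assms by simp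
    then show ?thesis by (simp add: abs_minus_commute)
  qed
qed

lemma pos_shift_neighbour [simp]: "adj a b \<Longrightarrow> pos (shift a \<sigma> \<alpha>) i b = pos \<alpha> i b"
  by (auto simp: adj_def)

text \<open>Entries of the same row do not constrain each other, so within a row there is no
  analogue of a blocked order.\<close>

lemma row_move_in_P:
  assumes "\<alpha> \<in> P" "shift a \<rho> (shift a \<sigma> \<alpha>) \<in> P" "a < n" "\<sigma> \<in> moves a" "fst \<sigma> \<noteq> fst \<rho>"
  shows "shift a \<sigma> \<alpha> \<in> P"
  unfolding GT_shift_iff[OF assms(1,3,4)]
proof (intro allI impI)
  fix b i assume ib: "(i, b) \<in> nb a"
  then have ab: "adj a b" by (simp add: nb_def)
  have "sep (shift a \<rho> (shift a \<sigma> \<alpha>)) (fst \<sigma>) a i b"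
    using GT_sep[OF assms(2) ab, of "fst \<sigma>" i] ib assms movesD(1)[OF assms(4)]
    by (auto simp: nb_def adj_def)
  moreover have "pos (shift a \<rho> (shift a \<sigma> \<alpha>)) (fst \<sigma>) a = pos (shift a \<sigma> \<alpha>) (fst \<sigma>) a"
    using assms(5) by (simp add: pos_shift)
  ultimately show "sep (shift a \<sigma> \<alpha>) (fst \<sigma>) a i b" using ab by (metis sep_cong pos_shift_neighbour)
qed

lemma cf_exchange_row:
  assumes a: "a < n" "\<sigma> \<in> moves a" "\<rho> \<in> moves a" "fst \<sigma> \<noteq> fst \<rho>"
  shows "cf a \<sigma> \<alpha> * cf a \<rho> (shift a \<sigma> \<alpha>) * br (th a \<sigma> \<alpha> - th a \<rho> \<alpha> + 1)
    = cf a \<rho> \<alpha> * cf a \<sigma> (shift a \<rho> \<alpha>) * br (th a \<sigma> \<alpha> - th a \<rho> \<alpha> - 1)"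
proof (cases "\<alpha> \<in> P \<and> shift a \<rho> (shift a \<sigma> \<alpha>) \<in> P")
  case False
  then show ?thesis using cf_path_outside shift_commute[of a \<sigma> a \<rho> \<alpha>] by (metis mult_zero_left)
next
  case True
  then have in1: "\<alpha> \<in> P" and in2: "shift a \<rho> (shift a \<sigma> \<alpha>) \<in> P" "shift a \<sigma> (shift a \<rho> \<alpha>) \<in> P"
    using shift_commute[of a \<sigma> a \<rho> \<alpha>] by simp_all
  have i1: "shift a \<sigma> \<alpha> \<in> P" and i2: "shift a \<rho> \<alpha> \<in> P"
    using row_move_in_P[OF in1 in2(1) a(1,2)] row_move_in_P[OF in1 in2(2) a(1,3)] a(4) by auto
  obtain R where R: "mv a \<sigma> \<alpha> = R / psi (th a \<sigma> \<alpha>) (th a \<rho> \<alpha>)"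
    "mv a \<sigma> (shift a \<rho> \<alpha>) = R / psi (th a \<sigma> \<alpha>) (th a \<rho> \<alpha> + 1)"
    using mv_shift_row[OF a(2-4)] .
  obtain R' where R': "mv a \<rho> \<alpha> = R' / psi (th a \<rho> \<alpha>) (th a \<sigma> \<alpha>)"
    "mv a \<rho> (shift a \<sigma> \<alpha>) = R' / psi (th a \<rho> \<alpha>) (th a \<sigma> \<alpha> + 1)"
    using mv_shift_row[OF a(3,2) a(4)[symmetric]] .
  have "adj a (Suc a)" by (simp add: adj_def)
  then have gap: "\<bar>th a \<rho> \<alpha> - th a \<sigma> \<alpha>\<bar> > 1"
    using moves_gap[OF in1 in2(1) _ a(1,3,2) a(4)[symmetric]] a(4) by (simp add: pos_shift)
  have "th a \<rho> \<alpha> - th a \<sigma> \<alpha> \<in> \<int>"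
  proof -
    let ?x = "pos \<alpha> (fst \<sigma>) a" and ?y = "pos \<alpha> (fst \<rho>) a"
    have i: "?y - ?x \<in> \<int>" "2 * ?x \<in> \<int>" "2 * ?y \<in> \<int>"
      using GT_pos_same[OF in1] GT_pos_half[OF in1] movesD(1)[OF a(2)] movesD(1)[OF a(3)] a(1) by auto
    have "- (?y - ?x) \<in> \<int>" "?y - ?x + 2 * ?x \<in> \<int>" "?y - ?x - 2 * ?y \<in> \<int>" 
      using i by (meson Ints_add Ints_diff Ints_minus)+
    moreover have "?y - ?x + 2 * ?x = 1 * ?y - (- 1) * ?x" "?y - ?x - 2 * ?y = (- 1) * ?y - 1 * ?x"
      "?y - ?x = 1 * ?y - 1 * ?x" "- (?y - ?x) = (- 1) * ?y - (- 1) * ?x" by simp_all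
    ultimately show ?thesis
      unfolding movesD(4)[OF a(2)] movesD(4)[OF a(3)]
      using movesD(3)[OF a(2)] movesD(3)[OF a(3)] i(1) by metis
  qed
  note ex = psi_exchange[OF this gap]
  have "R * R' * (br (th a \<sigma> \<alpha> - th a \<rho> \<alpha> + 1)
      / (psi (th a \<sigma> \<alpha>) (th a \<rho> \<alpha>) * psi (th a \<rho> \<alpha>) (th a \<sigma> \<alpha> + 1)))
    = R * R' * (br (th a \<sigma> \<alpha> - th a \<rho> \<alpha> - 1)
      / (psi (th a \<rho> \<alpha>) (th a \<sigma> \<alpha>) * psi (th a \<sigma> \<alpha>) (th a \<rho> \<alpha> + 1)))"
    unfolding ex ..
  then show ?thesis using in1 in2 i1 i2 a R R' by (simp add: cf_move mult_ac)
qed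

lemma odd_row_pos:
  assumes "\<alpha> \<in> P" "a < n" "odd a" "j \<in> idx a"
  shows "pos \<alpha> j a \<ge> 1/2"
proof -
  have ab: "adj a (Suc a)" by (simp add: adj_def)
  obtain i where "i \<in> idx (Suc a)" "above j a i (Suc a)" using dominated[OF ab assms(4,3)] .
  then have "pos \<alpha> j a \<ge> \<bar>pos \<alpha> i (Suc a)\<bar> + 1/2"
    using GT_sep[OF assms(1) ab, of j i] assms by (simp add: sep_def)
  then show ?thesis by linarith
qed

lemma dg_eq_0: "w \<in> nb a \<Longrightarrow> posp \<alpha> w = 0 \<Longrightarrow> dg a \<alpha> = 0"
  unfolding dg_def by (auto intro!: prod_zero bexI[of _ w])

text \<open>The row exchange rule with \<theta>' = - 1/2, where [\<theta> - \<theta>' + 1] =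
  [\<theta> + 3/2] and [\<theta> - \<theta>' - 1] = [\<theta> - 1/2]. The excluded values are the
  steps out of and into position 1/2, at which the diagonal coefficient is 0 by convention and the
  ratio fails.\<close>

lemma dg_shift_row:
  assumes "\<alpha> \<in> P" "shift a \<sigma> \<alpha> \<in> P" "a < n" "odd a" "\<sigma> \<in> moves a"
    and "th a \<sigma> \<alpha> \<noteq> 1/2" "th a \<sigma> \<alpha> \<noteq> - 3/2"
  shows "dg a (shift a \<sigma> \<alpha>) * br (th a \<sigma> \<alpha> + 3/2) = dg a \<alpha> * br (th a \<sigma> \<alpha> - 1/2)"
proof -
  let ?j = "fst \<sigma>" and ?x = "pos \<alpha> (fst \<sigma>) a" and ?\<beta> = "shift a \<sigma> \<alpha>"
  note S = movesD[OF assms(5)]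
  have x: "?x \<ge> 1/2" "?x + snd \<sigma> \<ge> 1/2"
    using odd_row_pos[OF assms(1,3,4) S(1)] odd_row_pos[OF assms(2,3,4) S(1)] by (auto simp: pos_shift)
  have px: "pos ?\<beta> ?j a = ?x + snd \<sigma>" by (simp add: pos_shift)
  have nh: "?x \<noteq> 1/2" "?x + snd \<sigma> \<noteq> 1/2" using S(3) S(4)[of \<alpha>] x assms(6,7) by auto
  have same: "(\<exists>r\<in>idx a. pos ?\<beta> r a = 1/2) \<longleftrightarrow> (\<exists>r\<in>idx a. pos \<alpha> r a = 1/2)"
  proof -
    have "pos ?\<beta> r a = 1/2 \<longleftrightarrow> pos \<alpha> r a = 1/2" for r
      using nh by (cases "r = ?j") (auto simp: pos_shift)
    then show ?thesis by simp
  qed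
  have N: "(\<Prod>w\<in>nb a. br (posp ?\<beta> w)) = (\<Prod>w\<in>nb a. br (posp \<alpha> w))"
    by (rule prod.cong) (auto simp: nb_def)
  let ?D = "\<lambda>\<alpha> r. br (pos \<alpha> r a + 1/2) * br (pos \<alpha> r a - 1/2)"
  have "(\<Prod>r\<in>idx a - {?j}. ?D ?\<beta> r) = (\<Prod>r\<in>idx a - {?j}. ?D \<alpha> r)"
    by (rule prod.cong) (auto simp: pos_shift)
  then have D: "(\<Prod>r\<in>idx a. ?D ?\<beta> r) = ?D ?\<beta> ?j * (\<Prod>r\<in>idx a - {?j}. ?D \<alpha> r)"
    "(\<Prod>r\<in>idx a. ?D \<alpha> r) = ?D \<alpha> ?j * (\<Prod>r\<in>idx a - {?j}. ?D \<alpha> r)"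
    using S(1) by (subst prod.remove[of _ ?j]; simp)+
  have h: "2 * ?x \<in> \<int>" using GT_pos_half[OF assms(1)] S(1) assms(3) by simp
  have nz: "br (?x + of_int k / 2) \<noteq> 0" if "?x + of_int k / 2 \<noteq> 0" for k :: int
  proof -
    have "2 * (?x + of_int k / 2) = 2 * ?x + of_int k" by simp
    then have "2 * (?x + of_int k / 2) \<in> \<int>" using h by (metis Ints_add Ints_of_int)
    then show ?thesis using br_eq_0 that by blast
  qed
  have nzs: "?x + 1/2 \<noteq> 0 \<Longrightarrow> br (?x + 1/2) \<noteq> 0" "?x - 1/2 \<noteq> 0 \<Longrightarrow> br (?x - 1/2) \<noteq> 0"
    "?x + 3/2 \<noteq> 0 \<Longrightarrow> br (?x + 3/2) \<noteq> 0" "?x - 3/2 \<noteq> 0 \<Longrightarrow> br (?x - 3/2) \<noteq> 0"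
    using nz[of 1] nz[of "- 1"] nz[of 3] nz[of "- 3"] by simp_all
  have key: "br (th a \<sigma> \<alpha> + 3/2) / ?D ?\<beta> ?j = br (th a \<sigma> \<alpha> - 1/2) / ?D \<alpha> ?j"
    using S(3)
  proof
    assume e: "snd \<sigma> = 1"
    have f: "?x + 1 + 1/2 = ?x + 3/2" "?x + 1 - 1/2 = ?x + 1/2" by simp_all
    show ?thesis unfolding px S(4) e f using nzs nh x by simp
  next
    assume e: "snd \<sigma> = - 1"
    have f: "?x + (- 1) + 1/2 = ?x - 1/2" "?x + (- 1) - 1/2 = ?x - 3/2" by simp_all
    have "- 1 * ?x + 3/2 = - (?x - 3/2)" "- 1 * ?x - 1/2 = - (?x + 1/2)" by simp_all
    then have g: "br (- 1 * ?x + 3/2) = - br (?x - 3/2)" "br (- 1 * ?x - 1/2) = - br (?x + 1/2)"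
      by (simp_all only: br_minus)
    show ?thesis unfolding px S(4) e f g using nzs nh x e by simp
  qed
  show ?thesis
  proof (cases "\<exists>r\<in>idx a. pos \<alpha> r a = 1/2")
    case True
    then show ?thesis unfolding dg_def same by simp
  next
    case False
    have "dg a ?\<beta> * br (th a \<sigma> \<alpha> + 3/2) = (\<Prod>w\<in>nb a. br (posp \<alpha> w)) / (\<Prod>r\<in>idx a - {?j}. ?D \<alpha> r)
        * (br (th a \<sigma> \<alpha> + 3/2) / ?D ?\<beta> ?j)"
      unfolding dg_def same N D using False by simp
    also have "\<dots> = dg a \<alpha> * br (th a \<sigma> \<alpha> - 1/2)"
      unfolding key unfolding dg_def D using False by simp
    finally show ?thesis .
  qed
qed

lemma cf_exchange_row_diag:
  assumes "a < n" "odd a" "\<sigma> \<in> moves a" "th a \<sigma> \<alpha> \<noteq> 1/2" "th a \<sigma> \<alpha> \<noteq> - 3/2"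
  shows "cf a \<sigma> \<alpha> * cf a (0, 0) (shift a \<sigma> \<alpha>) * br (th a \<sigma> \<alpha> + 3/2)
    = cf a (0, 0) \<alpha> * cf a \<sigma> \<alpha> * br (th a \<sigma> \<alpha> - 1/2)"
proof (cases "\<alpha> \<in> P \<and> shift a \<sigma> \<alpha> \<in> P")
  case False
  then have "cf a \<sigma> \<alpha> = 0" by (auto simp: cf_def)
  then show ?thesis by simp
next
  case True
  then show ?thesis using dg_shift_row[of \<alpha> a \<sigma>] assms by (simp add: cf_diag mult_ac)
qed

text \<open>The contribution of the step \<open>\<kappa>\<close> in row \<open>b\<close> and of the steps \<open>\<sigma>\<close>, then \<open>\<rho>\<close>, in row \<open>a\<close> to
  \<open>X\<^sub>a\<^sup>2 X\<^sub>b - (q\<^sup>1\<^sup>/\<^sup>2 + q\<^sup>-\<^sup>1\<^sup>/\<^sup>2) X\<^sub>a X\<^sub>b X\<^sub>a + X\<^sub>b X\<^sub>a\<^sup>2\<close>.\<close>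

definition serre :: "nat \<Rightarrow> nat \<Rightarrow> nat \<times> real \<Rightarrow> nat \<times> real \<Rightarrow> nat \<times> real \<Rightarrow> pattern \<Rightarrow> complex" where
  "serre a b \<kappa> \<sigma> \<rho> \<alpha> =
     cf b \<kappa> \<alpha> * cf a \<sigma> (shift b \<kappa> \<alpha>) * cf a \<rho> (shift a \<sigma> (shift b \<kappa> \<alpha>))
     - ch (1/2) * (cf a \<sigma> \<alpha> * cf b \<kappa> (shift a \<sigma> \<alpha>) * cf a \<rho> (shift b \<kappa> (shift a \<sigma> \<alpha>)))
     + cf a \<sigma> \<alpha> * cf a \<rho> (shift a \<sigma> \<alpha>) * cf b \<kappa> (shift a \<rho> (shift a \<sigma> \<alpha>))"

lemma serre_outside:
  assumes "\<not> (\<alpha> \<in> P \<and> shift b \<kappa> (shift a \<rho> (shift a \<sigma> \<alpha>)) \<in> P)"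
  shows "serre a b \<kappa> \<sigma> \<rho> \<alpha> = 0"
proof -
  have "shift b \<kappa> (shift a \<rho> (shift a \<sigma> \<alpha>)) = shift a \<rho> (shift a \<sigma> (shift b \<kappa> \<alpha>))"
    "shift b \<kappa> (shift a \<rho> (shift a \<sigma> \<alpha>)) = shift a \<rho> (shift b \<kappa> (shift a \<sigma> \<alpha>))"
    by (metis shift_commute)+
  then show ?thesis unfolding serre_def using assms cf_outside
    by (metis add.right_neutral diff_zero mult_zero_left mult_zero_right)
qed

lemma serre_eqs:
  assumes ab: "adj a b" "a < n" "b < n" "\<sigma> \<in> steps a" "\<rho> \<in> steps a" "\<kappa> \<in> steps b"
  shows "cf b \<kappa> \<alpha> * cf a \<sigma> (shift b \<kappa> \<alpha>) * cf a \<rho> (shift a \<sigma> (shift b \<kappa> \<alpha>))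
      * br (th b \<kappa> \<alpha> - th a \<sigma> \<alpha> - 1/2)
    = cf a \<sigma> \<alpha> * cf b \<kappa> (shift a \<sigma> \<alpha>) * cf a \<rho> (shift b \<kappa> (shift a \<sigma> \<alpha>))
      * br (th b \<kappa> \<alpha> - th a \<sigma> \<alpha> + 1/2)" (is ?A)
    and "cf a \<sigma> \<alpha> * cf b \<kappa> (shift a \<sigma> \<alpha>) * cf a \<rho> (shift b \<kappa> (shift a \<sigma> \<alpha>))
      * br (th b \<kappa> \<alpha> - th a \<rho> (shift a \<sigma> \<alpha>) - 1/2)
    = cf a \<sigma> \<alpha> * cf a \<rho> (shift a \<sigma> \<alpha>) * cf b \<kappa> (shift a \<rho> (shift a \<sigma> \<alpha>))
      * br (th b \<kappa> \<alpha> - th a \<rho> (shift a \<sigma> \<alpha>) + 1/2)" (is ?B)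
proof -
  have "b \<noteq> a" using ab adj_neq by blast
  then have w: "th b \<kappa> (shift a \<sigma> \<alpha>) = th b \<kappa> \<alpha>" by (rule th_shift_other)
  show ?A using arg_cong[OF cf_exchange[OF ab(1-4,6), of \<alpha>],
        of "\<lambda>z. z * cf a \<rho> (shift b \<kappa> (shift a \<sigma> \<alpha>))"] shift_commute[of a \<sigma> b \<kappa> \<alpha>]
    by (simp add: mult_ac)
  show ?B using arg_cong[OF cf_exchange[OF ab(1-3,5,6), of "shift a \<sigma> \<alpha>"],
        of "\<lambda>z. cf a \<sigma> \<alpha> * z"] unfolding w
    by (simp add: mult_ac)
qed

text \<open>Supplies the hypotheses of \<open>serre_pair\<close>. The exchange rule is assumed for
  varying \<open>\<beta>\<close> because it is used both at \<open>\<alpha>\<close> and after the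
  step \<open>\<kappa>\<close>.\<close>

lemma serre_cancel_gap:
  assumes ab: "adj a b" "a < n" "b < n" "\<sigma> \<in> steps a" "\<rho> \<in> steps a" "\<kappa> \<in> steps b"
    and P: "\<alpha> \<in> P"
    and same: "th a \<rho> (shift a \<sigma> \<alpha>) = th a \<rho> \<alpha>" "th a \<sigma> (shift a \<rho> \<alpha>) = th a \<sigma> \<alpha>"
    and gap: "th a \<sigma> \<alpha> - th a \<rho> \<alpha> \<noteq> 1" "th a \<rho> \<alpha> - th a \<sigma> \<alpha> \<noteq> 1"
    and ex: "\<And>\<beta>. th a \<sigma> \<beta> = th a \<sigma> \<alpha> \<Longrightarrow> th a \<rho> \<beta> = th a \<rho> \<alpha> \<Longrightarrow>
      cf a \<sigma> \<beta> * cf a \<rho> (shift a \<sigma> \<beta>) * br (th a \<sigma> \<alpha> - th a \<rho> \<alpha> + 1)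
      = cf a \<rho> \<beta> * cf a \<sigma> (shift a \<rho> \<beta>) * br (th a \<sigma> \<alpha> - th a \<rho> \<alpha> - 1)"
  shows "serre a b \<kappa> \<sigma> \<rho> \<alpha> + serre a b \<kappa> \<rho> \<sigma> \<alpha> = 0"
proof -
  define v w where "v = th b \<kappa> \<alpha> - th a \<rho> \<alpha>" and "w = th b \<kappa> \<alpha> - th a \<sigma> \<alpha>"
  have vw: "v - w = th a \<sigma> \<alpha> - th a \<rho> \<alpha>" by (simp add: v_def w_def)
  have "a \<noteq> b" using ab adj_neq by blast
  then have other: "th a \<sigma> (shift b \<kappa> \<alpha>) = th a \<sigma> \<alpha>" "th a \<rho> (shift b \<kappa> \<alpha>) = th a \<rho> \<alpha>"
    by (simp_all add: th_shift_other)
  have half: "2 * v \<in> \<int>" "2 * w \<in> \<int>"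
    using th_half[OF P, of a \<sigma>] th_half[OF P, of a \<rho>] th_half[OF P, of b \<kappa>] ab
    by (simp_all add: v_def w_def right_diff_distrib)
  have f1: "cf b \<kappa> \<alpha> * cf a \<sigma> (shift b \<kappa> \<alpha>) * cf a \<rho> (shift a \<sigma> (shift b \<kappa> \<alpha>)) * br (v - w + 1)
    = cf b \<kappa> \<alpha> * cf a \<rho> (shift b \<kappa> \<alpha>) * cf a \<sigma> (shift a \<rho> (shift b \<kappa> \<alpha>)) * br (v - w - 1)"
    using arg_cong[OF ex[OF other], of "\<lambda>z. cf b \<kappa> \<alpha> * z"] unfolding vw by (simp add: mult_ac)
  have f3: "cf a \<sigma> \<alpha> * cf a \<rho> (shift a \<sigma> \<alpha>) * cf b \<kappa> (shift a \<rho> (shift a \<sigma> \<alpha>)) * br (v - w + 1)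
    = cf a \<rho> \<alpha> * cf a \<sigma> (shift a \<rho> \<alpha>) * cf b \<kappa> (shift a \<sigma> (shift a \<rho> \<alpha>)) * br (v - w - 1)"
    using arg_cong[OF ex[OF refl refl], of "\<lambda>z. z * cf b \<kappa> (shift a \<rho> (shift a \<sigma> \<alpha>))"]
      shift_commute[of a \<sigma> a \<rho> \<alpha>] unfolding vw by (simp add: mult_ac)
  note e = serre_eqs[OF ab, of \<alpha>, unfolded same, folded v_def w_def]
  note e' = serre_eqs[OF ab(1-3,5,4,6), of \<alpha>, unfolded same, folded v_def w_def]
  show ?thesis unfolding serre_def
    by (rule serre_pair[OF half(2,1) _ _ e e' f1 f3]) (use gap vw in auto)
qed

text \<open>In the two cases that \<open>dg_shift_row\<close> excludes, the moved entry is at 1/2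
  before or after its step. An entry that it dominates in the row untouched by
  \<open>\<kappa>\<close> is then forced to be 0, which annihilates the diagonal coefficient in
  every term.\<close>

lemma serre_cancel_diag:
  assumes ab: "adj a b" "a < n" "b < n" "odd a" "\<sigma> \<in> moves a" "\<kappa> \<in> steps b"
  shows "serre a b \<kappa> \<sigma> (0, 0) \<alpha> + serre a b \<kappa> (0, 0) \<sigma> \<alpha> = 0"
proof (cases "\<alpha> \<in> P \<and> shift b \<kappa> (shift a \<sigma> \<alpha>) \<in> P")
  case False
  then show ?thesis using serre_outside[of \<alpha> b \<kappa> a "(0, 0)" \<sigma>] serre_outside[of \<alpha> b \<kappa> a \<sigma> "(0, 0)"]
    by simp
next
  case True
  then have in1: "\<alpha> \<in> P" and in2: "shift b \<kappa> (shift a \<sigma> \<alpha>) \<in> P" by auto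
  have st: "\<sigma> \<in> steps a" "(0, 0) \<in> steps a" using ab by (auto simp: steps_def)
  note S = movesD[OF ab(5)]
  show ?thesis
  proof (cases "th a \<sigma> \<alpha> = 1/2 \<or> th a \<sigma> \<alpha> = - 3/2")
    case False
    show ?thesis
    proof (rule serre_cancel_gap[OF ab(1-3) st ab(6) in1])
      show "cf a \<sigma> \<beta> * cf a (0, 0) (shift a \<sigma> \<beta>) * br (th a \<sigma> \<alpha> - th a (0, 0) \<alpha> + 1)
        = cf a (0, 0) \<beta> * cf a \<sigma> (shift a (0, 0) \<beta>) * br (th a \<sigma> \<alpha> - th a (0, 0) \<alpha> - 1)"
        if "th a \<sigma> \<beta> = th a \<sigma> \<alpha>" for \<beta>
        using cf_exchange_row_diag[of a \<sigma> \<beta>] ab False that by (simp add: algebra_simps)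
    qed (use False in auto)
  next
    case True
    have ne: "a \<noteq> b" using ab adj_neq by blast
    have "a \<ge> 1" using ab(4) by (cases a) auto
    then obtain b' where b': "adj a b'" "b' \<noteq> b" using other_neighbour[OF _ ab(1)] by blast
    obtain i where i: "i \<in> idx b'" "above (fst \<sigma>) a i b'" using dominated[OF b'(1) S(1) ab(4)] .
    have le: "a \<le> n" "b' \<le> n" using b' ab by (auto simp: adj_def)
    have "pos \<alpha> (fst \<sigma>) a \<ge> \<bar>pos \<alpha> i b'\<bar> + 1/2"
      using GT_sep[OF in1 b'(1) le S(1) i(1)] i(2) by (simp add: sep_def)
    moreover have "pos \<alpha> (fst \<sigma>) a + snd \<sigma> \<ge> \<bar>pos \<alpha> i b'\<bar> + 1/2"
      using GT_sep[OF in2 b'(1) le S(1) i(1)] i(2) b' ne adj_neq[OF b'(1)] by (simp add: sep_def pos_shift)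
    ultimately have w0: "pos \<alpha> i b' = 0" using True S(3) unfolding S(4) by auto
    have z: "cf a (0, 0) \<beta> = 0" if "pos \<beta> i b' = pos \<alpha> i b'" for \<beta>
      using dg_eq_0[of "(i, b')" a \<beta>] that w0 i b' by (simp add: cf_def nb_def)
    show ?thesis unfolding serre_def using b' by (simp add: z)
  qed
qed

text \<open>The second of two equal steps has position \<theta> + 1, so both exchange equations
  contain [w - 1/2]. Multiplied by this bracket, the three terms become the recurrence
  \<open>br_step\<close>; only w = 1/2 needs another argument.\<close>

lemma serre_double:
  assumes ab: "adj a b" "a < n" "b < n" "\<sigma> \<in> moves a" "\<kappa> \<in> steps b"
  shows "serre a b \<kappa> \<sigma> \<sigma> \<alpha> = 0"
proof (cases "\<alpha> \<in> P \<and> shift b \<kappa> (shift a \<sigma> (shift a \<sigma> \<alpha>)) \<in> P")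
  case False
  then show ?thesis by (rule serre_outside)
next
  case True
  then have in1: "\<alpha> \<in> P" and in2: "shift b \<kappa> (shift a \<sigma> (shift a \<sigma> \<alpha>)) \<in> P" by auto
  have st: "\<sigma> \<in> steps a" using ab by (auto simp: steps_def)
  have ne: "a \<noteq> b" using ab adj_neq by blast
  note S = movesD[OF ab(4)]
  define w where "w = th b \<kappa> \<alpha> - th a \<sigma> \<alpha>"
  have half: "2 * (w - 1/2) \<in> \<int>"
    using th_half[OF in1, of a \<sigma>] th_half[OF in1, of b \<kappa>] ab st
    by (simp add: w_def right_diff_distrib)
  define T1 where "T1 = cf b \<kappa> \<alpha> * cf a \<sigma> (shift b \<kappa> \<alpha>) * cf a \<sigma> (shift a \<sigma> (shift b \<kappa> \<alpha>))"
  define T2 where "T2 = cf a \<sigma> \<alpha> * cf b \<kappa> (shift a \<sigma> \<alpha>) * cf a \<sigma> (shift b \<kappa> (shift a \<sigma> \<alpha>))"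
  define T3 where "T3 = cf a \<sigma> \<alpha> * cf a \<sigma> (shift a \<sigma> \<alpha>) * cf b \<kappa> (shift a \<sigma> (shift a \<sigma> \<alpha>))"
  have arg: "th b \<kappa> \<alpha> - (th a \<sigma> \<alpha> + 1) - 1/2 = w - 3/2" "th b \<kappa> \<alpha> - (th a \<sigma> \<alpha> + 1) + 1/2 = w - 1/2"
    by (simp_all add: w_def)
  have e1: "T1 * br (w - 1/2) = T2 * br (w + 1/2)"
    using serre_eqs(1)[OF ab(1-3) st st ab(5), of \<alpha>] unfolding T1_def T2_def w_def .
  have e2: "T2 * br (w - 3/2) = T3 * br (w - 1/2)"
    using serre_eqs(2)[OF ab(1-3) st st ab(5), of \<alpha>]
    unfolding T2_def T3_def th_shift_same[OF ab(4)] arg .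
  have "T1 - ch (1/2) * T2 + T3 = 0"
  proof (cases "w = 1/2")
    case False
    then have nz: "br (w - 1/2) \<noteq> 0" using br_eq_0[OF half] by simp
    have "(T1 - ch (1/2) * T2 + T3) * br (w - 1/2)
        = T2 * (br (w + 1/2) + br (w - 3/2) - ch (1/2) * br (w - 1/2))"
      using e1 e2 by (simp add: algebra_simps)
    also have "\<dots> = 0" using br_step[of "w - 1/2"] by (simp add: add.commute)
    finally show ?thesis using nz by simp
  next
    case True
    have "T2 = 0" using e2 True br_minus[of 1] by simp
    moreover have "T1 + T3 = 0"
      using ab(5)
    proof (cases rule: steps_cases)
      case k: 1
      note K = movesD[OF k]
      have le: "a \<le> n" "b \<le> n" using ab by auto
      have "sp (above (fst \<sigma>) a (fst \<kappa>) b) (pos \<alpha> (fst \<sigma>) a) (pos \<alpha> (fst \<kappa>) b)"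
        using GT_sep[OF in1 ab(1) le S(1) K(1)] by (simp add: sep_sp)
      moreover have "sp (above (fst \<sigma>) a (fst \<kappa>) b) (pos \<alpha> (fst \<sigma>) a + 2 * snd \<sigma>) (pos \<alpha> (fst \<kappa>) b + snd \<kappa>)"
        using GT_sep[OF in2 ab(1) le S(1) K(1)] ne by (simp add: sep_sp pos_shift add.assoc)
      ultimately have "w \<noteq> 1/2"
        using sp_no_double[OF S(3) K(3)] GT_pos_half[OF in1 le(1) S(1)] GT_pos_half[OF in1 le(2) K(1)]
        unfolding w_def S(4) K(4) by blast
      with True show ?thesis by simp
    next
      case k: 2
      \<comment> \<open>Here \<theta> = - 1, and the two steps reflect the entry about 0. The
        diagonal coefficient is odd in this entry, so the outer two terms cancel.\<close>
      let ?\<beta> = "shift a \<sigma> (shift a \<sigma> \<alpha>)" and ?x = "pos \<alpha> (fst \<sigma>) a"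
      have x: "?x = - snd \<sigma>" using True k S(3) unfolding w_def S(4) by auto
      have "dg b ?\<beta> * br (posp \<alpha> (fst \<sigma>, a)) = dg b \<alpha> * br (posp ?\<beta> (fst \<sigma>, a))"
        using ab ne S(1) by (intro dg_ratio) (auto simp: nb_def pos_shift adj_sym)
      then have "dg b ?\<beta> * br (- snd \<sigma>) = dg b \<alpha> * br (snd \<sigma>)" using x by (simp add: pos_shift)
      then have "dg b \<alpha> = - dg b ?\<beta>" using S(3) br_minus[of 1] by auto
      then show ?thesis using in1 in2 k unfolding T1_def T3_def by (simp add: cf_diag)
    qed
    ultimately show ?thesis by simp
  qed
  then show ?thesis unfolding serre_def T1_def T2_def T3_def .
qed

lemma serre_cancel:
  assumes ab: "adj a b" "a < n" "b < n" "\<sigma> \<in> steps a" "\<rho> \<in> steps a" "\<kappa> \<in> steps b" and "\<rho> \<noteq> neg \<sigma>"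
  shows "serre a b \<kappa> \<sigma> \<rho> \<alpha> + serre a b \<kappa> \<rho> \<sigma> \<alpha> = 0"
proof -
  consider "\<sigma> \<in> moves a" "\<rho> \<in> moves a" | "\<sigma> \<in> moves a" "odd a" "\<rho> = (0, 0)"
    | "odd a" "\<sigma> = (0, 0)" "\<rho> \<in> moves a" | "\<sigma> = (0, 0)" "\<rho> = (0, 0)"
    using ab(4,5) by (auto simp: steps_def split: if_splits)
  then show ?thesis
  proof cases
    case 1
    note S = movesD[OF 1(1)] and T = movesD[OF 1(2)]
    show ?thesis
    proof (cases "fst \<sigma> = fst \<rho>")
      case True
      then have "\<sigma> = \<rho>" using assms(7) S(3) T(3) by (auto simp: neg_def prod_eq_iff)
      then show ?thesis using serre_double[OF ab(1-3) 1(1) ab(6)] by simp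
    next
      case False
      show ?thesis
      proof (cases "\<alpha> \<in> P \<and> shift b \<kappa> (shift a \<rho> (shift a \<sigma> \<alpha>)) \<in> P")
        case out: False
        then show ?thesis using serre_outside shift_commute[of a \<sigma> a \<rho> \<alpha>] by simp
      next
        case True
        then have in1: "\<alpha> \<in> P" and in2: "shift b \<kappa> (shift a \<rho> (shift a \<sigma> \<alpha>)) \<in> P" by auto
        have ne: "a \<noteq> b" using ab adj_neq by blast
        have "a \<ge> 1" using S(1) by (auto simp: idx_def)
        \<comment> \<open>The row on the other side of \<open>a\<close> does not see
          \<open>\<kappa>\<close>, so it separates the two entries at the beginning and at the
          end.\<close>
        then obtain b' where b': "adj a b'" "b' \<noteq> b" using other_neighbour[OF _ ab(1)] by blast
        have "\<bar>th a \<sigma> \<alpha> - th a \<rho> \<alpha>\<bar> > 1"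
          by (rule moves_gap[OF in1 in2 b'(1) ab(2) 1 False])
            (use b' ne False adj_neq[OF b'(1)] in \<open>simp_all add: pos_shift\<close>)
        then have gap: "th a \<sigma> \<alpha> - th a \<rho> \<alpha> \<noteq> 1" "th a \<rho> \<alpha> - th a \<sigma> \<alpha> \<noteq> 1" by auto
        show ?thesis
        proof (rule serre_cancel_gap[OF ab in1 _ _ gap])
          show "cf a \<sigma> \<beta> * cf a \<rho> (shift a \<sigma> \<beta>) * br (th a \<sigma> \<alpha> - th a \<rho> \<alpha> + 1)
            = cf a \<rho> \<beta> * cf a \<sigma> (shift a \<rho> \<beta>) * br (th a \<sigma> \<alpha> - th a \<rho> \<alpha> - 1)"
            if "th a \<sigma> \<beta> = th a \<sigma> \<alpha>" "th a \<rho> \<beta> = th a \<rho> \<alpha>" for \<beta>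
            using cf_exchange_row[OF ab(2) 1 False, of \<beta>] unfolding that .
        qed (use False in \<open>simp_all add: th_shift_index\<close>)
      qed
    qed
  next
    case 2
    then show ?thesis using serre_cancel_diag ab by blast
  next
    case 3
    then show ?thesis using serre_cancel_diag[OF ab(1-3) _ _ ab(6)] by (simp add: add.commute)
  next
    case 4
    then show ?thesis using assms(7) by (simp add: neg_def)
  qed
qed

end

section \<open>Opposite steps\<close>

lemma card_idx: "card (idx k) = k div 2" by (simp add: idx_def)

lemma nb_rows:
  assumes "a \<ge> 1"
  shows "nb a = (\<lambda>i. (i, Suc a)) ` idx (Suc a) \<union> (\<lambda>i. (i, a - 1)) ` idx (a - 1)"
    and "(\<lambda>i. (i, Suc a)) ` idx (Suc a) \<inter> (\<lambda>i. (i, a - 1)) ` idx (a - 1) = {}"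
  using assms by (auto simp: nb_def adj_def)

text \<open>Together with \<open>card_steps\<close> this fixes the degree in the divided
  differences. Without the entry moved by \<open>\<kappa>\<close>, odd \<open>a\<close> leaves
  \<open>a - 1\<close> zeros for \<open>a\<close> nodes, but even \<open>a\<close> only
  \<open>a - 2\<close>.\<close>

lemma card_nb:
  assumes "a \<ge> 1"
  shows "card (nb a) = (if odd a then a else a - 1)"
proof -
  have "card (nb a) = card (idx (Suc a)) + card (idx (a - 1))"
    unfolding nb_rows(1)[OF assms] using nb_rows(2)[OF assms]
    by (subst card_Un_disjoint) (auto simp: card_image inj_on_def)
  then show ?thesis using assms by (auto simp: card_idx elim!: oddE evenE)
qed

lemma card_steps: "card (steps a) = a"
proof -
  have "card (moves a) = 2 * (a div 2)"
    by (simp add: moves_def card_cartesian_product card_idx)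
  then show ?thesis by (auto simp: steps_def elim: oddE)
qed

text \<open>The entry (i, a - 1) is dominated by (j, a) exactly if (i + 1, a + 1) is, so dominated
  neighbours come in pairs; the remaining neighbour (1, a + 1) is never dominated.\<close>

lemma prod_above_sign:
  assumes "a \<ge> 1" "j \<in> idx a"
  shows "(\<Prod>w\<in>nb a. if above j a (fst w) (snd w) then - 1 else (1::'a::comm_ring_1)) = 1"
proof -
  let ?f = "\<lambda>w. if above j a (fst w) (snd w) then - 1 else (1::'a)"
  have "idx (Suc a) = insert 1 (Suc ` idx (a - 1))"
  proof -
    obtain c where c: "a = Suc c" using assms(1) by (cases a) auto
    have "Suc ` {1..c div 2} = {2..Suc (c div 2)}" by (simp add: image_Suc_atLeastAtMost)
    then show ?thesis by (auto simp: idx_def c)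
  qed
  then have "(\<Prod>i\<in>idx (Suc a). ?f (i, Suc a)) = ?f (1, Suc a) * (\<Prod>i\<in>Suc ` idx (a - 1). ?f (i, Suc a))"
    by (simp add: idx_def image_iff)
  also have "?f (1, Suc a) = 1" using assms(2) by (simp add: above_def idx_def)
  also have "(\<Prod>i\<in>Suc ` idx (a - 1). ?f (i, Suc a)) = (\<Prod>i\<in>idx (a - 1). ?f (i, a - 1))"
    using assms(1) by (subst prod.reindex) (auto intro!: prod.cong simp: above_def)
  finally have 1: "(\<Prod>i\<in>idx (Suc a). ?f (i, Suc a)) = (\<Prod>i\<in>idx (a - 1). ?f (i, a - 1))" by simp
  have "(\<Prod>w\<in>nb a. ?f w) = (\<Prod>i\<in>idx (Suc a). ?f (i, Suc a)) * (\<Prod>i\<in>idx (a - 1). ?f (i, a - 1))"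
    unfolding nb_rows(1)[OF assms(1)] using nb_rows(2)[OF assms(1)]
    by (subst prod.union_disjoint) (auto simp: prod.reindex inj_on_def)
  also have "\<dots> = (\<Prod>i\<in>idx (a - 1). ?f (i, a - 1) * ?f (i, a - 1))"
    unfolding 1 by (simp add: prod.distrib)
  also have "\<dots> = 1" by (rule prod.neutral) auto
  finally show ?thesis .
qed

text \<open>The counterpart of \<open>sp_sum\<close>: a neighbour that blocks a step makes one of
  the two brackets of \<open>up\<close> vanish, so the formula for the return coefficient also holds
  at the boundary of the set of patterns.\<close>

lemma sp_hit:
  assumes "e = 1 \<or> e = - 1" "2 * x \<in> \<int>" "2 * y \<in> \<int>" "x - y - 1/2 \<in> \<int>"
    and "sp A x y" "\<not> sp A (x + e) y"
  shows "y + e * x + 1/2 = 0 \<or> y - e * x - 1/2 = 0"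
proof (cases A)
  case True
  have "x - \<bar>y\<bar> - 1/2 \<in> \<int>" using Ints_abs_adj assms by blast
  then have "x - \<bar>y\<bar> - 1/2 < 1 \<Longrightarrow> x - \<bar>y\<bar> - 1/2 \<le> 0" by (rule Ints_less_1)
  then show ?thesis using assms(1,5,6) True unfolding sp_def by (auto simp: abs_if split: if_splits)
next
  note half = Ints_gap[OF assms(2)]
  case False
  have "y - \<bar>x\<bar> - 1/2 \<in> \<int>" using Ints_abs_adj assms by blast
  then have "y - \<bar>x\<bar> - 1/2 < 1 \<Longrightarrow> y - \<bar>x\<bar> - 1/2 \<le> 0" by (rule Ints_less_1)
  then show ?thesis using assms(1,5,6) False half unfolding sp_def by (auto simp: abs_if split: if_splits)
qed

section \<open>Squares of the step coefficients\<close>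

context gt
begin

text \<open>For possible steps, \<open>wt\<close>, \<open>up\<close> and \<open>low\<close> are the
  squares of \<open>ecf\<close>, \<open>phi\<close> and \<open>psi\<close>, up to the sign in
  \<open>phi_sq\<close>. They are free of the choice of roots and make sense for steps that leave
  the patterns too.\<close>

definition wt :: "nat \<Rightarrow> real \<Rightarrow> complex" where
  "wt a t = (if even a then 1 / (ch (t / 2) * ch ((t + 1) / 2))
     else 1 / (br (t + 1/2) * br (t + 1/2) * br (2 * t + 2) * br (2 * t)))"

definition up :: "real \<Rightarrow> real \<Rightarrow> complex" where
  "up t w = br (w + t + 1/2) * br (w - t - 1/2)"

definition low :: "real \<Rightarrow> real \<Rightarrow> complex" where
  "low t w = br (w + t) * br (w - t) * (br (w + t + 1) * br (w - t - 1))"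

lemma up_minus: "up t (- w) = up t w"
proof -
  have e: "- w + t + 1/2 = - (w - t - 1/2)" "- w - t - 1/2 = - (w + t + 1/2)" by simp_all
  show ?thesis unfolding up_def e br_minus by simp
qed

lemma up_ch: "ch w - ch (t + 1/2) = dl * up t w"
  unfolding up_def using ch_diff[of w "t + 1/2"] by (simp add: algebra_simps)

text \<open>The two nodes on the left are those of lowering and raising the entry \<open>w\<close>,
  so \<open>low\<close> is the share of one other entry in the product of node differences.\<close>

lemma low_ch: "(ch (t + 1/2) - ch (w + 1/2)) * (ch (t + 1/2) - ch (- w + 1/2)) = dl * dl * low t w"
proof -
  have 1: "ch (t + 1/2) - ch (w + 1/2) = dl * (br (w + t + 1) * br (t - w))"
    using ch_diff[of "t + 1/2" "w + 1/2"] by (simp add: algebra_simps)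
  have 2: "ch (t + 1/2) - ch (- w + 1/2) = dl * (br (t - w + 1) * br (w + t))"
    using ch_diff[of "t + 1/2" "- w + 1/2"] by (simp add: algebra_simps)
  have 3: "br (t - w) = - br (w - t)" "br (t - w + 1) = - br (w - t - 1)"
    using br_minus[of "w - t"] br_minus[of "w - t - 1"] by (simp_all add: algebra_simps)
  show ?thesis unfolding 1 2 3 low_def by (simp add: mult_ac)
qed

lemma sp_args:
  fixes e x y :: real
  assumes "e = 1 \<or> e = - 1" "2 * x \<in> \<int>" "2 * y \<in> \<int>" "x - y - 1/2 \<in> \<int>"
  shows "y + e * x + 1/2 \<in> \<int>" "y - e * x - 1/2 \<in> \<int>"
proof -
  have f: "y + 1 * x + 1/2 = (x - y - 1/2) + 2 * y + 1" "y - 1 * x - 1/2 = - (x - y - 1/2) - 1"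
    "y + (- 1) * x + 1/2 = - (x - y - 1/2)" "y - (- 1) * x - 1/2 = (x - y - 1/2) + 2 * y" by simp_all
  have "(x - y - 1/2) + 2 * y + 1 \<in> \<int>" "- (x - y - 1/2) - 1 \<in> \<int>"
    "- (x - y - 1/2) \<in> \<int>" "(x - y - 1/2) + 2 * y \<in> \<int>"
    using assms(2-4) by (meson Ints_add Ints_diff Ints_minus Ints_1)+
  then show "y + e * x + 1/2 \<in> \<int>" "y - e * x - 1/2 \<in> \<int>" using assms(1) f by metis+
qed

lemma phi_sq:
  assumes "e = 1 \<or> e = - 1" "2 * x \<in> \<int>" "2 * y \<in> \<int>" "x - y - 1/2 \<in> \<int>"
    and "sp A x y" "sp A (x + e) y"
  shows "phi (e * x) y * phi (e * x) y = (if A then - 1 else 1) * up (e * x) y"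
proof -
  note i = sp_args[OF assms(1-4)]
  note nz = sp_sum[OF assms(1,5,6)]
  have "phi (e * x) y * phi (e * x) y = (s \<bar>y + e * x + 1/2\<bar> * s \<bar>y + e * x + 1/2\<bar>)
      * (s \<bar>y - e * x - 1/2\<bar> * s \<bar>y - e * x - 1/2\<bar>)" by (simp add: phi_def mult_ac)
  also have "\<dots> = (if A then - 1 else 1) * up (e * x) y"
    unfolding s_sq[OF i(1) nz(1)] s_sq[OF i(2) nz(2)] up_def
    using assms(1,5,6) by (auto simp: sp_def abs_if split: if_splits)
  finally show ?thesis .
qed

lemma psi_sq:
  assumes "w + t \<in> \<int>" "w - t \<in> \<int>"
    and "\<bar>w\<bar> < t \<or> \<bar>w\<bar> < - t - 1 \<or> (w > \<bar>t\<bar> \<and> w > \<bar>t + 1\<bar>)"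
  shows "psi t w * psi t w = low t w"
proof -
  have i: "w + t + 1 \<in> \<int>" "w - t - 1 \<in> \<int>" using assms by auto
  have nz: "w + t \<noteq> 0" "w - t \<noteq> 0" "w + t + 1 \<noteq> 0" "w - t - 1 \<noteq> 0" using assms(3) by auto
  have "psi t w * psi t w = (s \<bar>w + t\<bar> * s \<bar>w + t\<bar>) * (s \<bar>w - t\<bar> * s \<bar>w - t\<bar>)
      * ((s \<bar>w + t + 1\<bar> * s \<bar>w + t + 1\<bar>) * (s \<bar>w - t - 1\<bar> * s \<bar>w - t - 1\<bar>))"
    by (simp add: psi_def mult_ac)
  also have "\<dots> = low t w"
    unfolding s_sq[OF assms(1) nz(1)] s_sq[OF assms(2) nz(2)] s_sq[OF i(1) nz(3)] s_sq[OF i(2) nz(4)] low_def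
    using assms(3) by (auto simp: abs_if split: if_splits)
  finally show ?thesis .
qed

lemma ecf_sq_even: assumes "even a" "2 * t \<in> \<int>" shows "ecf a t * ecf a t = wt a t"
proof -
  have "2 * (t + 1) \<in> \<int>" using assms(2) by (simp add: distrib_left)
  have "ecf a t * ecf a t = 1 / ((u \<bar>t\<bar> * u \<bar>t\<bar>) * (u \<bar>t + 1\<bar> * u \<bar>t + 1\<bar>))"
    using assms(1) by (simp add: ecf_def mult_ac)
  then show ?thesis unfolding u_sq[OF assms(2)] u_sq[OF \<open>2 * (t + 1) \<in> \<int>\<close>] using assms(1) by (simp add: wt_def)
qed

lemma ecf_sq_odd: assumes "odd a" "2 * t \<in> \<int>" "t \<ge> 1/2 \<or> t \<le> - 3/2"
  shows "ecf a t * ecf a t = wt a t"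
proof -
  have i: "2 * t + 2 \<in> \<int>" using assms(2) by simp
  have nz: "2 * t + 2 \<noteq> 0" "2 * t \<noteq> 0" using assms(3) by auto
  have b: "br \<bar>t + 1/2\<bar> * br \<bar>t + 1/2\<bar> = br (t + 1/2) * br (t + 1/2)"
    using br_minus[of "t + 1/2"] by (simp add: abs_if)
  have "ecf a t * ecf a t = 1 / ((br \<bar>t + 1/2\<bar> * br \<bar>t + 1/2\<bar>)
      * ((s \<bar>2 * t + 2\<bar> * s \<bar>2 * t + 2\<bar>) * (s \<bar>2 * t\<bar> * s \<bar>2 * t\<bar>)))"
    using assms(1) by (simp add: ecf_def mult_ac)
  also have "\<dots> = wt a t"
    unfolding b s_sq[OF i nz(1)] s_sq[OF assms(2) nz(2)] wt_def using assms(1,3) by (auto simp: mult_ac)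
  finally show ?thesis .
qed

lemma move_nb:
  assumes in1: "\<alpha> \<in> P" and a: "a < n" "\<sigma> \<in> moves a" and ib: "(i, b) \<in> nb a"
  shows "adj a b" "b \<le> n" "i \<in> idx b" "2 * pos \<alpha> i b \<in> \<int>" "pos \<alpha> (fst \<sigma>) a - pos \<alpha> i b - 1/2 \<in> \<int>"
    "sp (above (fst \<sigma>) a i b) (pos \<alpha> (fst \<sigma>) a) (pos \<alpha> i b)"
proof -
  note S = movesD[OF a(2)]
  have le: "a \<le> n" using a by simp
  show *: "adj a b" "i \<in> idx b" using ib by (auto simp: nb_def)
  then show **: "b \<le> n" using a by (auto simp: adj_def)
  show "2 * pos \<alpha> i b \<in> \<int>" using GT_pos_half[OF in1 ** *(2)] .
  show "pos \<alpha> (fst \<sigma>) a - pos \<alpha> i b - 1/2 \<in> \<int>" using GT_pos_adj[OF in1 *(1) le ** S(1) *(2)] .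
  show "sp (above (fst \<sigma>) a i b) (pos \<alpha> (fst \<sigma>) a) (pos \<alpha> i b)"
    using GT_sep[OF in1 *(1) le ** S(1) *(2)] by (simp add: sep_sp)
qed

lemma move_row:
  assumes in1: "\<alpha> \<in> P" and a: "a < n" "\<sigma> \<in> moves a" and in2: "shift a \<sigma> \<alpha> \<in> P"
    and r: "r \<in> idx a - {fst \<sigma>}"
  shows "pos \<alpha> r a + th a \<sigma> \<alpha> \<in> \<int>" "pos \<alpha> r a - th a \<sigma> \<alpha> \<in> \<int>"
    "\<bar>pos \<alpha> r a\<bar> < th a \<sigma> \<alpha> \<or> \<bar>pos \<alpha> r a\<bar> < - th a \<sigma> \<alpha> - 1
      \<or> (pos \<alpha> r a > \<bar>th a \<sigma> \<alpha>\<bar> \<and> pos \<alpha> r a > \<bar>th a \<sigma> \<alpha> + 1\<bar>)"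
proof -
  let ?j = "fst \<sigma>" and ?t = "th a \<sigma> \<alpha>" and ?\<beta> = "shift a \<sigma> \<alpha>" and ?x = "pos \<alpha> (fst \<sigma>) a" and ?y = "pos \<alpha> r a"
  note S = movesD[OF a(2)]
  have le: "a \<le> n" using a by simp
  have px: "pos ?\<beta> ?j a = ?x + snd \<sigma>" by (simp add: pos_shift)
  have half: "2 * ?x \<in> \<int>" using GT_pos_half[OF in1 le S(1)] .
  have ab: "adj a (Suc a)" by (simp add: adj_def)
  have yr: "pos ?\<beta> r a = ?y" using r by (simp add: pos_shift)
  show "\<bar>?y\<bar> < ?t \<or> \<bar>?y\<bar> < - ?t - 1 \<or> (?y > \<bar>?t\<bar> \<and> ?y > \<bar>?t + 1\<bar>)"
  proof (cases "?j < r")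
    case lt: True
    obtain w where "?x \<ge> \<bar>w\<bar> + 1/2" "pos ?\<beta> ?j a \<ge> \<bar>w\<bar> + 1/2" "w \<ge> \<bar>?y\<bar> + 1/2" "w \<ge> \<bar>pos ?\<beta> r a\<bar> + 1/2"
      using row_separated[OF in1 in2 ab a(1) S(1) _ lt] r ab by auto
    then show ?thesis unfolding S(4) px using S(3) by auto
  next
    case False
    then have lt: "r < ?j" using r by auto
    obtain w where "?y \<ge> \<bar>w\<bar> + 1/2" "pos ?\<beta> r a \<ge> \<bar>w\<bar> + 1/2" "w \<ge> \<bar>?x\<bar> + 1/2" "w \<ge> \<bar>pos ?\<beta> ?j a\<bar> + 1/2"
      using row_separated[OF in1 in2 ab a(1) _ S(1) lt] r ab by auto
    then show ?thesis unfolding S(4) px using S(3) by auto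
  qed
  have i: "?y - ?x \<in> \<int>" "2 * ?x \<in> \<int>" using GT_pos_same[OF in1 le] S(1) r half by auto
  then have i': "?y - ?x + 2 * ?x \<in> \<int>" by (rule Ints_add)
  show "?y + ?t \<in> \<int>" "?y - ?t \<in> \<int>" using i i' S(3) unfolding S(4) by (auto simp: add.commute)
qed

lemma odd_move_th:
  assumes "\<alpha> \<in> P" "shift a \<sigma> \<alpha> \<in> P" "a < n" "odd a" "\<sigma> \<in> moves a"
  shows "th a \<sigma> \<alpha> \<ge> 1/2 \<or> th a \<sigma> \<alpha> \<le> - 3/2"
proof -
  note S = movesD[OF assms(5)]
  have "pos \<alpha> (fst \<sigma>) a \<ge> 1/2" "pos \<alpha> (fst \<sigma>) a + snd \<sigma> \<ge> 1/2"
    using odd_row_pos[OF assms(1,3,4) S(1)] odd_row_pos[OF assms(2,3,4) S(1)] by (auto simp: pos_shift)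
  then show ?thesis using S(3) unfolding S(4) by auto
qed

text \<open>For a possible step the left-hand side is minus a square by \<open>mv_neg_shift\<close>,
  and the signs from \<open>phi_sq\<close> multiply to 1. For any other step the left-hand side is
  0, and so is a factor of the numerator by \<open>sp_hit\<close>.\<close>

lemma return_coeff:
  assumes in1: "\<alpha> \<in> P" and a: "a < n" "\<sigma> \<in> moves a"
  shows "cf a \<sigma> \<alpha> * cf a (neg \<sigma>) (shift a \<sigma> \<alpha>)
    = - (wt a (th a \<sigma> \<alpha>) * (\<Prod>w\<in>nb a. up (th a \<sigma> \<alpha>) (posp \<alpha> w))
        / (\<Prod>r\<in>idx a - {fst \<sigma>}. low (th a \<sigma> \<alpha>) (pos \<alpha> r a)))"
proof -
  let ?j = "fst \<sigma>" and ?t = "th a \<sigma> \<alpha>" and ?\<beta> = "shift a \<sigma> \<alpha>" and ?x = "pos \<alpha> (fst \<sigma>) a" and ?e = "snd \<sigma>"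
  note S = movesD[OF a(2)]
  have le: "a \<le> n" using a by simp
  have a1: "a \<ge> 1" using S(1) by (auto simp: idx_def)
  have px: "pos ?\<beta> ?j a = ?x + ?e" by (simp add: pos_shift)
  have half: "2 * ?x \<in> \<int>" using GT_pos_half[OF in1 le S(1)] .
  note nbD = move_nb[OF in1 a]
  show ?thesis
  proof (cases "?\<beta> \<in> P")
    case False
    then obtain b i where ib: "(i, b) \<in> nb a" "\<not> sep ?\<beta> ?j a i b"
      unfolding GT_shift_iff[OF in1 a] by blast
    then have "\<not> sp (above ?j a i b) (?x + ?e) (pos \<alpha> i b)" using nbD(1)[OF ib(1)] by (simp add: sep_sp px)
    then have "br (pos \<alpha> i b + ?e * ?x + 1/2) = 0 \<or> br (pos \<alpha> i b - ?e * ?x - 1/2) = 0"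
      using sp_hit[OF S(3) half nbD(4,5,6)[OF ib(1)]] br_0 by metis
    then have "up ?t (pos \<alpha> i b) = 0" unfolding S(4) up_def by auto
    then have "(\<Prod>w\<in>nb a. up ?t (posp \<alpha> w)) = 0" using ib(1) by (intro prod_zero bexI[of _ "(i, b)"]) auto
    then show ?thesis using False by (simp add: cf_def)
  next
    case True
    have "cf a \<sigma> \<alpha> * cf a (neg \<sigma>) ?\<beta> = - (mv a \<sigma> \<alpha> * mv a \<sigma> \<alpha>)"
      using cf_move[OF a(2) in1 True] cf_move[OF neg_moves[OF a(2)] True] in1 mv_neg_shift[OF a(2)] by simp
    moreover have "mv a \<sigma> \<alpha> * mv a \<sigma> \<alpha> = (ecf a ?t * ecf a ?t)
        * (\<Prod>w\<in>nb a. phi ?t (posp \<alpha> w) * phi ?t (posp \<alpha> w))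
        / (\<Prod>r\<in>idx a - {?j}. psi ?t (pos \<alpha> r a) * psi ?t (pos \<alpha> r a))"
    proof -
      have "complex_of_real ?e * complex_of_real ?e = 1" using S(3) by auto
      then show ?thesis unfolding mv_def prod.distrib by (simp add: field_simps)
    qed
    moreover have "ecf a ?t * ecf a ?t = wt a ?t"
    proof (cases "even a")
      case even: True
      then show ?thesis using ecf_sq_even th_half[OF in1 le] a(2) by (simp add: steps_def)
    next
      case odd: False
      have "?t \<ge> 1/2 \<or> ?t \<le> - 3/2" using odd_move_th[OF in1 True a(1) odd a(2)] .
      then show ?thesis using ecf_sq_odd odd th_half[OF in1 le] a(2) by (simp add: steps_def)
    qed
    moreover have "(\<Prod>w\<in>nb a. phi ?t (posp \<alpha> w) * phi ?t (posp \<alpha> w)) = (\<Prod>w\<in>nb a. up ?t (posp \<alpha> w))"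
    proof -
      have "(\<Prod>w\<in>nb a. phi ?t (posp \<alpha> w) * phi ?t (posp \<alpha> w))
          = (\<Prod>w\<in>nb a. (if above ?j a (fst w) (snd w) then - 1 else 1) * up ?t (posp \<alpha> w))"
      proof (rule prod.cong[OF refl])
        fix w assume w: "w \<in> nb a"
        then have w': "(fst w, snd w) \<in> nb a" by simp
        have "sp (above ?j a (fst w) (snd w)) (?x + ?e) (posp \<alpha> w)"
          using GT_sep[OF True nbD(1)[OF w'] le nbD(2)[OF w'] S(1) nbD(3)[OF w']] nbD(1)[OF w']
          by (simp add: sep_sp px)
        then show "phi ?t (posp \<alpha> w) * phi ?t (posp \<alpha> w)
            = (if above ?j a (fst w) (snd w) then - 1 else 1) * up ?t (posp \<alpha> w)"
          unfolding S(4) using phi_sq[OF S(3) half nbD(4,5,6)[OF w']] by blast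
      qed
      then show ?thesis unfolding prod.distrib prod_above_sign[OF a1 S(1)] by simp
    qed
    moreover have "(\<Prod>r\<in>idx a - {?j}. psi ?t (pos \<alpha> r a) * psi ?t (pos \<alpha> r a))
        = (\<Prod>r\<in>idx a - {?j}. low ?t (pos \<alpha> r a))"
    proof (rule prod.cong[OF refl])
      fix r assume r: "r \<in> idx a - {?j}"
      show "psi ?t (pos \<alpha> r a) * psi ?t (pos \<alpha> r a) = low ?t (pos \<alpha> r a)"
        using psi_sq move_row[OF in1 a True r] by blast
    qed
    ultimately show ?thesis by simp
  qed
qed

section \<open>Nodes and their coincidences\<close>

definition nd :: "nat \<Rightarrow> pattern \<Rightarrow> nat \<times> real \<Rightarrow> complex" where
  "nd a \<alpha> \<sigma> = ch (th a \<sigma> \<alpha> + 1/2)"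

lemma nd_moves_row:
  assumes "r \<in> idx a"
  shows "(z - nd a \<alpha> (r, 1)) * (z - nd a \<alpha> (r, - 1)) = (z - ch (pos \<alpha> r a + 1/2)) * (z - ch (- pos \<alpha> r a + 1/2))"
  using assms idx_pos[OF assms] by (simp add: nd_def th_def)

lemma nd_prod_rows:
  assumes "R \<subseteq> idx a"
  shows "(\<Prod>\<mu>\<in>R \<times> {1, - 1}. ch (t + 1/2) - nd a \<alpha> \<mu>) = (\<Prod>r\<in>R. dl * dl * low t (pos \<alpha> r a))"
proof -
  have "finite R" using assms finite_subset finite_idx by blast
  have "(\<Prod>\<mu>\<in>R \<times> {1, - 1}. ch (t + 1/2) - nd a \<alpha> \<mu>)
      = (\<Prod>r\<in>R. \<Prod>e\<in>{1, - 1}. ch (t + 1/2) - nd a \<alpha> (r, e))"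
    by (subst prod.cartesian_product) (simp add: case_prod_unfold)
  also have "\<dots> = (\<Prod>r\<in>R. dl * dl * low t (pos \<alpha> r a))"
  proof (rule prod.cong[OF refl])
    fix r assume "r \<in> R"
    then show "(\<Prod>e\<in>{1, - 1}. ch (t + 1/2) - nd a \<alpha> (r, e)) = dl * dl * low t (pos \<alpha> r a)"
      using nd_moves_row[of r a "ch (t + 1/2)" \<alpha>] low_ch[of t "pos \<alpha> r a"] assms by auto
  qed
  finally show ?thesis .
qed

text \<open>[2\<theta>] comes from the reverse step of the same entry, [\<theta> + 1/2]^2 from the
  diagonal step, and \<open>low\<close> from the two steps of each other entry.\<close>

lemma nd_prod_move:
  assumes "\<sigma> \<in> moves a"
  shows "(\<Prod>\<mu>\<in>steps a - {\<sigma>}. nd a \<alpha> \<sigma> - nd a \<alpha> \<mu>)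
    = dl * br (2 * th a \<sigma> \<alpha>) * (if odd a then dl * (br (th a \<sigma> \<alpha> + 1/2) * br (th a \<sigma> \<alpha> + 1/2)) else 1)
      * (\<Prod>r\<in>idx a - {fst \<sigma>}. dl * dl * low (th a \<sigma> \<alpha>) (pos \<alpha> r a))"
proof -
  let ?t = "th a \<sigma> \<alpha>" and ?f = "\<lambda>\<mu>. nd a \<alpha> \<sigma> - nd a \<alpha> \<mu>" and ?M = "(idx a - {fst \<sigma>}) \<times> {1, - 1}"
  let ?O = "if odd a then {(0, 0::real)} else {}"
  note S = movesD[OF assms]
  have set: "steps a - {\<sigma>} = insert (neg \<sigma>) (?O \<union> ?M)"
    using S(1,3) by (cases \<sigma>) (auto simp: steps_def moves_def neg_def)
  have ni: "neg \<sigma> \<notin> ?O \<union> ?M" using S(2) by (auto simp: neg_def)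
  have disj: "?O \<inter> ?M = {}" by auto
  have "prod ?f (steps a - {\<sigma>}) = ?f (neg \<sigma>) * prod ?f (?O \<union> ?M)"
    unfolding set using ni by (intro prod.insert) auto
  also have "prod ?f (?O \<union> ?M) = prod ?f ?O * prod ?f ?M"
    using disj by (intro prod.union_disjoint) auto
  finally have "prod ?f (steps a - {\<sigma>}) = ?f (neg \<sigma>) * (prod ?f ?O * prod ?f ?M)" .
  moreover have "?f (neg \<sigma>) = dl * br (2 * ?t)"
  proof -
    have "th a (neg \<sigma>) \<alpha> = - ?t" using S(2) by (simp add: th_def)
    then show ?thesis using ch_diff[of "?t + 1/2" "- ?t + 1/2"] by (simp add: nd_def)
  qed
  moreover have "prod ?f ?O = (if odd a then dl * (br (?t + 1/2) * br (?t + 1/2)) else 1)"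
    using ch_diff[of "?t + 1/2" 0] by (simp add: nd_def)
  moreover have "prod ?f ?M = (\<Prod>r\<in>idx a - {fst \<sigma>}. dl * dl * low ?t (pos \<alpha> r a))"
    unfolding nd_def[of a \<alpha> \<sigma>] by (rule nd_prod_rows) auto
  ultimately show ?thesis by simp
qed

lemma nd_prod_diag:
  assumes "odd a"
  shows "(\<Prod>\<mu>\<in>steps a - {(0, 0)}. nd a \<alpha> (0, 0) - nd a \<alpha> \<mu>)
    = (\<Prod>r\<in>idx a. dl * dl * (br (pos \<alpha> r a + 1/2) * br (pos \<alpha> r a - 1/2) * (br (pos \<alpha> r a + 1/2) * br (pos \<alpha> r a - 1/2))))"
proof -
  have "steps a - {(0, 0)} = idx a \<times> {1, - 1}" using assms by (auto simp: steps_def moves_def)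
  moreover have "nd a \<alpha> (0, 0) = ch (- 1/2 + 1/2)" by (simp add: nd_def)
  moreover have "low (- 1/2) w = br (w + 1/2) * br (w - 1/2) * (br (w + 1/2) * br (w - 1/2))" for w
    by (simp add: low_def mult_ac add.commute)
  ultimately show ?thesis using nd_prod_rows[of "idx a" a "- 1/2" \<alpha>] by simp
qed

lemma num_prod:
  "(\<Prod>w\<in>W. ch (posp \<alpha> w) - nd a \<alpha> \<sigma>) = dl ^ card W * (\<Prod>w\<in>W. up (th a \<sigma> \<alpha>) (posp \<alpha> w))"
  unfolding nd_def up_ch prod.distrib by simp

text \<open>The entry in row \<open>b\<close> that lies between the entries moved by \<open>\<sigma>\<close> and \<open>\<mu>\<close> in the adjacent
  row \<open>a\<close>; the diagonal step plays the part of an entry after the last one.\<close>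

definition between :: "nat \<Rightarrow> nat \<Rightarrow> nat \<times> real \<Rightarrow> nat \<times> real \<Rightarrow> nat" where
  "between a b \<sigma> \<mu> = (if b = Suc a then if fst \<mu> = 0 then Suc (fst \<sigma>) else fst \<mu> else fst \<sigma>)"

definition before :: "nat \<Rightarrow> nat \<times> real \<Rightarrow> nat \<times> real \<Rightarrow> bool" where
  "before a \<sigma> \<mu> \<longleftrightarrow> \<sigma> \<in> moves a \<and> \<mu> \<in> steps a \<and> (fst \<mu> = 0 \<or> fst \<sigma> < fst \<mu>)"

lemma between_bounds:
  assumes "\<alpha> \<in> P" "a < n" "adj a b" "before a \<sigma> \<mu>"
  shows "between a b \<sigma> \<mu> \<in> idx b"
    "pos \<alpha> (fst \<sigma>) a \<ge> \<bar>pos \<alpha> (between a b \<sigma> \<mu>) b\<bar> + 1/2"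
    "\<mu> \<in> moves a \<Longrightarrow> pos \<alpha> (between a b \<sigma> \<mu>) b \<ge> \<bar>pos \<alpha> (fst \<mu>) a\<bar> + 1/2"
    "\<bar>th a \<sigma> \<alpha> + 1/2\<bar> \<ge> pos \<alpha> (fst \<sigma>) a - 1/2"
    "\<mu> \<in> moves a \<Longrightarrow> \<bar>th a \<mu> \<alpha> + 1/2\<bar> \<le> \<bar>pos \<alpha> (fst \<mu>) a\<bar> + 1/2"
    "\<bar>th a \<mu> \<alpha> + 1/2\<bar> \<le> \<bar>pos \<alpha> (between a b \<sigma> \<mu>) b\<bar>"
proof -
  let ?i = "between a b \<sigma> \<mu>"
  have s: "\<sigma> \<in> moves a" and m: "\<mu> \<in> steps a" and o: "fst \<mu> = 0 \<or> fst \<sigma> < fst \<mu>"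
    using assms(4) by (auto simp: before_def)
  note S = movesD[OF s]
  have le: "a \<le> n" "b \<le> n" using assms(2,3) by (auto simp: adj_def)
  have i: "?i \<in> idx b \<and> above (fst \<sigma>) a ?i b \<and> (\<mu> \<in> moves a \<longrightarrow> \<not> above (fst \<mu>) a ?i b)"
    using m
  proof (cases rule: steps_cases)
    case 1
    then show ?thesis using movesD(1,2)[OF 1] S(1) o assms(3)
      by (auto simp: between_def above_def adj_def idx_def)
  next
    case 2
    then show ?thesis using S(1) o assms(3)
      by (auto simp: between_def above_def adj_def idx_def elim!: oddE)
  qed
  then show "?i \<in> idx b" by blast
  have "sep \<alpha> (fst \<sigma>) a ?i b" using GT_sep[OF assms(1,3) le S(1)] i by blast
  then show 1: "pos \<alpha> (fst \<sigma>) a \<ge> \<bar>pos \<alpha> ?i b\<bar> + 1/2" using i by (simp add: sep_def)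
  show 2: "pos \<alpha> ?i b \<ge> \<bar>pos \<alpha> (fst \<mu>) a\<bar> + 1/2" if "\<mu> \<in> moves a"
    using GT_sep[OF assms(1,3) le movesD(1)[OF that]] i that by (simp add: sep_def)
  show "\<bar>th a \<sigma> \<alpha> + 1/2\<bar> \<ge> pos \<alpha> (fst \<sigma>) a - 1/2" using S(3) unfolding S(4) by auto
  show 3: "\<bar>th a \<mu> \<alpha> + 1/2\<bar> \<le> \<bar>pos \<alpha> (fst \<mu>) a\<bar> + 1/2" if "\<mu> \<in> moves a"
    using movesD(3)[OF that] unfolding movesD(4)[OF that] by auto
  show "\<bar>th a \<mu> \<alpha> + 1/2\<bar> \<le> \<bar>pos \<alpha> ?i b\<bar>"
    using m
  proof (cases rule: steps_cases)
    case m: 1 then show ?thesis using 2[OF m] 3[OF m] by simp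
  qed simp
qed

lemma nd_eq_iff:
  assumes "\<alpha> \<in> P" "a < n" "\<sigma> \<in> steps a" "\<mu> \<in> steps a"
  shows "nd a \<alpha> \<sigma> = nd a \<alpha> \<mu> \<longleftrightarrow> \<bar>th a \<sigma> \<alpha> + 1/2\<bar> = \<bar>th a \<mu> \<alpha> + 1/2\<bar>"
  unfolding nd_def using th_half[OF assms(1) _ assms(3)] th_half[OF assms(1) _ assms(4)] assms(2)
  by (intro ch_eq_iff) (auto simp: distrib_left)

lemma before_cases:
  assumes "\<sigma> \<in> steps a" "\<mu> \<in> steps a" "fst \<sigma> \<noteq> fst \<mu>"
  shows "before a \<sigma> \<mu> \<or> before a \<mu> \<sigma>"
  using assms movesD(2) unfolding before_def steps_def by (auto split: if_splits)

text \<open>With a further entry in between, the chain of \<open>between_bounds\<close> contains a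
  strict inequality; this is why no three nodes coincide.\<close>

lemma nd_strict:
  assumes "\<alpha> \<in> P" "a < n" "before a \<sigma> \<mu>" "before a \<mu> \<nu>"
  shows "\<bar>th a \<sigma> \<alpha> + 1/2\<bar> > \<bar>th a \<nu> \<alpha> + 1/2\<bar>"
proof -
  have ab: "adj a (Suc a)" by (simp add: adj_def)
  have "\<mu> \<in> moves a" using assms(4) by (simp add: before_def)
  then show ?thesis
    using between_bounds[OF assms(1,2) ab assms(3)] between_bounds[OF assms(1,2) ab assms(4)] by linarith
qed

lemma nd_coincide_between:
  assumes "\<alpha> \<in> P" "a < n" "adj a b" "before a \<sigma> \<mu>" "nd a \<alpha> \<sigma> = nd a \<alpha> \<mu>"
  shows "\<bar>pos \<alpha> (between a b \<sigma> \<mu>) b\<bar> = \<bar>th a \<mu> \<alpha> + 1/2\<bar>" "pos \<alpha> (fst \<sigma>) a - 1/2 = \<bar>th a \<mu> \<alpha> + 1/2\<bar>"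
proof -
  have "\<bar>th a \<sigma> \<alpha> + 1/2\<bar> = \<bar>th a \<mu> \<alpha> + 1/2\<bar>"
    using assms nd_eq_iff[of \<alpha> a \<sigma> \<mu>] by (auto simp: before_def steps_def)
  then show "\<bar>pos \<alpha> (between a b \<sigma> \<mu>) b\<bar> = \<bar>th a \<mu> \<alpha> + 1/2\<bar>" "pos \<alpha> (fst \<sigma>) a - 1/2 = \<bar>th a \<mu> \<alpha> + 1/2\<bar>"
    using between_bounds[OF assms(1-4)] by linarith+
qed

text \<open>Coinciding nodes squeeze an entry in each of the two adjacent rows onto their common
  value: these are the double zero that \<open>divided_difference_degenerate\<close> asks for. The
  hypothesis on position 0 excludes the coincidence of raising and lowering one entry.
  \<open>W\<close> may contain zeros that are not neighbours.\<close>

lemma node_sum: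
  assumes in1: "\<alpha> \<in> P" and ab: "a < n" "a \<ge> 1" "adj a b" and k: "\<kappa> \<in> steps b" "shift b \<kappa> \<alpha> \<in> P"
    and J: "J \<subseteq> steps a" and W: "finite W" "nb a - {(fst \<kappa>, b)} \<subseteq> W"
    and f: "\<And>w. w \<in> nb a \<Longrightarrow> f w = ch (posp \<alpha> w)"
    and zero: "\<And>\<sigma>. \<lbrakk>\<sigma> \<in> J; neg \<sigma> \<in> J; \<sigma> \<in> moves a\<rbrakk> \<Longrightarrow> pos \<alpha> (fst \<sigma>) a \<noteq> 0"
    and card: "card J = card W + 1"
  shows "(\<Sum>\<sigma>\<in>J. (\<Prod>w\<in>W. f w - nd a \<alpha> \<sigma>) / (\<Prod>\<mu>\<in>J - {\<sigma>}. nd a \<alpha> \<sigma> - nd a \<alpha> \<mu>)) = (- 1) ^ card W"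
proof (rule divided_difference_degenerate)
  show "finite W" "card J = card W + 1" by fact+
  show "finite J" using J finite_subset finite_steps(1) by blast
  have row: "fst \<sigma> \<noteq> fst \<mu>" if "\<sigma> \<in> J" "\<mu> \<in> J" "nd a \<alpha> \<sigma> = nd a \<alpha> \<mu>" "\<sigma> \<noteq> \<mu>" for \<sigma> \<mu>
  proof
    assume eq: "fst \<sigma> = fst \<mu>"
    have st: "\<sigma> \<in> steps a" "\<mu> \<in> steps a" using that J by auto
    have m: "\<sigma> \<in> moves a" using st eq that(4) movesD(2)[of \<mu> a] by (auto simp: steps_def split: if_splits)
    have m': "\<mu> \<in> moves a" using st eq movesD(2)[OF m] by (auto simp: steps_def split: if_splits)
    have "\<mu> = neg \<sigma>" using eq that(4) movesD(3)[OF m] movesD(3)[OF m'] by (auto simp: neg_def prod_eq_iff)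
    then have nz: "pos \<alpha> (fst \<sigma>) a \<noteq> 0" using zero that m by blast
    have "\<bar>th a \<sigma> \<alpha> + 1/2\<bar> = \<bar>th a \<mu> \<alpha> + 1/2\<bar>" using that(3) nd_eq_iff[OF in1 ab(1) st] by blast
    moreover have "th a \<mu> \<alpha> = - th a \<sigma> \<alpha>"
      unfolding \<open>\<mu> = neg \<sigma>\<close> using movesD(2)[OF m] by (simp add: th_def)
    ultimately have "th a \<sigma> \<alpha> = 0" by auto
    then show False using nz movesD(3)[OF m] unfolding movesD(4)[OF m] by auto
  qed
  show "\<sigma> = \<nu>" if "\<sigma> \<in> J" "\<mu> \<in> J" "\<nu> \<in> J" "nd a \<alpha> \<sigma> = nd a \<alpha> \<mu>" "nd a \<alpha> \<mu> = nd a \<alpha> \<nu>" "\<sigma> \<noteq> \<mu>" "\<mu> \<noteq> \<nu>"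
    for \<sigma> \<mu> \<nu>
  proof (rule ccontr)
    assume "\<sigma> \<noteq> \<nu>"
    have st: "\<sigma> \<in> steps a" "\<mu> \<in> steps a" "\<nu> \<in> steps a" using that J by auto
    have d: "fst \<sigma> \<noteq> fst \<mu>" "fst \<mu> \<noteq> fst \<nu>" "fst \<sigma> \<noteq> fst \<nu>" using row that \<open>\<sigma> \<noteq> \<nu>\<close> by auto
    have e: "\<bar>th a \<sigma> \<alpha> + 1/2\<bar> = \<bar>th a \<mu> \<alpha> + 1/2\<bar>" "\<bar>th a \<mu> \<alpha> + 1/2\<bar> = \<bar>th a \<nu> \<alpha> + 1/2\<bar>"
      using that nd_eq_iff[OF in1 ab(1)] st by auto
    have no: "\<not> (before a x y \<and> before a y z)" if "x \<in> {\<sigma>, \<mu>, \<nu>}" "y \<in> {\<sigma>, \<mu>, \<nu>}" "z \<in> {\<sigma>, \<mu>, \<nu>}" for x y z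
      using nd_strict[OF in1 ab(1), of x y z] that e by auto
    show False using before_cases[OF st(1,2) d(1)] before_cases[OF st(2,3) d(2)] before_cases[OF st(1,3) d(3)] no
      by blast
  qed
  show "\<exists>v\<in>W. \<exists>w\<in>W. v \<noteq> w \<and> f v = nd a \<alpha> \<sigma> \<and> f w = nd a \<alpha> \<sigma>"
    if "\<sigma> \<in> J" "\<mu> \<in> J" "nd a \<alpha> \<sigma> = nd a \<alpha> \<mu>" "\<sigma> \<noteq> \<mu>" for \<sigma> \<mu>
  proof -
    have *: "\<exists>v\<in>W. \<exists>w\<in>W. v \<noteq> w \<and> f v = nd a \<alpha> \<mu> \<and> f w = nd a \<alpha> \<mu>"
      if "before a \<sigma> \<mu>" "nd a \<alpha> \<sigma> = nd a \<alpha> \<mu>" for \<sigma> \<mu>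
    proof -
      define p where "p b' = (between a b' \<sigma> \<mu>, b')" for b'
      have m: "\<mu> \<in> steps a" using that by (simp add: before_def)
      have pos: "p b' \<in> W \<and> f (p b') = nd a \<alpha> \<mu>" if b': "adj a b'" for b'
      proof -
        let ?i = "between a b' \<sigma> \<mu>"
        note B = between_bounds[OF in1 ab(1) b' \<open>before a \<sigma> \<mu>\<close>]
        note E = nd_coincide_between[OF in1 ab(1) b' \<open>before a \<sigma> \<mu>\<close> \<open>nd a \<alpha> \<sigma> = nd a \<alpha> \<mu>\<close>]
        have nb: "p b' \<in> nb a" using B(1) b' by (simp add: p_def nb_def)
        have "ch (posp \<alpha> (p b')) = nd a \<alpha> \<mu>" unfolding p_def nd_def using E(1)
          by (metis ch_abs fst_conv snd_conv)
        \<comment> \<open>A squeezed entry has no freedom: the same bounds hold before and after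
          \<open>\<kappa>\<close> and determine its position, so it is not the entry that
          \<open>\<kappa>\<close> moves.\<close>
        moreover have "p b' \<noteq> (fst \<kappa>, b)"
        proof
          assume h: "p b' = (fst \<kappa>, b)"
          have ne: "a \<noteq> b" using adj_neq[OF ab(3)] .
          have km: "\<kappa> \<in> moves b" using h nb k(1) by (auto simp: steps_def nb_def split: if_splits)
          note B' = between_bounds[OF k(2) ab(1) b' \<open>before a \<sigma> \<mu>\<close>]
          have eq: "pos (shift b \<kappa> \<alpha>) ?i b' = pos \<alpha> ?i b' + snd \<kappa>" using h by (auto simp: p_def pos_shift)
          from m show False
          proof (cases rule: steps_cases)
            case mm: 1
            show ?thesis using B(3)[OF mm] B'(3)[OF mm] B(2) B'(2) B(5)[OF mm] E(2) eq ne movesD(3)[OF km]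
              by auto
          next
            case 2
            then show ?thesis using B(2) B'(2) E(2) eq ne movesD(3)[OF km] by auto
          qed
        qed
        ultimately show ?thesis using nb W(2) f[OF nb] by auto
      qed
      have "adj a (Suc a)" "adj a (a - 1)" using ab(2) by (auto simp: adj_def)
      moreover have "Suc a \<noteq> a - 1" by arith
      then have "p (Suc a) \<noteq> p (a - 1)" by (simp add: p_def)
      ultimately show ?thesis using pos by blast
    qed
    have st: "\<sigma> \<in> steps a" "\<mu> \<in> steps a" using that J by auto
    show ?thesis using before_cases[OF st row[OF that]] *[of \<sigma> \<mu>] *[of \<mu> \<sigma>] that(3) by auto
  qed
qed


section \<open>Sums over opposite steps\<close>

lemma up_prod_split:
  assumes "adj a b" "\<kappa> \<in> moves b"
  shows "(\<Prod>w\<in>nb a. up t (posp \<alpha> w)) = up t (th b \<kappa> \<alpha>) * (\<Prod>w\<in>nb a - {(fst \<kappa>, b)}. up t (posp \<alpha> w))"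
    and "(\<Prod>w\<in>nb a. up t (posp (shift b \<kappa> \<alpha>) w))
      = up t (th b \<kappa> \<alpha> + 1) * (\<Prod>w\<in>nb a - {(fst \<kappa>, b)}. up t (posp \<alpha> w))"
proof -
  let ?w = "(fst \<kappa>, b)"
  note K = movesD[OF assms(2)]
  have w: "?w \<in> nb a" using assms K by (simp add: nb_def)
  have sgn: "up t (snd \<kappa> * y) = up t y" for y using K(3) up_minus by auto
  have "up t (th b \<kappa> \<alpha>) = up t (posp \<alpha> ?w)" unfolding K(4) using sgn by simp
  then show "(\<Prod>w\<in>nb a. up t (posp \<alpha> w)) = up t (th b \<kappa> \<alpha>) * (\<Prod>w\<in>nb a - {?w}. up t (posp \<alpha> w))"
    using w by (subst prod.remove) auto
  have "th b \<kappa> \<alpha> + 1 = snd \<kappa> * posp (shift b \<kappa> \<alpha>) ?w" using K(4,5) by (simp add: pos_shift distrib_left)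
  then have "up t (th b \<kappa> \<alpha> + 1) = up t (posp (shift b \<kappa> \<alpha>) ?w)" using sgn by simp
  moreover have "(\<Prod>w\<in>nb a - {?w}. up t (posp (shift b \<kappa> \<alpha>) w)) = (\<Prod>w\<in>nb a - {?w}. up t (posp \<alpha> w))"
    by (rule prod.cong) (auto simp: pos_shift)
  ultimately show "(\<Prod>w\<in>nb a. up t (posp (shift b \<kappa> \<alpha>) w))
      = up t (th b \<kappa> \<alpha> + 1) * (\<Prod>w\<in>nb a - {?w}. up t (posp \<alpha> w))"
    using w by (subst prod.remove) auto
qed

text \<open>The reverse step has position - \<theta> - 1, so the kernel is used at x = \<omega> -
  \<theta> and y = \<omega> + \<theta> + 1 and gives [2\<theta> + 2]. The outer two terms are return
  coefficients before and after \<open>\<kappa>\<close>; the middle one follows from an exchange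
  equation.\<close>

lemma serre_return_move:
  assumes ab: "adj a b" "a < n" "b < n" and P: "\<alpha> \<in> P" "shift b \<kappa> \<alpha> \<in> P"
    and k: "\<kappa> \<in> moves b" and s: "\<sigma> \<in> moves a"
  shows "serre a b \<kappa> \<sigma> (neg \<sigma>) \<alpha> = - (cf b \<kappa> \<alpha> * (wt a (th a \<sigma> \<alpha>) * br (2 * th a \<sigma> \<alpha> + 2)
    * (\<Prod>w\<in>nb a - {(fst \<kappa>, b)}. up (th a \<sigma> \<alpha>) (posp \<alpha> w))
    / (\<Prod>r\<in>idx a - {fst \<sigma>}. low (th a \<sigma> \<alpha>) (pos \<alpha> r a))))"
proof -
  let ?t = "th a \<sigma> \<alpha>" and ?w = "th b \<kappa> \<alpha>"
  note S = movesD[OF s] and K = movesD[OF k]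
  have ne: "a \<noteq> b" using ab adj_neq by blast
  have st: "\<sigma> \<in> steps a" "neg \<sigma> \<in> steps a" "\<kappa> \<in> steps b"
    unfolding neg_steps using s k by (auto simp: steps_def)
  define H where "H = wt a ?t * (\<Prod>w\<in>nb a - {(fst \<kappa>, b)}. up ?t (posp \<alpha> w))
    / (\<Prod>r\<in>idx a - {fst \<sigma>}. low ?t (pos \<alpha> r a))"
  define x y where "x = ?w - ?t" and "y = ?w + ?t + 1"
  define T1 where "T1 = cf b \<kappa> \<alpha> * cf a \<sigma> (shift b \<kappa> \<alpha>) * cf a (neg \<sigma>) (shift a \<sigma> (shift b \<kappa> \<alpha>))"
  define T2 where "T2 = cf a \<sigma> \<alpha> * cf b \<kappa> (shift a \<sigma> \<alpha>) * cf a (neg \<sigma>) (shift b \<kappa> (shift a \<sigma> \<alpha>))"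
  define T3 where "T3 = cf a \<sigma> \<alpha> * cf a (neg \<sigma>) (shift a \<sigma> \<alpha>) * cf b \<kappa> (shift a (neg \<sigma>) (shift a \<sigma> \<alpha>))"
  have th2: "th a (neg \<sigma>) (shift a \<sigma> \<alpha>) = - ?t - 1" using th_neg_shift[OF st(1)] .
  have "up ?t (?w + 1) = br (y + 1/2) * br (x + 1/2)" "up ?t ?w = br (y - 1/2) * br (x - 1/2)"
    by (simp_all add: up_def x_def y_def algebra_simps)
  note U = this
  have r0: "cf a \<sigma> \<alpha> * cf a (neg \<sigma>) (shift a \<sigma> \<alpha>) = - (H * (br (y - 1/2) * br (x - 1/2)))"
    unfolding return_coeff[OF P(1) ab(2) s] up_prod_split(1)[OF ab(1) k] U H_def by simp
  have r1: "cf a \<sigma> (shift b \<kappa> \<alpha>) * cf a (neg \<sigma>) (shift a \<sigma> (shift b \<kappa> \<alpha>)) = - (H * (br (y + 1/2) * br (x + 1/2)))"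
    unfolding return_coeff[OF P(2) ab(2) s] th_shift_other[OF ne] up_prod_split(2)[OF ab(1) k] U H_def
    using ne by simp
  have T1: "T1 = - (cf b \<kappa> \<alpha> * H) * (br (x + 1/2) * br (y + 1/2))"
    unfolding T1_def using r1 by (simp add: mult_ac)
  have T3: "T3 = - (cf b \<kappa> \<alpha> * H) * (br (x - 1/2) * br (y - 1/2))"
    unfolding T3_def using r0 by (simp add: mult_ac)
  have e1: "T1 * br (x - 1/2) = T2 * br (x + 1/2)"
    using serre_eqs(1)[OF ab st, of \<alpha>] unfolding T1_def T2_def x_def .
  have "?w - (- ?t - 1) - 1/2 = y - 1/2" "?w - (- ?t - 1) + 1/2 = y + 1/2" by (simp_all add: y_def)
  note q = this
  have e2: "T2 * br (y - 1/2) = T3 * br (y + 1/2)"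
    unfolding T2_def T3_def using serre_eqs(2)[OF ab st, of \<alpha>, unfolded th2 q] .
  have le: "a \<le> n" "b \<le> n" using ab by auto
  have half: "2 * ?t \<in> \<int>" "2 * ?w \<in> \<int>" using th_half[OF P(1) le(1) st(1)] th_half[OF P(1) le(2) st(3)] .
  have "2 * (x + 1/2) = 2 * ?w - 2 * ?t + 1" "2 * (y - 1/2) = 2 * ?w + 2 * ?t + 1"
    by (simp_all add: x_def y_def)
  then have hx: "2 * (x + 1/2) \<in> \<int>" and hy: "2 * (y - 1/2) \<in> \<int>"
    using half by (metis Ints_add Ints_diff Ints_1)+
  have T2: "T2 = - (cf b \<kappa> \<alpha> * H) * (br (x - 1/2) * br (y + 1/2))"
  proof (cases "x + 1/2 = 0")
    case False
    then have "br (x + 1/2) \<noteq> 0" using br_eq_0[OF hx] by simp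
    moreover have "T2 * br (x + 1/2) = - (cf b \<kappa> \<alpha> * H) * (br (x - 1/2) * br (y + 1/2)) * br (x + 1/2)"
      using e1 unfolding T1 by (simp add: mult_ac)
    ultimately show ?thesis using mult_right_cancel by blast
  next
    case True
    \<comment> \<open>Both exchange equations leave \<open>T2\<close> open only if \<theta> = 0 and
      \<omega> = - 1/2: a neighbour of an entry 0 stepping across 0, against betweenness before or
      after its step.\<close>
    have "y - 1/2 \<noteq> 0"
    proof
      assume "y - 1/2 = 0"
      then have z: "?t = 0" "?w = - 1/2" using True by (auto simp: x_def y_def)
      have px: "pos \<alpha> (fst \<sigma>) a = 0" using z S(3) unfolding S(4) by auto
      have "sp (above (fst \<sigma>) a (fst \<kappa>) b) 0 (pos \<alpha> (fst \<kappa>) b)"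
        using GT_sep[OF P(1) ab(1) le S(1) K(1)] px by (simp add: sep_sp)
      moreover have "sp (above (fst \<sigma>) a (fst \<kappa>) b) 0 (pos \<alpha> (fst \<kappa>) b + snd \<kappa>)"
        using GT_sep[OF P(2) ab(1) le S(1) K(1)] px ne by (simp add: sep_sp pos_shift)
      ultimately show False using z(2) K(3) unfolding K(4) sp_def by (auto split: if_splits)
    qed
    then have "br (y - 1/2) \<noteq> 0" using br_eq_0[OF hy] by simp
    moreover have "T2 * br (y - 1/2) = - (cf b \<kappa> \<alpha> * H) * (br (x - 1/2) * br (y + 1/2)) * br (y - 1/2)"
      using e2 unfolding T3 by (simp add: mult_ac)
    ultimately show ?thesis using mult_right_cancel by blast
  qed
  have "serre a b \<kappa> \<sigma> (neg \<sigma>) \<alpha> = T1 - ch (1/2) * T2 + T3"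
    unfolding serre_def T1_def T2_def T3_def ..
  also have "\<dots> = - (cf b \<kappa> \<alpha> * H) * (br (x + 1/2) * br (y + 1/2)
      - ch (1/2) * (br (x - 1/2) * br (y + 1/2)) + br (x - 1/2) * br (y - 1/2))"
    unfolding T1 T2 T3 by (simp add: algebra_simps)
  also have "\<dots> = - (cf b \<kappa> \<alpha> * H) * br (y - x + 1)" unfolding serre_kernel ..
  also have "y - x + 1 = 2 * ?t + 2" by (simp add: x_def y_def)
  finally show ?thesis unfolding H_def by (simp add: mult_ac)
qed

text \<open>The diagonal coefficient is \<open>G\<close> times [\<omega>] before the step
  \<open>\<kappa>\<close> and \<open>G\<close> times [\<omega> + 1] after it. The kernel at u = v is
  [1] = 1, and the square of the imaginary unit gives the sign.\<close>

lemma serre_return_diag: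
  assumes ab: "adj a b" "a < n" "b < n" and P: "\<alpha> \<in> P" "shift b \<kappa> \<alpha> \<in> P"
    and k: "\<kappa> \<in> moves b" and a: "odd a"
  shows "serre a b \<kappa> (0, 0) (0, 0) \<alpha>
    = - (cf b \<kappa> \<alpha> * ((\<Prod>w\<in>nb a - {(fst \<kappa>, b)}. ch (posp \<alpha> w) - nd a \<alpha> (0, 0))
      / (\<Prod>\<mu>\<in>steps a - {(0, 0)}. nd a \<alpha> (0, 0) - nd a \<alpha> \<mu>)))"
proof -
  let ?w = "(fst \<kappa>, b)" and ?\<beta> = "shift b \<kappa> \<alpha>" and ?W = "nb a - {(fst \<kappa>, b)}" and ?t = "th b \<kappa> \<alpha>"
  note K = movesD[OF k]
  have ne: "a \<noteq> b" using ab adj_neq by blast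
  have w: "?w \<in> nb a" using ab K by (simp add: nb_def)
  define N D where "N = (\<Prod>w\<in>?W. br (posp \<alpha> w))" and
    "D = (\<Prod>r\<in>idx a. br (pos \<alpha> r a + 1/2) * br (pos \<alpha> r a - 1/2))"
  define G where "G = (if \<exists>r\<in>idx a. pos \<alpha> r a = 1/2 then 0 else of_real (snd \<kappa>) * N / D)"
  \<comment> \<open>At a position 1/2 the conventional value 0 of the diagonal coefficient agrees
    with the quotient by \<open>D\<close> = 0.\<close>
  have D0: "D = 0" if "\<exists>r\<in>idx a. pos \<alpha> r a = 1/2"
  proof -
    from that obtain r where r: "r \<in> idx a" "pos \<alpha> r a = 1/2" by blast
    then have "pos \<alpha> r a - 1/2 = 0" by simp
    then have "br (pos \<alpha> r a - 1/2) = 0" by (simp only: br_0)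
    then show ?thesis unfolding D_def using r(1) by (intro prod_zero bexI[of _ r]) simp_all
  qed
  have ee: "complex_of_real (snd \<kappa>) * complex_of_real (snd \<kappa>) = 1" using K(3) by auto
  have "(\<Prod>w\<in>?W. br (posp ?\<beta> w)) = N" unfolding N_def by (rule prod.cong) (auto simp: pos_shift)
  then have p: "(\<Prod>w\<in>nb a. br (posp \<alpha> w)) = br (posp \<alpha> ?w) * N"
    "(\<Prod>w\<in>nb a. br (posp ?\<beta> w)) = br (posp ?\<beta> ?w) * N"
    using w N_def by (simp_all add: prod.remove[of _ ?w])
  have pw: "posp \<alpha> ?w = snd \<kappa> * ?t" "posp ?\<beta> ?w = snd \<kappa> * (?t + 1)"
    using K(3) unfolding K(4) by (auto simp: pos_shift)
  have d0: "dg a \<alpha> = G * br ?t" unfolding dg_def G_def D_def[symmetric] p pw br_sign[OF K(3)] by simp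
  have d1: "dg a ?\<beta> = G * br (?t + 1)"
    using ne unfolding dg_def G_def p pw br_sign[OF K(3)] by (simp add: D_def)
  have "serre a b \<kappa> (0, 0) (0, 0) \<alpha> = - (cf b \<kappa> \<alpha> * (G * G *
      (br (?t + 1) * br (?t + 1) - ch (1/2) * (br ?t * br (?t + 1)) + br ?t * br ?t)))"
    unfolding serre_def using P by (simp add: cf_diag d0 d1 algebra_simps)
  also have "br (?t + 1) * br (?t + 1) - ch (1/2) * (br ?t * br (?t + 1)) + br ?t * br ?t = 1"
    using serre_kernel[of "?t + 1/2" "?t + 1/2"] by (simp add: add.assoc)
  also have "G * G * 1 = (\<Prod>w\<in>?W. ch (posp \<alpha> w) - nd a \<alpha> (0, 0))
      / (\<Prod>\<mu>\<in>steps a - {(0, 0)}. nd a \<alpha> (0, 0) - nd a \<alpha> \<mu>)"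
  proof -
    have "a \<ge> 1" using a by (cases a) auto
    then have c: "card ?W = 2 * (a div 2)" using card_nb[of a] a w by (auto simp: card_Diff_singleton elim: oddE)
    have u: "up (- 1/2) v = br v * br v" for v by (simp add: up_def)
    have num: "(\<Prod>w\<in>?W. ch (posp \<alpha> w) - nd a \<alpha> (0, 0)) = dl ^ (2 * (a div 2)) * (N * N)"
      unfolding num_prod c th_diag u prod.distrib N_def ..
    have den: "(\<Prod>\<mu>\<in>steps a - {(0, 0)}. nd a \<alpha> (0, 0) - nd a \<alpha> \<mu>) = dl ^ (2 * (a div 2)) * (D * D)"
      unfolding nd_prod_diag[OF a] prod.distrib D_def by (simp add: card_idx mult_2 power_add mult_ac)
    show ?thesis unfolding num den using D0 ee by (auto simp: G_def field_simps)
  qed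
  finally show ?thesis .
qed

lemma num_over_den_odd:
  assumes "odd a" "\<sigma> \<in> moves a" "W \<subseteq> nb a" "card W = a - 1"
  shows "(\<Prod>w\<in>W. ch (posp \<alpha> w) - nd a \<alpha> \<sigma>) / (\<Prod>\<mu>\<in>steps a - {\<sigma>}. nd a \<alpha> \<sigma> - nd a \<alpha> \<mu>)
    = (\<Prod>w\<in>W. up (th a \<sigma> \<alpha>) (posp \<alpha> w))
      / (br (2 * th a \<sigma> \<alpha>) * (br (th a \<sigma> \<alpha> + 1/2) * br (th a \<sigma> \<alpha> + 1/2))
        * (\<Prod>r\<in>idx a - {fst \<sigma>}. low (th a \<sigma> \<alpha>) (pos \<alpha> r a)))"
proof -
  have j: "fst \<sigma> \<in> idx a" using movesD(1)[OF assms(2)] .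
  then have "a div 2 \<ge> 1" by (auto simp: idx_def)
  then have c: "card W = 2 + 2 * (a div 2 - 1)" using assms(1,4) by (auto elim!: oddE)
  have "(\<Prod>r\<in>idx a - {fst \<sigma>}. dl * dl * low (th a \<sigma> \<alpha>) (pos \<alpha> r a))
      = dl ^ (2 * (a div 2 - 1)) * (\<Prod>r\<in>idx a - {fst \<sigma>}. low (th a \<sigma> \<alpha>) (pos \<alpha> r a))"
    using j by (simp add: prod.distrib card_idx mult_2 power_add power_mult_distrib)
  then show ?thesis unfolding num_prod nd_prod_move[OF assms(2)] c using assms(1)
    by (simp add: power_add power2_eq_square)
qed

lemma num_over_den_even:
  assumes "even a" "\<sigma> \<in> moves a" "W \<subseteq> nb a" "card W = a - 2"
  shows "(\<Prod>w\<in>W. ch (posp \<alpha> w) - nd a \<alpha> \<sigma>) / (\<Prod>\<mu>\<in>steps a - {\<sigma>}. nd a \<alpha> \<sigma> - nd a \<alpha> \<mu>)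
    = (\<Prod>w\<in>W. up (th a \<sigma> \<alpha>) (posp \<alpha> w))
      / (dl * br (2 * th a \<sigma> \<alpha>) * (\<Prod>r\<in>idx a - {fst \<sigma>}. low (th a \<sigma> \<alpha>) (pos \<alpha> r a)))"
proof -
  have j: "fst \<sigma> \<in> idx a" using movesD(1)[OF assms(2)] .
  then have "a div 2 \<ge> 1" by (auto simp: idx_def)
  then have c: "card W = 2 * (a div 2 - 1)" using assms(1,4) by (auto elim!: evenE)
  have "(\<Prod>r\<in>idx a - {fst \<sigma>}. dl * dl * low (th a \<sigma> \<alpha>) (pos \<alpha> r a))
      = dl ^ (2 * (a div 2 - 1)) * (\<Prod>r\<in>idx a - {fst \<sigma>}. low (th a \<sigma> \<alpha>) (pos \<alpha> r a))"
    using j by (simp add: prod.distrib card_idx mult_2 power_add power_mult_distrib)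
  then show ?thesis unfolding num_prod nd_prod_move[OF assms(2)] c using assms(1)
    by simp
qed

lemma ch_half_th: "\<alpha> \<in> P \<Longrightarrow> a < n \<Longrightarrow> \<sigma> \<in> steps a \<Longrightarrow> ch (th a \<sigma> \<alpha> / 2) \<noteq> 0 \<and> ch ((th a \<sigma> \<alpha> + 1) / 2) \<noteq> 0"
  using th_half[of \<alpha> a \<sigma>] ch_half_nz[of "th a \<sigma> \<alpha>"] ch_half_nz[of "th a \<sigma> \<alpha> + 1"]
  by (simp add: distrib_left)

text \<open>In the second form [t][t + 1] is, up to sign and \<open>dl\<close>, the difference of
  \<open>ch (1 / 2)\<close> and the node: the zero that even rows lack. The first form remains valid
  at t = 0.\<close>

lemma wt_even:
  assumes "even a" "ch (t / 2) \<noteq> 0" "ch ((t + 1) / 2) \<noteq> 0"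
  shows "wt a t * br (2 * t + 2) = br (t + 1) / ch (t / 2)"
    and "br t \<noteq> 0 \<Longrightarrow> wt a t * br (2 * t + 2) = br t * br (t + 1) / br (2 * t)"
    and "br t \<noteq> 0 \<Longrightarrow> wt a t * ch ((t + 1) / 2) = br t / br (2 * t)"
  using assms br_double[of "t + 1"] br_double[of t] by (simp_all add: wt_def distrib_left)

text \<open>After [2\<theta> + 2] has been cancelled, \<open>wt\<close> is the inverse of
  [2\<theta>][\<theta> + 1/2]^2, exactly what the reverse and the diagonal step contribute to the
  node differences. So every term is one of the divided difference.\<close>

lemma serre_sum_odd:
  assumes ab: "adj a b" "a < n" "b < n" and P: "\<alpha> \<in> P" "shift b \<kappa> \<alpha> \<in> P"
    and k: "\<kappa> \<in> moves b" and a: "odd a"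
  shows "(\<Sum>\<sigma>\<in>steps a. serre a b \<kappa> \<sigma> (neg \<sigma>) \<alpha>) = - cf b \<kappa> \<alpha>"
proof -
  let ?W = "nb a - {(fst \<kappa>, b)}"
  let ?N = "\<lambda>\<sigma>. (\<Prod>w\<in>?W. ch (posp \<alpha> w) - nd a \<alpha> \<sigma>) / (\<Prod>\<mu>\<in>steps a - {\<sigma>}. nd a \<alpha> \<sigma> - nd a \<alpha> \<mu>)"
  note K = movesD[OF k]
  have ne: "a \<noteq> b" using ab adj_neq by blast
  have a1: "a \<ge> 1" using a by (cases a) auto
  have w: "(fst \<kappa>, b) \<in> nb a" using ab K by (simp add: nb_def)
  then have cW: "card ?W = a - 1" using card_nb[OF a1] a by (simp add: card_Diff_singleton)
  have eq: "serre a b \<kappa> \<sigma> (neg \<sigma>) \<alpha> = - (cf b \<kappa> \<alpha> * ?N \<sigma>)" if "\<sigma> \<in> steps a" for \<sigma>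
    using that
  proof (cases rule: steps_cases)
    case 2
    then show ?thesis using serre_return_diag[OF ab P k a] by (simp add: neg_def)
  next
    case s: 1
    note S = movesD[OF s]
    let ?t = "th a \<sigma> \<alpha>" and ?x = "pos \<alpha> (fst \<sigma>) a"
    let ?U = "\<Prod>w\<in>?W. up ?t (posp \<alpha> w)" and ?L = "\<Prod>r\<in>idx a - {fst \<sigma>}. low ?t (pos \<alpha> r a)"
    have le: "a \<le> n" using ab by simp
    have half: "2 * ?t \<in> \<int>" using th_half[OF P(1) le that] .
    have N: "?N \<sigma> = ?U / (br (2 * ?t) * (br (?t + 1/2) * br (?t + 1/2)) * ?L)"
      using num_over_den_odd[OF a s _ cW, of \<alpha>] by simp
    have "wt a ?t * br (2 * ?t + 2) * ?U / ?L = ?N \<sigma>"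
    proof (cases "?t = - 1")
      case False
      have "2 * (2 * ?t + 2) = 2 * ?t + 2 * ?t + 4" by simp
      then have "2 * (2 * ?t + 2) \<in> \<int>" using half by (metis Ints_add Ints_numeral)
      then have "br (2 * ?t + 2) \<noteq> 0" using False br_eq_0[of "2 * ?t + 2"] by simp
      then show ?thesis unfolding N using a by (simp add: wt_def mult_ac)
    next
      case True
      \<comment> \<open>At \<theta> = - 1 the factor [2\<theta> + 2] cannot be cancelled. The entry
        is then at 1 and dominates an entry of the untouched row, which integrality puts at 1/2 or -
        1/2, a zero of the numerator.\<close>
      obtain b' where b': "adj a b'" "b' \<noteq> b" using other_neighbour[OF a1 ab(1)] .
      obtain i where i: "i \<in> idx b'" "above (fst \<sigma>) a i b'" using dominated[OF b'(1) S(1) a] .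
      have le': "b' \<le> n" using b'(1) ab by (auto simp: adj_def)
      have x1: "?x = 1" using True S(3) odd_row_pos[OF P(1) ab(2) a S(1)] unfolding S(4) by auto
      let ?v = "pos \<alpha> i b'"
      have "1 \<ge> \<bar>?v\<bar> + 1/2" using GT_sep[OF P(1) b'(1) le le' S(1) i(1)] i(2) x1 by (simp add: sep_def)
      moreover have "1/2 - ?v \<in> \<int>" using GT_pos_adj[OF P(1) b'(1) le le' S(1) i(1)] x1 by simp
      then obtain z :: int where z: "1/2 - ?v = of_int z" by (auto elim: Ints_cases)
      ultimately have "of_int z \<ge> (0::real)" "of_int z \<le> (1::real)" by auto
      then have "z = 0 \<or> z = 1" by auto
      then have "?v = 1/2 \<or> ?v = - 1/2" using z by auto
      moreover have "up (- 1) (1/2) = 0" "up (- 1) (- 1/2) = 0" by (simp_all add: up_def)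
      ultimately have "up ?t ?v = 0" unfolding True by metis
      moreover have "(i, b') \<in> ?W" using b' i by (simp add: nb_def)
      ultimately have U0: "?U = 0" by (intro prod_zero bexI[of _ "(i, b')"]) simp_all
      show ?thesis unfolding N U0 by simp
    qed
    then show ?thesis using serre_return_move[OF ab P k s] by simp
  qed
  have "(\<Sum>\<sigma>\<in>steps a. serre a b \<kappa> \<sigma> (neg \<sigma>) \<alpha>) = - (cf b \<kappa> \<alpha> * (\<Sum>\<sigma>\<in>steps a. ?N \<sigma>))"
    by (simp add: eq sum_distrib_left sum_negf)
  also have "(\<Sum>\<sigma>\<in>steps a. ?N \<sigma>) = (- 1) ^ card ?W"
  proof (rule node_sum[OF P(1) ab(2) a1 ab(1) _ P(2)])
    show "card (steps a) = card ?W + 1" using cW card_steps a1 by simp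
    show "pos \<alpha> (fst \<sigma>) a \<noteq> 0" if "\<sigma> \<in> moves a" for \<sigma>
      using odd_row_pos[OF P(1) ab(2) a movesD(1)[OF that]] by simp
  qed (use k in \<open>auto simp: steps_def\<close>)
  finally show ?thesis using cW a by simp
qed

text \<open>The missing zero is \<open>ch (1 / 2)\<close>, supplied by [\<theta>][\<theta> + 1]. The
  argument divides by [\<theta>], so an entry at position 0 is a separate case.\<close>

lemma serre_sum_even_move:
  assumes ab: "adj a b" "a < n" "b < n" and P: "\<alpha> \<in> P" "shift b \<kappa> \<alpha> \<in> P"
    and k: "\<kappa> \<in> moves b" and a: "even a" "a \<ge> 1"
  shows "(\<Sum>\<sigma>\<in>steps a. serre a b \<kappa> \<sigma> (neg \<sigma>) \<alpha>) = - cf b \<kappa> \<alpha>"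
proof -
  let ?W = "nb a - {(fst \<kappa>, b)}" and ?c = "ch (1/2)"
  let ?num = "\<lambda>\<sigma>. \<Prod>w\<in>?W. ch (posp \<alpha> w) - nd a \<alpha> \<sigma>"
  let ?den = "\<lambda>J \<sigma>. \<Prod>\<mu>\<in>J - {\<sigma>}. nd a \<alpha> \<sigma> - nd a \<alpha> \<mu>"
  note K = movesD[OF k]
  have ks: "\<kappa> \<in> steps b" using k by (simp add: steps_def)
  have steps: "steps a = moves a" using a by (simp add: steps_def)
  have a2: "a \<ge> 2" using a by auto
  have w: "(fst \<kappa>, b) \<in> nb a" using ab K by (simp add: nb_def)
  then have cW: "card ?W = a - 2" using card_nb[OF a(2)] a by (simp add: card_Diff_singleton)
  have even_W: "even (card ?W)" using cW a by simp
  have generic: "serre a b \<kappa> \<sigma> (neg \<sigma>) \<alpha> = cf b \<kappa> \<alpha> * (?num \<sigma> * (?c - nd a \<alpha> \<sigma>) / ?den (steps a) \<sigma>)"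
    if s: "\<sigma> \<in> moves a" "th a \<sigma> \<alpha> \<noteq> 0" for \<sigma>
  proof -
    let ?t = "th a \<sigma> \<alpha>"
    have st: "\<sigma> \<in> steps a" using s by (simp add: steps_def)
    have nz: "br ?t \<noteq> 0" using br_eq_0[OF th_half[OF P(1) _ st]] s(2) ab by simp
    have c: "?c - nd a \<alpha> \<sigma> = - (dl * (br ?t * br (?t + 1)))"
      using ch_diff[of "?t + 1/2" "1/2"] by (simp add: nd_def algebra_simps)
    have wt: "wt a ?t * br (2 * ?t + 2) = br ?t * br (?t + 1) / br (2 * ?t)"
      using wt_even(2)[OF a(1) _ _ nz] ch_half_th[OF P(1) ab(2) st] by blast
    have "?num \<sigma> * (?c - nd a \<alpha> \<sigma>) / ?den (steps a) \<sigma> = (?c - nd a \<alpha> \<sigma>) * (?num \<sigma> / ?den (steps a) \<sigma>)"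
      by simp
    also have "\<dots> = - (wt a ?t * br (2 * ?t + 2) * (\<Prod>w\<in>?W. up ?t (posp \<alpha> w))
        / (\<Prod>r\<in>idx a - {fst \<sigma>}. low ?t (pos \<alpha> r a)))"
      unfolding num_over_den_even[OF a(1) s(1) Diff_subset cW] c wt by (simp add: mult_ac)
    finally show ?thesis using serre_return_move[OF ab P k s(1)] by simp
  qed
  show ?thesis
  proof (cases "\<exists>j\<in>idx a. pos \<alpha> j a = 0")
    case False
    \<comment> \<open>The tag (0, 0) is never a neighbour, as no row has an index 0; it carries the
      additional zero.\<close>
    define f where "f w = (if w = (0, 0) then ?c else ch (posp \<alpha> w))" for w
    let ?V = "insert (0, 0) ?W"
    have n0: "(0, 0) \<notin> nb a" by (simp add: nb_def)
    have fW: "(\<Prod>w\<in>?V. f w - nd a \<alpha> \<sigma>) = ?num \<sigma> * (?c - nd a \<alpha> \<sigma>)" for \<sigma>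
    proof -
      have "(\<Prod>w\<in>?W. f w - nd a \<alpha> \<sigma>) = ?num \<sigma>" using n0 by (intro prod.cong) (auto simp: f_def)
      moreover have "(\<Prod>w\<in>?V. f w - nd a \<alpha> \<sigma>) = (f (0, 0) - nd a \<alpha> \<sigma>) * (\<Prod>w\<in>?W. f w - nd a \<alpha> \<sigma>)"
        using n0 by (intro prod.insert) auto
      ultimately show ?thesis by (simp add: f_def)
    qed
    have cV: "card ?V = a - 1" using n0 cW a2 by simp
    have "(\<Sum>\<sigma>\<in>steps a. serre a b \<kappa> \<sigma> (neg \<sigma>) \<alpha>)
        = cf b \<kappa> \<alpha> * (\<Sum>\<sigma>\<in>steps a. (\<Prod>w\<in>?V. f w - nd a \<alpha> \<sigma>) / ?den (steps a) \<sigma>)"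
      unfolding sum_distrib_left
    proof (rule sum.cong[OF refl])
      fix \<sigma> assume "\<sigma> \<in> steps a"
      then have s: "\<sigma> \<in> moves a" using steps by simp
      then have "th a \<sigma> \<alpha> \<noteq> 0" using False movesD(1,3)[OF s] unfolding movesD(4)[OF s] by auto
      then show "serre a b \<kappa> \<sigma> (neg \<sigma>) \<alpha> = cf b \<kappa> \<alpha> * ((\<Prod>w\<in>?V. f w - nd a \<alpha> \<sigma>) / ?den (steps a) \<sigma>)"
        using generic[OF s] unfolding fW by simp
    qed
    also have "(\<Sum>\<sigma>\<in>steps a. (\<Prod>w\<in>?V. f w - nd a \<alpha> \<sigma>) / ?den (steps a) \<sigma>) = (- 1) ^ card ?V"
    proof (rule node_sum[OF P(1) ab(2) a(2) ab(1) ks P(2)])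
      show "card (steps a) = card ?V + 1" using cV card_steps a2 by simp
      show "pos \<alpha> (fst \<sigma>) a \<noteq> 0" if "\<sigma> \<in> moves a" for \<sigma> using False movesD(1)[OF that] by blast
      show "f w = ch (posp \<alpha> w)" if "w \<in> nb a" for w using that n0 by (auto simp: f_def)
    qed auto
    finally show ?thesis using cV a by simp
  next
    case True
    \<comment> \<open>Raising and lowering this entry give the same node, which is also the extra zero \<open>?c\<close> of the
      numerator. Each of the two steps contributes half of what a single node does.\<close>
    then obtain j where j: "j \<in> idx a" "pos \<alpha> j a = 0" by blast
    let ?p = "(j, 1::real)" and ?m = "(j, - 1::real)"
    let ?J = "steps a - {?m}"
    have pm: "?p \<in> moves a" "?m \<in> moves a" "?p \<noteq> ?m" using j by (auto simp: moves_def)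
    have j0: "j \<noteq> 0" using j idx_pos by blast
    have th0: "th a ?p \<alpha> = 0" "th a ?m \<alpha> = 0" using j j0 by (simp_all add: th_def)
    have only: "th a \<sigma> \<alpha> \<noteq> 0" if "\<sigma> \<in> moves a" "\<sigma> \<noteq> ?p" "\<sigma> \<noteq> ?m" for \<sigma>
    proof
      assume "th a \<sigma> \<alpha> = 0"
      then have z: "pos \<alpha> (fst \<sigma>) a = 0" using movesD(3)[OF that(1)] unfolding movesD(4)[OF that(1)] by auto
      have "fst \<sigma> \<noteq> j" using that movesD(3)[OF that(1)] by (auto simp: prod_eq_iff)
      moreover have A: "adj a (Suc a)" by (simp add: adj_def)
      ultimately show False
        using row_separated[OF P(1) P(1) A ab(2) j(1) movesD(1)[OF that(1)] _ refl]
          row_separated[OF P(1) P(1) A ab(2) movesD(1)[OF that(1)] j(1) _ refl] z j(2)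
        by (cases "fst \<sigma> < j") fastforce+
    qed
    have z: "nd a \<alpha> ?p = ?c" "nd a \<alpha> ?m = ?c" using th0 by (simp_all add: nd_def)
    have Jp: "?den ?J ?p = (\<Prod>r\<in>idx a - {j}. dl * dl * low 0 (pos \<alpha> r a))"
    proof -
      have "?J - {?p} = (idx a - {j}) \<times> {1, - 1}" using steps by (auto simp: moves_def)
      then show ?thesis using nd_prod_rows[of "idx a - {j}" a 0 \<alpha>] z by (simp add: nd_def)
    qed
    have zero: "serre a b \<kappa> \<sigma> (neg \<sigma>) \<alpha> = - (cf b \<kappa> \<alpha> * (?num ?p / ?den ?J ?p)) / 2"
      if "\<sigma> = ?p \<or> \<sigma> = ?m" for \<sigma>
    proof -
      have s: "\<sigma> \<in> moves a" "th a \<sigma> \<alpha> = 0" "fst \<sigma> = j" using that pm th0 by auto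
      \<comment> \<open>Here \<open>ch 0\<close> = 2 is the source of the half.\<close>
      have A: "wt a 0 * br (2 * 0 + 2) = 1 / 2"
        using wt_even(1)[OF a(1), of 0] ch_half_nz[of 0] ch_half_nz[of 1] by (simp add: ch_def qpow_def)
      have Q: "?num ?p / ?den ?J ?p = (\<Prod>w\<in>?W. up 0 (posp \<alpha> w)) / (\<Prod>r\<in>idx a - {j}. low 0 (pos \<alpha> r a))"
      proof -
        have "card ?W = 2 * (a div 2 - 1)" using cW a by (auto elim!: evenE)
        then have "?num ?p = dl ^ (2 * (a div 2 - 1)) * (\<Prod>w\<in>?W. up 0 (posp \<alpha> w))"
          unfolding num_prod th0 by simp
        moreover have "(\<Prod>r\<in>idx a - {j}. dl * dl * low 0 (pos \<alpha> r a))
          = dl ^ (2 * (a div 2 - 1)) * (\<Prod>r\<in>idx a - {j}. low 0 (pos \<alpha> r a))"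
          using j by (simp add: prod.distrib card_idx mult_2 power_add power_mult_distrib)
        ultimately show ?thesis unfolding Jp by simp
      qed
      show ?thesis unfolding serre_return_move[OF ab P k s(1)] s(2,3) A Q by simp
    qed
    have other: "serre a b \<kappa> \<sigma> (neg \<sigma>) \<alpha> = - (cf b \<kappa> \<alpha> * (?num \<sigma> / ?den ?J \<sigma>))"
      if "\<sigma> \<in> ?J - {?p}" for \<sigma>
    proof -
      have s: "\<sigma> \<in> moves a" "\<sigma> \<noteq> ?p" "\<sigma> \<noteq> ?m" using that steps by auto
      have rm: "?den (steps a) \<sigma> = (nd a \<alpha> \<sigma> - ?c) * ?den ?J \<sigma>"
      proof -
        have "?den (steps a) \<sigma> = (nd a \<alpha> \<sigma> - nd a \<alpha> ?m) * (\<Prod>\<mu>\<in>steps a - {\<sigma>} - {?m}. nd a \<alpha> \<sigma> - nd a \<alpha> \<mu>)"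
          using s pm steps by (intro prod.remove) auto
        moreover have "steps a - {\<sigma>} - {?m} = ?J - {\<sigma>}" by auto
        ultimately show ?thesis using z by simp
      qed
      show ?thesis
      proof (cases "nd a \<alpha> \<sigma> = ?c")
        case True
        \<comment> \<open>This occurs at \<theta> = - 1. The node equals the one of position 0, and
          both quotients are divisions by 0.\<close>
        have d0: "?den ?J \<sigma> = 0" using s pm steps z True by (intro prod_zero bexI[of _ ?p]) auto
        show ?thesis unfolding generic[OF s(1) only[OF s]] rm d0 by simp
      next
        case False
        then have nz: "nd a \<alpha> \<sigma> - ?c \<noteq> 0" by simp
        have "?num \<sigma> * (?c - nd a \<alpha> \<sigma>) / ((nd a \<alpha> \<sigma> - ?c) * ?den ?J \<sigma>)
            = - (?num \<sigma> * (nd a \<alpha> \<sigma> - ?c)) / (?den ?J \<sigma> * (nd a \<alpha> \<sigma> - ?c))"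
          by (simp add: algebra_simps)
        also have "\<dots> = - (?num \<sigma> / ?den ?J \<sigma>)" using nz by simp
        finally have key: "?num \<sigma> * (?c - nd a \<alpha> \<sigma>) / ((nd a \<alpha> \<sigma> - ?c) * ?den ?J \<sigma>)
          = - (?num \<sigma> / ?den ?J \<sigma>)" .
        show ?thesis unfolding generic[OF s(1) only[OF s]] rm key by (rule mult_minus_right)
      qed
    qed
    have fin: "finite (steps a)" by simp
    have "(\<Sum>\<sigma>\<in>steps a. serre a b \<kappa> \<sigma> (neg \<sigma>) \<alpha>)
        = serre a b \<kappa> ?m (neg ?m) \<alpha> + (serre a b \<kappa> ?p (neg ?p) \<alpha> + (\<Sum>\<sigma>\<in>?J - {?p}. serre a b \<kappa> \<sigma> (neg \<sigma>) \<alpha>))"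
    proof -
      have "(\<Sum>\<sigma>\<in>?J. serre a b \<kappa> \<sigma> (neg \<sigma>) \<alpha>)
          = serre a b \<kappa> ?p (neg ?p) \<alpha> + (\<Sum>\<sigma>\<in>?J - {?p}. serre a b \<kappa> \<sigma> (neg \<sigma>) \<alpha>)"
        using pm steps by (intro sum.remove) auto
      moreover have "(\<Sum>\<sigma>\<in>steps a. serre a b \<kappa> \<sigma> (neg \<sigma>) \<alpha>)
          = serre a b \<kappa> ?m (neg ?m) \<alpha> + (\<Sum>\<sigma>\<in>?J. serre a b \<kappa> \<sigma> (neg \<sigma>) \<alpha>)"
        using pm steps by (intro sum.remove) auto
      ultimately show ?thesis by (simp only:)
    qed
    also have "\<dots> = - (cf b \<kappa> \<alpha> * (?num ?p / ?den ?J ?p + (\<Sum>\<sigma>\<in>?J - {?p}. ?num \<sigma> / ?den ?J \<sigma>)))"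
    proof -
      have "(\<Sum>\<sigma>\<in>?J - {?p}. serre a b \<kappa> \<sigma> (neg \<sigma>) \<alpha>) = - (cf b \<kappa> \<alpha> * (\<Sum>\<sigma>\<in>?J - {?p}. ?num \<sigma> / ?den ?J \<sigma>))"
        unfolding sum_distrib_left sum_negf[symmetric] by (rule sum.cong[OF refl other])
      then show ?thesis using zero[of ?p] zero[of ?m] by (simp add: distrib_left)
    qed
    also have "?num ?p / ?den ?J ?p + (\<Sum>\<sigma>\<in>?J - {?p}. ?num \<sigma> / ?den ?J \<sigma>) = (\<Sum>\<sigma>\<in>?J. ?num \<sigma> / ?den ?J \<sigma>)"
      using pm steps by (intro sum.remove[symmetric]) auto
    also have "\<dots> = (- 1) ^ card ?W"
    proof (rule node_sum[OF P(1) ab(2) a(2) ab(1) ks P(2)])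
      have "?m \<in> steps a" using pm steps by simp
      then show "card ?J = card ?W + 1" using cW card_steps[of a] a2 by (simp add: card_Diff_singleton)
      show "pos \<alpha> (fst \<sigma>) a \<noteq> 0" if "\<sigma> \<in> ?J" "neg \<sigma> \<in> ?J" "\<sigma> \<in> moves a" for \<sigma>
      proof -
        have "\<sigma> \<noteq> ?m" "\<sigma> \<noteq> ?p" using that by (auto simp: neg_def)
        then have "th a \<sigma> \<alpha> \<noteq> 0" using only that by blast
        then show ?thesis unfolding movesD(4)[OF that(3)] by simp
      qed
    qed auto
    finally show ?thesis using even_W by simp
  qed
qed

text \<open>No neighbour moves, so all \<open>a - 1\<close> of them serve as zeros. If row
  \<open>a\<close> has an entry 0, the diagonal coefficient vanishes at \<open>\<alpha>\<close>, and
  the raising and lowering of that entry cancel because the coefficient is odd in it.\<close>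

lemma serre_sum_even_diag:
  assumes ab: "adj a b" "a < n" "b < n" and P: "\<alpha> \<in> P" and a: "even a" "a \<ge> 1"
  shows "(\<Sum>\<sigma>\<in>steps a. serre a b (0, 0) \<sigma> (neg \<sigma>) \<alpha>) = - cf b (0, 0) \<alpha>"
proof -
  let ?k = "(0, 0::real)" and ?c = "ch (1/2)"
  let ?N = "\<lambda>\<sigma>. (\<Prod>w\<in>nb a. ch (posp \<alpha> w) - nd a \<alpha> \<sigma>) / (\<Prod>\<mu>\<in>steps a - {\<sigma>}. nd a \<alpha> \<sigma> - nd a \<alpha> \<mu>)"
  let ?S = "\<lambda>\<sigma>. cf a \<sigma> \<alpha> * cf a (neg \<sigma>) (shift a \<sigma> \<alpha>)"
  have ba: "adj b a" using ab adj_sym by blast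
  have bodd: "odd b" using ab a by (auto simp: adj_def)
  have steps: "steps a = moves a" using a by (simp add: steps_def)
  have a2: "a \<ge> 2" using a by auto
  have cN: "card (nb a) = a - 1" using card_nb[OF a(2)] a by simp
  have expand: "serre a b ?k \<sigma> (neg \<sigma>) \<alpha> = ?S \<sigma> * (2 * (\<i> * dg b \<alpha>) - ?c * (\<i> * dg b (shift a \<sigma> \<alpha>)))" for \<sigma>
  proof (cases "shift a \<sigma> \<alpha> \<in> P")
    case True then show ?thesis unfolding serre_def using P by (simp add: cf_diag algebra_simps)
  next
    case False then show ?thesis unfolding serre_def by (simp add: cf_def)
  qed
  show ?thesis
  proof (cases "\<exists>j\<in>idx a. pos \<alpha> j a = 0")
    case False
    have eq: "serre a b ?k \<sigma> (neg \<sigma>) \<alpha> = cf b ?k \<alpha> * ?N \<sigma>" if st: "\<sigma> \<in> steps a" for \<sigma>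
    proof -
      have s: "\<sigma> \<in> moves a" using st steps by simp
      let ?t = "th a \<sigma> \<alpha>"
      let ?U = "\<Prod>w\<in>nb a. up ?t (posp \<alpha> w)" and ?L = "\<Prod>r\<in>idx a - {fst \<sigma>}. low ?t (pos \<alpha> r a)"
      have "?t \<noteq> 0" using False movesD(1,3)[OF s] unfolding movesD(4)[OF s] by auto
      then have nz: "br ?t \<noteq> 0" using br_eq_0[OF th_half[OF P _ st]] ab by simp
      have "dg b (shift a \<sigma> \<alpha>) * br ?t = dg b \<alpha> * br (?t + 1)" using dg_shift_adj[OF s ba] .
      then have d: "dg b (shift a \<sigma> \<alpha>) = dg b \<alpha> * br (?t + 1) / br ?t" using nz by (simp add: field_simps)
      \<comment> \<open>By the recurrence [2][\<theta> + 1] = [\<theta> + 2] + [\<theta>], so the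
        left-hand side is [\<theta>] - [\<theta> + 2].\<close>
      have id: "2 * br ?t - ?c * br (?t + 1) = - ch ((?t + 1) / 2)"
        using br_step[of "?t + 1"] br_diff[of "?t + 1"] by (simp add: algebra_simps)
      have "serre a b ?k \<sigma> (neg \<sigma>) \<alpha> = \<i> * dg b \<alpha> * (?S \<sigma> * (2 * br ?t - ?c * br (?t + 1)) / br ?t)"
        unfolding expand d using nz by (simp add: field_simps)
      also have "?S \<sigma> * (2 * br ?t - ?c * br (?t + 1)) / br ?t = (wt a ?t * ch ((?t + 1) / 2)) * ?U / (?L * br ?t)"
        unfolding id return_coeff[OF P ab(2) s] by (simp add: mult_ac)
      also have "wt a ?t * ch ((?t + 1) / 2) = br ?t / br (2 * ?t)"
        using wt_even(3)[OF a(1) _ _ nz] ch_half_th[OF P ab(2) st] by blast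
      also have "br ?t / br (2 * ?t) * ?U / (?L * br ?t) = ?U / (br (2 * ?t) * ?L)" using nz by simp
      also have "\<dots> = ?N \<sigma>"
      proof -
        have j: "fst \<sigma> \<in> idx a" using movesD(1)[OF s] .
        then have "a div 2 \<ge> 1" by (auto simp: idx_def)
        then have c: "card (nb a) = 1 + 2 * (a div 2 - 1)" using cN a by (auto elim!: evenE)
        have "(\<Prod>r\<in>idx a - {fst \<sigma>}. dl * dl * low ?t (pos \<alpha> r a)) = dl ^ (2 * (a div 2 - 1)) * ?L"
          using j by (simp add: prod.distrib card_idx mult_2 power_add power_mult_distrib)
        then show ?thesis unfolding num_prod nd_prod_move[OF s] c using a(1) by simp
      qed
      finally show ?thesis using P by (simp add: cf_diag)
    qed
    have "(\<Sum>\<sigma>\<in>steps a. serre a b ?k \<sigma> (neg \<sigma>) \<alpha>) = cf b ?k \<alpha> * (\<Sum>\<sigma>\<in>steps a. ?N \<sigma>)"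
      unfolding sum_distrib_left by (rule sum.cong[OF refl eq])
    also have "(\<Sum>\<sigma>\<in>steps a. ?N \<sigma>) = (- 1) ^ card (nb a)"
    proof (rule node_sum[OF P ab(2) a(2) ab(1), of ?k])
      show "card (steps a) = card (nb a) + 1" using cN card_steps a2 by simp
      show "pos \<alpha> (fst \<sigma>) a \<noteq> 0" if "\<sigma> \<in> moves a" for \<sigma> using False movesD(1)[OF that] by blast
      show "?k \<in> steps b" using bodd by (simp add: steps_def)
    qed (use P in auto)
    finally show ?thesis using cN a by simp
  next
    case True
    then obtain j where j: "j \<in> idx a" "pos \<alpha> j a = 0" by blast
    let ?p = "(j, 1::real)" and ?m = "(j, - 1::real)"
    have jb: "(j, a) \<in> nb b" using j ba by (simp add: nb_def)
    have pm: "?p \<in> moves a" "?m \<in> moves a" "?p \<noteq> ?m" using j by (auto simp: moves_def)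
    have d0: "dg b \<alpha> = 0" using dg_eq_0[OF jb] j by simp
    have other: "serre a b ?k \<sigma> (neg \<sigma>) \<alpha> = 0" if "\<sigma> \<in> steps a - {?p, ?m}" for \<sigma>
    proof -
      have s: "\<sigma> \<in> moves a" using that steps by simp
      have "fst \<sigma> \<noteq> j" using that movesD(3)[OF s] by (auto simp: prod_eq_iff)
      then have "dg b (shift a \<sigma> \<alpha>) = 0" using dg_eq_0[OF jb, of "shift a \<sigma> \<alpha>"] j by (simp add: pos_shift)
      then show ?thesis unfolding expand d0 by simp
    qed
    have th0: "th a ?p \<alpha> = 0" "th a ?m \<alpha> = 0" using j idx_pos[OF j(1)] by (simp_all add: th_def)
    have S: "?S ?p = ?S ?m" unfolding return_coeff[OF P ab(2) pm(1)] return_coeff[OF P ab(2) pm(2)] th0 by simp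
    have "dg b (shift a ?p \<alpha>) * br (posp (shift a ?m \<alpha>) (j, a)) = dg b (shift a ?m \<alpha>) * br (posp (shift a ?p \<alpha>) (j, a))"
      using jb ba adj_neq[OF ba] by (intro dg_ratio) (auto simp: pos_shift)
    then have d: "dg b (shift a ?m \<alpha>) = - dg b (shift a ?p \<alpha>)"
      using j br_minus[of 1] by (simp add: pos_shift)
    have "(\<Sum>\<sigma>\<in>steps a. serre a b ?k \<sigma> (neg \<sigma>) \<alpha>) = (\<Sum>\<sigma>\<in>{?p, ?m}. serre a b ?k \<sigma> (neg \<sigma>) \<alpha>)"
      using other pm steps by (intro sum.mono_neutral_right) auto
    also have "\<dots> = 0" using pm(3) unfolding expand d0 by (simp add: S d)
    finally show ?thesis using d0 P by (simp add: cf_diag)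
  qed
qed

lemma serre_sum:
  assumes ab: "adj a b" "a < n" "b < n" "a \<ge> 1" and P: "\<alpha> \<in> P" and k: "\<kappa> \<in> steps b"
  shows "(\<Sum>\<sigma>\<in>steps a. serre a b \<kappa> \<sigma> (neg \<sigma>) \<alpha>) = - cf b \<kappa> \<alpha>"
proof (cases "shift b \<kappa> \<alpha> \<in> P")
  case False
  then have "serre a b \<kappa> \<sigma> (neg \<sigma>) \<alpha> = 0" for \<sigma> by (intro serre_outside) simp
  then show ?thesis using False by (simp add: cf_def)
next
  case True
  from k show ?thesis
  proof (cases rule: steps_cases)
    case 1
    then show ?thesis
      using serre_sum_odd[OF ab(1-3) P True 1] serre_sum_even_move[OF ab(1-3) P True 1 _ ab(4)] by blast
  next
    case 2
    then have "even a" using ab(1) by (auto simp: adj_def)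
    then show ?thesis using serre_sum_even_diag[OF ab(1-3) P _ ab(4)] 2 by simp
  qed
qed

section \<open>Matrices of the generators\<close>

definition mat :: "nat \<Rightarrow> pattern \<Rightarrow> pattern \<Rightarrow> complex" where
  "mat a \<alpha> \<beta> = (\<Sum>\<sigma>\<in>steps a. cf a \<sigma> \<alpha> * ket (shift a \<sigma> \<alpha>) \<beta>)"

lemma mat_apply: "(\<Sum>\<gamma>\<in>P. mat a \<alpha> \<gamma> * g \<gamma>) = (\<Sum>\<sigma>\<in>steps a. cf a \<sigma> \<alpha> * g (shift a \<sigma> \<alpha>))"
proof -
  have fin: "finite P" by (rule finite_GT_patterns)
  have "(\<Sum>\<gamma>\<in>P. mat a \<alpha> \<gamma> * g \<gamma>) = (\<Sum>\<sigma>\<in>steps a. cf a \<sigma> \<alpha> * (\<Sum>\<gamma>\<in>P. ket (shift a \<sigma> \<alpha>) \<gamma> * g \<gamma>))"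
    unfolding mat_def sum_distrib_right sum_distrib_left by (subst sum.swap) (simp add: mult.assoc)
  also have "\<dots> = (\<Sum>\<sigma>\<in>steps a. cf a \<sigma> \<alpha> * g (shift a \<sigma> \<alpha>))"
  proof (rule sum.cong[OF refl])
    fix \<sigma>
    show "cf a \<sigma> \<alpha> * (\<Sum>\<gamma>\<in>P. ket (shift a \<sigma> \<alpha>) \<gamma> * g \<gamma>) = cf a \<sigma> \<alpha> * g (shift a \<sigma> \<alpha>)"
    proof (cases "shift a \<sigma> \<alpha> \<in> P")
      case True
      have "(\<Sum>\<gamma>\<in>P. ket (shift a \<sigma> \<alpha>) \<gamma> * g \<gamma>) = (\<Sum>\<gamma>\<in>P. if shift a \<sigma> \<alpha> = \<gamma> then g \<gamma> else 0)"
        by (rule sum.cong) (auto simp: ket_def)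
      then show ?thesis using True fin by simp
    qed (simp add: cf_def)
  qed
  finally show ?thesis .
qed

lemma mat_outside: "\<beta> \<notin> P \<Longrightarrow> mat a \<alpha> \<beta> = 0"
  unfolding mat_def by (rule sum.neutral) (auto simp: ket_def cf_def)

text \<open>The pattern reached does not depend on the order of the steps, so the sum over pairs in
  row \<open>a\<close> may be symmetrised. By \<open>serre_cancel\<close> only opposite pairs
  remain; they all lead to \<open>shift b \<kappa> \<alpha>\<close>, and \<open>serre_sum\<close>
  adds them up.\<close>

lemma serre_relation:
  assumes ab: "adj a b" "a < n" "b < n" "a \<ge> 1" and P: "\<alpha> \<in> P"
  shows "(\<Sum>\<gamma>\<in>P. mat b \<alpha> \<gamma> * (\<Sum>\<delta>\<in>P. mat a \<gamma> \<delta> * mat a \<delta> \<beta>))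
    - ch (1/2) * (\<Sum>\<gamma>\<in>P. mat a \<alpha> \<gamma> * (\<Sum>\<delta>\<in>P. mat b \<gamma> \<delta> * mat a \<delta> \<beta>))
    + (\<Sum>\<gamma>\<in>P. mat a \<alpha> \<gamma> * (\<Sum>\<delta>\<in>P. mat a \<gamma> \<delta> * mat b \<delta> \<beta>)) = - mat b \<alpha> \<beta>"
proof -
  define k where "k \<kappa> \<sigma> \<rho> = ket (shift b \<kappa> (shift a \<rho> (shift a \<sigma> \<alpha>))) \<beta>" for \<kappa> \<sigma> \<rho>
  have k1: "ket (shift a \<rho> (shift a \<sigma> (shift b \<kappa> \<alpha>))) \<beta> = k \<kappa> \<sigma> \<rho>"
    "ket (shift a \<rho> (shift b \<kappa> (shift a \<sigma> \<alpha>))) \<beta> = k \<kappa> \<sigma> \<rho>" for \<kappa> \<sigma> \<rho>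
    unfolding k_def by (metis shift_commute)+
  have "(\<Sum>\<gamma>\<in>P. mat b \<alpha> \<gamma> * (\<Sum>\<delta>\<in>P. mat a \<gamma> \<delta> * mat a \<delta> \<beta>))
      = (\<Sum>\<kappa>\<in>steps b. \<Sum>\<sigma>\<in>steps a. \<Sum>\<rho>\<in>steps a.
        cf b \<kappa> \<alpha> * cf a \<sigma> (shift b \<kappa> \<alpha>) * cf a \<rho> (shift a \<sigma> (shift b \<kappa> \<alpha>)) * k \<kappa> \<sigma> \<rho>)"
    unfolding mat_apply unfolding mat_def k1 sum_distrib_left by (simp add: mult.assoc)
  moreover have "(\<Sum>\<gamma>\<in>P. mat a \<alpha> \<gamma> * (\<Sum>\<delta>\<in>P. mat b \<gamma> \<delta> * mat a \<delta> \<beta>))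
      = (\<Sum>\<kappa>\<in>steps b. \<Sum>\<sigma>\<in>steps a. \<Sum>\<rho>\<in>steps a.
        cf a \<sigma> \<alpha> * cf b \<kappa> (shift a \<sigma> \<alpha>) * cf a \<rho> (shift b \<kappa> (shift a \<sigma> \<alpha>)) * k \<kappa> \<sigma> \<rho>)"
    unfolding mat_apply unfolding mat_def k1 sum_distrib_left by (subst sum.swap) (simp add: mult.assoc)
  moreover have "(\<Sum>\<gamma>\<in>P. mat a \<alpha> \<gamma> * (\<Sum>\<delta>\<in>P. mat a \<gamma> \<delta> * mat b \<delta> \<beta>))
      = (\<Sum>\<kappa>\<in>steps b. \<Sum>\<sigma>\<in>steps a. \<Sum>\<rho>\<in>steps a.
        cf a \<sigma> \<alpha> * cf a \<rho> (shift a \<sigma> \<alpha>) * cf b \<kappa> (shift a \<rho> (shift a \<sigma> \<alpha>)) * k \<kappa> \<sigma> \<rho>)"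
  proof -
    have "(\<Sum>\<gamma>\<in>P. mat a \<alpha> \<gamma> * (\<Sum>\<delta>\<in>P. mat a \<gamma> \<delta> * mat b \<delta> \<beta>))
      = (\<Sum>\<sigma>\<in>steps a. \<Sum>\<rho>\<in>steps a. \<Sum>\<kappa>\<in>steps b.
        cf a \<sigma> \<alpha> * cf a \<rho> (shift a \<sigma> \<alpha>) * cf b \<kappa> (shift a \<rho> (shift a \<sigma> \<alpha>)) * k \<kappa> \<sigma> \<rho>)"
      unfolding mat_apply unfolding mat_def k_def sum_distrib_left by (simp add: mult.assoc)
    also have "\<dots> = (\<Sum>\<sigma>\<in>steps a. \<Sum>\<kappa>\<in>steps b. \<Sum>\<rho>\<in>steps a.
        cf a \<sigma> \<alpha> * cf a \<rho> (shift a \<sigma> \<alpha>) * cf b \<kappa> (shift a \<rho> (shift a \<sigma> \<alpha>)) * k \<kappa> \<sigma> \<rho>)"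
      by (rule sum.cong[OF refl], rule sum.swap)
    finally show ?thesis by (simp only: sum.swap[of _ "steps b"])
  qed
  ultimately have "(\<Sum>\<gamma>\<in>P. mat b \<alpha> \<gamma> * (\<Sum>\<delta>\<in>P. mat a \<gamma> \<delta> * mat a \<delta> \<beta>))
    - ch (1/2) * (\<Sum>\<gamma>\<in>P. mat a \<alpha> \<gamma> * (\<Sum>\<delta>\<in>P. mat b \<gamma> \<delta> * mat a \<delta> \<beta>))
    + (\<Sum>\<gamma>\<in>P. mat a \<alpha> \<gamma> * (\<Sum>\<delta>\<in>P. mat a \<gamma> \<delta> * mat b \<delta> \<beta>))
    = (\<Sum>\<kappa>\<in>steps b. \<Sum>\<sigma>\<in>steps a. \<Sum>\<rho>\<in>steps a. serre a b \<kappa> \<sigma> \<rho> \<alpha> * k \<kappa> \<sigma> \<rho>)"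
    unfolding serre_def by (simp add: sum_distrib_left sum_subtractf sum.distrib algebra_simps)
  also have "\<dots> = (\<Sum>\<kappa>\<in>steps b. - cf b \<kappa> \<alpha> * ket (shift b \<kappa> \<alpha>) \<beta>)"
  proof (rule sum.cong[OF refl])
    fix \<kappa> assume kb: "\<kappa> \<in> steps b"
    let ?S = "\<lambda>\<sigma> \<rho>. serre a b \<kappa> \<sigma> \<rho> \<alpha>" and ?z = "ket (shift b \<kappa> \<alpha>) \<beta>"
    have ksym: "k \<kappa> \<rho> \<sigma> = k \<kappa> \<sigma> \<rho>" for \<sigma> \<rho> unfolding k_def by (metis shift_commute)
    have bij: "(\<Sum>\<sigma>\<in>steps a. ?S (neg \<sigma>) \<sigma>) = (\<Sum>\<sigma>\<in>steps a. ?S \<sigma> (neg \<sigma>))"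
      by (rule sum.reindex_bij_witness[of _ neg neg]) auto
    \<comment> \<open>Doubling makes room for both orders of a pair; the opposite pairs are then
      counted twice as well, as \<open>bij\<close> shows.\<close>
    have "2 * (\<Sum>\<sigma>\<in>steps a. \<Sum>\<rho>\<in>steps a. ?S \<sigma> \<rho> * k \<kappa> \<sigma> \<rho>)
        = (\<Sum>\<sigma>\<in>steps a. \<Sum>\<rho>\<in>steps a. ?S \<sigma> \<rho> * k \<kappa> \<sigma> \<rho>) + (\<Sum>\<sigma>\<in>steps a. \<Sum>\<rho>\<in>steps a. ?S \<rho> \<sigma> * k \<kappa> \<rho> \<sigma>)"
      using sum.swap[of "\<lambda>\<sigma> \<rho>. ?S \<sigma> \<rho> * k \<kappa> \<sigma> \<rho>" "steps a" "steps a"] by simp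
    also have "\<dots> = (\<Sum>\<sigma>\<in>steps a. \<Sum>\<rho>\<in>steps a. (?S \<sigma> \<rho> + ?S \<rho> \<sigma>) * k \<kappa> \<sigma> \<rho>)"
      by (simp add: sum.distrib[symmetric] distrib_right ksym)
    also have "\<dots> = (\<Sum>\<sigma>\<in>steps a. (?S \<sigma> (neg \<sigma>) + ?S (neg \<sigma>) \<sigma>) * ?z)"
    proof (rule sum.cong[OF refl])
      fix \<sigma> assume s: "\<sigma> \<in> steps a"
      have "(\<Sum>\<rho>\<in>steps a. (?S \<sigma> \<rho> + ?S \<rho> \<sigma>) * k \<kappa> \<sigma> \<rho>)
          = (\<Sum>\<rho>\<in>{neg \<sigma>}. (?S \<sigma> \<rho> + ?S \<rho> \<sigma>) * k \<kappa> \<sigma> \<rho>)"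
        using s serre_cancel[OF ab(1-3) s _ kb] by (intro sum.mono_neutral_right) auto
      then show "(\<Sum>\<rho>\<in>steps a. (?S \<sigma> \<rho> + ?S \<rho> \<sigma>) * k \<kappa> \<sigma> \<rho>) = (?S \<sigma> (neg \<sigma>) + ?S (neg \<sigma>) \<sigma>) * ?z"
        by (simp add: k_def)
    qed
    also have "\<dots> = 2 * ((\<Sum>\<sigma>\<in>steps a. ?S \<sigma> (neg \<sigma>)) * ?z)"
      unfolding sum_distrib_right[symmetric] sum.distrib bij by simp
    finally show "(\<Sum>\<sigma>\<in>steps a. \<Sum>\<rho>\<in>steps a. ?S \<sigma> \<rho> * k \<kappa> \<sigma> \<rho>) = - cf b \<kappa> \<alpha> * ?z"
      unfolding serre_sum[OF ab P kb] by simp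
  qed
  finally show ?thesis unfolding mat_def by (simp add: sum_negf)
qed

end

section \<open>Operators and evaluation of the free algebra\<close>

lemma hilb_add: "v \<in> hilb B \<Longrightarrow> w \<in> hilb B \<Longrightarrow> (\<lambda>\<beta>. a * v \<beta> + b * w \<beta>) \<in> hilb B"
  by (simp add: hilb_def)

lemma hilb_sum: "(\<And>i. i \<in> S \<Longrightarrow> x i \<in> hilb B) \<Longrightarrow> (\<lambda>\<beta>. \<Sum>i\<in>S. c i * x i \<beta>) \<in> hilb B"
  by (auto simp: hilb_def intro!: sum.neutral)

lemma hilb_0 [simp]: "(\<lambda>\<beta>. 0) \<in> hilb B"
  by (simp add: hilb_def)

lemma hilb_simple:
  "v \<in> hilb B \<Longrightarrow> w \<in> hilb B \<Longrightarrow> (\<lambda>\<beta>. v \<beta> + w \<beta>) \<in> hilb B"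
  "v \<in> hilb B \<Longrightarrow> (\<lambda>\<beta>. c * v \<beta>) \<in> hilb B"
  "v \<in> hilb B \<Longrightarrow> (\<lambda>\<beta>. - v \<beta>) \<in> hilb B"
  by (simp_all add: hilb_def)

lemma ket_hilb: "\<beta> \<in> B \<Longrightarrow> ket \<beta> \<in> hilb B"
  by (auto simp: hilb_def ket_def)

lemma operators_sel [simp]:
  "f \<otimes>\<^bsub>operators B\<^esub> g = compose (hilb B) f g"
  "\<one>\<^bsub>operators B\<^esub> = (\<lambda>v\<in>hilb B. v)"
  "\<zero>\<^bsub>operators B\<^esub> = (\<lambda>v\<in>hilb B. \<lambda>\<beta>. 0)"
  "f \<oplus>\<^bsub>operators B\<^esub> g = (\<lambda>v\<in>hilb B. \<lambda>\<beta>. f v \<beta> + g v \<beta>)"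
  "c \<odot>\<^bsub>operators B\<^esub> f = (\<lambda>v\<in>hilb B. \<lambda>\<beta>. c * f v \<beta>)"
  by (simp_all add: operators_def)

lemma operatorsI:
  assumes "f \<in> extensional (hilb B)" "\<And>v. v \<in> hilb B \<Longrightarrow> f v \<in> hilb B"
    "\<And>v w a b. v \<in> hilb B \<Longrightarrow> w \<in> hilb B \<Longrightarrow>
      f (\<lambda>\<beta>. a * v \<beta> + b * w \<beta>) = (\<lambda>\<beta>. a * f v \<beta> + b * f w \<beta>)"
  shows "f \<in> carrier (operators B)"
  using assms by (auto simp: operators_def PiE_def)

lemma operatorsD:
  assumes "f \<in> carrier (operators B)"
  shows "f \<in> extensional (hilb B)" "\<And>v. v \<in> hilb B \<Longrightarrow> f v \<in> hilb B"
    "\<And>v w a b. v \<in> hilb B \<Longrightarrow> w \<in> hilb B \<Longrightarrow>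
      f (\<lambda>\<beta>. a * v \<beta> + b * w \<beta>) = (\<lambda>\<beta>. a * f v \<beta> + b * f w \<beta>)"
  using assms unfolding operators_def by (simp_all add: PiE_def Pi_def)

lemma operator_0: assumes "f \<in> carrier (operators B)" shows "f (\<lambda>\<beta>. 0) = (\<lambda>\<beta>. 0)"
  using operatorsD(3)[OF assms, of "\<lambda>\<beta>. 0" "\<lambda>\<beta>. 0" 0 0] by simp

lemma operator_simple:
  assumes "f \<in> carrier (operators B)" "v \<in> hilb B" "w \<in> hilb B"
  shows "f (\<lambda>\<beta>. v \<beta> + w \<beta>) = (\<lambda>\<beta>. f v \<beta> + f w \<beta>)"
    "f (\<lambda>\<beta>. c * v \<beta>) = (\<lambda>\<beta>. c * f v \<beta>)"
    "f (\<lambda>\<beta>. - v \<beta>) = (\<lambda>\<beta>. - f v \<beta>)"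
  using operatorsD(3)[OF assms, of 1 1] operatorsD(3)[OF assms(1,2,2), of c 0]
    operatorsD(3)[OF assms(1,2,2), of "- 1" 0] by simp_all

lemma operator_sum:
  assumes "f \<in> carrier (operators B)" "finite S" "\<And>i. i \<in> S \<Longrightarrow> x i \<in> hilb B"
  shows "f (\<lambda>\<beta>. \<Sum>i\<in>S. c i * x i \<beta>) = (\<lambda>\<beta>. \<Sum>i\<in>S. c i * f (x i) \<beta>)"
  using assms(2,3)
proof (induction S rule: finite_induct)
  case empty
  then show ?case using operator_0[OF assms(1)] by simp
next
  case (insert j S)
  have "f (\<lambda>\<beta>. c j * x j \<beta> + 1 * (\<Sum>i\<in>S. c i * x i \<beta>))
      = (\<lambda>\<beta>. c j * f (x j) \<beta> + 1 * f (\<lambda>\<beta>. \<Sum>i\<in>S. c i * x i \<beta>) \<beta>)"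
    using insert by (intro operatorsD(3)[OF assms(1)] hilb_sum) auto
  then show ?case using insert by simp
qed

lemma operator_eqI:
  assumes "f \<in> carrier (operators B)" "g \<in> carrier (operators B)"
    "\<And>v \<beta>. v \<in> hilb B \<Longrightarrow> f v \<beta> = g v \<beta>"
  shows "f = g"
  using assms operatorsD(1) by (intro extensionalityI[of f "hilb B" g]) auto

lemma operators_closed:
  "f \<in> carrier (operators B) \<Longrightarrow> g \<in> carrier (operators B) \<Longrightarrow> compose (hilb B) f g \<in> carrier (operators B)"
  "(\<lambda>v\<in>hilb B. v) \<in> carrier (operators B)"
  "(\<lambda>v\<in>hilb B. \<lambda>\<beta>. 0) \<in> carrier (operators B)"
  "f \<in> carrier (operators B) \<Longrightarrow> g \<in> carrier (operators B)
    \<Longrightarrow> (\<lambda>v\<in>hilb B. \<lambda>\<beta>. f v \<beta> + g v \<beta>) \<in> carrier (operators B)"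
  "f \<in> carrier (operators B) \<Longrightarrow> (\<lambda>v\<in>hilb B. \<lambda>\<beta>. c * f v \<beta>) \<in> carrier (operators B)"
  "f \<in> carrier (operators B) \<Longrightarrow> (\<lambda>v\<in>hilb B. \<lambda>\<beta>. - f v \<beta>) \<in> carrier (operators B)"
  by (rule operatorsI; simp add: compose_def operatorsD hilb_add hilb_simple fun_eq_iff algebra_simps)+

lemma ring_operators: "ring (operators B)"
proof (rule ringI)
  show "abelian_group (operators B)"
  proof (rule abelian_groupI)
    fix f assume f: "f \<in> carrier (operators B)"
    show "\<exists>g\<in>carrier (operators B). g \<oplus>\<^bsub>operators B\<^esub> f = \<zero>\<^bsub>operators B\<^esub>"
      using f by (intro bexI[of _ "\<lambda>v\<in>hilb B. \<lambda>\<beta>. - f v \<beta>"] operators_closed) (auto simp: fun_eq_iff)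
    show "\<zero>\<^bsub>operators B\<^esub> \<oplus>\<^bsub>operators B\<^esub> f = f"
      by (rule operator_eqI) (use f operators_closed(4)[OF operators_closed(3) f] in auto)
  qed (simp_all add: operators_closed, auto simp: fun_eq_iff restrict_def add_ac)
  show "Group.monoid (operators B)"
  proof (rule monoidI)
    fix f assume f: "f \<in> carrier (operators B)"
    show "\<one>\<^bsub>operators B\<^esub> \<otimes>\<^bsub>operators B\<^esub> f = f" "f \<otimes>\<^bsub>operators B\<^esub> \<one>\<^bsub>operators B\<^esub> = f"
      by (rule operator_eqI; use f operators_closed(1)[OF operators_closed(2) f]
          operators_closed(1)[OF f operators_closed(2)] in \<open>auto simp: compose_def operatorsD\<close>)+
  next
    fix f g h
    assume "f \<in> carrier (operators B)" "g \<in> carrier (operators B)" "h \<in> carrier (operators B)"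
    then show "f \<otimes>\<^bsub>operators B\<^esub> g \<otimes>\<^bsub>operators B\<^esub> h = f \<otimes>\<^bsub>operators B\<^esub> (g \<otimes>\<^bsub>operators B\<^esub> h)"
      by (auto simp: compose_def operatorsD fun_eq_iff)
  qed (simp_all add: operators_closed)
next
  fix f g h
  assume "f \<in> carrier (operators B)" "g \<in> carrier (operators B)" "h \<in> carrier (operators B)"
  then show "(f \<oplus>\<^bsub>operators B\<^esub> g) \<otimes>\<^bsub>operators B\<^esub> h = f \<otimes>\<^bsub>operators B\<^esub> h \<oplus>\<^bsub>operators B\<^esub> g \<otimes>\<^bsub>operators B\<^esub> h"
    "h \<otimes>\<^bsub>operators B\<^esub> (f \<oplus>\<^bsub>operators B\<^esub> g) = h \<otimes>\<^bsub>operators B\<^esub> f \<oplus>\<^bsub>operators B\<^esub> h \<otimes>\<^bsub>operators B\<^esub> g"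
    by (auto simp: compose_def operatorsD operator_simple fun_eq_iff)
qed

lemma operators_uminus:
  assumes "f \<in> carrier (operators B)"
  shows "\<ominus>\<^bsub>operators B\<^esub> f = (\<lambda>v\<in>hilb B. \<lambda>\<beta>. - f v \<beta>)"
proof -
  interpret ring "operators B" by (rule ring_operators)
  have "(\<lambda>v\<in>hilb B. \<lambda>\<beta>. - f v \<beta>) \<oplus>\<^bsub>operators B\<^esub> f = \<zero>\<^bsub>operators B\<^esub>"
    by (auto simp: fun_eq_iff)
  then show ?thesis using assms by (intro minus_equality operators_closed)
qed

text \<open>Uniqueness holds because pairing with the basis vectors recovers every
  coordinate.\<close>

lemma hadjoint_eq:
  assumes "finite B" "g \<in> carrier (operators B)"
    and "\<And>v w. v \<in> hilb B \<Longrightarrow> w \<in> hilb B \<Longrightarrow> hinner B (f v) w = hinner B v (g w)"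
  shows "hadjoint B f = g"
  unfolding hadjoint_def
proof (rule the_equality)
  show "g \<in> carrier (operators B) \<and> (\<forall>v\<in>hilb B. \<forall>w\<in>hilb B. hinner B (f v) w = hinner B v (g w))"
    using assms by blast
  fix h
  assume h: "h \<in> carrier (operators B) \<and> (\<forall>v\<in>hilb B. \<forall>w\<in>hilb B. hinner B (f v) w = hinner B v (h w))"
  have ket: "hinner B (ket \<beta>) w = w \<beta>" if "\<beta> \<in> B" for \<beta> and w
  proof -
    have "hinner B (ket \<beta>) w = (\<Sum>\<gamma>\<in>B. if \<gamma> = \<beta> then w \<gamma> else 0)"
      unfolding hinner_def ket_def by (rule sum.cong) auto
    then show ?thesis using that assms(1) by simp
  qed
  show "h = g"
  proof (rule operator_eqI)
    fix w \<beta> assume w: "w \<in> hilb B"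
    show "h w \<beta> = g w \<beta>"
    proof (cases "\<beta> \<in> B")
      case True
      then have "hinner B (ket \<beta>) (h w) = hinner B (ket \<beta>) (g w)"
        using h assms(3) w ket_hilb by metis
      then show ?thesis using ket True by simp
    next
      case False
      have "h w \<in> hilb B" "g w \<in> hilb B" using h assms(2) w operatorsD(2) by blast+
      then show ?thesis using False by (simp add: hilb_def)
    qed
  qed (use h assms in auto)
qed

text \<open>The first index of the matrix is the source, so composition multiplies the matrices in
  reverse order.\<close>

definition matop :: "'b set \<Rightarrow> ('b \<Rightarrow> 'b \<Rightarrow> complex) \<Rightarrow> ('b \<Rightarrow> complex) \<Rightarrow> 'b \<Rightarrow> complex" where
  "matop B M = (\<lambda>v\<in>hilb B. \<lambda>\<beta>. \<Sum>\<alpha>\<in>B. v \<alpha> * M \<alpha> \<beta>)"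

lemma matop_carrier:
  assumes "\<forall>\<alpha> \<beta>. \<beta> \<notin> B \<longrightarrow> M \<alpha> \<beta> = 0"
  shows "matop B M \<in> carrier (operators B)"
  using assms
  by (intro operatorsI) (auto simp: matop_def hilb_def fun_eq_iff sum.distrib distrib_right
      sum_distrib_left mult.assoc intro!: sum.neutral)

lemma matop_mult:
  assumes "\<forall>\<alpha> \<beta>. \<beta> \<notin> B \<longrightarrow> N \<alpha> \<beta> = 0"
  shows "matop B M \<otimes>\<^bsub>operators B\<^esub> matop B N = matop B (\<lambda>\<alpha> \<beta>. \<Sum>\<gamma>\<in>B. N \<alpha> \<gamma> * M \<gamma> \<beta>)"
proof (rule extensionalityI[of _ "hilb B"])
  fix v assume v: "v \<in> hilb B"
  have "matop B N v \<in> hilb B" using operatorsD(2)[OF matop_carrier[OF assms] v] by blast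
  then have "(matop B M \<otimes>\<^bsub>operators B\<^esub> matop B N) v
      = (\<lambda>\<beta>. \<Sum>\<gamma>\<in>B. (\<Sum>\<alpha>\<in>B. v \<alpha> * N \<alpha> \<gamma>) * M \<gamma> \<beta>)"
    using v by (simp add: compose_def matop_def)
  also have "\<dots> = matop B (\<lambda>\<alpha> \<beta>. \<Sum>\<gamma>\<in>B. N \<alpha> \<gamma> * M \<gamma> \<beta>) v"
    using v unfolding matop_def
    by (simp add: sum_distrib_left sum_distrib_right mult.assoc fun_eq_iff) (intro allI, subst sum.swap, rule refl)
  finally show "(matop B M \<otimes>\<^bsub>operators B\<^esub> matop B N) v = matop B (\<lambda>\<alpha> \<beta>. \<Sum>\<gamma>\<in>B. N \<alpha> \<gamma> * M \<gamma> \<beta>) v" .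
qed (auto simp: matop_def compose_def)

lemma matop_add: "matop B M \<oplus>\<^bsub>operators B\<^esub> matop B N = matop B (\<lambda>\<alpha> \<beta>. M \<alpha> \<beta> + N \<alpha> \<beta>)"
  by (auto simp: matop_def fun_eq_iff sum.distrib distrib_left)

lemma matop_smult: "c \<odot>\<^bsub>operators B\<^esub> matop B M = matop B (\<lambda>\<alpha> \<beta>. c * M \<alpha> \<beta>)"
  by (auto simp: matop_def fun_eq_iff sum_distrib_left mult_ac)

lemma matop_uminus:
  assumes "\<forall>\<alpha> \<beta>. \<beta> \<notin> B \<longrightarrow> M \<alpha> \<beta> = 0"
  shows "\<ominus>\<^bsub>operators B\<^esub> matop B M = matop B (\<lambda>\<alpha> \<beta>. - M \<alpha> \<beta>)"
proof -
  have "\<ominus>\<^bsub>operators B\<^esub> matop B M = (\<lambda>v\<in>hilb B. \<lambda>\<beta>. - matop B M v \<beta>)"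
    by (rule operators_uminus[OF matop_carrier[OF assms]])
  also have "\<dots> = matop B (\<lambda>\<alpha> \<beta>. - M \<alpha> \<beta>)" by (auto simp: matop_def fun_eq_iff sum_negf)
  finally show ?thesis .
qed

lemma matop_minus:
  assumes "\<forall>\<alpha> \<beta>. \<beta> \<notin> B \<longrightarrow> N \<alpha> \<beta> = 0"
  shows "matop B M \<ominus>\<^bsub>operators B\<^esub> matop B N = matop B (\<lambda>\<alpha> \<beta>. M \<alpha> \<beta> - N \<alpha> \<beta>)"
  unfolding a_minus_def matop_uminus[OF assms] matop_add by simp

lemma matop_cong: "(\<And>\<alpha> \<beta>. \<alpha> \<in> B \<Longrightarrow> M \<alpha> \<beta> = N \<alpha> \<beta>) \<Longrightarrow> matop B M = matop B N"
  by (auto simp: matop_def fun_eq_iff restrict_def)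

lemma matop_skew:
  assumes "finite B" "\<And>\<alpha> \<beta>. \<alpha> \<in> B \<Longrightarrow> \<beta> \<in> B \<Longrightarrow> cnj (M \<alpha> \<beta>) = - M \<beta> \<alpha>"
    "v \<in> hilb B" "w \<in> hilb B"
  shows "hinner B (matop B M v) w = - hinner B v (matop B M w)"
proof -
  have "hinner B (matop B M v) w = (\<Sum>\<beta>\<in>B. \<Sum>\<alpha>\<in>B. cnj (v \<alpha>) * cnj (M \<alpha> \<beta>) * w \<beta>)"
    using assms by (simp add: hinner_def matop_def cnj_sum sum_distrib_right)
  also have "\<dots> = (\<Sum>\<alpha>\<in>B. \<Sum>\<beta>\<in>B. cnj (v \<alpha>) * cnj (M \<alpha> \<beta>) * w \<beta>)" by (rule sum.swap)
  also have "\<dots> = (\<Sum>\<alpha>\<in>B. \<Sum>\<beta>\<in>B. - (cnj (v \<alpha>) * (w \<beta> * M \<beta> \<alpha>)))"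
    using assms(2) by (intro sum.cong) auto
  also have "\<dots> = - hinner B v (matop B M w)"
    using assms by (simp add: hinner_def matop_def sum_distrib_left sum_negf)
  finally show ?thesis .
qed

section \<open>The free algebra\<close>

definition splits :: "'x list \<Rightarrow> ('x list \<times> 'x list) set" where
  "splits w = {(a, b). a @ b = w}"

lemma mem_splits: "(a, b) \<in> splits w \<longleftrightarrow> a @ b = w" by (simp add: splits_def)

lemma splits_image: "splits w = (\<lambda>i. (take i w, drop i w)) ` {..length w}"
proof -
  have "(a, b) \<in> (\<lambda>i. (take i w, drop i w)) ` {..length w}" if "a @ b = w" for a b
    using that by (intro image_eqI[of _ _ "length a"]) auto
  then show ?thesis unfolding splits_def by auto
qed

lemma finite_splits [simp]: "finite (splits w)"
  by (simp add: splits_image)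

lemma sum_splits: "(\<Sum>i\<le>length w. G (take i w) (drop i w)) = (\<Sum>(a, b)\<in>splits w. G a b)"
proof -
  have "inj_on (\<lambda>i. (take i w, drop i w)) {..length w}"
    by (rule inj_onI) (metis atMost_iff length_take min.absorb2 prod.inject)
  then show ?thesis unfolding splits_image by (simp add: sum.reindex)
qed

text \<open>Both sides run over the ways of cutting the word into three pieces; this is
  associativity in the free algebra.\<close>

lemma sum_splits_assoc:
  "(\<Sum>(x, c)\<in>splits w. \<Sum>(a, b)\<in>splits x. G a b c) = (\<Sum>(a, y)\<in>splits w. \<Sum>(b, c)\<in>splits y. G a b c)"
proof -
  have "(\<Sum>(x, c)\<in>splits w. \<Sum>(a, b)\<in>splits x. G a b c)
      = (\<Sum>(p, q)\<in>Sigma (splits w) (\<lambda>p. splits (fst p)). G (fst q) (snd q) (snd p))"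
    by (subst sum.Sigma[symmetric]) (auto simp: case_prod_unfold)
  also have "\<dots> = (\<Sum>(p, q)\<in>Sigma (splits w) (\<lambda>p. splits (snd p)). G (fst p) (fst q) (snd q))"
    by (rule sum.reindex_bij_witness[of _ "\<lambda>(p, q). ((fst p @ fst q, snd q), (fst p, fst q))"
          "\<lambda>(p, q). ((fst q, snd q @ snd p), (snd q, snd p))"]) (auto simp: mem_splits split: if_splits)
  also have "\<dots> = (\<Sum>(a, y)\<in>splits w. \<Sum>(b, c)\<in>splits y. G a b c)"
    by (subst sum.Sigma[symmetric]) (auto simp: case_prod_unfold)
  finally show ?thesis .
qed

definition supp :: "(nat list \<Rightarrow> complex) \<Rightarrow> nat list set" where "supp f = {w. f w \<noteq> 0}"

lemma free_algebra_sel [simp]: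
  "(f \<otimes>\<^bsub>free_algebra n\<^esub> g) = (\<lambda>w. \<Sum>(a, b)\<in>splits w. f a * g b)"
  "\<one>\<^bsub>free_algebra n\<^esub> = (\<lambda>w. if w = [] then 1 else 0)"
  "\<zero>\<^bsub>free_algebra n\<^esub> = (\<lambda>w. 0)"
  "f \<oplus>\<^bsub>free_algebra n\<^esub> g = (\<lambda>w. f w + g w)"
  "c \<odot>\<^bsub>free_algebra n\<^esub> f = (\<lambda>w. c * f w)"
  by (simp_all add: free_algebra_def sum_splits[where G = "\<lambda>a b. f a * g b"])

lemma free_carrier: "f \<in> carrier (free_algebra n) \<longleftrightarrow> finite (supp f) \<and> (\<forall>w\<in>supp f. set w \<subseteq> {2..n})"
  by (auto simp: free_algebra_def supp_def)

lemma free_carrierI: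
  assumes "finite S" "supp f \<subseteq> S" "\<And>w. w \<in> supp f \<Longrightarrow> set w \<subseteq> {2..n}"
  shows "f \<in> carrier (free_algebra n)"
  using assms finite_subset by (auto simp: free_carrier)

lemma supp_mult: "supp (\<lambda>w. \<Sum>(a, b)\<in>splits w. f a * g b) \<subseteq> (\<lambda>(a, b). a @ b) ` (supp f \<times> supp g)"
proof
  fix w assume "w \<in> supp (\<lambda>w. \<Sum>(a, b)\<in>splits w. f a * g b)"
  then obtain a b where "(a, b) \<in> splits w" "f a * g b \<noteq> 0"
    unfolding supp_def by (metis (mono_tags, lifting) case_prodE mem_Collect_eq sum.neutral surj_pair case_prod_conv)
  then show "w \<in> (\<lambda>(a, b). a @ b) ` (supp f \<times> supp g)" by (auto simp: mem_splits supp_def)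
qed

lemma free_closed:
  assumes "f \<in> carrier (free_algebra n)" "g \<in> carrier (free_algebra n)"
  shows "(\<lambda>w. \<Sum>(a, b)\<in>splits w. f a * g b) \<in> carrier (free_algebra n)"
    "(\<lambda>w. f w + g w) \<in> carrier (free_algebra n)" "(\<lambda>w. c * f w) \<in> carrier (free_algebra n)"
    "(\<lambda>w. - f w) \<in> carrier (free_algebra n)"
proof -
  show "(\<lambda>w. \<Sum>(a, b)\<in>splits w. f a * g b) \<in> carrier (free_algebra n)"
    using assms supp_mult[of f g]
    by (intro free_carrierI[of "(\<lambda>(a, b). a @ b) ` (supp f \<times> supp g)"]) (fastforce simp: free_carrier)+
  have "supp (\<lambda>w. f w + g w) \<subseteq> supp f \<union> supp g" by (auto simp: supp_def)
  then show "(\<lambda>w. f w + g w) \<in> carrier (free_algebra n)"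
    using assms by (intro free_carrierI[of "supp f \<union> supp g"]) (auto simp only: free_carrier)
  show "(\<lambda>w. c * f w) \<in> carrier (free_algebra n)" "(\<lambda>w. - f w) \<in> carrier (free_algebra n)"
    using assms by (intro free_carrierI[of "supp f"]; auto simp: free_carrier supp_def)+
qed

lemma free_closed_const:
  "(\<lambda>w. 0) \<in> carrier (free_algebra n)" "(\<lambda>w. if w = [] then 1 else 0) \<in> carrier (free_algebra n)"
  by (rule free_carrierI[of "{[]}"]; auto simp: supp_def split: if_splits)+

lemma free_gen_closed: "i \<in> {2..n} \<Longrightarrow> free_gen i \<in> carrier (free_algebra n)"
  by (rule free_carrierI[of "{[i]}"]) (auto simp: supp_def free_gen_def split: if_splits)

lemma ring_free_algebra: "ring (free_algebra n)"
proof (rule ringI)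
  show "abelian_group (free_algebra n)"
  proof (rule abelian_groupI)
    fix f assume f: "f \<in> carrier (free_algebra n)"
    show "\<exists>g\<in>carrier (free_algebra n). g \<oplus>\<^bsub>free_algebra n\<^esub> f = \<zero>\<^bsub>free_algebra n\<^esub>"
      using f by (intro bexI[of _ "\<lambda>w. - f w"] free_closed) auto
  qed (auto simp: free_closed free_closed_const)
  show "Group.monoid (free_algebra n)"
  proof (rule monoidI)
    fix f g h
    show "f \<otimes>\<^bsub>free_algebra n\<^esub> g \<otimes>\<^bsub>free_algebra n\<^esub> h = f \<otimes>\<^bsub>free_algebra n\<^esub> (g \<otimes>\<^bsub>free_algebra n\<^esub> h)"
    proof
      fix w
      have "(\<Sum>(x, c)\<in>splits w. (\<Sum>(a, b)\<in>splits x. f a * g b) * h c)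
          = (\<Sum>(x, c)\<in>splits w. \<Sum>(a, b)\<in>splits x. f a * g b * h c)"
        by (simp add: sum_distrib_right case_prod_unfold)
      also have "\<dots> = (\<Sum>(a, y)\<in>splits w. \<Sum>(b, c)\<in>splits y. f a * g b * h c)"
        by (rule sum_splits_assoc)
      also have "\<dots> = (\<Sum>(a, y)\<in>splits w. f a * (\<Sum>(b, c)\<in>splits y. g b * h c))"
        by (simp add: sum_distrib_left case_prod_unfold mult.assoc)
      finally show "(f \<otimes>\<^bsub>free_algebra n\<^esub> g \<otimes>\<^bsub>free_algebra n\<^esub> h) w = (f \<otimes>\<^bsub>free_algebra n\<^esub> (g \<otimes>\<^bsub>free_algebra n\<^esub> h)) w"
        by simp
    qed
  next
    fix f
    show "\<one>\<^bsub>free_algebra n\<^esub> \<otimes>\<^bsub>free_algebra n\<^esub> f = f"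
    proof
      fix w
      have "(\<Sum>(a, b)\<in>splits w. (if a = [] then 1 else 0) * f b) = (\<Sum>(a, b)\<in>{([] :: nat list, w)}. (if a = [] then 1 else 0) * f b)"
        by (rule sum.mono_neutral_right) (auto simp: mem_splits split: if_splits)
      then show "(\<one>\<^bsub>free_algebra n\<^esub> \<otimes>\<^bsub>free_algebra n\<^esub> f) w = f w" by simp
    qed
    show "f \<otimes>\<^bsub>free_algebra n\<^esub> \<one>\<^bsub>free_algebra n\<^esub> = f"
    proof
      fix w
      have "(\<Sum>(a, b)\<in>splits w. f a * (if b = [] then 1 else 0)) = (\<Sum>(a, b)\<in>{(w, [] :: nat list)}. f a * (if b = [] then 1 else 0))"
        by (rule sum.mono_neutral_right) (auto simp: mem_splits split: if_splits)
      then show "(f \<otimes>\<^bsub>free_algebra n\<^esub> \<one>\<^bsub>free_algebra n\<^esub>) w = f w" by simp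
    qed
  qed (auto simp: free_closed free_closed_const)
next
  fix f g h
  show "(f \<oplus>\<^bsub>free_algebra n\<^esub> g) \<otimes>\<^bsub>free_algebra n\<^esub> h = f \<otimes>\<^bsub>free_algebra n\<^esub> h \<oplus>\<^bsub>free_algebra n\<^esub> g \<otimes>\<^bsub>free_algebra n\<^esub> h"
    "h \<otimes>\<^bsub>free_algebra n\<^esub> (f \<oplus>\<^bsub>free_algebra n\<^esub> g) = h \<otimes>\<^bsub>free_algebra n\<^esub> f \<oplus>\<^bsub>free_algebra n\<^esub> h \<otimes>\<^bsub>free_algebra n\<^esub> g"
    by (simp_all add: case_prod_unfold distrib_right distrib_left sum.distrib fun_eq_iff)
qed

lemma defining_relationsE:
  fixes A (structure)
  assumes "(l, r) \<in> defining_relations \<tau> n A x"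
  obtains (commute) i j where "i \<in> {2..n}" "j \<in> {2..n}" "\<bar>int i - int j\<bar> > 1"
      "l = x i \<otimes> x j \<ominus> x j \<otimes> x i" "r = \<zero>"
    | (upper) i where "2 \<le> i" "i \<le> n - 1"
      "l = (x (i + 1) \<otimes> x (i + 1) \<otimes> x i
        \<ominus> (qpow \<tau> (1 / 2) + qpow \<tau> (- 1 / 2)) \<odot> (x (i + 1) \<otimes> x i \<otimes> x (i + 1))) \<oplus> x i \<otimes> x (i + 1) \<otimes> x (i + 1)"
      "r = \<ominus> x i"
    | (lower) i where "2 \<le> i" "i \<le> n - 1"
      "l = (x (i + 1) \<otimes> x i \<otimes> x i
        \<ominus> (qpow \<tau> (1 / 2) + qpow \<tau> (- 1 / 2)) \<odot> (x i \<otimes> x (i + 1) \<otimes> x i)) \<oplus> x i \<otimes> x i \<otimes> x (i + 1)"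
      "r = \<ominus> x (i + 1)"
  using assms unfolding defining_relations_def Let_def by blast

section \<open>Evaluation of the free algebra at a family of operators\<close>

locale operator_family =
  fixes B :: "'b set" and n :: nat and X :: "nat \<Rightarrow> ('b \<Rightarrow> complex) \<Rightarrow> 'b \<Rightarrow> complex"
  assumes finB: "finite B"
    and X_closed: "\<And>i. i \<in> {2..n} \<Longrightarrow> X i \<in> carrier (operators B)"
begin

abbreviation F where "F \<equiv> free_algebra n"
abbreviation Op where "Op \<equiv> operators B"

sublocale F: ring F by (rule ring_free_algebra)
sublocale Op: ring Op by (rule ring_operators)

definition word :: "nat list \<Rightarrow> ('b \<Rightarrow> complex) \<Rightarrow> 'b \<Rightarrow> complex" where
  "word w = foldr (\<lambda>i x. X i \<otimes>\<^bsub>Op\<^esub> x) w \<one>\<^bsub>Op\<^esub>"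

lemma word_closed: "set w \<subseteq> {2..n} \<Longrightarrow> word w \<in> carrier Op"
proof (induction w)
  case (Cons i w)
  then have "X i \<in> carrier Op" "word w \<in> carrier Op" using X_closed by auto
  then have "X i \<otimes>\<^bsub>Op\<^esub> word w \<in> carrier Op" by (rule Op.m_closed)
  then show ?case by (simp add: word_def)
qed (simp add: word_def operators_closed)

lemma word_hilb: "set w \<subseteq> {2..n} \<Longrightarrow> v \<in> hilb B \<Longrightarrow> word w v \<in> hilb B"
  using operatorsD(2)[OF word_closed] by blast

lemma word_Cons: "v \<in> hilb B \<Longrightarrow> word (i # w) v = X i (word w v)"
  by (simp add: word_def compose_def)

lemma word_append: 
  assumes "set w \<subseteq> {2..n}" "set w' \<subseteq> {2..n}" "v \<in> hilb B"
  shows "word (w @ w') v = word w (word w' v)"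
  using assms(1)
proof (induction w)
  case Nil
  then show ?case using word_hilb assms by (simp add: word_def)
next
  case (Cons i w)
  have "word (w @ w') v = word w (word w' v)" using Cons by simp
  moreover have "word w' v \<in> hilb B" using word_hilb assms(2,3) by blast
  ultimately show ?case using assms(3) by (simp add: word_Cons)
qed

definition ev :: "(nat list \<Rightarrow> complex) \<Rightarrow> ('b \<Rightarrow> complex) \<Rightarrow> 'b \<Rightarrow> complex" where
  "ev f = (\<lambda>v\<in>hilb B. \<lambda>\<beta>. \<Sum>w\<in>supp f. f w * word w v \<beta>)"

lemma ev_superset:
  assumes "finite S" "supp f \<subseteq> S" "v \<in> hilb B"
  shows "ev f v \<beta> = (\<Sum>w\<in>S. f w * word w v \<beta>)"
  unfolding ev_def using assms by simp (rule sum.mono_neutral_left, auto simp: supp_def)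

lemma ev_closed: assumes "f \<in> carrier F" shows "ev f \<in> carrier Op"
proof (rule operatorsI)
  have w: "set w \<subseteq> {2..n}" if "w \<in> supp f" for w using assms that by (auto simp: free_carrier)
  show "ev f \<in> extensional (hilb B)" by (simp add: ev_def)
  show "ev f v \<in> hilb B" if "v \<in> hilb B" for v
    using that w word_hilb by (auto simp: ev_def intro!: hilb_sum)
  fix v v' a b assume v: "v \<in> hilb B" "v' \<in> hilb B"
  show "ev f (\<lambda>\<beta>. a * v \<beta> + b * v' \<beta>) = (\<lambda>\<beta>. a * ev f v \<beta> + b * ev f v' \<beta>)"
  proof
    fix \<beta>
    have "ev f (\<lambda>\<beta>. a * v \<beta> + b * v' \<beta>) \<beta> = (\<Sum>x\<in>supp f. f x * (a * word x v \<beta> + b * word x v' \<beta>))"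
      using operatorsD(3)[OF word_closed[OF w] v] hilb_add[OF v] by (simp add: ev_def)
    also have "\<dots> = a * ev f v \<beta> + b * ev f v' \<beta>"
      using v by (simp add: ev_def distrib_left sum.distrib sum_distrib_left mult_ac)
    finally show "ev f (\<lambda>\<beta>. a * v \<beta> + b * v' \<beta>) \<beta> = a * ev f v \<beta> + b * ev f v' \<beta>" .
  qed
qed

lemma ev_add: assumes "f \<in> carrier F" "g \<in> carrier F" shows "ev (f \<oplus>\<^bsub>F\<^esub> g) = ev f \<oplus>\<^bsub>Op\<^esub> ev g"
proof (rule operator_eqI)
  fix v \<beta> assume v: "v \<in> hilb B"
  let ?S = "supp f \<union> supp g"
  have fin: "finite ?S" using assms by (auto simp: free_carrier)
  have "supp (\<lambda>w. f w + g w) \<subseteq> ?S" by (auto simp: supp_def)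
  then show "ev (f \<oplus>\<^bsub>F\<^esub> g) v \<beta> = (ev f \<oplus>\<^bsub>Op\<^esub> ev g) v \<beta>"
    using v by (simp add: ev_superset[OF fin _ v] distrib_right sum.distrib)
qed (use assms in \<open>simp_all add: ev_closed free_closed operators_closed\<close>)

lemma ev_smult: assumes "f \<in> carrier F" shows "ev (c \<odot>\<^bsub>F\<^esub> f) = c \<odot>\<^bsub>Op\<^esub> ev f"
proof (rule operator_eqI)
  fix v \<beta> assume v: "v \<in> hilb B"
  have fin: "finite (supp f)" using assms by (auto simp: free_carrier)
  have "supp (\<lambda>w. c * f w) \<subseteq> supp f" by (auto simp: supp_def)
  then show "ev (c \<odot>\<^bsub>F\<^esub> f) v \<beta> = (c \<odot>\<^bsub>Op\<^esub> ev f) v \<beta>"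
    using v by (simp add: ev_superset[OF fin _ v] sum_distrib_left mult.assoc)
qed (use assms in \<open>simp_all add: ev_closed free_closed operators_closed\<close>)

lemma ev_mult: assumes "f \<in> carrier F" "g \<in> carrier F" shows "ev (f \<otimes>\<^bsub>F\<^esub> g) = ev f \<otimes>\<^bsub>Op\<^esub> ev g"
proof (rule operator_eqI)
  fix v \<beta> assume v: "v \<in> hilb B"
  let ?A = "supp f" and ?B = "supp g"
  let ?S = "(\<lambda>(a, b). a @ b) ` (?A \<times> ?B)"
  have fin: "finite ?A" "finite ?B" using assms by (auto simp: free_carrier)
  then have finS: "finite ?S" by simp
  have A: "set a \<subseteq> {2..n}" if "a \<in> ?A" for a using assms(1) that by (auto simp: free_carrier)
  have B: "set b \<subseteq> {2..n}" if "b \<in> ?B" for b using assms(2) that by (auto simp: free_carrier)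
  let ?h = "\<lambda>(a, b). f a * g b * word (a @ b) v \<beta>"
  have "ev (f \<otimes>\<^bsub>F\<^esub> g) v \<beta> = (\<Sum>w\<in>?S. (\<Sum>(a, b)\<in>splits w. f a * g b) * word w v \<beta>)"
    using ev_superset[OF finS supp_mult v] by simp
  \<comment> \<open>Pairs of words are grouped by their concatenation, so that the sum over products
    of words becomes a double sum.\<close>
  also have "\<dots> = (\<Sum>w\<in>?S. sum ?h {x \<in> ?A \<times> ?B. (\<lambda>(a, b). a @ b) x = w})"
  proof (rule sum.cong[OF refl])
    fix w
    have "(\<Sum>(a, b)\<in>splits w. f a * g b) * word w v \<beta> = (\<Sum>x\<in>splits w. ?h x)"
      unfolding sum_distrib_right by (rule sum.cong) (auto simp: mem_splits split: if_splits)
    also have "\<dots> = sum ?h {x \<in> ?A \<times> ?B. (\<lambda>(a, b). a @ b) x = w}"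
      by (rule sum.mono_neutral_right) (auto simp: mem_splits supp_def)
    finally show "(\<Sum>(a, b)\<in>splits w. f a * g b) * word w v \<beta>
        = sum ?h {x \<in> ?A \<times> ?B. (\<lambda>(a, b). a @ b) x = w}" .
  qed
  also have "\<dots> = sum ?h (?A \<times> ?B)" using fin finS by (intro sum.group) auto
  also have "\<dots> = (\<Sum>a\<in>?A. \<Sum>b\<in>?B. f a * g b * word a (word b v) \<beta>)"
    unfolding sum.cartesian_product by (rule sum.cong) (auto simp: word_append A B v)
  also have "\<dots> = (\<Sum>a\<in>?A. f a * word a (ev g v) \<beta>)"
  proof (rule sum.cong[OF refl])
    fix a assume a: "a \<in> ?A"
    have "word a (ev g v) = (\<lambda>\<beta>. \<Sum>b\<in>?B. g b * word a (word b v) \<beta>)"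
      using operator_sum[OF word_closed[OF A[OF a]] fin(2), of "\<lambda>b. word b v" g] v word_hilb B
      by (simp add: ev_def)
    then show "(\<Sum>b\<in>?B. f a * g b * word a (word b v) \<beta>) = f a * word a (ev g v) \<beta>"
      by (simp add: sum_distrib_left mult.assoc)
  qed
  also have "\<dots> = (ev f \<otimes>\<^bsub>Op\<^esub> ev g) v \<beta>"
    using v operatorsD(2)[OF ev_closed[OF assms(2)] v] by (simp add: compose_def ev_def[of f])
  finally show "ev (f \<otimes>\<^bsub>F\<^esub> g) v \<beta> = (ev f \<otimes>\<^bsub>Op\<^esub> ev g) v \<beta>" .
qed (use assms in \<open>simp_all add: ev_closed free_closed operators_closed\<close>)

lemma ev_one: "ev \<one>\<^bsub>F\<^esub> = \<one>\<^bsub>Op\<^esub>"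
proof (rule operator_eqI)
  fix v \<beta> assume v: "v \<in> hilb B"
  have "supp (\<lambda>w. if w = [] then 1 else 0) \<subseteq> {[]}" by (auto simp: supp_def)
  then show "ev \<one>\<^bsub>F\<^esub> v \<beta> = \<one>\<^bsub>Op\<^esub> v \<beta>" using v by (simp add: ev_superset[of "{[]}"] word_def)
qed (use ev_closed[OF F.one_closed] in \<open>simp_all add: operators_closed\<close>)

lemma ev_gen: assumes "i \<in> {2..n}" shows "ev (free_gen i) = X i"
proof (rule operator_eqI)
  fix v \<beta> assume v: "v \<in> hilb B"
  have "supp (free_gen i) \<subseteq> {[i]}" by (auto simp: supp_def free_gen_def)
  then show "ev (free_gen i) v \<beta> = X i v \<beta>"
    using v by (simp add: ev_superset[of "{[i]}"] word_def free_gen_def compose_def)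
qed (use assms X_closed free_gen_closed ev_closed in auto)

lemma ev_hom: "ring_hom_ring F Op ev"
  by (rule ring_hom_ringI[OF F.ring_axioms Op.ring_axioms])
    (use ev_closed ev_mult ev_add ev_one in auto)

sublocale ev: ring_hom_ring F Op ev by (rule ev_hom)

lemma ev_minus: "f \<in> carrier F \<Longrightarrow> g \<in> carrier F \<Longrightarrow> ev (f \<ominus>\<^bsub>F\<^esub> g) = ev f \<ominus>\<^bsub>Op\<^esub> ev g"
  unfolding a_minus_def by (simp only: ev.hom_add ev.hom_a_inv F.a_inv_closed)

lemma smult_closed: "f \<in> carrier F \<Longrightarrow> c \<odot>\<^bsub>F\<^esub> f \<in> carrier F"
  using free_closed(3) by simp

lemma ev_relations:
  assumes "(l, r) \<in> defining_relations \<tau> n F free_gen"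
  shows "l \<in> carrier F \<and> r \<in> carrier F \<and> (ev l, ev r) \<in> defining_relations \<tau> n Op X"
proof -
  let ?c = "qpow \<tau> (1 / 2) + qpow \<tau> (- 1 / 2)" and ?g = free_gen
  note c = F.m_closed F.a_closed F.minus_closed F.a_inv_closed smult_closed
  note h = ev.hom_mult ev_minus ev.hom_add ev.hom_a_inv ev_smult
  from assms show ?thesis
  proof (cases rule: defining_relationsE)
    case (commute i j)
    then have g: "?g i \<in> carrier F" "?g j \<in> carrier F" by (simp_all only: free_gen_closed)
    have e: "ev (?g i) = X i" "ev (?g j) = X j" using commute ev_gen by auto
    have "l \<in> carrier F \<and> r \<in> carrier F \<and> ev l = X i \<otimes>\<^bsub>Op\<^esub> X j \<ominus>\<^bsub>Op\<^esub> X j \<otimes>\<^bsub>Op\<^esub> X i \<and> ev r = \<zero>\<^bsub>Op\<^esub>"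
      unfolding commute(4,5) by (simp only: c h g e F.zero_closed ev.hom_zero)
    then show ?thesis using commute(1-3) unfolding defining_relations_def Let_def by blast
  next
    case (upper i)
    then have "i \<in> {2..n}" "i + 1 \<in> {2..n}" by auto
    then have g: "?g i \<in> carrier F" "?g (i + 1) \<in> carrier F" and e: "ev (?g i) = X i" "ev (?g (i + 1)) = X (i + 1)"
      using free_gen_closed ev_gen by blast+
    have "l \<in> carrier F \<and> r \<in> carrier F \<and>
      ev l = (X (i + 1) \<otimes>\<^bsub>Op\<^esub> X (i + 1) \<otimes>\<^bsub>Op\<^esub> X i \<ominus>\<^bsub>Op\<^esub> ?c \<odot>\<^bsub>Op\<^esub> (X (i + 1) \<otimes>\<^bsub>Op\<^esub> X i \<otimes>\<^bsub>Op\<^esub> X (i + 1)))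
           \<oplus>\<^bsub>Op\<^esub> X i \<otimes>\<^bsub>Op\<^esub> X (i + 1) \<otimes>\<^bsub>Op\<^esub> X (i + 1) \<and> ev r = \<ominus>\<^bsub>Op\<^esub> X i"
      unfolding upper(3,4) by (simp only: c h g e)
    then show ?thesis using upper(1,2) unfolding defining_relations_def Let_def by blast
  next
    case (lower i)
    then have "i \<in> {2..n}" "i + 1 \<in> {2..n}" by auto
    then have g: "?g i \<in> carrier F" "?g (i + 1) \<in> carrier F" and e: "ev (?g i) = X i" "ev (?g (i + 1)) = X (i + 1)"
      using free_gen_closed ev_gen by blast+
    have "l \<in> carrier F \<and> r \<in> carrier F \<and>
      ev l = (X (i + 1) \<otimes>\<^bsub>Op\<^esub> X i \<otimes>\<^bsub>Op\<^esub> X i \<ominus>\<^bsub>Op\<^esub> ?c \<odot>\<^bsub>Op\<^esub> (X i \<otimes>\<^bsub>Op\<^esub> X (i + 1) \<otimes>\<^bsub>Op\<^esub> X i))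
           \<oplus>\<^bsub>Op\<^esub> X i \<otimes>\<^bsub>Op\<^esub> X i \<otimes>\<^bsub>Op\<^esub> X (i + 1) \<and> ev r = \<ominus>\<^bsub>Op\<^esub> X (i + 1)"
      unfolding lower(3,4) by (simp only: c h g e)
    then show ?thesis using lower(1,2) unfolding defining_relations_def Let_def by blast
  qed
qed

lemma word_skew:
  assumes skew: "\<And>i v w. i \<in> {2..n} \<Longrightarrow> v \<in> hilb B \<Longrightarrow> w \<in> hilb B \<Longrightarrow> hinner B (X i v) w = - hinner B v (X i w)"
    and "set w \<subseteq> {2..n}" "v \<in> hilb B" "x \<in> hilb B"
  shows "hinner B (word w v) x = (- 1) ^ length w * hinner B v (word (rev w) x)"
  using assms(2,4)
proof (induction w arbitrary: x)
  case Nil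
  then show ?case using assms(3) by (simp add: word_def)
next
  case (Cons i w)
  have i: "i \<in> {2..n}" and w: "set w \<subseteq> {2..n}" using Cons.prems by auto
  have Xx: "X i x \<in> hilb B" using operatorsD(2)[OF X_closed[OF i]] Cons.prems by blast
  have "hinner B (word (i # w) v) x = hinner B (X i (word w v)) x"
    using assms(3) by (simp add: word_Cons)
  also have "\<dots> = - hinner B (word w v) (X i x)"
    using skew[OF i word_hilb[OF w assms(3)]] Cons.prems by blast
  also have "\<dots> = (- 1) ^ length (i # w) * hinner B v (word (rev w) (X i x))"
    using Cons.IH[OF w Xx] by simp
  also have "word (rev w) (X i x) = word (rev (i # w)) x"
    using word_append[of "rev w" "[i]" x] w i Cons.prems by (simp add: word_def compose_def)
  finally show ?case .
qed

lemma free_star_closed: assumes "f \<in> carrier F" shows "free_star f \<in> carrier F"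
proof (rule free_carrierI)
  have "supp (free_star f) \<subseteq> rev ` supp f"
    unfolding supp_def free_star_def by (auto intro!: image_eqI[of _ rev "rev _"])
  then show "supp (free_star f) \<subseteq> rev ` supp f" .
  then show "set w \<subseteq> {2..n}" if "w \<in> supp (free_star f)" for w
    using that assms by (fastforce simp: free_carrier)
  show "finite (rev ` supp f)" using assms by (simp add: free_carrier)
qed

lemma ev_star:
  assumes skew: "\<And>i v w. i \<in> {2..n} \<Longrightarrow> v \<in> hilb B \<Longrightarrow> w \<in> hilb B \<Longrightarrow> hinner B (X i v) w = - hinner B v (X i w)"
    and f: "f \<in> carrier F"
  shows "hadjoint B (ev f) = ev (free_star f)"
proof (rule hadjoint_eq[OF finB ev_closed[OF free_star_closed[OF f]]])
  fix v x assume v: "v \<in> hilb B" "x \<in> hilb B"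
  have fin: "finite (supp f)" and sub: "\<And>w. w \<in> supp f \<Longrightarrow> set w \<subseteq> {2..n}"
    using f by (auto simp: free_carrier)
  have S: "supp (free_star f) = rev ` supp f"
    unfolding supp_def free_star_def by (auto intro!: image_eqI[of _ rev "rev _"])
  have "hinner B (ev f v) x = (\<Sum>\<beta>\<in>B. \<Sum>w\<in>supp f. cnj (f w) * (cnj (word w v \<beta>) * x \<beta>))"
    using v by (simp add: hinner_def ev_def cnj_sum sum_distrib_right mult.assoc)
  also have "\<dots> = (\<Sum>w\<in>supp f. cnj (f w) * hinner B (word w v) x)"
    unfolding hinner_def sum_distrib_left by (rule sum.swap)
  also have "\<dots> = (\<Sum>w\<in>supp f. (- 1) ^ length w * cnj (f w) * hinner B v (word (rev w) x))"
    using word_skew[OF skew sub v] by (intro sum.cong) auto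
  also have "\<dots> = (\<Sum>w\<in>rev ` supp f. free_star f w * hinner B v (word w x))"
    by (subst sum.reindex) (auto simp: free_star_def)
  also have "\<dots> = (\<Sum>w\<in>rev ` supp f. \<Sum>\<beta>\<in>B. cnj (v \<beta>) * (free_star f w * word w x \<beta>))"
    by (simp add: hinner_def sum_distrib_left mult_ac)
  also have "\<dots> = (\<Sum>\<beta>\<in>B. \<Sum>w\<in>rev ` supp f. cnj (v \<beta>) * (free_star f w * word w x \<beta>))"
    by (rule sum.swap)
  also have "\<dots> = hinner B v (ev (free_star f) x)"
    using v by (simp add: hinner_def ev_def S sum_distrib_left)
  finally show "hinner B (ev f v) x = hinner B v (ev (free_star f) x)" .
qed

section \<open>Passage to the quotient algebra\<close>

context
  fixes \<tau> :: complex
  assumes rel: "\<And>l r. (l, r) \<in> defining_relations \<tau> n Op X \<Longrightarrow> l = r"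
begin

abbreviation I where "I \<equiv> Uq_ideal \<tau> n"

lemma ideal_I: "ideal I F"
  unfolding Uq_ideal_def
  by (rule F.genideal_ideal) (use ev_relations F.minus_closed in blast)

text \<open>The kernel of \<open>ev\<close> is an ideal, and it contains the differences that
  generate \<open>I\<close>.\<close>

lemma ev_I: assumes "f \<in> I" shows "ev f = \<zero>\<^bsub>Op\<^esub>"
proof -
  have "I \<subseteq> a_kernel F Op ev"
    unfolding Uq_ideal_def
  proof (rule F.genideal_minimal[OF ev.kernel_is_ideal], rule subsetI)
    fix z assume "z \<in> {l \<ominus>\<^bsub>F\<^esub> r | l r. (l, r) \<in> defining_relations \<tau> n F free_gen}"
    then obtain l r where z: "z = l \<ominus>\<^bsub>F\<^esub> r" and lr: "(l, r) \<in> defining_relations \<tau> n F free_gen" by blast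
    have "l \<in> carrier F" "r \<in> carrier F" "ev l = ev r" using ev_relations[OF lr] rel by blast+
    then have "z \<in> carrier F" "ev z = \<zero>\<^bsub>Op\<^esub>"
      unfolding z by (simp_all only: F.minus_closed ev_minus ev.hom_closed Op.r_neg a_minus_def[of Op])
    then show "z \<in> a_kernel F Op ev" by (simp only: a_kernel_def' mem_Collect_eq)
  qed
  then show ?thesis using assms by (auto simp only: a_kernel_def')
qed

text \<open>Any member of a class will do; a choice is made since \<^const>\<open>Uq_star\<close> is defined on sets, and
  its values are only known to be nonempty sets with constant \<open>ev\<close>.\<close>

definition rep :: "(nat list \<Rightarrow> complex) set \<Rightarrow> ('b \<Rightarrow> complex) \<Rightarrow> 'b \<Rightarrow> complex" where
  "rep Y = ev (SOME f. f \<in> Y)"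

lemma some_in: "y \<in> Y \<Longrightarrow> (SOME y. y \<in> Y) \<in> Y"
  by (rule someI[of "\<lambda>y. y \<in> Y"])

lemma Uq_sel:
  "carrier (Uq \<tau> n) = a_rcosets\<^bsub>F\<^esub> I"
  "Y \<otimes>\<^bsub>Uq \<tau> n\<^esub> Z = rcoset_mult F I Y Z"
  "\<one>\<^bsub>Uq \<tau> n\<^esub> = I +>\<^bsub>F\<^esub> \<one>\<^bsub>F\<^esub>"
  "Y \<oplus>\<^bsub>Uq \<tau> n\<^esub> Z = Y <+>\<^bsub>F\<^esub> Z"
  "c \<odot>\<^bsub>Uq \<tau> n\<^esub> Y = (\<Union>a\<in>Y. I +>\<^bsub>F\<^esub> (c \<odot>\<^bsub>F\<^esub> a))"
  by (simp_all add: Uq_def ring.defs module.defs FactRing_def del: free_algebra_sel)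

lemma coset_ev: assumes "f \<in> carrier F" "g \<in> I +>\<^bsub>F\<^esub> f" shows "g \<in> carrier F" "ev g = ev f"
proof -
  interpret I: ideal I F by (rule ideal_I)
  obtain h where h: "h \<in> I" "g = h \<oplus>\<^bsub>F\<^esub> f"
    using assms(2) by (auto simp: a_r_coset_def' simp del: free_algebra_sel)
  have hc: "h \<in> carrier F" using h(1) by (rule I.a_Hcarr)
  show "g \<in> carrier F" unfolding h(2) using hc assms(1) by (rule F.a_closed)
  show "ev g = ev f"
    unfolding h(2) by (simp only: ev.hom_add hc assms(1) ev_I[OF h(1)] Op.l_zero ev.hom_closed)
qed

lemma rep_coset: assumes "f \<in> carrier F" shows "rep (I +>\<^bsub>F\<^esub> f) = ev f"
proof -
  interpret I: ideal I F by (rule ideal_I)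
  have "f \<in> I +>\<^bsub>F\<^esub> f" using assms by (rule I.a_rcos_self)
  then have "(SOME g. g \<in> I +>\<^bsub>F\<^esub> f) \<in> I +>\<^bsub>F\<^esub> f" by (rule some_in)
  then show ?thesis unfolding rep_def by (rule coset_ev(2)[OF assms])
qed

lemma Uq_carrierE:
  assumes "Y \<in> carrier (Uq \<tau> n)"
  obtains f where "f \<in> carrier F" "Y = I +>\<^bsub>F\<^esub> f"
  using assms unfolding Uq_sel A_RCOSETS_def' by blast

lemma rep_hom: "rep \<in> algebra_hom (Uq \<tau> n) Op"
proof -
  interpret I: ideal I F by (rule ideal_I)
  have "rep \<in> ring_hom (Uq \<tau> n) Op"
  proof (rule ring_hom_memI)
    fix Y assume "Y \<in> carrier (Uq \<tau> n)"
    then obtain f where f: "f \<in> carrier F" "Y = I +>\<^bsub>F\<^esub> f" by (rule Uq_carrierE)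
    then show "rep Y \<in> carrier Op" by (simp only: rep_coset ev.hom_closed)
    fix Z assume "Z \<in> carrier (Uq \<tau> n)"
    then obtain g where g: "g \<in> carrier F" "Z = I +>\<^bsub>F\<^esub> g" by (rule Uq_carrierE)
    show "rep (Y \<otimes>\<^bsub>Uq \<tau> n\<^esub> Z) = rep Y \<otimes>\<^bsub>Op\<^esub> rep Z"
      unfolding Uq_sel f(2) g(2)
      by (simp only: I.rcoset_mult_add f(1) g(1) rep_coset F.m_closed ev.hom_mult)
    show "rep (Y \<oplus>\<^bsub>Uq \<tau> n\<^esub> Z) = rep Y \<oplus>\<^bsub>Op\<^esub> rep Z"
      unfolding Uq_sel f(2) g(2)
      by (simp only: I.a_rcos_sum f(1) g(1) rep_coset F.a_closed ev.hom_add)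
  next
    show "rep \<one>\<^bsub>Uq \<tau> n\<^esub> = \<one>\<^bsub>Op\<^esub>" unfolding Uq_sel by (simp only: rep_coset F.one_closed ev.hom_one)
  qed
  moreover have "rep (c \<odot>\<^bsub>Uq \<tau> n\<^esub> Y) = c \<odot>\<^bsub>Op\<^esub> rep Y" if "Y \<in> carrier (Uq \<tau> n)" for c Y
  proof -
    from that obtain f where f: "f \<in> carrier F" "Y = I +>\<^bsub>F\<^esub> f" by (rule Uq_carrierE)
    have fY: "f \<in> Y" unfolding f(2) using f(1) by (rule I.a_rcos_self)
    have cf: "c \<odot>\<^bsub>F\<^esub> f \<in> carrier F" using f(1) by (rule smult_closed)
    have "c \<odot>\<^bsub>F\<^esub> f \<in> c \<odot>\<^bsub>Uq \<tau> n\<^esub> Y" unfolding Uq_sel using fY I.a_rcos_self[OF cf] by blast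
    then have "(SOME g. g \<in> c \<odot>\<^bsub>Uq \<tau> n\<^esub> Y) \<in> c \<odot>\<^bsub>Uq \<tau> n\<^esub> Y" by (rule some_in)
    \<comment> \<open>A scalar multiple is a union over the members of the class; the chosen element
      stems from some \<open>a\<close>, at which \<open>ev\<close> agrees with its value at
      \<open>f\<close>.\<close>
    then obtain a where a: "a \<in> Y" "(SOME g. g \<in> c \<odot>\<^bsub>Uq \<tau> n\<^esub> Y) \<in> I +>\<^bsub>F\<^esub> (c \<odot>\<^bsub>F\<^esub> a)"
      unfolding Uq_sel by blast
    have ac: "a \<in> carrier F" "ev a = ev f" using coset_ev[OF f(1)] a(1) unfolding f(2) by blast+
    have "rep (c \<odot>\<^bsub>Uq \<tau> n\<^esub> Y) = ev (c \<odot>\<^bsub>F\<^esub> a)"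
      unfolding rep_def using coset_ev(2)[OF smult_closed[OF ac(1)] a(2)] .
    also have "\<dots> = c \<odot>\<^bsub>Op\<^esub> rep Y" unfolding ev_smult[OF ac(1)] ac(2) f(2) rep_coset[OF f(1)] ..
    finally show ?thesis .
  qed
  ultimately show ?thesis unfolding algebra_hom_def by blast
qed

lemma rep_gen: "i \<in> {2..n} \<Longrightarrow> rep (Uq_gen \<tau> n i) = X i"
  unfolding Uq_gen_def using rep_coset free_gen_closed ev_gen by metis

text \<open>The element chosen in \<open>Uq_star Y\<close> has the form \<open>free_star g\<close>
  with \<open>g\<close> in the class. Its image is the adjoint of \<open>ev g\<close>, so it depends
  on the class only.\<close>

lemma rep_star:
  assumes skew: "\<And>i v w. i \<in> {2..n} \<Longrightarrow> v \<in> hilb B \<Longrightarrow> w \<in> hilb B \<Longrightarrow> hinner B (X i v) w = - hinner B v (X i w)"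
    and Y: "Y \<in> carrier (Uq \<tau> n)"
  shows "rep (Uq_star Y) = hadjoint B (rep Y)"
proof -
  interpret I: ideal I F by (rule ideal_I)
  obtain f where f: "f \<in> carrier F" "Y = I +>\<^bsub>F\<^esub> f" using Y by (rule Uq_carrierE)
  have "f \<in> Y" unfolding f(2) using f(1) by (rule I.a_rcos_self)
  then have "free_star f \<in> Uq_star Y" unfolding Uq_star_def by (rule imageI)
  then have "(SOME g. g \<in> Uq_star Y) \<in> Uq_star Y" by (rule some_in)
  then obtain g where g: "g \<in> Y" "(SOME g. g \<in> Uq_star Y) = free_star g" unfolding Uq_star_def by blast
  have gc: "g \<in> carrier F" "ev g = ev f" using coset_ev[OF f(1)] g(1) unfolding f(2) by blast+
  show ?thesis
    unfolding rep_def[of "Uq_star Y"] g(2) unfolding f(2) rep_coset[OF f(1)] gc(2)[symmetric]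
    using ev_star[OF skew gc(1)] by simp
qed

end

end

section \<open>The operators of the Gel'fand--Tsetlin basis\<close>

context gt
begin

section \<open>Comparison with the displayed coefficients\<close>

lemma lab_pos: "lab \<alpha> j k = (if even k then pos \<alpha> j k else pos \<alpha> j k + 1/2)"
  by (auto simp: lab_def pos_def field_simps elim!: evenE oddE)

lemma prod_nb:
  assumes "a \<ge> 1"
  shows "(\<Prod>w\<in>nb a. f (fst w) (snd w)) = (\<Prod>r\<in>idx (Suc a). f r (Suc a)) * (\<Prod>r\<in>idx (a - 1). f r (a - 1))"
  unfolding nb_rows(1)[OF assms] using nb_rows(2)[OF assms]
  by (subst prod.union_disjoint) (auto simp: prod.reindex inj_on_def)

lemma raise_shift: "raise j k \<alpha> = shift k (j, 1) \<alpha>" "lower j k \<alpha> = shift k (j, - 1) \<alpha>"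
  by (simp_all add: raise_def lower_def shift_def)

text \<open>The displayed coefficients have no moduli around sums of labels, while
  \<open>phi\<close> and \<open>psi\<close> do. These bounds make the sums nonnegative for raising
  steps.\<close>

lemma move_up_pos:
  assumes "\<alpha> \<in> P" "a < n" "j \<in> idx a"
  shows "(i, b) \<in> nb a \<Longrightarrow> pos \<alpha> i b + pos \<alpha> j a \<ge> 1/2"
    and "r \<in> idx a \<Longrightarrow> r \<noteq> j \<Longrightarrow> pos \<alpha> r a + pos \<alpha> j a \<ge> 1"
proof -
  have m: "(j, 1) \<in> moves a" using assms(3) by (simp add: moves_def)
  show "pos \<alpha> i b + pos \<alpha> j a \<ge> 1/2" if "(i, b) \<in> nb a"
    using move_nb(6)[OF assms(1,2) m that] by (auto simp: sp_def split: if_splits)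
  have ab: "adj a (Suc a)" by (simp add: adj_def)
  show "pos \<alpha> r a + pos \<alpha> j a \<ge> 1" if "r \<in> idx a" "r \<noteq> j"
  proof (cases "r < j")
    case True
    note r = that(1)
    obtain w where "pos \<alpha> r a \<ge> \<bar>w\<bar> + 1/2" "w \<ge> \<bar>pos \<alpha> j a\<bar> + 1/2"
      using row_separated[OF assms(1,1) ab assms(2) r assms(3) True] by auto
    then show ?thesis by linarith
  next
    case False
    then have lt: "j < r" using that by simp
    note r = that(1)
    obtain w where "pos \<alpha> j a \<ge> \<bar>w\<bar> + 1/2" "w \<ge> \<bar>pos \<alpha> r a\<bar> + 1/2"
      using row_separated[OF assms(1,1) ab assms(2) assms(3) r lt] by auto
    then show ?thesis by linarith
  qed
qed

lemma mv_A_coeff: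
  assumes P: "\<alpha> \<in> P" and p: "p \<ge> 1" "2 * p < n" and j: "j \<in> idx (2 * p)"
  shows "mv (2 * p) (j, 1) \<alpha> = A_coeff s u p j \<alpha>"
proof -
  let ?t = "pos \<alpha> j (2 * p)"
  have t: "th (2 * p) (j, 1) \<alpha> = ?t" using idx_pos[OF j] by (simp add: th_def)
  have l: "lab \<alpha> r (2 * p + 1) = pos \<alpha> r (2 * p + 1) + 1/2" "lab \<alpha> r (2 * p) = pos \<alpha> r (2 * p)"
    "lab \<alpha> r (2 * p - 1) = pos \<alpha> r (2 * p - 1) + 1/2" for r
    using p by (auto simp: lab_pos)
  have ix: "idx (2 * p) = {1..p}" "idx (Suc (2 * p)) = {1..p}" "idx (2 * p - 1) = {1..p - 1}"
    using p by (auto simp: idx_def)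
  have nbm: "r \<in> idx (Suc (2 * p)) \<Longrightarrow> (r, Suc (2 * p)) \<in> nb (2 * p)"
    "r \<in> idx (2 * p - 1) \<Longrightarrow> (r, 2 * p - 1) \<in> nb (2 * p)" for r using p by (auto simp: nb_def adj_def)
  have ph: "phi ?t w = s (w + 1/2 + ?t) * s \<bar>w + 1/2 - ?t - 1\<bar>" if "w + ?t \<ge> 1/2" for w
  proof -
    have "\<bar>w + ?t + 1/2\<bar> = w + 1/2 + ?t" "w - ?t - 1/2 = w + 1/2 - ?t - 1" using that by simp_all
    then show ?thesis unfolding phi_def by simp
  qed
  have U: "(\<Prod>r\<in>{1..p}. s (lab \<alpha> r (2 * p + 1) + lab \<alpha> j (2 * p)) * s \<bar>lab \<alpha> r (2 * p + 1) - lab \<alpha> j (2 * p) - 1\<bar>)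
      = (\<Prod>r\<in>idx (Suc (2 * p)). phi ?t (pos \<alpha> r (Suc (2 * p))))"
    unfolding ix(2)[symmetric] l using move_up_pos(1)[OF P p(2) j nbm(1)] by (intro prod.cong) (simp_all add: ph)
  have D: "(\<Prod>r\<in>{1..p - 1}. s (lab \<alpha> r (2 * p - 1) + lab \<alpha> j (2 * p)) * s \<bar>lab \<alpha> r (2 * p - 1) - lab \<alpha> j (2 * p) - 1\<bar>)
      = (\<Prod>r\<in>idx (2 * p - 1). phi ?t (pos \<alpha> r (2 * p - 1)))"
    unfolding ix(3)[symmetric] l using move_up_pos(1)[OF P p(2) j nbm(2)] by (intro prod.cong) (simp_all add: ph)
  have L: "(\<Prod>r\<in>{1..p} - {j}. s (lab \<alpha> r (2 * p) + lab \<alpha> j (2 * p)) * s \<bar>lab \<alpha> r (2 * p) - lab \<alpha> j (2 * p)\<bar> *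
      s (lab \<alpha> r (2 * p) + lab \<alpha> j (2 * p) + 1) * s \<bar>lab \<alpha> r (2 * p) - lab \<alpha> j (2 * p) - 1\<bar>)
      = (\<Prod>r\<in>idx (2 * p) - {j}. psi ?t (pos \<alpha> r (2 * p)))"
    unfolding ix(1)[symmetric] l
  proof (rule prod.cong[OF refl])
    fix r assume r: "r \<in> idx (2 * p) - {j}"
    have "\<bar>pos \<alpha> r (2 * p) + ?t\<bar> = pos \<alpha> r (2 * p) + ?t" "\<bar>pos \<alpha> r (2 * p) + ?t + 1\<bar> = pos \<alpha> r (2 * p) + ?t + 1"
      using move_up_pos(2)[OF P p(2) j, of r] r by auto
    then show "s (pos \<alpha> r (2 * p) + ?t) * s \<bar>pos \<alpha> r (2 * p) - ?t\<bar> * s (pos \<alpha> r (2 * p) + ?t + 1)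
        * s \<bar>pos \<alpha> r (2 * p) - ?t - 1\<bar> = psi ?t (pos \<alpha> r (2 * p))"
      by (simp add: psi_def)
  qed
  have a1: "2 * p \<ge> 1" using p by simp
  have "mv (2 * p) (j, 1) \<alpha> = ecf (2 * p) ?t * ((\<Prod>r\<in>idx (Suc (2 * p)). phi ?t (pos \<alpha> r (Suc (2 * p))))
      * (\<Prod>r\<in>idx (2 * p - 1). phi ?t (pos \<alpha> r (2 * p - 1)))) / (\<Prod>r\<in>idx (2 * p) - {j}. psi ?t (pos \<alpha> r (2 * p)))"
    unfolding mv_def t prod_nb[OF a1, of "\<lambda>i b. phi ?t (pos \<alpha> i b)"] by simp
  also have "\<dots> = A_coeff s u p j \<alpha>"
    unfolding A_coeff_def Let_def U D L by (simp add: ecf_def l)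
  finally show ?thesis .
qed

lemma mv_B_coeff:
  assumes P: "\<alpha> \<in> P" and p: "2 * p + 1 < n" and j: "j \<in> idx (2 * p + 1)"
  shows "mv (2 * p + 1) (j, 1) \<alpha> = B_coeff \<tau> s p j \<alpha>"
proof -
  let ?a = "2 * p + 1"
  let ?t = "pos \<alpha> j ?a"
  have t: "th ?a (j, 1) \<alpha> = ?t" using idx_pos[OF j] by (simp add: th_def)
  have l: "lab \<alpha> r (2 * p + 1) = pos \<alpha> r ?a + 1/2" "lab \<alpha> r (2 * p) = pos \<alpha> r (2 * p)"
    "lab \<alpha> r (2 * p + 2) = pos \<alpha> r (2 * p + 2)" for r
    by (auto simp: lab_pos)
  have ix: "idx ?a = {1..p}" "idx (2 * p + 2) = {1..p + 1}" "idx (2 * p) = {1..p}"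
    by (auto simp: idx_def)
  have nbm: "r \<in> idx (2 * p + 2) \<Longrightarrow> (r, 2 * p + 2) \<in> nb ?a"
    "r \<in> idx (2 * p) \<Longrightarrow> (r, 2 * p) \<in> nb ?a" for r by (auto simp: nb_def adj_def)
  have ph: "phi ?t w = s (w + (?t + 1/2)) * s \<bar>w - (?t + 1/2)\<bar>" if "w + ?t \<ge> 1/2" for w
  proof -
    have "\<bar>w + ?t + 1/2\<bar> = w + (?t + 1/2)" "w - ?t - 1/2 = w - (?t + 1/2)" using that by simp_all
    then show ?thesis unfolding phi_def by (simp only:)
  qed
  have U: "(\<Prod>r\<in>{1..p + 1}. s (lab \<alpha> r (2 * p + 2) + lab \<alpha> j (2 * p + 1)) * s \<bar>lab \<alpha> r (2 * p + 2) - lab \<alpha> j (2 * p + 1)\<bar>)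
      = (\<Prod>r\<in>idx (2 * p + 2). phi ?t (pos \<alpha> r (2 * p + 2)))"
    unfolding ix(2)[symmetric] l using move_up_pos(1)[OF P p j nbm(1)] by (intro prod.cong refl) (simp only: ph)
  have D: "(\<Prod>r\<in>{1..p}. s (lab \<alpha> r (2 * p) + lab \<alpha> j (2 * p + 1)) * s \<bar>lab \<alpha> r (2 * p) - lab \<alpha> j (2 * p + 1)\<bar>)
      = (\<Prod>r\<in>idx (2 * p). phi ?t (pos \<alpha> r (2 * p)))"
    unfolding ix(3)[symmetric] l using move_up_pos(1)[OF P p j nbm(2)] by (intro prod.cong refl) (simp only: ph)
  have L: "(\<Prod>r\<in>{1..p} - {j}. s (lab \<alpha> r (2 * p + 1) + lab \<alpha> j (2 * p + 1)) * s \<bar>lab \<alpha> r (2 * p + 1) - lab \<alpha> j (2 * p + 1)\<bar> *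
      s (lab \<alpha> r (2 * p + 1) + lab \<alpha> j (2 * p + 1) - 1) * s \<bar>lab \<alpha> r (2 * p + 1) - lab \<alpha> j (2 * p + 1) - 1\<bar>)
      = (\<Prod>r\<in>idx ?a - {j}. psi ?t (pos \<alpha> r ?a))"
    unfolding ix(1)[symmetric] l
  proof (rule prod.cong[OF refl])
    fix r assume r: "r \<in> idx ?a - {j}"
    let ?y = "pos \<alpha> r ?a"
    have "\<bar>?y + ?t\<bar> = ?y + 1/2 + (?t + 1/2) - 1" "\<bar>?y + ?t + 1\<bar> = ?y + 1/2 + (?t + 1/2)"
      "?y - ?t = ?y + 1/2 - (?t + 1/2)"
      "\<bar>?y - ?t - 1\<bar> = \<bar>?y + 1/2 - (?t + 1/2) - 1\<bar>"
      using move_up_pos(2)[OF P p j, of r] r by auto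
    then show "s (?y + 1/2 + (?t + 1/2)) * s \<bar>?y + 1/2 - (?t + 1/2)\<bar> * s (?y + 1/2 + (?t + 1/2) - 1)
        * s \<bar>?y + 1/2 - (?t + 1/2) - 1\<bar> = psi ?t ?y"
      unfolding psi_def by (simp only: mult_ac)
  qed
  have tp: "?t \<ge> 1/2" using odd_row_pos[OF P p _ j] by simp
  then have E: "\<bar>?t + 1/2\<bar> = ?t + 1/2" "\<bar>2 * ?t + 2\<bar> = 2 * (?t + 1/2) + 1" "\<bar>2 * ?t\<bar> = 2 * (?t + 1/2) - 1" by simp_all
  have "mv ?a (j, 1) \<alpha> = ecf ?a ?t * ((\<Prod>r\<in>idx (Suc ?a). phi ?t (pos \<alpha> r (Suc ?a)))
      * (\<Prod>r\<in>idx (?a - 1). phi ?t (pos \<alpha> r (?a - 1)))) / (\<Prod>r\<in>idx ?a - {j}. psi ?t (pos \<alpha> r ?a))"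
    unfolding mv_def t prod_nb[of ?a "\<lambda>i b. phi ?t (pos \<alpha> i b)", OF le_add2] by simp
  also have "Suc ?a = 2 * p + 2" by simp
  also have "?a - 1 = 2 * p" by simp
  also have "ecf ?a ?t = 1 / (qnum \<tau> (of_real (lab \<alpha> j ?a)) * s (2 * lab \<alpha> j ?a + 1) * s (2 * lab \<alpha> j ?a - 1))"
    unfolding ecf_def E l by (simp add: br_def)
  finally show ?thesis unfolding B_coeff_def Let_def U D L by simp
qed

lemma dg_diag_coeff: "dg (2 * p + 1) \<alpha> = diag_coeff \<tau> p \<alpha>"
proof -
  let ?a = "2 * p + 1"
  have l: "lab \<alpha> r (2 * p + 1) = pos \<alpha> r ?a + 1/2" "lab \<alpha> r (2 * p) = pos \<alpha> r (2 * p)"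
    "lab \<alpha> r (2 * p + 2) = pos \<alpha> r (2 * p + 2)" for r
    by (auto simp: lab_pos)
  have ix: "idx ?a = {1..p}" "idx (2 * p + 2) = {1..p + 1}" "idx (2 * p) = {1..p}"
    by (auto simp: idx_def)
  have one: "x + 1/2 = 1 \<longleftrightarrow> x = 1/2" for x :: real by auto
  have N: "(\<Prod>w\<in>nb ?a. br (posp \<alpha> w)) = (\<Prod>r\<in>idx (2 * p + 2). br (pos \<alpha> r (2 * p + 2))) * (\<Prod>r\<in>idx (2 * p). br (pos \<alpha> r (2 * p)))"
    using prod_nb[of ?a "\<lambda>i b. br (pos \<alpha> i b)"] by simp
  have br1: "qnum \<tau> (complex_of_real (x + 1/2) - 1) = br (x - 1/2)" for x
    by (simp add: br_def algebra_simps)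
  show ?thesis
    unfolding diag_coeff_def dg_def N l one ix br1 br_def[symmetric] ..
qed

lemma sum_moves: "(\<Sum>\<sigma>\<in>moves a. f \<sigma>) = (\<Sum>j\<in>idx a. f (j, 1) + f (j, - 1))"
proof -
  have "(\<Sum>\<sigma>\<in>moves a. f \<sigma>) = (\<Sum>j\<in>idx a. \<Sum>e\<in>{1, - 1}. f (j, e))"
    unfolding moves_def sum.cartesian_product by simp
  then show ?thesis by simp
qed

text \<open>By \<open>mv_neg_shift\<close> a lowering step contributes minus the raising coefficient
  at the lowered pattern, as displayed; thus only raising coefficients have to be compared.\<close>

lemma sum_moves_coeff:
  assumes P: "\<alpha> \<in> P" and a: "a < n"
    and up: "\<And>\<beta> j. \<beta> \<in> P \<Longrightarrow> j \<in> idx a \<Longrightarrow> mv a (j, 1) \<beta> = K j \<beta>"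
  shows "(\<Sum>\<sigma>\<in>moves a. cf a \<sigma> \<alpha> * ket (shift a \<sigma> \<alpha>) \<beta>)
    = (\<Sum>j\<in>{j\<in>idx a. raise j a \<alpha> \<in> P}. K j \<alpha> * ket (raise j a \<alpha>) \<beta>)
    - (\<Sum>j\<in>{j\<in>idx a. lower j a \<alpha> \<in> P}. K j (lower j a \<alpha>) * ket (lower j a \<alpha>) \<beta>)"
proof -
  have u: "cf a (j, 1) \<alpha> = (if raise j a \<alpha> \<in> P then K j \<alpha> else 0)" if "j \<in> idx a" for j
    using that P up[OF P that] idx_pos[OF that] by (simp add: cf_def raise_shift)
  have d: "cf a (j, - 1) \<alpha> = (if lower j a \<alpha> \<in> P then - K j (lower j a \<alpha>) else 0)" if "j \<in> idx a" for j
  proof -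
    let ?l = "shift a (j, - 1) \<alpha>"
    have m: "(j, 1) \<in> moves a" using that by (simp add: moves_def)
    have n: "neg (j, 1) = (j, - 1)" "neg (j, - 1) = (j, 1)" by (simp_all add: neg_def)
    have "shift a (j, 1) ?l = \<alpha>" using shift_neg[of a "(j, - 1)" \<alpha>] unfolding n .
    then have "mv a (j, - 1) \<alpha> = - mv a (j, 1) ?l" using mv_neg_shift[OF m, of ?l] unfolding n by simp
    then show ?thesis using that P up[of ?l j] idx_pos[OF that] by (simp add: cf_def raise_shift)
  qed
  have "(\<Sum>\<sigma>\<in>moves a. cf a \<sigma> \<alpha> * ket (shift a \<sigma> \<alpha>) \<beta>)
      = (\<Sum>j\<in>idx a. (if raise j a \<alpha> \<in> P then K j \<alpha> * ket (raise j a \<alpha>) \<beta> else 0)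
        - (if lower j a \<alpha> \<in> P then K j (lower j a \<alpha>) * ket (lower j a \<alpha>) \<beta> else 0))"
    unfolding sum_moves by (rule sum.cong) (simp_all add: u d raise_shift)
  then show ?thesis by (simp add: sum_subtractf sum.inter_filter)
qed

lemma image_odd_mat:
  assumes "\<alpha> \<in> P" "p \<ge> 1" "2 * p < n"
  shows "image_odd s u P p \<alpha> \<beta> = mat (2 * p) \<alpha> \<beta>"
  using sum_moves_coeff[OF assms(1,3), of "A_coeff s u p" \<beta>] mv_A_coeff[OF _ assms(2,3)]
  by (simp add: image_odd_def mat_def steps_def idx_def)

lemma image_even_mat:
  assumes "\<alpha> \<in> P" "2 * p + 1 < n"
  shows "image_even \<tau> s P p \<alpha> \<beta> = mat (2 * p + 1) \<alpha> \<beta>"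
proof -
  have ix: "idx (2 * p + 1) = {1..p}" by (simp add: idx_def)
  have "mat (2 * p + 1) \<alpha> \<beta> = (\<Sum>\<sigma>\<in>moves (2 * p + 1). cf (2 * p + 1) \<sigma> \<alpha> * ket (shift (2 * p + 1) \<sigma> \<alpha>) \<beta>)
      + cf (2 * p + 1) (0, 0) \<alpha> * ket \<alpha> \<beta>"
    by (simp add: mat_def steps_def)
  also have "cf (2 * p + 1) (0, 0) \<alpha> = \<i> * diag_coeff \<tau> p \<alpha>" unfolding cf_diag[OF assms(1)] dg_diag_coeff ..
  also have "(\<Sum>\<sigma>\<in>moves (2 * p + 1). cf (2 * p + 1) \<sigma> \<alpha> * ket (shift (2 * p + 1) \<sigma> \<alpha>) \<beta>)
    = (\<Sum>j\<in>{j\<in>{1..p}. raise j (2 * p + 1) \<alpha> \<in> P}. B_coeff \<tau> s p j \<alpha> * ket (raise j (2 * p + 1) \<alpha>) \<beta>)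
    - (\<Sum>j\<in>{j\<in>{1..p}. lower j (2 * p + 1) \<alpha> \<in> P}.
        B_coeff \<tau> s p j (lower j (2 * p + 1) \<alpha>) * ket (lower j (2 * p + 1) \<alpha>) \<beta>)"
    using sum_moves_coeff[OF assms, of "B_coeff \<tau> s p" \<beta>] mv_B_coeff[OF _ assms(2)] unfolding ix by blast
  finally show ?thesis unfolding image_even_def by simp
qed

lemma GT_operator_matop:
  assumes "i \<in> {2..n}"
  shows "GT_operator \<tau> s u n m i = matop P (mat (i - 1))"
proof -
  have "(if odd i then image_odd s u P ((i - 1) div 2) \<alpha> \<beta> else image_even \<tau> s P ((i - 2) div 2) \<alpha> \<beta>)
      = mat (i - 1) \<alpha> \<beta>" if "\<alpha> \<in> P" for \<alpha> \<beta>
  proof (cases "odd i")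
    case True
    then obtain p where p: "i = 2 * p + 1" by (elim oddE)
    then show ?thesis using image_odd_mat[OF that, of p] assms by simp
  next
    case False
    then obtain q where q: "i = 2 * q" by auto
    then obtain p where p: "q = Suc p" using assms by (cases q) auto
    then show ?thesis using image_even_mat[OF that, of p] assms q by simp
  qed
  then show ?thesis unfolding GT_operator_def matop_def by (auto simp: fun_eq_iff restrict_def)
qed

section \<open>Generators acting on non-adjacent rows\<close>

lemma cf_cong:
  assumes "\<And>j k. k = a \<or> adj a k \<Longrightarrow> pos \<alpha> j k = pos \<beta> j k" "\<alpha> \<in> P \<longleftrightarrow> \<beta> \<in> P" "shift a \<sigma> \<alpha> \<in> P \<longleftrightarrow> shift a \<sigma> \<beta> \<in> P"
  shows "cf a \<sigma> \<alpha> = cf a \<sigma> \<beta>"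
proof -
  have "th a \<sigma> \<alpha> = th a \<sigma> \<beta>" by (simp add: th_def assms(1))
  moreover have "(\<Prod>w\<in>nb a. f (posp \<alpha> w)) = (\<Prod>w\<in>nb a. f (posp \<beta> w))" for f :: "real \<Rightarrow> complex"
    using assms(1) by (intro prod.cong) (auto simp: nb_def)
  ultimately show ?thesis using assms by (simp add: cf_def mv_def dg_def)
qed

lemma far_move_in_P:
  assumes "a \<noteq> b" "\<not> adj a b" "a < n" "\<sigma> \<in> steps a" "\<alpha> \<in> P" "shift b \<kappa> (shift a \<sigma> \<alpha>) \<in> P"
  shows "shift a \<sigma> \<alpha> \<in> P"
  using assms(4)
proof (cases rule: steps_cases)
  case 1
  show ?thesis unfolding GT_shift_iff[OF assms(5,3) 1]
  proof (intro allI impI)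
    fix b' i assume ib: "(i, b') \<in> nb a"
    then have ab: "adj a b'" "b' \<noteq> b" "b' \<le> n" using assms by (auto simp: nb_def adj_def)
    have "sep (shift b \<kappa> (shift a \<sigma> \<alpha>)) (fst \<sigma>) a i b'"
      using GT_sep[OF assms(6) ab(1) _ ab(3) movesD(1)[OF 1]] ib assms(3) by (simp add: nb_def)
    moreover have "pos (shift b \<kappa> (shift a \<sigma> \<alpha>)) (fst \<sigma>) a = pos (shift a \<sigma> \<alpha>) (fst \<sigma>) a"
      "pos (shift b \<kappa> (shift a \<sigma> \<alpha>)) i b' = pos (shift a \<sigma> \<alpha>) i b'" using ab assms(1) by simp_all
    ultimately show "sep (shift a \<sigma> \<alpha>) (fst \<sigma>) a i b'" using sep_cong by blast
  qed
next
  case 2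
  then show ?thesis using assms(5) by simp
qed

text \<open>A coefficient sees only its own row and the two next to it, and entries of non-adjacent
  rows share no inequality. So neither step alters the coefficient of the other or makes it
  impossible.\<close>

lemma cf_commute:
  assumes "a \<noteq> b" "\<not> adj a b" "a < n" "b < n" "\<sigma> \<in> steps a" "\<kappa> \<in> steps b"
  shows "cf b \<kappa> \<alpha> * cf a \<sigma> (shift b \<kappa> \<alpha>) = cf a \<sigma> \<alpha> * cf b \<kappa> (shift a \<sigma> \<alpha>)"
proof (cases "\<alpha> \<in> P \<and> shift a \<sigma> (shift b \<kappa> \<alpha>) \<in> P")
  case False
  then show ?thesis using cf_path_outside shift_commute[of a \<sigma> b \<kappa> \<alpha>] by metis
next
  case True
  then have in1: "\<alpha> \<in> P" and in2: "shift a \<sigma> (shift b \<kappa> \<alpha>) \<in> P" "shift b \<kappa> (shift a \<sigma> \<alpha>) \<in> P"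
    using shift_commute[of a \<sigma> b \<kappa> \<alpha>] by simp_all
  have i1: "shift a \<sigma> \<alpha> \<in> P" using far_move_in_P[OF assms(1-3,5) in1 in2(2)] .
  have i2: "shift b \<kappa> \<alpha> \<in> P"
    using far_move_in_P[OF assms(1)[symmetric] _ assms(4,6) in1 in2(1)] assms(2) adj_sym by blast
  have "cf a \<sigma> (shift b \<kappa> \<alpha>) = cf a \<sigma> \<alpha>"
    using assms(1,2) in1 in2 i1 i2 by (intro cf_cong) (auto intro: pos_shift_row)
  moreover have "cf b \<kappa> (shift a \<sigma> \<alpha>) = cf b \<kappa> \<alpha>"
    using assms(1,2) in1 in2 i1 i2 adj_sym by (intro cf_cong) (auto intro: pos_shift_row)
  ultimately show ?thesis by simp
qed

lemma mat_commute:
  assumes "a \<noteq> b" "\<not> adj a b" "a < n" "b < n"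
  shows "(\<Sum>\<gamma>\<in>P. mat b \<alpha> \<gamma> * mat a \<gamma> \<beta>) = (\<Sum>\<gamma>\<in>P. mat a \<alpha> \<gamma> * mat b \<gamma> \<beta>)"
proof -
  have "(\<Sum>\<gamma>\<in>P. mat b \<alpha> \<gamma> * mat a \<gamma> \<beta>)
      = (\<Sum>\<kappa>\<in>steps b. \<Sum>\<sigma>\<in>steps a. cf b \<kappa> \<alpha> * cf a \<sigma> (shift b \<kappa> \<alpha>) * ket (shift a \<sigma> (shift b \<kappa> \<alpha>)) \<beta>)"
    unfolding mat_apply unfolding mat_def sum_distrib_left by (simp add: mult.assoc)
  also have "\<dots> = (\<Sum>\<kappa>\<in>steps b. \<Sum>\<sigma>\<in>steps a. cf a \<sigma> \<alpha> * cf b \<kappa> (shift a \<sigma> \<alpha>) * ket (shift b \<kappa> (shift a \<sigma> \<alpha>)) \<beta>)"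
    by (intro sum.cong refl) (simp only: cf_commute[OF assms] shift_commute[of a _ b])
  also have "\<dots> = (\<Sum>\<gamma>\<in>P. mat a \<alpha> \<gamma> * mat b \<gamma> \<beta>)"
    unfolding mat_apply unfolding mat_def sum_distrib_left by (subst sum.swap) (simp add: mult.assoc)
  finally show ?thesis .
qed

lemma defining_relations_hold:
  assumes "(l, r) \<in> defining_relations \<tau> n (operators P) (GT_operator \<tau> s u n m)"
  shows "l = r"
proof -
  let ?I = "GT_operator \<tau> s u n m" and ?O = "operators P" and ?c = "qpow \<tau> (1 / 2) + qpow \<tau> (- 1 / 2)"
  have c: "?c = ch (1/2)" by (simp add: ch_def)
  have out: "\<forall>\<alpha> \<beta>. \<beta> \<notin> P \<longrightarrow> mat a \<alpha> \<beta> = 0" for a using mat_outside by blast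
  have out2: "\<forall>\<alpha> \<beta>. \<beta> \<notin> P \<longrightarrow> (\<Sum>\<gamma>\<in>P. M \<alpha> \<gamma> * mat b \<gamma> \<beta>) = 0" for M :: "pattern \<Rightarrow> pattern \<Rightarrow> complex" and b
    using mat_outside by simp
  have out3: "\<forall>\<alpha> \<beta>. \<beta> \<notin> P \<longrightarrow> c * (\<Sum>\<gamma>\<in>P. M \<alpha> \<gamma> * (\<Sum>\<delta>\<in>P. N \<gamma> \<delta> * mat b \<delta> \<beta>)) = 0"
    for M N :: "pattern \<Rightarrow> pattern \<Rightarrow> complex" and b c
    using mat_outside by simp
  let ?X = "\<lambda>i. matop P (mat i)"
  \<comment> \<open>The generator with index i acts on row i - 1, so both cubic relations are
    \<open>serre_relation\<close> for the rows i and i - 1, with the roles of \<open>a\<close> and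
    \<open>b\<close> exchanged. They differ further in the order of the outer terms.\<close>
  have serre: "(?X a \<otimes>\<^bsub>?O\<^esub> ?X a \<otimes>\<^bsub>?O\<^esub> ?X b \<ominus>\<^bsub>?O\<^esub> ?c \<odot>\<^bsub>?O\<^esub> (?X a \<otimes>\<^bsub>?O\<^esub> ?X b \<otimes>\<^bsub>?O\<^esub> ?X a))
      \<oplus>\<^bsub>?O\<^esub> ?X b \<otimes>\<^bsub>?O\<^esub> ?X a \<otimes>\<^bsub>?O\<^esub> ?X a = \<ominus>\<^bsub>?O\<^esub> ?X b"
    and serre': "(?X b \<otimes>\<^bsub>?O\<^esub> ?X a \<otimes>\<^bsub>?O\<^esub> ?X a \<ominus>\<^bsub>?O\<^esub> ?c \<odot>\<^bsub>?O\<^esub> (?X a \<otimes>\<^bsub>?O\<^esub> ?X b \<otimes>\<^bsub>?O\<^esub> ?X a))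
      \<oplus>\<^bsub>?O\<^esub> ?X a \<otimes>\<^bsub>?O\<^esub> ?X a \<otimes>\<^bsub>?O\<^esub> ?X b = \<ominus>\<^bsub>?O\<^esub> ?X b"
    if "adj a b" "a < n" "b < n" "a \<ge> 1" for a b
  proof -
    note rel = serre_relation[OF that]
    show "(?X a \<otimes>\<^bsub>?O\<^esub> ?X a \<otimes>\<^bsub>?O\<^esub> ?X b \<ominus>\<^bsub>?O\<^esub> ?c \<odot>\<^bsub>?O\<^esub> (?X a \<otimes>\<^bsub>?O\<^esub> ?X b \<otimes>\<^bsub>?O\<^esub> ?X a))
      \<oplus>\<^bsub>?O\<^esub> ?X b \<otimes>\<^bsub>?O\<^esub> ?X a \<otimes>\<^bsub>?O\<^esub> ?X a = \<ominus>\<^bsub>?O\<^esub> ?X b"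
      unfolding c matop_mult[OF out] matop_smult matop_minus[OF out3] matop_add matop_uminus[OF out]
      by (rule matop_cong) (simp only: rel)
    have swap: "x - y + z = z - y + x" for x y z :: complex by simp
    show "(?X b \<otimes>\<^bsub>?O\<^esub> ?X a \<otimes>\<^bsub>?O\<^esub> ?X a \<ominus>\<^bsub>?O\<^esub> ?c \<odot>\<^bsub>?O\<^esub> (?X a \<otimes>\<^bsub>?O\<^esub> ?X b \<otimes>\<^bsub>?O\<^esub> ?X a))
      \<oplus>\<^bsub>?O\<^esub> ?X a \<otimes>\<^bsub>?O\<^esub> ?X a \<otimes>\<^bsub>?O\<^esub> ?X b = \<ominus>\<^bsub>?O\<^esub> ?X b"
      unfolding c matop_mult[OF out] matop_smult matop_minus[OF out3] matop_add matop_uminus[OF out]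
      by (rule matop_cong, subst swap) (simp only: rel)
  qed
  from assms show ?thesis
  proof (cases rule: defining_relationsE)
    case (commute i j)
    have far: "i - 1 \<noteq> j - 1" "\<not> adj (i - 1) (j - 1)" "i - 1 < n" "j - 1 < n"
      using commute(1-3) by (auto simp: adj_def)
    have "matop P (\<lambda>\<alpha> \<beta>. 0) = \<zero>\<^bsub>?O\<^esub>" by (simp add: matop_def)
    then show ?thesis
      unfolding commute(4,5) GT_operator_matop[OF commute(1)] GT_operator_matop[OF commute(2)]
        matop_mult[OF out] matop_minus[OF out2] mat_commute[OF far] by simp
  next
    case (upper i)
    then have i: "i \<in> {2..n}" "i + 1 \<in> {2..n}" by auto
    have e: "?I i = ?X (i - 1)" "?I (i + 1) = ?X i"
      using GT_operator_matop[OF i(1)] GT_operator_matop[OF i(2)] by simp_all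
    have h: "adj i (i - 1)" "i < n" "i - 1 < n" "i \<ge> 1" using upper(1,2) by (auto simp: adj_def)
    show ?thesis unfolding upper(3,4) e by (rule serre[OF h])
  next
    case (lower i)
    then have i: "i \<in> {2..n}" "i + 1 \<in> {2..n}" by auto
    have e: "?I i = ?X (i - 1)" "?I (i + 1) = ?X i"
      using GT_operator_matop[OF i(1)] GT_operator_matop[OF i(2)] by simp_all
    have h: "adj (i - 1) i" "i - 1 < n" "i < n" "i - 1 \<ge> 1" using lower(1,2) by (auto simp: adj_def)
    show ?thesis unfolding lower(3,4) e by (rule serre'[OF h])
  qed
qed

section \<open>Skew-adjointness for real \<tau>\<close>

context
  assumes real: "\<tau> \<in> \<real>"
begin

lemma qpow_real: "qpow \<tau> (of_real x) \<in> \<real>"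
proof -
  obtain t where "\<tau> = of_real t" using real by (auto elim: Reals_cases)
  then have "qpow \<tau> (of_real x) = of_real (exp (t * x))" by (simp add: qpow_def flip: exp_of_real)
  then show ?thesis by simp
qed

lemma br_real: "br x \<in> \<real>"
  using qpow_real[of "x / 2"] qpow_real[of "- x / 2"] qpow_real[of "1/2"] qpow_real[of "- 1/2"]
  unfolding br_def qnum_def by (intro Reals_divide Reals_diff) simp_all

lemma s_real: assumes "k \<in> \<int>" "k \<noteq> 0" shows "s \<bar>k\<bar> \<in> \<real>"
proof -
  obtain i :: int where i: "k = of_int i" using assms by (auto elim: Ints_cases)
  then have "\<bar>k\<bar> = real (nat \<bar>i\<bar>)" "nat \<bar>i\<bar> > 0" using assms by auto
  then show ?thesis using roots real unfolding root_choice_def by metis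
qed

lemma u_real: assumes "2 * x \<in> \<int>" shows "u \<bar>x\<bar> \<in> \<real>"
proof -
  have "\<bar>x\<bar> \<in> \<int> \<or> \<bar>x\<bar> \<in> half_integers" using half_cases[OF assms] .
  then show ?thesis using roots real unfolding root_choice_def by simp
qed

text \<open>The choice of roots says something about \<open>s\<close> only at positive integers, so
  the arguments must be nonzero integers; this is where the step has to be a possible one.\<close>

lemma mv_real:
  assumes "\<alpha> \<in> P" "shift a \<sigma> \<alpha> \<in> P" "a < n" "\<sigma> \<in> moves a"
  shows "mv a \<sigma> \<alpha> \<in> \<real>"
proof -
  let ?t = "th a \<sigma> \<alpha>"
  note S = movesD[OF assms(4)]
  have le: "a \<le> n" using assms(3) by simp
  have half: "2 * ?t \<in> \<int>" using th_half[OF assms(1) le] assms(4) by (simp add: steps_def)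
  have "ecf a ?t \<in> \<real>"
  proof (cases "even a")
    case True
    have "2 * (?t + 1) \<in> \<int>" using half by (simp add: distrib_left)
    then show ?thesis using True u_real[OF half] u_real[of "?t + 1"] by (simp add: ecf_def Reals_mult Reals_divide)
  next
    case False
    have nz: "2 * ?t \<noteq> 0" "2 * ?t + 2 \<noteq> 0" using odd_move_th[OF assms(1-3) False assms(4)] by auto
    have "2 * ?t + 2 \<in> \<int>" using half by simp
    then show ?thesis using False s_real[OF half nz(1)] s_real[OF _ nz(2)] br_real
      by (simp add: ecf_def Reals_mult Reals_divide)
  qed
  moreover have "(\<Prod>w\<in>nb a. phi ?t (posp \<alpha> w)) \<in> \<real>"
  proof (rule prod_in_Reals)
    fix w assume "w \<in> nb a"
    then have w: "(fst w, snd w) \<in> nb a" by simp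
    note N = move_nb[OF assms(1,3,4) w] and N' = move_nb(6)[OF assms(2,3,4) w]
    have half: "2 * pos \<alpha> (fst \<sigma>) a \<in> \<int>" using GT_pos_half[OF assms(1) le S(1)] .
    have "sp (above (fst \<sigma>) a (fst w) (snd w)) (pos \<alpha> (fst \<sigma>) a + snd \<sigma>) (posp \<alpha> w)"
      using N' adj_neq[OF N(1)] by (simp add: pos_shift)
    note nz = sp_sum[OF S(3) N(6) this]
    show "phi ?t (posp \<alpha> w) \<in> \<real>"
      unfolding phi_def S(4) using s_real[OF sp_args(1)[OF S(3) half N(4,5)] nz(1)]
        s_real[OF sp_args(2)[OF S(3) half N(4,5)] nz(2)] by (rule Reals_mult)
  qed
  moreover have "(\<Prod>r\<in>idx a - {fst \<sigma>}. psi ?t (pos \<alpha> r a)) \<in> \<real>"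
  proof (rule prod_in_Reals)
    fix r assume r: "r \<in> idx a - {fst \<sigma>}"
    let ?y = "pos \<alpha> r a"
    note R = move_row[OF assms(1,3,4,2) r]
    have i: "?y + ?t + 1 \<in> \<int>" "?y - ?t - 1 \<in> \<int>" using R(1,2) by auto
    have nz: "?y + ?t \<noteq> 0" "?y - ?t \<noteq> 0" "?y + ?t + 1 \<noteq> 0" "?y - ?t - 1 \<noteq> 0" using R(3) by auto
    show "psi ?t ?y \<in> \<real>" unfolding psi_def
      using s_real[OF R(1) nz(1)] s_real[OF R(2) nz(2)] s_real[OF i(1) nz(3)] s_real[OF i(2) nz(4)]
      by (intro Reals_mult)
  qed
  ultimately show ?thesis unfolding mv_def by (intro Reals_divide Reals_mult) auto
qed

lemma dg_real: "dg a \<alpha> \<in> \<real>"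
  unfolding dg_def using br_real by (auto intro!: Reals_divide prod_in_Reals Reals_mult)

text \<open>Coefficients of moves are real and change sign under reversal; the diagonal coefficient
  is real up to the factor \<i>, whose conjugate is - \<i>.\<close>

lemma mat_skew:
  assumes "\<alpha> \<in> P" "\<beta> \<in> P" "a < n"
  shows "cnj (mat a \<alpha> \<beta>) = - mat a \<beta> \<alpha>"
proof -
  have "cnj (mat a \<alpha> \<beta>) = (\<Sum>\<sigma>\<in>steps a. cnj (cf a \<sigma> \<alpha>) * ket (shift a \<sigma> \<alpha>) \<beta>)"
    by (simp add: mat_def cnj_sum ket_def if_distrib cong: if_cong)
  also have "\<dots> = (\<Sum>\<sigma>\<in>steps a. - (cf a (neg \<sigma>) \<beta> * ket (shift a (neg \<sigma>) \<beta>) \<alpha>))"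
  proof (rule sum.cong[OF refl])
    fix \<sigma> assume s: "\<sigma> \<in> steps a"
    show "cnj (cf a \<sigma> \<alpha>) * ket (shift a \<sigma> \<alpha>) \<beta> = - (cf a (neg \<sigma>) \<beta> * ket (shift a (neg \<sigma>) \<beta>) \<alpha>)"
    proof (cases "\<beta> = shift a \<sigma> \<alpha>")
      case True
      have "cnj (cf a \<sigma> \<alpha>) = - cf a (neg \<sigma>) \<beta>"
        using s
      proof (cases rule: steps_cases)
        case m: 1
        have "cf a \<sigma> \<alpha> = mv a \<sigma> \<alpha>" "cf a (neg \<sigma>) \<beta> = - mv a \<sigma> \<alpha>"
          using cf_move[OF m] cf_move[OF neg_moves[OF m]] mv_neg_shift[OF m] assms(1,2) True by simp_all
        moreover have "cnj (mv a \<sigma> \<alpha>) = mv a \<sigma> \<alpha>"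
          using mv_real[OF assms(1) _ assms(3) m] assms(2) True by (simp add: Reals_cnj_iff)
        ultimately show ?thesis by simp
      next
        case 2
        have "cnj (dg a \<alpha>) = dg a \<alpha>" using dg_real by (simp add: Reals_cnj_iff)
        then show ?thesis using 2 True assms(1) by (simp add: cf_diag neg_def)
      qed
      then show ?thesis using True by (simp add: ket_def)
    next
      case False
      then have "shift a (neg \<sigma>) \<beta> \<noteq> \<alpha>" using shift_neg[of a "neg \<sigma>" \<beta>] by auto
      then show ?thesis using False by (simp add: ket_def)
    qed
  qed
  also have "\<dots> = - mat a \<beta> \<alpha>"
    unfolding mat_def sum_negf by (subst sum.reindex_bij_witness[of _ neg neg]) auto
  finally show ?thesis .
qed

end

end

theorem mainTheorem1:
  fixes \<tau> :: complex and n :: nat and m :: "nat \<Rightarrow> real" and s u :: "real \<Rightarrow> complex"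
  assumes "\<not> root_of_unity (exp \<tau>)"
    and "n \<ge> 3"
    and "highest_weight n m"
    and "root_choice \<tau> s u"
  defines "P \<equiv> GT_patterns n m"
    and "I \<equiv> GT_operator \<tau> s u n m"
  shows "finite P \<and>
    (\<forall>i\<in>{2..n}. I i \<in> carrier (operators P)) \<and>
    (\<forall>(lhs, rhs) \<in> defining_relations \<tau> n (operators P) I. lhs = rhs) \<and>
    (\<tau> \<in> \<real> \<longrightarrow> (\<forall>i\<in>{2..n}. hadjoint P (I i) = \<ominus>\<^bsub>operators P\<^esub> I i)) \<and>
    (\<exists>T. Uq_representation \<tau> n P T \<and>
       (\<forall>i\<in>{2..n}. T (Uq_gen \<tau> n i) = I i) \<and>
       (\<tau> \<in> \<real> \<longrightarrow> Uq_star_representation \<tau> n P T))"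
proof -
  interpret G: gt \<tau> s u n m by unfold_locales (fact assms)+
  have fin: "finite P" unfolding P_def by (rule finite_GT_patterns)
  have I_matop: "I i = matop P (G.mat (i - 1))" if "i \<in> {2..n}" for i
    unfolding I_def P_def by (rule G.GT_operator_matop[OF that])
  have closed: "I i \<in> carrier (operators P)" if "i \<in> {2..n}" for i
    unfolding I_matop[OF that] P_def using G.mat_outside by (intro matop_carrier) blast
  have rel: "l = r" if "(l, r) \<in> defining_relations \<tau> n (operators P) I" for l r
    using G.defining_relations_hold that unfolding I_def P_def by blast
  have skew: "hinner P (I i v) w = - hinner P v (I i w)"
    if "\<tau> \<in> \<real>" "i \<in> {2..n}" "v \<in> hilb P" "w \<in> hilb P" for i v w
    unfolding I_matop[OF that(2)]
    using G.mat_skew[OF that(1)] that(2) by (intro matop_skew[OF fin _ that(3,4)]) (auto simp: P_def)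
  have adjoint: "hadjoint P (I i) = \<ominus>\<^bsub>operators P\<^esub> I i" if "\<tau> \<in> \<real>" "i \<in> {2..n}" for i
  proof (rule hadjoint_eq[OF fin])
    show "\<ominus>\<^bsub>operators P\<^esub> I i \<in> carrier (operators P)"
      unfolding operators_uminus[OF closed[OF that(2)]] by (rule operators_closed(6)[OF closed[OF that(2)]])
    show "hinner P (I i v) w = hinner P v ((\<ominus>\<^bsub>operators P\<^esub> I i) w)" if "v \<in> hilb P" "w \<in> hilb P" for v w
      unfolding operators_uminus[OF closed[OF \<open>i \<in> {2..n}\<close>]] skew[OF \<open>\<tau> \<in> \<real>\<close> \<open>i \<in> {2..n}\<close> that]
      using that by (simp add: hinner_def sum_negf)
  qed
  interpret F: operator_family P n I by unfold_locales (use fin closed in auto)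
  have "Uq_representation \<tau> n P F.rep"
    unfolding Uq_representation_def using fin F.rep_hom[OF rel] by blast
  moreover have "F.rep (Uq_gen \<tau> n i) = I i" if "i \<in> {2..n}" for i
    using F.rep_gen[OF rel that] .
  moreover have "Uq_star_representation \<tau> n P F.rep" if "\<tau> \<in> \<real>"
    unfolding Uq_star_representation_def using calculation(1) F.rep_star[OF rel skew[OF that]] by blast
  ultimately show ?thesis using fin closed rel adjoint by blast
qed

end
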